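(* Let $\varphi:\Lambda\to\Gamma$ be a regular covering map of finite simplicial graphs such that $\Gamma$ (and hence $\Lambda$) has no isolated vertices. Then the group $\mathrm{LAut}(\varphi)$ of liftable automorphisms of $A_\Gamma$ is generated by liftable graph symmetries, inversions, liftable transvections and liftable partial conjugations.
   Context: Graphs are finite simplicial graphs; subgraphs are induced. $A_\Gamma=\langle v\in V\Gamma\mid [u,v]=1 \text{ for every edge }\{u,v\}\rangle$ is the right-angled Artin group. $\mathrm{lk}(v)$ is the subgraph induced by neighbours of $v$, $\mathrm{st}(v)$ the subgraph induced by $\mathrm{lk}(v)\cup\{v\}$. A covering map of graphs $\varphi:\Lambda\to\Gamma$ is a surjective simplicial map that maps the neighbours of each vertex $u$ bijectively onto the neighbours of $\varphi(u)$; it is regular if the group $\mathrm{Deck}(\varphi)$ of graph automorphisms $\mu$ of $\Lambda$ with $\varphi\mu=\varphi$ acts transitively on each fiber. Let $\phi:A_\Lambda\to A_\Gamma$ be the induced homomorphism $u\mapsto\varphi(u)$. $f\in\mathrm{Aut}(A_\Gamma)$ is liftable if there is $F\in\mathrm{Aut}(A_\Lambda)$ with $f\circ\phi=\phi\circ F$; $\mathrm{LAut}(\varphi)$ is the group of liftable automorphisms. Elementary automorphisms of $A_\Gamma$: a graph symmetry (graph automorphism of $\Gamma$ extended to $A_\Gamma$ by permuting generators); an inversion (sending each vertex $v$ to $v$ or $v^{-1}$); a transvection (for vertices $b\ne a$ with $\mathrm{lk}(b)\subseteq\mathrm{st}(a)$, the automorphism sending $b$ to $ba$ and fixing all other vertices);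 a partial conjugation $P^v_C$ (for a vertex $v$ and a union $C$ of connected components of $\Gamma\setminus\mathrm{st}(v)$, sending each vertex $w$ of $C$ to $vwv^{-1}$ and fixing all other vertices). *)

theory Defs
  imports "HOL-Algebra.Algebra"
begin

definition sgraph :: "'a set \<Rightarrow> ('a \<Rightarrow> 'a \<Rightarrow> bool) \<Rightarrow> bool" where
  "sgraph V E \<longleftrightarrow> finite V \<and> (\<forall>u w. E u w \<longrightarrow> u \<in> V \<and> w \<in> V)
     \<and> (\<forall>u w. E u w \<longrightarrow> E w u) \<and> (\<forall>u. \<not> E u u)"

definition lk :: "'a set \<Rightarrow> ('a \<Rightarrow> 'a \<Rightarrow> bool) \<Rightarrow> 'a \<Rightarrow> 'a set" where
  "lk V E v = {w \<in> V. E v w}"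

definition st :: "'a set \<Rightarrow> ('a \<Rightarrow> 'a \<Rightarrow> bool) \<Rightarrow> 'a \<Rightarrow> 'a set" where
  "st V E v = insert v (lk V E v)"

definition no_isolated :: "'a set \<Rightarrow> ('a \<Rightarrow> 'a \<Rightarrow> bool) \<Rightarrow> bool" where
  "no_isolated V E \<longleftrightarrow> (\<forall>v \<in> V. \<exists>w. E v w)"

definition graph_aut :: "'a set \<Rightarrow> ('a \<Rightarrow> 'a \<Rightarrow> bool) \<Rightarrow> ('a \<Rightarrow> 'a) \<Rightarrow> bool" where
  "graph_aut V E \<sigma> \<longleftrightarrow> bij_betw \<sigma> V V \<and> (\<forall>u \<in> V. \<forall>w \<in> V. E u w \<longleftrightarrow> E (\<sigma> u) (\<sigma> w))"

definition reach_in :: "'a set \<Rightarrow> ('a \<Rightarrow> 'a \<Rightarrow> bool) \<Rightarrow> ('a \<times> 'a) set" where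
  "reach_in U E = {(x, y). x \<in> U \<and> y \<in> U \<and> E x y}\<^sup>*"

definition union_of_components :: "'a set \<Rightarrow> ('a \<Rightarrow> 'a \<Rightarrow> bool) \<Rightarrow> 'a set \<Rightarrow> bool" where
  "union_of_components U E C \<longleftrightarrow> C \<subseteq> U \<and> (\<forall>x \<in> C. \<forall>y. (x, y) \<in> reach_in U E \<longrightarrow> y \<in> C)"

definition covering_map :: "'a set \<Rightarrow> ('a \<Rightarrow> 'a \<Rightarrow> bool) \<Rightarrow> 'b set \<Rightarrow> ('b \<Rightarrow> 'b \<Rightarrow> bool)
    \<Rightarrow> ('a \<Rightarrow> 'b) \<Rightarrow> bool" where
  "covering_map VL EL VG EG \<phi> \<longleftrightarrow> \<phi> ` VL = VG
     \<and> (\<forall>u w. EL u w \<longrightarrow> EG (\<phi> u) (\<phi> w))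
     \<and> (\<forall>u \<in> VL. bij_betw \<phi> (lk VL EL u) (lk VG EG (\<phi> u)))"

definition Deck :: "'a set \<Rightarrow> ('a \<Rightarrow> 'a \<Rightarrow> bool) \<Rightarrow> ('a \<Rightarrow> 'b) \<Rightarrow> ('a \<Rightarrow> 'a) set" where
  "Deck VL EL \<phi> = {\<mu>. graph_aut VL EL \<mu> \<and> (\<forall>u \<in> VL. \<phi> (\<mu> u) = \<phi> u)}"

definition regular_covering :: "'a set \<Rightarrow> ('a \<Rightarrow> 'a \<Rightarrow> bool) \<Rightarrow> 'b set \<Rightarrow> ('b \<Rightarrow> 'b \<Rightarrow> bool)
    \<Rightarrow> ('a \<Rightarrow> 'b) \<Rightarrow> bool" where
  "regular_covering VL EL VG EG \<phi> \<longleftrightarrow> covering_map VL EL VG EG \<phi>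
     \<and> (\<forall>u \<in> VL. \<forall>w \<in> VL. \<phi> u = \<phi> w \<longrightarrow> (\<exists>\<mu> \<in> Deck VL EL \<phi>. \<mu> u = w))"

text \<open>Words are lists of letters (v, b); (v, True) stands for v and (v, False) for v^-1.
  A_Gamma is the set of words over V modulo free cancellation and commutation of
  adjacent letters whose underlying vertices are adjacent in Gamma.\<close>

type_synonym 'a word = "('a \<times> bool) list"

definition raag_step :: "('a \<Rightarrow> 'a \<Rightarrow> bool) \<Rightarrow> ('a word \<times> 'a word) set" where
  "raag_step E =
     {(xs @ [(v, b), (v, \<not> b)] @ ys, xs @ ys) | xs ys v b. True}
   \<union> {(xs @ [x, y] @ ys, xs @ [y, x] @ ys) | xs ys x y. E (fst x) (fst y)}"

definition raag_rel :: "('a \<Rightarrow> 'a \<Rightarrow> bool) \<Rightarrow> ('a word \<times> 'a word) set" where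
  "raag_rel E = (raag_step E \<union> (raag_step E)\<inverse>)\<^sup>*"

definition words :: "'a set \<Rightarrow> 'a word set" where
  "words V = {w. set (map fst w) \<subseteq> V}"

definition RAAG :: "'a set \<Rightarrow> ('a \<Rightarrow> 'a \<Rightarrow> bool) \<Rightarrow> 'a word set monoid" where
  "RAAG V E = \<lparr> carrier = words V // raag_rel E,
               monoid.mult = (\<lambda>A B. raag_rel E `` {x @ y | x y. x \<in> A \<and> y \<in> B}),
               one = raag_rel E `` {[]} \<rparr>"

definition inv_word :: "'a word \<Rightarrow> 'a word" where
  "inv_word w = rev (map (\<lambda>(v, b). (v, \<not> b)) w)"

definition word_subst :: "('a \<Rightarrow> 'b word) \<Rightarrow> 'a word \<Rightarrow> 'b word" where
  "word_subst g w = concat (map (\<lambda>(v, b). if b then g v else inv_word (g v)) w)"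

text \<open>The map A_Gamma -> A_Gamma' determined by sending each generator v to (the class of)
  the word g v; restricted to the carrier so that automorphisms are extensional as in
  the library's AutoGroup.\<close>
definition raag_ext :: "'a set \<Rightarrow> ('a \<Rightarrow> 'a \<Rightarrow> bool) \<Rightarrow> ('b \<Rightarrow> 'b \<Rightarrow> bool)
    \<Rightarrow> ('a \<Rightarrow> 'b word) \<Rightarrow> 'a word set \<Rightarrow> 'b word set" where
  "raag_ext V E E' g = (\<lambda>Z \<in> carrier (RAAG V E). raag_rel E' `` (word_subst g ` Z))"

definition induced_hom :: "'a set \<Rightarrow> ('a \<Rightarrow> 'a \<Rightarrow> bool) \<Rightarrow> ('b \<Rightarrow> 'b \<Rightarrow> bool)
    \<Rightarrow> ('a \<Rightarrow> 'b) \<Rightarrow> 'a word set \<Rightarrow> 'b word set" where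
  "induced_hom VL EL EG \<phi> = raag_ext VL EL EG (\<lambda>u. [(\<phi> u, True)])"

definition liftable :: "'a set \<Rightarrow> ('a \<Rightarrow> 'a \<Rightarrow> bool) \<Rightarrow> 'b set \<Rightarrow> ('b \<Rightarrow> 'b \<Rightarrow> bool)
    \<Rightarrow> ('a \<Rightarrow> 'b) \<Rightarrow> ('b word set \<Rightarrow> 'b word set) \<Rightarrow> bool" where
  "liftable VL EL VG EG \<phi> f \<longleftrightarrow> f \<in> auto (RAAG VG EG) \<and>
     (\<exists>F \<in> auto (RAAG VL EL). \<forall>x \<in> carrier (RAAG VL EL).
        f (induced_hom VL EL EG \<phi> x) = induced_hom VL EL EG \<phi> (F x))"

definition LAut :: "'a set \<Rightarrow> ('a \<Rightarrow> 'a \<Rightarrow> bool) \<Rightarrow> 'b set \<Rightarrow> ('b \<Rightarrow> 'b \<Rightarrow> bool)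
    \<Rightarrow> ('a \<Rightarrow> 'b) \<Rightarrow> ('b word set \<Rightarrow> 'b word set) set" where
  "LAut VL EL VG EG \<phi> = {f. liftable VL EL VG EG \<phi> f}"

definition graph_symmetries :: "'a set \<Rightarrow> ('a \<Rightarrow> 'a \<Rightarrow> bool) \<Rightarrow> ('a word set \<Rightarrow> 'a word set) set" where
  "graph_symmetries V E = {raag_ext V E E (\<lambda>v. [(\<sigma> v, True)]) | \<sigma>. graph_aut V E \<sigma>}"

definition inversions :: "'a set \<Rightarrow> ('a \<Rightarrow> 'a \<Rightarrow> bool) \<Rightarrow> ('a word set \<Rightarrow> 'a word set) set" where
  "inversions V E = {raag_ext V E E (\<lambda>v. [(v, v \<notin> S)]) | S. S \<subseteq> V}"

definition transvections :: "'a set \<Rightarrow> ('a \<Rightarrow> 'a \<Rightarrow> bool) \<Rightarrow> ('a word set \<Rightarrow> 'a word set) set" where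
  "transvections V E = {raag_ext V E E (\<lambda>v. if v = b then [(b, True), (a, True)] else [(v, True)])
      | a b. a \<in> V \<and> b \<in> V \<and> b \<noteq> a \<and> lk V E b \<subseteq> st V E a}"

definition partial_conjugations :: "'a set \<Rightarrow> ('a \<Rightarrow> 'a \<Rightarrow> bool) \<Rightarrow> ('a word set \<Rightarrow> 'a word set) set" where
  "partial_conjugations V E = {raag_ext V E E
        (\<lambda>w. if w \<in> C then [(v, True), (w, True), (v, False)] else [(w, True)])
      | v C. v \<in> V \<and> union_of_components (V - st V E v) E C}"

end

theory Submission
  imports Defs
begin

text \<open>Let \<open>F\<close> be a lift of the automorphism \<open>f\<close>. A non-vanishing term in the determinant of the action of
  \<open>F\<close> on homology is a graph automorphism, which can be chosen compatible with the covering; after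
  composing with it, all non-zero matrix entries belong to pairs of vertices \<open>u\<close>, \<open>z\<close> upstairs with
  \<open>lk u \<subseteq> st z\<close>, so that liftable transvections and inversions reduce the matrix to the identity.

  Then the vertices are treated by descending degree, the aim being that \<open>f\<close> conjugates every
  generator. Centralisers of links show that, up to an inner automorphism, \<open>f\<close> preserves the subgroup
  generated by the set \<open>U\<close> of vertices dominating a given vertex \<open>x\<close> outside its link. Let \<open>S \<subseteq> U\<close> be
  the vertices of the same degree as \<open>x\<close>; they have no neighbours in \<open>U\<close>, and \<open>f\<close> conjugates the
  generators in \<open>U - S\<close> already. A Nielsen reduction by transvections of elements of \<open>S\<close> and partial
  conjugations turns \<open>f\<close> into a map that permutes the letters over \<open>U\<close>. The supports of the partial
  conjugations can be chosen so that they lift: vertices upstairs that are joined outside the star of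
  a lift \<open>i\<close> are mapped by \<open>F\<close> into a common conjugate of the subgroup of words without \<open>i\<close>. When \<open>f\<close>
  conjugates every generator, the same reduction with \<open>S\<close> empty makes it the identity.\<close>

section \<open>Words up to shuffling\<close>

text \<open>The obstacle is that every move downstairs must lift. As no vertex is isolated, a vertex
  upstairs is dominated by at most one vertex of each fibre, so a transvection has a canonical lift,
  and the matrix entries of \<open>F\<close> and \<open>f\<close> at dominating pairs agree. A
  partial conjugation lifts when its support is closed under \<open>sat\<close>: its indicator is
  then a sum of exponents prescribed separately at the lifts of the conjugating vertex. The Nielsen
  reduction may therefore not conjugate single generators. If the head of one image is absorbed by
  the conjugator of a generator, it must be absorbed by those of the whole \<open>sat\<close>-class;
  \<open>fixed_coset_unique\<close> provides this, because a vertex outside \<open>S\<close> keeps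
  the exponent of its generator. Descending degree ensures that the generators of
  \<open>U - S\<close> have conjugators at all. A vertex of \<open>S\<close> is adjacent to no
  vertex of \<open>U\<close>, so the prefixes of an element that end in an \<open>S\<close>-letter
  form a chain, as in a free group, and a well-founded weight can be read off from them.\<close>

class graph =
  fixes adj :: "'a \<Rightarrow> 'a \<Rightarrow> bool"
  assumes adj_sym: "adj x y \<Longrightarrow> adj y x"
    and adj_irrefl [simp]: "\<not> adj x x"

lemma adj_commute: "adj x y \<longleftrightarrow> adj y x"
  using adj_sym by blast

fun linv :: "'v \<times> bool \<Rightarrow> 'v \<times> bool" where
  "linv (v, b) = (v, \<not> b)"

lemma fst_linv [simp]: "fst (linv a) = fst a"
  and linv_linv [simp]: "linv (linv a) = a"
  and linv_neq [simp]: "linv a \<noteq> a" "a \<noteq> linv a"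
  by (cases a; simp)+

lemma linv_inject [simp]: "linv a = linv b \<longleftrightarrow> a = b"
  by (cases a; cases b) auto

lemma letter_same_vertex: "fst a = fst b \<Longrightarrow> a = b \<or> a = linv b"
  by (cases a; cases b) auto

inductive swp :: "'v::graph word \<Rightarrow> 'v word \<Rightarrow> bool" where
  swp_here: "adj (fst x) (fst y) \<Longrightarrow> swp (x # y # ys) (y # x # ys)"
| swp_there: "swp u v \<Longrightarrow> swp (a # u) (a # v)"

abbreviation shuf :: "'v::graph word \<Rightarrow> 'v word \<Rightarrow> bool" where
  "shuf \<equiv> swp\<^sup>*\<^sup>*"

lemma swp_sym: "swp u v \<Longrightarrow> swp v u"
  by (induction rule: swp.induct) (auto intro: swp.intros adj_sym)

lemma shuf_sym: "shuf u v \<Longrightarrow> shuf v u"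
  by (induction rule: rtranclp_induct) (auto intro: swp_sym converse_rtranclp_into_rtranclp)

lemma shuf_trans: "shuf u v \<Longrightarrow> shuf v w \<Longrightarrow> shuf u w"
  by (rule rtranclp_trans)

lemma shuf_Cons: "shuf u v \<Longrightarrow> shuf (a # u) (a # v)"
  by (induction rule: rtranclp_induct) (auto intro: swp_there rtranclp.rtrancl_into_rtrancl)

lemma shuf_swap: "adj (fst x) (fst y) \<Longrightarrow> shuf (x # y # w) (y # x # w)"
  by (auto intro: swp_here)

lemma swp_mset: "swp u v \<Longrightarrow> mset u = mset v"
  by (induction rule: swp.induct) auto

lemma shuf_mset: "shuf u v \<Longrightarrow> mset u = mset v"
  by (induction rule: rtranclp_induct) (auto dest: swp_mset)

lemma shuf_Nil_iff [simp]: "shuf [] v \<longleftrightarrow> v = []" "shuf v [] \<longleftrightarrow> v = []"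
  by (auto dest: shuf_mset)

text \<open>A letter can be brought to the front exactly when its first occurrence is preceded by
  adjacent vertices only; by \<open>shuf_pull\<close> the outcome is invariant under
  shuffling.\<close>

fun pull :: "'v::graph \<times> bool \<Rightarrow> 'v word \<Rightarrow> 'v word option" where
  "pull a [] = None"
| "pull a (x # w) = (if x = a then Some w
     else if adj (fst a) (fst x) then map_option (Cons x) (pull a w) else None)"

lemma pull_shuf: "pull a w = Some w' \<Longrightarrow> shuf w (a # w')"
proof (induction w arbitrary: w')
  case (Cons x w)
  show ?case
  proof (cases "x = a")
    case False
    with Cons.prems obtain u where u: "adj (fst a) (fst x)" "pull a w = Some u" "w' = x # u"
      by (auto split: if_splits)
    have "shuf (x # w) (x # a # u)"
      using Cons.IH[OF u(2)] by (rule shuf_Cons)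
    also have "shuf \<dots> (a # x # u)"
      using u(1) by (intro shuf_swap) (simp add: adj_commute)
    finally show ?thesis
      by (simp add: u(3))
  qed (use Cons.prems in auto)
qed simp

lemma rel_option_shuf_trans:
  "rel_option shuf x y \<Longrightarrow> rel_option shuf y z \<Longrightarrow> rel_option shuf x z"
  by (cases x; cases y; cases z) auto

lemma swp_pull: "swp w v \<Longrightarrow> rel_option shuf (pull a w) (pull a v)"
proof (induction rule: swp.induct)
  case (swp_here x y ys)
  then have "x \<noteq> y"
    by auto
  with swp_here show ?case
    by (cases "pull a ys") (auto simp: adj_commute intro: shuf_swap)
next
  case (swp_there u v b)
  then show ?case
    by (cases "pull a u"; cases "pull a v") (auto intro: shuf_Cons)
qed

lemma shuf_pull: "shuf w v \<Longrightarrow> rel_option shuf (pull a w) (pull a v)"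
proof (induction rule: rtranclp_induct)
  case base
  then show ?case
    by (cases "pull a w") auto
next
  case (step y z)
  then show ?case
    using swp_pull rel_option_shuf_trans by blast
qed

lemma shuf_pull_None: "shuf w v \<Longrightarrow> pull a w = None \<longleftrightarrow> pull a v = None"
  using shuf_pull[of w v a] by (cases "pull a w"; cases "pull a v") auto

text \<open>A letter cancels with a later one when the inverse can be pulled to the front of the
  tail behind it; shuffling does not affect this (\<open>shuf_reduced\<close>).\<close>

fun reduced :: "'v::graph word \<Rightarrow> bool" where
  "reduced [] \<longleftrightarrow> True"
| "reduced (a # w) \<longleftrightarrow> reduced w \<and> pull (linv a) w = None"

lemma swp_reduced: "swp w v \<Longrightarrow> reduced w \<Longrightarrow> reduced v"
proof (induction rule: swp.induct)
  case (swp_here x y ys)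
  then show ?case
    by (auto simp: adj_commute split: if_splits)
next
  case (swp_there u v a)
  then show ?case
    using shuf_pull_None[of u v "linv a"] by auto
qed

lemma shuf_reduced: "shuf w v \<Longrightarrow> reduced w \<longleftrightarrow> reduced v"
proof -
  have *: "shuf w v \<Longrightarrow> reduced w \<Longrightarrow> reduced v" for w v :: "'a word"
    by (induction rule: rtranclp_induct) (auto intro: swp_reduced)
  assume "shuf w v"
  then show ?thesis
    using * shuf_sym by blast
qed

text \<open>Left multiplication by a letter on reduced words. As in van der Waerden's argument for
  free products, the group acts on reduced words up to shuffling, which yields normal forms without
  a confluence proof.\<close>

definition act :: "'v::graph \<times> bool \<Rightarrow> 'v word \<Rightarrow> 'v word" where
  "act a w = (case pull (linv a) w of Some w' \<Rightarrow> w' | None \<Rightarrow> a # w)"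

lemma reduced_pull:
  assumes "reduced w" "pull a w = Some w'"
  shows "reduced w'" "pull (linv a) w' = None"
proof -
  have "reduced (a # w')"
    using shuf_reduced[OF pull_shuf[OF assms(2)]] assms(1) by blast
  then show "reduced w'" "pull (linv a) w' = None"
    by auto
qed

lemma reduced_act: "reduced w \<Longrightarrow> reduced (act a w)"
  by (auto simp: act_def reduced_pull split: option.splits)

lemma shuf_act: "shuf w v \<Longrightarrow> shuf (act a w) (act a v)"
  using shuf_pull[of w v "linv a"] by (auto simp: act_def shuf_Cons split: option.splits)

lemma act_linv: "reduced w \<Longrightarrow> shuf (act a (act (linv a) w)) w"
  by (cases "pull a w")
    (auto simp: act_def reduced_pull intro: shuf_sym pull_shuf split: option.splits)

text \<open>The commutation relation for the action; \<open>act_linv\<close> is the cancellation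
  relation. The four cases record which letters meet their inverse in front, and adjacency makes the
  two tests independent.\<close>

lemma act_swap:
  assumes "adj (fst a) (fst b)" "reduced w"
  shows "shuf (act a (act b w)) (act b (act a w))"
proof -
  have ab: "linv a \<noteq> b" "linv b \<noteq> a"
    using assms(1) by auto
  show ?thesis
  proof (cases "pull (linv a) w")
    case None
    note A = None
    show ?thesis
    proof (cases "pull (linv b) w")
      case None
      then show ?thesis
        using A ab assms(1) by (auto simp: act_def adj_commute intro: shuf_swap)
    next
      case (Some w1)
      have "pull (linv a) w1 = None"
        using shuf_pull_None[OF pull_shuf[OF Some], of "linv a"] A ab assms(1)
        by (auto split: if_splits)
      then show ?thesis
        using A Some ab assms(1) by (auto simp: act_def adj_commute)
    qed
  next
    case (Some w1)
    note A = Some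
    show ?thesis
    proof (cases "pull (linv b) w")
      case None
      have "pull (linv b) w1 = None"
        using shuf_pull_None[OF pull_shuf[OF A], of "linv b"] None ab assms(1)
        by (auto simp: adj_commute split: if_splits)
      then show ?thesis
        using A None ab assms(1) by (auto simp: act_def adj_commute)
    next
      case (Some w2)
      have "rel_option shuf (pull (linv a) w) (pull (linv a) (linv b # w2))"
        by (rule shuf_pull[OF pull_shuf[OF Some]])
      then obtain w3 where w3: "pull (linv a) w2 = Some w3" "shuf w1 (linv b # w3)"
        using A ab assms(1) by (auto simp: option.rel_sel split: if_splits)
      obtain w4 where w4: "pull (linv b) w1 = Some w4" "shuf w3 w4"
        using shuf_pull[OF w3(2), of "linv b"] by (auto simp: option_rel_Some2 intro: shuf_sym)
      show ?thesis
        using A Some w3 w4 by (auto simp: act_def)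
    qed
  qed
qed

definition nf :: "'v::graph word \<Rightarrow> 'v word" where
  "nf w = foldr act w []"

lemma reduced_foldr_act: "reduced w \<Longrightarrow> reduced (foldr act u w)"
  by (induction u) (auto intro: reduced_act)

lemma reduced_nf [simp]: "reduced (nf w)"
  by (simp add: nf_def reduced_foldr_act)

lemma shuf_foldr_act: "shuf w v \<Longrightarrow> shuf (foldr act u w) (foldr act u v)"
  by (induction u) (auto intro: shuf_act)

lemma nf_reduced: "reduced w \<Longrightarrow> nf w = w"
  by (induction w) (auto simp: nf_def act_def)

lemma swp_foldr_act:
  "swp u v \<Longrightarrow> reduced w \<Longrightarrow> shuf (foldr act u w) (foldr act v w)"
  by (induction rule: swp.induct) (auto intro: shuf_act act_swap reduced_foldr_act)

lemma shuf_foldr_act_left: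
  "shuf u v \<Longrightarrow> reduced w \<Longrightarrow> shuf (foldr act u w) (foldr act v w)"
proof (induction rule: rtranclp_induct)
  case (step y z)
  then show ?case
    using swp_foldr_act shuf_trans by blast
qed simp

text \<open>Multiplying a letter into a reduced word first, or acting with it afterwards, makes no
  difference; hence a word acts as its normal form does, and \<open>weq\<close> is compatible with
  concatenation.\<close>

lemma foldr_act_act:
  assumes "reduced u" "reduced w"
  shows "shuf (foldr act (act a u) w) (act a (foldr act u w))"
proof (cases "pull (linv a) u")
  case None
  then show ?thesis
    by (simp add: act_def)
next
  case (Some u')
  have "shuf (foldr act u w) (foldr act (linv a # u') w)"
    using assms by (intro shuf_foldr_act_left pull_shuf Some)
  then have "shuf (act a (foldr act u w)) (act a (act (linv a) (foldr act u' w)))"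
    by (auto intro: shuf_act)
  also have "shuf \<dots> (foldr act u' w)"
    using assms by (intro act_linv reduced_foldr_act)
  finally show ?thesis
    using Some by (auto simp: act_def intro: shuf_sym)
qed

lemma foldr_act_nf: "reduced w \<Longrightarrow> shuf (foldr act (nf u) w) (foldr act u w)"
proof (induction u)
  case (Cons a u)
  have "shuf (foldr act (nf (a # u)) w) (act a (foldr act (nf u) w))"
    using foldr_act_act[OF reduced_nf Cons.prems, of a u] by (simp add: nf_def)
  also have "shuf \<dots> (act a (foldr act u w))"
    by (intro shuf_act Cons)
  finally show ?case
    by simp
qed (simp add: nf_def)

text \<open>Equality in the group is defined through normal forms, so that length and support can be
  read off; \<open>raag_rel_iff\<close> identifies it with the relation generated by cancellation
  and commutation.\<close>

definition weq :: "'v::graph word \<Rightarrow> 'v word \<Rightarrow> bool" where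
  "weq u v \<longleftrightarrow> shuf (nf u) (nf v)"

lemma equivp_weq: "equivp weq"
  by (intro equivpI reflpI sympI transpI) (auto simp: weq_def intro: shuf_sym shuf_trans)

lemma weq_reduced: "reduced u \<Longrightarrow> reduced v \<Longrightarrow> weq u v \<longleftrightarrow> shuf u v"
  by (simp add: weq_def nf_reduced)

lemma weq_nf: "weq (nf w) w"
  by (simp add: weq_def nf_reduced)

lemma nf_append: "nf (u @ v) = foldr act u (nf v)"
  by (simp add: nf_def)

lemma weq_append:
  assumes "weq u u'" "weq v v'"
  shows "weq (u @ v) (u' @ v')"
proof -
  have "shuf (foldr act u (nf v)) (foldr act (nf u) (nf v))"
    by (rule shuf_sym[OF foldr_act_nf]) simp
  also have "shuf \<dots> (foldr act (nf u') (nf v))"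
    using assms(1) unfolding weq_def by (intro shuf_foldr_act_left) auto
  also have "shuf \<dots> (foldr act u' (nf v))"
    by (rule foldr_act_nf) simp
  also have "shuf \<dots> (foldr act u' (nf v'))"
    using assms(2) unfolding weq_def by (rule shuf_foldr_act)
  finally show ?thesis
    by (simp add: weq_def nf_append)
qed

lemma inv_word_linv: "inv_word w = rev (map linv w)"
proof -
  have "(\<lambda>(v, b). (v, \<not> b)) = (linv :: 'a \<times> bool \<Rightarrow> _)"
    by auto
  then show ?thesis
    by (simp add: inv_word_def)
qed

lemma inv_word_simps [simp]:
  "inv_word [] = []" "inv_word (u @ v) = inv_word v @ inv_word u"
  "inv_word (a # w) = inv_word w @ [linv a]"
  by (auto simp: inv_word_linv)

lemma inv_word_inv_word [simp]: "inv_word (inv_word w) = w"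
  by (induction w) auto

lemma weq_cancel: "weq (linv a # a # w) w"
proof -
  have "shuf (nf (linv a # a # w)) (nf w)"
    using act_linv[of "nf w" "linv a"] by (simp add: nf_def reduced_foldr_act)
  then show ?thesis
    by (simp add: weq_def)
qed

lemma weq_inv_word_left: "weq (inv_word w @ w) []"
proof (induction w)
  case Nil
  then show ?case
    by (simp add: weq_def)
next
  case (Cons a w)
  have "weq (inv_word w @ (linv a # a # w)) (inv_word w @ w)"
    by (intro weq_append weq_cancel) (simp add: weq_def)
  then show ?case
    using Cons equivp_transp[OF equivp_weq] by fastforce
qed

lemma weq_inv_word:
  assumes "weq u v"
  shows "weq (inv_word u) (inv_word v)"
proof -
  have refl: "weq w w" for w :: "'a word"
    by (simp add: weq_def)
  have "weq (inv_word u @ []) (inv_word u @ (v @ inv_word v))"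
    using weq_inv_word_left[of "inv_word v"] equivp_symp[OF equivp_weq]
    by (intro weq_append refl) auto
  moreover have "weq ((inv_word u @ v) @ inv_word v) ((inv_word u @ u) @ inv_word v)"
    using assms equivp_symp[OF equivp_weq] by (intro weq_append refl) auto
  moreover have "weq ((inv_word u @ u) @ inv_word v) ([] @ inv_word v)"
    by (intro weq_append refl weq_inv_word_left)
  ultimately show ?thesis
    using equivp_transp[OF equivp_weq] by (metis append.assoc append_Nil append_Nil2)
qed

\<comment> \<open>The group as a quotient type, written additively although it is not
  commutative\<close>
quotient_type (overloaded) 'v raag = "'v::graph word" / weq
  by (rule equivp_weq)

instantiation raag :: (graph) group_add
begin

lift_definition zero_raag :: "'a raag" is "[]" .
lift_definition plus_raag :: "'a raag \<Rightarrow> 'a raag \<Rightarrow> 'a raag" is "(@)"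
  by (rule weq_append)
lift_definition uminus_raag :: "'a raag \<Rightarrow> 'a raag" is inv_word
  by (rule weq_inv_word)
definition minus_raag :: "'a raag \<Rightarrow> 'a raag \<Rightarrow> 'a raag" where
  "minus_raag a b = a + (- b)"

instance
proof
  fix a b c :: "'a raag"
  show "a + b + c = a + (b + c)"
    by transfer (simp add: weq_def)
  show "0 + a = a" "a + 0 = a"
    by (transfer; simp add: weq_def)+
  show "- a + a = 0"
    by transfer (rule weq_inv_word_left)
  show "a + - b = a - b"
    by (simp add: minus_raag_def)
qed

end

section \<open>Length, support and end letters\<close>

lift_definition lett :: "'v::graph \<times> bool \<Rightarrow> 'v raag" is "\<lambda>a. [a]" .

abbreviation gen :: "'v::graph \<Rightarrow> 'v raag" where
  "gen v \<equiv> lett (v, True)"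

definition val :: "'v::graph word \<Rightarrow> 'v raag" where
  "val w = abs_raag w"

lemma val_eq_iff: "val u = val v \<longleftrightarrow> weq u v"
  by (simp add: val_def raag.abs_eq_iff)

lemma val_Nil [simp]: "val [] = 0"
  by (simp add: val_def zero_raag_def)

lemma val_append [simp]: "val (u @ v) = val u + val v"
  by (simp add: val_def plus_raag.abs_eq)

lemma val_Cons [simp]: "val (a # w) = lett a + val w"
  using val_append[of "[a]" w] by (simp add: val_def lett.abs_eq)

lemma val_inv_word [simp]: "val (inv_word w) = - val w"
  by (simp add: val_def uminus_raag.abs_eq)

lemma lett_linv [simp]: "lett (linv a) = - lett a"
proof -
  have "- lett a = val (inv_word [a])"
    unfolding val_inv_word by simp
  then show ?thesis
    by simp
qed

lemma lett_False [simp]: "lett (v, False) = - gen v"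
  using lett_linv[of "(v, True)"] by simp

definition rep :: "'v::graph raag \<Rightarrow> 'v word" where
  "rep g = nf (rep_raag g)"

lemma reduced_rep [simp]: "reduced (rep g)"
  by (simp add: rep_def)

lemma val_rep [simp]: "val (rep g) = g"
proof -
  have "val (rep g) = val (rep_raag g)"
    by (simp add: val_eq_iff rep_def weq_nf)
  then show ?thesis
    by (simp add: val_def Quotient_abs_rep[OF Quotient_raag])
qed

lemma shuf_val: "shuf u v \<Longrightarrow> reduced u \<Longrightarrow> val u = val v"
  using shuf_reduced[of u v] by (simp add: val_eq_iff weq_reduced)

lemma reduced_val_eq: "reduced u \<Longrightarrow> reduced v \<Longrightarrow> val u = val v \<longleftrightarrow> shuf u v"
  by (simp add: val_eq_iff weq_reduced)

lemma shuf_rep_val: "reduced w \<Longrightarrow> shuf (rep (val w)) w"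
  by (simp flip: reduced_val_eq)

lemma val_nf [simp]: "val (nf w) = val w"
  by (simp add: val_eq_iff weq_nf)

lemma length_act_le: "length (act a w) \<le> Suc (length w)"
  and set_act_subset: "set (act a w) \<subseteq> insert a (set w)"
proof -
  have "pull b w = Some w' \<Longrightarrow> length w = Suc (length w') \<and> set w' \<subseteq> set w" for b w'
    using pull_shuf[of b w w'] by (auto dest!: shuf_mset dest: mset_eq_length mset_eq_setD)
  then show "length (act a w) \<le> Suc (length w)" "set (act a w) \<subseteq> insert a (set w)"
    by (fastforce simp: act_def split: option.splits)+
qed

lemma length_nf_le: "length (nf w) \<le> length w"
proof (induction w)
  case (Cons a w)
  then show ?case
    using length_act_le[of a "nf w"] by (simp add: nf_def)
qed (simp add: nf_def)

lemma set_nf_subset: "set (nf w) \<subseteq> set w"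
proof (induction w)
  case (Cons a w)
  then show ?case
    using set_act_subset[of a "nf w"] by (auto simp: nf_def)
qed (simp add: nf_def)

lemma length_nf_less: "\<not> reduced w \<Longrightarrow> length (nf w) < length w"
proof (induction w)
  case (Cons a w)
  show ?case
  proof (cases "reduced w")
    case True
    with Cons.prems obtain w' where "pull (linv a) w = Some w'"
      by auto
    moreover from this have "length w = Suc (length w')"
      by (auto dest!: pull_shuf shuf_mset dest: mset_eq_length)
    moreover have "nf (a # w) = act a w"
      using nf_reduced[OF True] by (simp add: nf_def)
    ultimately show ?thesis
      by (simp add: act_def)
  next
    case False
    then show ?thesis
      using Cons.IH length_act_le[of a "nf w"] by (simp add: nf_def)
  qed
qed simp

lemma length_inv_word [simp]: "length (inv_word w) = length w"
  and fst_set_inv_word [simp]: "fst ` set (inv_word w) = fst ` set w"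
  by (induction w) auto

definition len :: "'v::graph raag \<Rightarrow> nat" where
  "len g = length (rep g)"

definition supp :: "'v::graph raag \<Rightarrow> 'v set" where
  "supp g = fst ` set (rep g)"

definition cnt :: "'v::graph \<times> bool \<Rightarrow> 'v raag \<Rightarrow> nat" where
  "cnt a g = count (mset (rep g)) a"

lemma shuf_nf_rep: "shuf (rep (val w)) (nf w)"
  by (simp flip: reduced_val_eq)

lemma mset_rep_val: "reduced w \<Longrightarrow> mset (rep (val w)) = mset w"
  by (intro shuf_mset shuf_rep_val)

lemma len_val: "reduced w \<Longrightarrow> len (val w) = length w"
  unfolding len_def by (metis mset_rep_val mset_eq_length)

lemma supp_val: "reduced w \<Longrightarrow> supp (val w) = fst ` set w"
  unfolding supp_def by (metis mset_rep_val mset_eq_setD)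

lemma cnt_val: "reduced w \<Longrightarrow> cnt a (val w) = count (mset w) a"
  by (simp add: cnt_def mset_rep_val)

lemma len_val_le: "len (val w) \<le> length w"
  using length_nf_le[of w] mset_eq_length[OF shuf_mset[OF shuf_nf_rep[of w]]]
  by (simp add: len_def)

lemma supp_val_subset: "supp (val w) \<subseteq> fst ` set w"
  using set_nf_subset[of w] mset_eq_setD[OF shuf_mset[OF shuf_nf_rep[of w]]]
  by (auto simp: supp_def)

lemma reduced_if_len: "len (val w) = length w \<Longrightarrow> reduced w"
  using length_nf_less[of w] mset_eq_length[OF shuf_mset[OF shuf_nf_rep[of w]]]
  by (auto simp: len_def)

lemma len_zero [simp]: "len 0 = 0"
  using len_val[of "[]"] by simp

lemma supp_zero [simp]: "supp 0 = {}"
  using supp_val[of "[]"] by simp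

lemma len_lett [simp]: "len (lett a) = 1"
  using len_val[of "[a]"] by simp

lemma supp_lett [simp]: "supp (lett a) = {fst a}"
  using supp_val[of "[a]"] by simp

lemma len_eq_0_iff [simp]: "len g = 0 \<longleftrightarrow> g = 0"
proof
  assume "len g = 0"
  then have "val (rep g) = 0"
    by (simp add: len_def)
  then show "g = 0"
    by simp
qed simp

lemma len_add_le: "len (g + h) \<le> len g + len h"
  using len_val_le[of "rep g @ rep h"] by (simp add: len_def)

lemma len_uminus [simp]: "len (- g) = len g"
proof -
  have *: "len (- g) \<le> len g" for g :: "'a raag"
    using len_val_le[of "inv_word (rep g)"] by (simp add: len_def)
  show ?thesis
    using *[of g] *[of "- g"] by simp
qed

lemma supp_uminus [simp]: "supp (- g) = supp g"
proof -
  have *: "supp (- g) \<subseteq> supp g" for g :: "'a raag"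
    using supp_val_subset[of "inv_word (rep g)"] by (simp add: supp_def)
  show ?thesis
    using *[of g] *[of "- g"] by auto
qed

lemma supp_add_subset: "supp (g + h) \<subseteq> supp g \<union> supp h"
  using supp_val_subset[of "rep g @ rep h"] by (auto simp: supp_def)

section \<open>First and last letters, and products without cancellation\<close>

definition starts :: "'v::graph \<times> bool \<Rightarrow> 'v raag \<Rightarrow> bool" where
  "starts a g \<longleftrightarrow> pull a (rep g) \<noteq> None"

definition ends :: "'v::graph \<times> bool \<Rightarrow> 'v raag \<Rightarrow> bool" where
  "ends a g \<longleftrightarrow> starts (linv a) (- g)"

lemma starts_val: "reduced w \<Longrightarrow> starts a (val w) \<longleftrightarrow> pull a w \<noteq> None"
  using shuf_pull_None[OF shuf_rep_val, of w a] by (auto simp: starts_def)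

lemma reduced_Cons_rep: "\<not> starts (linv a) g \<Longrightarrow> reduced (a # rep g)"
  by (simp add: starts_def)

lemma len_lett_add: "\<not> starts (linv a) g \<Longrightarrow> len (lett a + g) = Suc (len g)"
  using len_val[OF reduced_Cons_rep[of a g]] by (simp add: len_def)

lemma starts_lett_add: "\<not> starts (linv a) g \<Longrightarrow> starts a (lett a + g)"
  using starts_val[OF reduced_Cons_rep[of a g], of a] by simp

lemma starts_obtain:
  assumes "starts a g"
  obtains h where "g = lett a + h" "\<not> starts (linv a) h" "len g = Suc (len h)"
proof -
  obtain w where w: "pull a (rep g) = Some w"
    using assms by (auto simp: starts_def)
  then have r: "shuf (rep g) (a # w)" "reduced (a # w)"
    using pull_shuf shuf_reduced reduced_rep by blast+
  have "val (rep g) = val (a # w)"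
    by (intro shuf_val r reduced_rep)
  then have "g = lett a + val w"
    by simp
  moreover have "\<not> starts (linv a) (val w)"
    using r by (simp add: starts_val)
  ultimately show thesis
    using len_lett_add[of a "val w"] by (intro that[of "val w"]) simp_all
qed

lemma starts_lett_add_iff [simp]: "starts a (lett a + g) \<longleftrightarrow> \<not> starts (linv a) g"
proof
  assume "starts a (lett a + g)"
  then obtain h where "lett a + g = lett a + h" "\<not> starts (linv a) h"
    using starts_obtain by blast
  then show "\<not> starts (linv a) g"
    by simp
qed (rule starts_lett_add)

lemma len_diff_lett: "starts a g \<Longrightarrow> Suc (len (- lett a + g)) = len g"
  by (erule starts_obtain) (auto simp flip: add.assoc)

lemma starts_iff_len: "starts a g \<longleftrightarrow> len (- lett a + g) < len g"
  using len_diff_lett[of a g] len_lett_add[of "linv a" g] by fastforce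

lemma starts_two:
  assumes "starts a g" "starts b g" "a \<noteq> b"
  shows "adj (fst a) (fst b)"
proof -
  have "pull a w \<noteq> None \<Longrightarrow> pull b w \<noteq> None \<Longrightarrow> adj (fst a) (fst b)" for w
    using assms(3) by (induction w) (auto simp: adj_commute split: if_splits)
  then show ?thesis
    using assms by (simp add: starts_def)
qed

lemma starts_adj:
  assumes "adj (fst a) (fst b)"
  shows "starts a (lett b + g) \<longleftrightarrow> starts a g"
proof -
  have *: "starts a (lett b + g) \<longleftrightarrow> starts a g"
    if "\<not> starts (linv b) g" "adj (fst a) (fst b)" for b g
    using starts_val[OF reduced_Cons_rep[OF that(1)], of a] that(2) by (auto simp: starts_def)
  show ?thesis
  proof (cases "starts (linv b) g")
    case True
    then obtain h where h: "g = lett (linv b) + h" "\<not> starts (linv (linv b)) h"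
      by (rule starts_obtain)
    then show ?thesis
      using *[OF h(2)] assms by (simp flip: add.assoc)
  qed (use * assms in blast)
qed

lemma raag_induct [case_names zero add]:
  assumes "P 0" and "\<And>a g. \<not> starts (linv a) g \<Longrightarrow> P g \<Longrightarrow> P (lett a + g)"
  shows "P g"
proof -
  have "reduced w \<Longrightarrow> P (val w)" for w
    by (induction w) (auto simp: assms starts_val)
  then show ?thesis
    by (metis reduced_rep val_rep)
qed

lemma starts_exists: "g \<noteq> 0 \<Longrightarrow> \<exists>a. starts a g"
proof (induction g rule: raag_induct)
  case (add a g)
  then show ?case
    using starts_lett_add by blast
qed simp

lemma ends_exists: "g \<noteq> 0 \<Longrightarrow> \<exists>a. ends a g"
  using starts_exists[of "- g"] by (metis ends_def linv_linv neg_equal_0_iff_equal)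

lemma ends_obtain:
  assumes "ends a g"
  obtains h where "g = h + lett a" "len g = Suc (len h)"
proof -
  obtain h where h: "- g = lett (linv a) + h" "len (- g) = Suc (len h)"
    using assms starts_obtain unfolding ends_def by metis
  then have "g = - h + lett a" "len g = Suc (len (- h))"
    by (metis lett_linv minus_add minus_minus, metis h(2) len_uminus)
  then show thesis
    by (rule that)
qed

lemma ends_iff_len: "ends a g \<longleftrightarrow> len (g - lett a) < len g"
proof -
  have "len (lett a - g) = len (g - lett a)"
    by (metis len_uminus minus_diff_eq)
  then show ?thesis
    by (simp add: ends_def starts_iff_len)
qed

lemma ends_add_lett_iff [simp]: "ends a (g + lett a) \<longleftrightarrow> \<not> ends (linv a) g"
  using starts_lett_add_iff[of "linv a" "- g"] by (simp add: ends_def minus_add)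

lemma starts_imp_supp: "starts a g \<Longrightarrow> fst a \<in> supp g"
  by (cases a) (force simp: starts_def supp_def dest!: pull_shuf shuf_mset mset_eq_setD)

lemma ends_imp_supp: "ends a g \<Longrightarrow> fst a \<in> supp g"
  using starts_imp_supp[of "linv a" "- g"] by (simp add: ends_def)

text \<open>Absence of cancellation is expressed by additivity of length, because in this form it
  passes to inverses and to triple products by arithmetic (\<open>red_uminus\<close>,
  \<open>red_assoc\<close>).\<close>

definition red :: "'v::graph raag \<Rightarrow> 'v raag \<Rightarrow> bool" where
  "red g h \<longleftrightarrow> len (g + h) = len g + len h"

lemma red_reduced: "red g h \<Longrightarrow> reduced (rep g @ rep h)"
  by (rule reduced_if_len) (simp add: red_def len_def)

lemma red_rep_mset: "red g h \<Longrightarrow> mset (rep (g + h)) = mset (rep g) + mset (rep h)"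
  using mset_rep_val[OF red_reduced[of g h]] by simp

lemma red_supp: "red g h \<Longrightarrow> supp (g + h) = supp g \<union> supp h"
  using supp_val[OF red_reduced[of g h]] by (simp add: supp_def image_Un)

lemma red_cnt: "red g h \<Longrightarrow> cnt a (g + h) = cnt a g + cnt a h"
  using cnt_val[OF red_reduced[of g h], of a] by (simp add: cnt_def)

lemma red_lett: "red (lett a) g \<longleftrightarrow> \<not> starts (linv a) g"
proof -
  have "len (lett a + g) < len g" if "starts (linv a) g"
    using that by (simp add: starts_iff_len)
  then show ?thesis
    using len_lett_add[of a g] by (fastforce simp: red_def)
qed

lemma red_uminus: "red (- h) (- g) \<longleftrightarrow> red g h"
proof -
  have "len (- h + - g) = len (g + h)"
    by (metis len_uminus minus_add)
  then show ?thesis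
    by (simp add: red_def add.commute)
qed

lemma red_lett_right: "red g (lett a) \<longleftrightarrow> \<not> ends (linv a) g"
  using red_uminus[of "lett a" g] red_lett[of "linv a" "- g"]
  by (metis ends_def lett_linv linv_linv red_uminus)

lemma red_zero [simp]: "red 0 g" "red g 0"
  by (simp_all add: red_def)

lemma red_assoc: "red g h \<Longrightarrow> red (g + h) k \<longleftrightarrow> red h k \<and> red g (h + k)"
  using len_add_le[of h k] len_add_le[of g "h + k"]
  by (auto simp: red_def add.assoc)

lemma starts_red: "red g h \<Longrightarrow> starts a g \<Longrightarrow> starts a (g + h)"
proof -
  assume *: "red g h" "starts a g"
  have "len (- lett a + (g + h)) \<le> len (- lett a + g) + len h"
    using len_add_le[of "- lett a + g" h] by (simp add: add.assoc)
  also have "\<dots> < len g + len h"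
    using *(2) by (simp add: starts_iff_len)
  finally show ?thesis
    using *(1) by (simp add: starts_iff_len red_def)
qed

lemma ends_red: "red g h \<Longrightarrow> ends a h \<Longrightarrow> ends a (g + h)"
  unfolding ends_def minus_add by (rule starts_red) (simp_all only: red_uminus)

lemma lett_commute: "adj (fst a) (fst b) \<Longrightarrow> lett a + lett b = lett b + lett a"
proof -
  assume adj: "adj (fst a) (fst b)"
  then have "reduced [a, b]"
    by auto
  with shuf_val[OF shuf_swap[OF adj, of "[]"]] show ?thesis
    by simp
qed

text \<open>All letters of \<open>g\<close> turn out to be adjacent to \<open>b\<close>, so
  \<open>b\<close> can be moved past them until it is a last letter and meets its inverse in front
  of \<open>h\<close>.\<close>

lemma not_red_lett:
  "red g h \<Longrightarrow> starts (linv b) (g + h) \<Longrightarrow> \<not> starts (linv b) g \<Longrightarrow>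
    \<exists>a. ends a (lett b + g) \<and> starts (linv a) h"
proof (induction g arbitrary: b rule: raag_induct)
  case zero
  have "ends b (lett b + 0)"
    by (simp add: ends_iff_len)
  moreover have "starts (linv b) h"
    using zero by simp
  ultimately show ?case
    by blast
next
  case (add c g)
  have rc: "red (lett c) g"
    using add.hyps by (simp add: red_lett)
  have gh: "red g h" "red (lett c) (g + h)"
    using add.prems(1) red_assoc[OF rc] by auto
  have sc: "starts c (lett c + (g + h))" "starts c (lett c + g)"
    using gh(2) rc by (auto simp: red_lett)
  have sb: "starts (linv b) (lett c + (g + h))"
    using add.prems(2) by (simp add: add.assoc)
  have "linv b \<noteq> c"
    using add.prems(3) sc(2) by blast
  then have adj: "adj (fst b) (fst c)"
    using starts_two[OF sb sc(1)] by simp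
  have "starts (linv b) (g + h)"
    using sb starts_adj[of "linv b" c] adj by simp
  moreover have "\<not> starts (linv b) g"
    using add.prems(3) starts_adj[of "linv b" c] adj by simp
  ultimately obtain a where a: "ends a (lett b + g)" "starts (linv a) h"
    using add.IH[OF gh(1)] by blast
  have "\<not> starts (linv c) (lett b + g)"
    using add.hyps starts_adj[of "linv c" b] adj by (simp add: adj_commute)
  then have "red (lett c) (lett b + g)"
    by (simp add: red_lett)
  then have "ends a (lett c + (lett b + g))"
    using a(1) by (rule ends_red)
  moreover have "lett b + (lett c + g) = lett c + (lett b + g)"
    by (simp only: lett_commute[OF adj] flip: add.assoc)
  ultimately have "ends a (lett b + (lett c + g))"
    by simp
  with a(2) show ?case
    by blast
qed

text \<open>Cancellation is always visible at one pair of letters: peel letters off the front of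
  \<open>g\<close> until the rest multiplies with \<open>h\<close> without cancellation, and apply
  \<open>not_red_lett\<close> to the letter that spoils it.\<close>

lemma not_red: "\<not> red g h \<Longrightarrow> \<exists>a. ends a g \<and> starts (linv a) h"
proof (induction g rule: raag_induct)
  case (add b g)
  have b: "red (lett b) g"
    using add.hyps(1) by (simp only: red_lett simp_thms)
  show ?case
  proof (cases "red g h")
    case False
    then obtain a where "ends a g" "starts (linv a) h"
      using add.IH by blast
    then show ?thesis
      using ends_red[OF b, of a] by blast
  next
    case True
    then have "starts (linv b) (g + h)"
      using add.prems unfolding red_assoc[OF b] red_lett by blast
    then show ?thesis
      using not_red_lett[OF True _ add.hyps(1)] by blast
  qed
qed simp

section \<open>Homomorphisms and parabolic subgroups\<close>

definition cm :: "'g::group_add \<Rightarrow> 'g \<Rightarrow> bool" where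
  "cm x y \<longleftrightarrow> x + y = y + x"

lemma cm_sym: "cm x y \<Longrightarrow> cm y x"
  by (simp add: cm_def)

lemma cm_refl [simp]: "cm x x"
  and cm_zero [simp]: "cm 0 x" "cm x 0"
  by (simp_all add: cm_def)

lemma cm_add:
  assumes "cm x y" "cm x z"
  shows "cm x (y + z)"
proof -
  have "x + (y + z) = y + (x + z)"
    using assms(1) by (simp add: cm_def flip: add.assoc)
  also have "\<dots> = y + z + x"
    using assms(2) by (simp add: cm_def add.assoc)
  finally show ?thesis
    by (simp add: cm_def)
qed

lemma cm_uminus:
  assumes "cm x y"
  shows "cm x (- y)"
proof -
  have "x + - y = - y + (y + x) + - y"
    by (simp only: minus_add_cancel)
  also have "\<dots> = - y + (x + y) + - y"
    using assms by (simp add: cm_def)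
  also have "\<dots> = - y + x"
    by (simp only: add.assoc add.right_inverse add_0_right)
  finally show ?thesis
    by (simp only: cm_def)
qed

lemma cm_uminus_iff [simp]: "cm x (- y) \<longleftrightarrow> cm x y" "cm (- x) y \<longleftrightarrow> cm x y"
  by (metis cm_sym cm_uminus minus_minus)+

lemma cm_add_left: "cm y x \<Longrightarrow> cm z x \<Longrightarrow> cm (y + z) x"
  by (metis cm_sym cm_add)

lemma cm_conj: "cm (h + x - h) (h + y - h) \<longleftrightarrow> cm x y"
proof -
  have *: "(h + x - h) + (h + y - h) = h + (x + y) + - h" for x y
    by (simp only: diff_conv_add_uminus add.assoc minus_add_cancel)
  show ?thesis
    unfolding cm_def * add_right_cancel add_left_cancel ..
qed

definition slet :: "('v \<Rightarrow> 'g::group_add) \<Rightarrow> 'v \<times> bool \<Rightarrow> 'g" where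
  "slet s a = (if snd a then s (fst a) else - s (fst a))"

lemma slet_linv [simp]: "slet s (linv a) = - slet s a"
  by (cases a) (simp add: slet_def)

lemma slet_gen [simp]: "slet s (v, True) = s v" "slet s (v, False) = - s v"
  by (simp_all add: slet_def)

definition sval :: "('v \<Rightarrow> 'g::group_add) \<Rightarrow> 'v word \<Rightarrow> 'g" where
  "sval s w = sum_list (map (slet s) w)"

lemma sval_simps [simp]: "sval s [] = 0" "sval s (a # w) = slet s a + sval s w"
  "sval s (u @ v) = sval s u + sval s v"
  by (simp_all add: sval_def)

definition compat :: "('v::graph \<Rightarrow> 'g::group_add) \<Rightarrow> bool" where
  "compat s \<longleftrightarrow> (\<forall>u v. adj u v \<longrightarrow> cm (s u) (s v))"

definition ext :: "('v::graph \<Rightarrow> 'g::group_add) \<Rightarrow> 'v raag \<Rightarrow> 'g" where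
  "ext s g = sval s (rep g)"

definition ghom :: "('g::group_add \<Rightarrow> 'h::group_add) \<Rightarrow> bool" where
  "ghom f \<longleftrightarrow> (\<forall>x y. f (x + y) = f x + f y)"

lemma ghom_add: "ghom f \<Longrightarrow> f (x + y) = f x + f y"
  by (simp add: ghom_def)

lemma ghom_zero: "ghom f \<Longrightarrow> f 0 = 0"
  by (metis ghom_add add_0_right add_left_cancel)

lemma ghom_uminus: "ghom f \<Longrightarrow> f (- x) = - f x"
  by (metis ghom_add ghom_zero left_minus minus_unique minus_minus)

lemma ghom_diff: "ghom f \<Longrightarrow> f (x - y) = f x - f y"
  by (simp only: diff_conv_add_uminus ghom_add ghom_uminus)

lemmas ghom_simps = ghom_add ghom_zero ghom_uminus ghom_diff

lemma ghom_comp: "ghom f \<Longrightarrow> ghom g \<Longrightarrow> ghom (\<lambda>x. f (g x))"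
  by (simp add: ghom_def)

lemma ghom_id: "ghom (\<lambda>x. x)"
  by (simp add: ghom_def)

lemma ghom_cm: "ghom f \<Longrightarrow> cm x y \<Longrightarrow> cm (f x) (f y)"
  by (metis cm_def ghom_add)

lemma compat_slet: "compat s \<Longrightarrow> adj (fst a) (fst b) \<Longrightarrow> cm (slet s a) (slet s b)"
  by (simp add: compat_def slet_def)

lemma swp_sval: "swp u v \<Longrightarrow> compat s \<Longrightarrow> sval s u = sval s v"
proof (induction rule: swp.induct)
  case (swp_here x y ys)
  then show ?case
    using compat_slet[of s x y] by (simp add: cm_def flip: add.assoc)
qed simp

lemma shuf_sval: "shuf u v \<Longrightarrow> compat s \<Longrightarrow> sval s u = sval s v"
  by (induction rule: rtranclp_induct) (auto dest: swp_sval)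

lemma sval_act: "compat s \<Longrightarrow> sval s (act a w) = slet s a + sval s w"
proof (cases "pull (linv a) w")
  case (Some w')
  assume "compat s"
  then have "sval s w = - slet s a + sval s w'"
    using shuf_sval[OF pull_shuf[OF Some]] by simp
  then show ?thesis
    using Some by (simp add: act_def flip: add.assoc)
qed (simp add: act_def)

lemma sval_nf: "compat s \<Longrightarrow> sval s (nf w) = sval s w"
  by (induction w) (auto simp: nf_def sval_act)

lemma ext_val: "compat s \<Longrightarrow> ext s (val w) = sval s w"
proof -
  assume "compat s"
  moreover from this have "sval s (rep (val w)) = sval s (nf w)"
    using shuf_nf_rep by (intro shuf_sval)
  ultimately show ?thesis
    by (simp add: ext_def sval_nf)
qed

lemma ghom_ext: "compat s \<Longrightarrow> ghom (ext s)"
proof -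
  assume "compat s"
  then have "ext s (val (rep x @ rep y)) = ext s x + ext s y" for x y
    by (simp only: ext_val sval_simps) (simp add: ext_def)
  then show ?thesis
    by (simp add: ghom_def)
qed

lemma ext_lett [simp]: "compat s \<Longrightarrow> ext s (lett a) = slet s a"
  using ext_val[of s "[a]"] by simp

lemma ghom_lett: "ghom f \<Longrightarrow> f (lett a) = slet (\<lambda>v. f (gen v)) a"
  by (cases a) (auto simp: slet_def ghom_uminus)

text \<open>The parabolic subgroup generated by \<open>U\<close>, described by supports so that
  intersections of such subgroups are immediate (\<open>gp_Int\<close>).\<close>

definition gp :: "'v::graph set \<Rightarrow> 'v raag set" where
  "gp U = {g. supp g \<subseteq> U}"

lemma gp_zero [simp]: "0 \<in> gp U"
  and gp_lett [simp]: "lett a \<in> gp U \<longleftrightarrow> fst a \<in> U"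
  and gp_uminus [simp]: "- g \<in> gp U \<longleftrightarrow> g \<in> gp U"
  by (simp_all add: gp_def)

lemma gp_add: "g \<in> gp U \<Longrightarrow> h \<in> gp U \<Longrightarrow> g + h \<in> gp U"
  using supp_add_subset by (fastforce simp: gp_def)

lemma gp_diff: "g \<in> gp U \<Longrightarrow> h \<in> gp U \<Longrightarrow> g - h \<in> gp U"
  by (simp only: diff_conv_add_uminus gp_add gp_uminus)

lemma gp_add_left [simp]: "g \<in> gp U \<Longrightarrow> g + h \<in> gp U \<longleftrightarrow> h \<in> gp U"
  using gp_add[of g U h] gp_add[of "- g" U "g + h"] by (auto simp flip: add.assoc)

lemma gp_mono: "U \<subseteq> W \<Longrightarrow> gp U \<subseteq> gp W"
  by (auto simp: gp_def)

lemma gp_Int: "gp (U \<inter> W) = gp U \<inter> gp W"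
  by (auto simp: gp_def)

lemma val_in_gp: "fst ` set w \<subseteq> U \<Longrightarrow> val w \<in> gp U"
  using supp_val_subset by (force simp: gp_def)

lemma red_gp: "red g h \<Longrightarrow> g + h \<in> gp U \<longleftrightarrow> g \<in> gp U \<and> h \<in> gp U"
  by (simp add: gp_def red_supp)

lemma gp_induct [consumes 1, case_names zero add]:
  assumes "g \<in> gp U" "P 0"
    and "\<And>a g. fst a \<in> U \<Longrightarrow> g \<in> gp U \<Longrightarrow> \<not> starts (linv a) g \<Longrightarrow> P g \<Longrightarrow> P (lett a + g)"
  shows "P g"
  using assms(1)
proof (induction g rule: raag_induct)
  case (add a g)
  then have "red (lett a) g"
    by (simp add: red_lett)
  then have "fst a \<in> U" "g \<in> gp U"
    using add.prems red_gp by force+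
  then show ?case
    using add assms(3) by blast
qed (use assms in blast)

lemma ghom_eq_on_gp:
  assumes "ghom f" "ghom h" "\<And>v. v \<in> U \<Longrightarrow> f (gen v) = h (gen v)" "g \<in> gp U"
  shows "f g = h g"
  using assms(4)
proof (induction g rule: gp_induct)
  case (add a g)
  then have "f (lett a) = h (lett a)"
    using ghom_lett[OF assms(1), of a] ghom_lett[OF assms(2), of a] assms(3) by (simp add: slet_def)
  then show ?case
    using add by (simp add: ghom_add[OF assms(1)] ghom_add[OF assms(2)])
qed (simp add: ghom_zero[OF assms(1)] ghom_zero[OF assms(2)])

lemma ghom_image_gp:
  assumes "ghom f" "\<And>v. v \<in> U \<Longrightarrow> f (gen v) \<in> gp W" "g \<in> gp U"
  shows "f g \<in> gp W"
  using assms(3)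
proof (induction g rule: gp_induct)
  case (add a g)
  then have "f (lett a) \<in> gp W"
    using ghom_lett[OF assms(1), of a] assms(2) by (simp add: slet_def)
  then show ?case
    using add by (simp add: ghom_add[OF assms(1)])
qed (simp add: ghom_zero[OF assms(1)])

lemma cm_gp:
  assumes "g \<in> gp U" "\<And>a. fst a \<in> U \<Longrightarrow> cm (lett a) h"
  shows "cm g h"
  using assms(1) by (induction g rule: gp_induct) (auto intro: cm_add_left assms)

lemma cm_lett: "adj (fst a) (fst b) \<Longrightarrow> cm (lett a) (lett b)"
  unfolding cm_def by (rule lett_commute)

lemma compat_gen: "compat gen"
  by (auto simp: compat_def intro: cm_lett)

section \<open>Exponent sums and retractions onto parabolic subgroups\<close>

definition expo :: "'v::graph \<Rightarrow> 'v raag \<Rightarrow> int" where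
  "expo x = ext (\<lambda>v. if v = x then 1 else 0)"

lemma compat_int: "compat (s :: 'v::graph \<Rightarrow> int)"
  by (simp add: compat_def cm_def)

lemma ghom_expo: "ghom (expo x)"
  unfolding expo_def by (intro ghom_ext compat_int)

lemma expo_simps [simp]: "expo x (g + h) = expo x g + expo x h" "expo x 0 = 0"
  "expo x (- g) = - expo x g" "expo x (g - h) = expo x g - expo x h"
  using ghom_simps[OF ghom_expo] by blast+

lemma expo_lett: "expo x (lett a) = (if fst a = x then if snd a then 1 else - 1 else 0)"
  by (simp add: expo_def compat_int slet_def)

lemma expo_eq_cnt: "expo x g = int (cnt (x, True) g) - int (cnt (x, False) g)"
proof (induction g rule: raag_induct)
  case zero
  then show ?case
    using cnt_val[of "[] :: 'a word"] by simp
next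
  case (add a g)
  then have *: "red (lett a) g"
    by (simp add: red_lett)
  have c: "cnt b (lett a) = (if b = a then 1 else 0)" for b
    using cnt_val[of "[a]" b] by simp
  show ?case
    by (simp add: red_cnt[OF *] expo_lett c add.IH) (cases a; auto)
qed

lemma expo_notin_supp: "x \<notin> supp g \<Longrightarrow> expo x g = 0"
proof -
  assume "x \<notin> supp g"
  then have *: "(x, b) \<notin> set (rep g)" for b
    by (force simp: supp_def)
  have "count (mset (rep g)) (x, b) = 0" for b
    using * by (metis count_eq_zero_iff set_mset_mset)
  from this[of True] this[of False] show ?thesis
    unfolding expo_eq_cnt cnt_def by linarith
qed

definition retr :: "'v::graph set \<Rightarrow> 'v raag \<Rightarrow> 'v raag" where
  "retr U = ext (\<lambda>v. if v \<in> U then gen v else 0)"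

lemma compat_retr: "compat (\<lambda>v. if v \<in> U then gen v else 0)"
  using compat_gen by (auto simp: compat_def)

lemma ghom_retr: "ghom (retr U)"
  unfolding retr_def by (intro ghom_ext compat_retr)

lemmas retr_simps [simp] = ghom_simps[OF ghom_retr]

lemma retr_lett [simp]: "retr U (lett a) = (if fst a \<in> U then lett a else 0)"
  by (cases a) (auto simp: retr_def compat_retr slet_def)

lemma retr_gp: "g \<in> gp U \<Longrightarrow> retr U g = g"
  by (induction g rule: gp_induct) auto

lemma retr_in_gp: "retr U g \<in> gp U"
  by (induction g rule: raag_induct) (auto intro: gp_add)

lemma expo_retr: "x \<in> U \<Longrightarrow> expo x (retr U g) = expo x g"
  by (induction g rule: raag_induct) (auto simp: expo_lett)

lemma len_retr_le: "len (retr U g) \<le> len g"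
proof (induction g rule: raag_induct)
  case (add a g)
  then show ?case
    using len_add_le[of "lett a" "retr U g"] by (auto simp: len_lett_add)
qed simp

lemma len_retr_less: "g \<notin> gp U \<Longrightarrow> len (retr U g) < len g"
proof (induction g rule: raag_induct)
  case (add a g)
  show ?case
  proof (cases "fst a \<in> U")
    case True
    then have "g \<notin> gp U"
      using add.prems gp_add gp_lett by blast
    then show ?thesis
      using add.IH len_add_le[of "lett a" "retr U g"] len_lett_add[OF add.hyps] True by simp
  next
    case False
    then show ?thesis
      using len_retr_le[of U g] len_lett_add[OF add.hyps] by simp
  qed
qed simp

section \<open>Prefixes\<close>

lemma starts_lett [simp]: "starts a (lett b) \<longleftrightarrow> a = b"
  using starts_val[of "[b]" a] by auto

lemma starts_zero [simp]: "\<not> starts a 0"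
  by (simp add: starts_iff_len)

lemma ends_zero [simp]: "\<not> ends a 0"
  by (simp add: ends_iff_len)

lemma red_assoc2: "red t u \<Longrightarrow> red c (t + u) \<longleftrightarrow> red c t \<and> red (c + t) u"
  using len_add_le[of c t] len_add_le[of "c + t" u]
  by (auto simp: red_def add.assoc)

lemma starts_gp_adj:
  assumes "k \<in> gp U" "\<And>u. u \<in> U \<Longrightarrow> adj (fst a) u"
  shows "starts a (k + g) \<longleftrightarrow> starts a g"
  using assms(1) by (induction k rule: gp_induct) (auto simp: starts_adj assms(2) add.assoc)

definition pre :: "'v::graph raag \<Rightarrow> 'v raag \<Rightarrow> bool" where
  "pre s q \<longleftrightarrow> red s (- s + q)"

lemma pre_add_iff [simp]: "pre s (s + r) \<longleftrightarrow> red s r"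
  by (simp add: pre_def flip: add.assoc)

lemma pre_obtain:
  assumes "pre s q"
  obtains r where "q = s + r" "red s r"
  using assms that[of "- s + q"] by (simp add: pre_def flip: add.assoc)

lemma pre_lett: "pre (lett a) q \<longleftrightarrow> starts a q"
proof -
  have "\<not> starts (linv a) (- lett a + q) \<longleftrightarrow> starts a q"
    using starts_lett_add_iff[of a "- lett a + q"] by (simp flip: add.assoc)
  then show ?thesis
    by (simp add: pre_def red_lett)
qed

lemma pre_refl [simp]: "pre s s"
  and pre_zero [simp]: "pre 0 s"
  by (simp_all add: pre_def)

lemma pre_trans:
  assumes "pre s t" "pre t q"
  shows "pre s q"
proof -
  obtain r where r: "t = s + r" "red s r"
    using assms(1) by (rule pre_obtain)
  obtain r' where r': "q = t + r'" "red t r'"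
    using assms(2) by (rule pre_obtain)
  then have "red s (r + r')"
    using r red_assoc by blast
  then show ?thesis
    using r r' by (simp add: add.assoc)
qed

lemma pre_len: "pre s q \<Longrightarrow> len s \<le> len q"
  by (erule pre_obtain) (simp add: red_def)

lemma pre_len_eq: "pre s q \<Longrightarrow> len s = len q \<Longrightarrow> s = q"
  by (erule pre_obtain) (simp add: red_def)

lemma pre_supp: "pre s q \<Longrightarrow> supp s \<subseteq> supp q"
  by (erule pre_obtain) (simp add: red_supp)

lemma pre_gp: "pre s q \<Longrightarrow> q \<in> gp U \<Longrightarrow> s \<in> gp U"
  using pre_supp by (fastforce simp: gp_def)

lemma pre_left:
  assumes "red c r" "pre t r"
  shows "pre (c + t) (c + r)"
proof -
  obtain u where "r = t + u" "red t u"
    using assms(2) by (rule pre_obtain)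
  then show ?thesis
    using assms(1) red_assoc2[of t u c] by (simp flip: add.assoc)
qed

text \<open>The letter \<open>a\<close> is first in \<open>q\<close> but not in the prefix
  \<open>s\<close>, so it has to be moved forward across all of \<open>s\<close>.\<close>

lemma starts_pre_adj:
  assumes "starts a q" "pre s q" "\<not> starts a s"
  shows "\<forall>v \<in> supp s. adj (fst a) v"
  using assms
proof (induction s arbitrary: q rule: raag_induct)
  case (add b s)
  have rb: "red (lett b) s"
    using add.hyps by (simp add: red_lett)
  obtain r where r: "q = lett b + s + r" "red (lett b + s) r"
    using add.prems(2) by (rule pre_obtain)
  have r': "red s r" "red (lett b) (s + r)"
    using r(2) red_assoc[OF rb] by auto
  have q: "q = lett b + (s + r)"
    using r(1) by (simp add: add.assoc)
  have "starts b q" "starts b (lett b + s)"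
    using r'(2) rb unfolding q by (simp_all add: red_lett)
  then have adj: "adj (fst a) (fst b)"
    using starts_two[OF add.prems(1)] add.prems(3) by blast
  have "starts a (s + r)" "\<not> starts a s"
    using add.prems(1,3) starts_adj[OF adj] unfolding q by auto
  then have "\<forall>v \<in> supp s. adj (fst a) v"
    using add.IH r'(1) by simp
  then show ?case
    using adj by (simp add: red_supp[OF rb])
qed simp

lemma pre_adj_letter:
  assumes "pre t (lett l + q)" "\<not> starts (linv l) q" "\<forall>v \<in> supp t. adj (fst l) v"
  shows "pre t q"
proof -
  have t: "- t \<in> gp (supp t)"
    by (simp add: gp_def)
  have "cm (- t) (lett l)"
    using assms(3) by (intro cm_gp[OF t]) (auto intro: cm_lett adj_sym)
  then have *: "- t + (lett l + q) = lett l + (- t + q)"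
    by (simp add: cm_def flip: add.assoc)
  have "\<not> starts (linv l) (- t + q)"
    using assms(2,3) starts_gp_adj[OF t, of "linv l" q] by simp
  then have "len (- t + (lett l + q)) = Suc (len (- t + q))"
    unfolding * by (rule len_lett_add)
  then show ?thesis
    using assms(1) len_lett_add[OF assms(2)] by (simp add: pre_def red_def flip: add.assoc)
qed

lemma no_common_letter_adj:
  assumes "pre s q" "pre t q" "\<And>l. starts l s \<Longrightarrow> \<not> starts l t"
  shows "\<forall>u \<in> supp s. \<forall>v \<in> supp t. adj u v"
  using assms
proof (induction s arbitrary: q rule: raag_induct)
  case (add l s)
  have rl: "red (lett l) s"
    using add.hyps by (simp add: red_lett)
  obtain r where r: "q = lett l + s + r" "red (lett l + s) r"
    using add.prems(1) by (rule pre_obtain)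
  have r': "red s r" "red (lett l) (s + r)"
    using r(2) red_assoc[OF rl] by auto
  have q: "q = lett l + (s + r)"
    using r(1) by (simp add: add.assoc)
  have "starts l q" "starts l (lett l + s)"
    using r'(2) rl unfolding q by (simp_all add: red_lett)
  then have adj: "\<forall>v \<in> supp t. adj (fst l) v"
    using starts_pre_adj add.prems(2,3) by blast
  have "pre t (s + r)"
    using pre_adj_letter[of t l "s + r"] add.prems(2) adj r'(2) by (simp add: q red_lett)
  moreover have "\<not> starts b t" if "starts b s" for b
  proof
    assume b: "starts b t"
    then have "adj (fst l) (fst b)"
      using adj starts_imp_supp by blast
    then have "starts b (lett l + s)"
      using that starts_adj[of b l s] by (simp add: adj_commute)
    then show False
      using add.prems(3) b by blast
  qed
  ultimately have "\<forall>u \<in> supp s. \<forall>v \<in> supp t. adj u v"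
    using add.IH[of "s + r"] r'(1) by simp
  then show ?case
    using adj by (simp add: red_supp[OF rl])
qed simp

text \<open>Strip common first letters as long as there are any. Afterwards every letter of one
  remainder must pass across the other one inside \<open>q\<close>, which is
  \<open>no_common_letter_adj\<close>.\<close>

lemma pre_meet:
  assumes "pre s q" "pre t q"
  shows "\<exists>d a b. s = d + a \<and> t = d + b \<and> red d a \<and> red d b \<and>
    (\<forall>u \<in> supp a. \<forall>v \<in> supp b. adj u v)"
  using assms
proof (induction "len s" arbitrary: s t q rule: less_induct)
  case less
  show ?case
  proof (cases "\<exists>l. starts l s \<and> starts l t")
    case False
    then have "\<forall>u \<in> supp s. \<forall>v \<in> supp t. adj u v"
      using no_common_letter_adj[OF less.prems] by blast
    then have "s = 0 + s \<and> t = 0 + t \<and> red 0 s \<and> red 0 t \<and>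
        (\<forall>u \<in> supp s. \<forall>v \<in> supp t. adj u v)"
      by simp
    then show ?thesis
      by blast
  next
    case True
    then obtain l where l: "starts l s" "starts l t"
      by blast
    obtain s1 where s1: "s = lett l + s1" "\<not> starts (linv l) s1" "len s = Suc (len s1)"
      using l(1) by (rule starts_obtain)
    obtain t1 where t1: "t = lett l + t1" "\<not> starts (linv l) t1"
      using l(2) by (rule starts_obtain)
    have red: "red (lett l) s1" "red (lett l) t1"
      using s1 t1 by (simp_all add: red_lett)
    obtain r where r: "q = s + r" "red s r"
      using less.prems(1) by (rule pre_obtain)
    obtain r' where r': "q = t + r'" "red t r'"
      using less.prems(2) by (rule pre_obtain)
    have rr: "red s1 r" "red t1 r'"
      using r r' red red_assoc s1(1) t1(1) by blast+
    have eq: "s1 + r = t1 + r'"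
      using r(1) r'(1) by (simp add: s1(1) t1(1) add.assoc)
    have "pre s1 (s1 + r)"
      using rr(1) by simp
    moreover have "pre t1 (s1 + r)"
      using rr(2) by (simp add: eq)
    ultimately obtain d a b where d: "s1 = d + a" "t1 = d + b" "red d a" "red d b"
      "\<forall>u \<in> supp a. \<forall>v \<in> supp b. adj u v"
      using less.hyps[of s1 "s1 + r" t1] s1(3) by auto
    have "red (lett l + d) a" "red (lett l + d) b"
      using red d red_assoc2 by blast+
    moreover have "s = lett l + d + a" "t = lett l + d + b"
      using d s1(1) t1(1) by (simp_all add: add.assoc)
    ultimately show ?thesis
      using d(5) by blast
  qed
qed

text \<open>\<open>p + lett a\<close> has a single last letter, that is, it is join-irreducible in
  the prefix order. The elements having it as a prefix behave like a half-space, see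
  \<open>irr_pre_iff\<close>.\<close>

definition irr :: "'v::graph raag \<Rightarrow> 'v \<times> bool \<Rightarrow> bool" where
  "irr p a \<longleftrightarrow> red p (lett a) \<and> (\<forall>b. ends b (p + lett a) \<longrightarrow> b = a)"

text \<open>By \<open>pre_meet\<close> the two elements differ by remainders with mutually adjacent
  supports. A non-trivial remainder contains the unique last letter, so two non-trivial ones would
  make \<open>a\<close> and \<open>a'\<close> adjacent.\<close>

lemma irr_comparable:
  assumes "irr p a" "irr p' a'" "pre (p + lett a) q" "pre (p' + lett a') q" "\<not> adj (fst a) (fst a')"
  shows "pre (p + lett a) (p' + lett a') \<or> pre (p' + lett a') (p + lett a)"
proof -
  obtain d x y where d: "p + lett a = d + x" "p' + lett a' = d + y" "red d x" "red d y"
    "\<forall>u \<in> supp x. \<forall>v \<in> supp y. adj u v"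
    using pre_meet[OF assms(3,4)] by blast
  have *: "fst a \<in> supp x" if "irr p a" "p + lett a = d + x" "red d x" "x \<noteq> 0" for p a x
  proof -
    obtain b where b: "ends b x"
      using ends_exists[OF \<open>x \<noteq> 0\<close>] by blast
    then have "ends b (p + lett a)"
      using that ends_red by metis
    then show ?thesis
      using that(1) b ends_imp_supp unfolding irr_def by blast
  qed
  have "x = 0 \<or> y = 0"
    using *[OF assms(1) d(1,3)] *[OF assms(2) d(2,4)] d(5) assms(5) by blast
  then show ?thesis
    using d by auto
qed

text \<open>Letters of \<open>p\<close> are put back one at a time, beginning with a last one. Each
  could cancel in \<open>- p + q\<close> only by passing across all of \<open>t\<close>, which the
  assumption on the last letters of \<open>p\<close> rules out.\<close>

lemma pre_gate:
  assumes "red p t" "\<And>b. ends b p \<Longrightarrow> \<not> (\<forall>v \<in> supp t. adj (fst b) v)" "pre t (- p + q)"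
  shows "pre (p + t) q"
  using assms
proof (induction "len p" arbitrary: p t)
  case 0
  then show ?case
    by simp
next
  case (Suc n)
  then have "p \<noteq> 0"
    by auto
  then obtain c where c: "ends c p"
    using ends_exists by blast
  then obtain p' where p': "p = p' + lett c" "len p = Suc (len p')"
    by (rule ends_obtain)
  then have rp: "red p' (lett c)"
    by (simp add: red_def)
  let ?r = "- p + q"
  have ct: "red (lett c) t" "red p' (lett c + t)"
    using Suc.prems(1) red_assoc[OF rp] unfolding p'(1) by blast+
  have "\<not> starts (linv c) ?r"
    using starts_pre_adj[OF _ Suc.prems(3), of "linv c"] Suc.prems(2)[OF c] ct(1)
    by (auto simp: red_lett)
  then have "red (lett c) ?r"
    by (simp add: red_lett)
  then have "pre (lett c + t) (lett c + ?r)"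
    using Suc.prems(3) by (rule pre_left)
  moreover have "lett c + ?r = - p' + q"
    by (simp add: p'(1) minus_add add.assoc[symmetric] del: add_uminus_conv_diff)
  ultimately have "pre (lett c + t) (- p' + q)"
    by simp
  moreover have "\<not> (\<forall>v \<in> supp (lett c + t). adj (fst b) v)" if "ends b p'" for b
  proof
    assume *: "\<forall>v \<in> supp (lett c + t). adj (fst b) v"
    then have bc: "adj (fst b) (fst c)" and bt: "\<forall>v \<in> supp t. adj (fst b) v"
      by (auto simp: red_supp[OF ct(1)])
    have "ends b p"
      using that starts_adj[of "linv b" "linv c" "- p'"] bc
      unfolding p'(1) ends_def minus_add by simp
    then show False
      using Suc.prems(2) bt by blast
  qed
  ultimately have "pre (p' + (lett c + t)) q"
    using Suc.hyps ct(2) p'(2) by auto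
  then show ?case
    by (simp add: p'(1) add.assoc)
qed

text \<open>The right-hand side allows cancellation between \<open>- p\<close> and \<open>q\<close>.
  Whether a head is a prefix can thus be decided after removing \<open>p\<close> by looking at one
  first letter, which is stable under multiplication on the right by elements avoiding its
  vertex.\<close>

lemma irr_pre_iff:
  assumes "irr p a"
  shows "pre (p + lett a) q \<longleftrightarrow> starts a (- p + q)"
proof
  assume "pre (p + lett a) q"
  then obtain r where r: "q = p + lett a + r" "red (p + lett a) r"
    by (rule pre_obtain)
  then have "red (lett a) r"
    using assms red_assoc unfolding irr_def by blast
  then show "starts a (- p + q)"
    by (simp add: r(1) red_lett add.assoc)
next
  assume *: "starts a (- p + q)"
  have "\<not> adj (fst b) (fst a)" if "ends b p" for b
  proof
    assume adj: "adj (fst b) (fst a)"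
    then have "ends b (p + lett a)"
      using that starts_adj[of "linv b" "linv a" "- p"] unfolding ends_def minus_add by simp
    then show False
      using assms adj unfolding irr_def by (metis adj_irrefl)
  qed
  then show "pre (p + lett a) q"
    using assms * by (intro pre_gate) (auto simp: irr_def pre_lett)
qed

lemma starts_add_lett:
  assumes "starts a x" "fst b \<noteq> fst a"
  shows "starts a (x + lett b)"
proof (cases "ends (linv b) x")
  case False
  then show ?thesis
    using assms(1) by (intro starts_red) (simp_all add: red_lett_right)
next
  case True
  then obtain y where y: "x = y + lett (linv b)" "len x = Suc (len y)"
    by (rule ends_obtain)
  show ?thesis
  proof (rule ccontr)
    assume "\<not> starts a (x + lett b)"
    then have ny: "\<not> starts a y"
      by (simp add: y(1))
    have "pre y x"
      by (subst y(1), subst pre_add_iff) (use y in \<open>simp add: red_def\<close>)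
    then have "\<forall>v \<in> supp y. adj (fst a) v"
      using starts_pre_adj[OF assms(1)] ny by blast
    then have "starts a (y + lett (linv b)) \<longleftrightarrow> starts a (lett (linv b))"
      by (intro starts_gp_adj[of y "supp y"]) (auto simp: gp_def)
    then show False
      using assms y(1) by (metis fst_linv starts_lett)
  qed
qed

lemma starts_add_gp:
  assumes "k \<in> gp (- {fst a})" "starts a x"
  shows "starts a (x + k)"
  using assms by (induction k arbitrary: x rule: gp_induct)
    (simp_all add: starts_add_lett flip: add.assoc)

section \<open>Shortest conjugates, their powers and centralisers\<close>

definition minconj :: "'v::graph raag \<Rightarrow> bool" where
  "minconj w \<longleftrightarrow> (\<forall>h. len w \<le> len (- h + w + h))"

lemma minconj_exists: "\<exists>h w. minconj w \<and> g = h + w - h"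
proof -
  obtain h where h: "\<And>k. len (- h + g + h) \<le> len (- k + g + k)"
    using ex_has_least_nat[of "\<lambda>_. True" 0 "\<lambda>k. len (- k + g + k)"] by blast
  let ?w = "- h + g + h"
  have "- k + ?w + k = - (h + k) + g + (h + k)" for k
    by (simp only: minus_add add.assoc)
  then have "minconj ?w"
    unfolding minconj_def using h by metis
  moreover have "g = h + ?w - h"
    by (simp only: diff_conv_add_uminus add.assoc add.right_inverse add_0_right add_minus_cancel)
  ultimately show ?thesis
    by blast
qed

lemma minconj_lett [simp]: "minconj (lett a)"
proof -
  have "len (- h + lett a + h) \<noteq> 0" for h
  proof
    assume "len (- h + lett a + h) = 0"
    then have "- h + (lett a + h) = - h + (0 + h)"
      by (simp add: add.assoc)
    then have "lett a = 0"
      by (simp only: add_left_cancel add_right_cancel)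
    then show False
      using len_lett[of a] by simp
  qed
  then show ?thesis
    by (simp add: minconj_def Suc_le_eq del: len_eq_0_iff)
qed

lemma minconj_cyclically_reduced:
  assumes "minconj w" "ends a w"
  shows "\<not> starts (linv a) w"
proof
  assume "starts (linv a) w"
  then obtain w1 where w1: "w = lett (linv a) + w1" "\<not> starts (linv (linv a)) w1" "len w = Suc (len w1)"
    by (rule starts_obtain)
  \<comment> \<open>Otherwise \<open>a\<close> would be adjacent to all of \<open>w1\<close>, and
    the last letter of \<open>w\<close> would be its first letter \<open>linv a\<close>.\<close>
  have "ends a w1"
  proof (rule ccontr)
    assume n: "\<not> ends a w1"
    have w: "- w = - w1 + lett a"
      by (simp add: w1(1) minus_add)
    have "pre (- w1) (- w)"
      unfolding w pre_add_iff using w1(3) by (simp add: red_def flip: w)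
    then have "\<forall>v \<in> supp w1. adj (fst a) v"
      using starts_pre_adj[of "linv a" "- w" "- w1"] assms(2) n by (simp add: ends_def)
    then have "starts (linv a) (- w1 + lett a) \<longleftrightarrow> starts (linv a) (lett a)"
      by (intro starts_gp_adj[of _ "supp w1"]) (auto simp: gp_def)
    then show False
      using assms(2) w by (simp add: ends_def)
  qed
  then have "len (w1 - lett a) < len w"
    using w1(3) by (simp add: ends_iff_len)
  moreover have "- lett (linv a) + w + lett (linv a) = w1 - lett a"
    by (simp add: w1(1) flip: add.assoc)
  ultimately show False
    using assms(1) unfolding minconj_def by (metis leD)
qed

primrec npow :: "nat \<Rightarrow> 'g::group_add \<Rightarrow> 'g" where
  "npow 0 w = 0"
| "npow (Suc n) w = w + npow n w"

lemma npow_add: "npow (m + n) w = npow m w + npow n w"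
  by (induction m) (auto simp: add.assoc)

lemma cm_npow: "cm w c \<Longrightarrow> cm (npow n w) c"
  by (induction n) (auto intro: cm_add_left)

lemma expo_npow [simp]: "expo x (npow n w) = int n * expo x w"
  by (induction n) (auto simp: algebra_simps)

text \<open>A cancelling letter of the power is not a first letter of \<open>w\<close>, so it would
  have to pass across a whole copy of \<open>w\<close>; but its own vertex occurs there.\<close>

lemma minconj_red_npow: "minconj w \<Longrightarrow> red w (npow n w)"
proof (induction n)
  case (Suc n)
  show ?case
  proof (rule ccontr)
    assume "\<not> red w (npow (Suc n) w)"
    then obtain a where a: "ends a w" "starts (linv a) (npow (Suc n) w)"
      using not_red by blast
    have "pre w (npow (Suc n) w)"
      using Suc by simp
    moreover have "\<not> starts (linv a) w"
      using minconj_cyclically_reduced Suc.prems a(1) by blast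
    ultimately have "\<forall>v \<in> supp w. adj (fst a) v"
      using starts_pre_adj a(2) by fastforce
    then show False
      using ends_imp_supp[OF a(1)] by (metis adj_irrefl)
  qed
qed simp

lemma len_npow: "minconj w \<Longrightarrow> len (npow n w) = n * len w"
  by (induction n) (simp_all add: minconj_red_npow[unfolded red_def])

lemma cnt_zero [simp]: "cnt (a :: 'a::graph \<times> bool) 0 = 0"
  using cnt_val[of "[] :: 'a word" a] by simp

lemma cnt_npow: "minconj w \<Longrightarrow> cnt a (npow n w) = n * cnt a w"
  by (induction n) (simp_all add: red_cnt[OF minconj_red_npow])

lemma cnt_pos_iff: "0 < cnt (x, b) g \<longleftrightarrow> (x, b) \<in> set (rep g)"
  by (simp add: cnt_def)

text \<open>Over pairwise non-adjacent vertices the order of letters survives shuffling; then the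
  projection does not depend on the representing word and turns products without cancellation into
  concatenations.\<close>

definition prj :: "'v::graph set \<Rightarrow> 'v raag \<Rightarrow> 'v word" where
  "prj U g = filter (\<lambda>l. fst l \<in> U) (rep g)"

lemma shuf_filter:
  assumes "shuf w w'" "\<And>u v. u \<in> U \<Longrightarrow> v \<in> U \<Longrightarrow> \<not> adj u v"
  shows "filter (\<lambda>l. fst l \<in> U) w = filter (\<lambda>l. fst l \<in> U) w'"
proof -
  have "swp u v \<Longrightarrow> filter (\<lambda>l. fst l \<in> U) u = filter (\<lambda>l. fst l \<in> U) v" for u v
    by (induction rule: swp.induct) (auto simp: assms(2))
  with assms(1) show ?thesis
    by (induction rule: rtranclp_induct) auto
qed

lemma prj_red:
  assumes "red g h" "\<And>u v. u \<in> U \<Longrightarrow> v \<in> U \<Longrightarrow> \<not> adj u v"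
  shows "prj U (g + h) = prj U g @ prj U h"
proof -
  have "shuf (rep (g + h)) (rep g @ rep h)"
    using shuf_rep_val[OF red_reduced[OF assms(1)]] by simp
  from shuf_filter[OF this assms(2)] show ?thesis
    by (simp add: prj_def)
qed

lemma count_prj: "fst a \<in> U \<Longrightarrow> count (mset (prj U g)) a = cnt a g"
  by (simp add: prj_def cnt_def)

text \<open>The centraliser of a cyclically reduced element: after multiplying \<open>c\<close> by a high power of
  \<open>w\<close> no cancellation occurs, and then the projections of \<open>c\<close> and \<open>w\<close> to the letters over two
  non-adjacent vertices commute in a free monoid.\<close>

lemma centralizer:
  assumes w: "minconj w" "expo x w \<noteq> 0" and c: "cm w c" "expo x c = 0"
  shows "c \<in> gp {v. adj x v}"
proof -
  \<comment> \<open>The change of length caused by \<open>c\<close> is non-increasing in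
    \<open>n\<close> and at least \<open>- len c\<close>, hence eventually constant; from then on
    multiplying by \<open>w\<close> causes no cancellation.\<close>
  define a where "a n = int (len (npow n w + c)) - int n * int (len w)" for n
  have dec: "a (Suc n) \<le> a n" for n
  proof -
    have "len (npow (Suc n) w + c) \<le> len w + len (npow n w + c)"
      using len_add_le[of w "npow n w + c"] by (simp add: add.assoc)
    then show ?thesis
      by (simp add: a_def algebra_simps)
  qed
  have bound: "0 \<le> a n + int (len c)" for n
  proof -
    have "len (npow n w) \<le> len (npow n w + c) + len c"
      using len_add_le[of "npow n w + c" "- c"] by (simp add: add.assoc)
    then show ?thesis
      by (simp add: a_def len_npow[OF w(1)] algebra_simps flip: of_nat_mult)
  qed
  obtain j where j: "\<And>n. nat (a j + int (len c)) \<le> nat (a n + int (len c))"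
    using ex_has_least_nat[of "\<lambda>_. True" 0 "\<lambda>n. nat (a n + int (len c))"] by blast
  have aj: "a (n + j) = a j" for n
  proof (rule antisym)
    show "a (n + j) \<le> a j"
      by (induction n) (auto intro: order_trans dec)
    show "a j \<le> a (n + j)"
      using j[of "n + j"] bound by (simp add: nat_le_eq_zle)
  qed
  define c' where "c' = npow j w + c"
  have red: "red (npow n w) c'" for n
  proof -
    have "npow n w + c' = npow (n + j) w + c"
      by (simp add: c'_def npow_add add.assoc)
    then show ?thesis
      using aj[of n] unfolding a_def red_def len_npow[OF w(1)] c'_def
      by (simp add: algebra_simps flip: of_nat_mult of_nat_add)
  qed
  have cm: "cm (npow n w) c'" for n
    using c(1) by (auto simp: c'_def intro!: cm_add cm_npow intro: cm_sym)
  have red': "red c' (npow n w)" for n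
    using red[of n] cm[of n] by (simp add: red_def cm_def)
  have cnt_eq: "cnt (y, b) c' = cnt (y, b) (npow j w)" if "\<not> adj x y" for y b
  proof -
    let ?U = "{x, y}"
    have U: "\<And>u v. u \<in> ?U \<Longrightarrow> v \<in> ?U \<Longrightarrow> \<not> adj u v"
      using that by (auto simp: adj_commute)
    have "w + c' = c' + w"
      using cm[of 1] by (simp add: cm_def)
    then have "prj ?U w @ prj ?U c' = prj ?U c' @ prj ?U w"
      using prj_red[of w c' ?U] prj_red[of c' w ?U] red[of 1] red'[of 1] U by simp
    \<comment> \<open>Commuting words of a free monoid are powers of one word. Comparing exponents
      at \<open>x\<close>, which are non-zero for \<open>w\<close> and zero for \<open>c\<close>,
      then determines \<open>m = j * n\<close>.\<close>
    then obtain n m zs where zs: "concat (replicate n zs) = prj ?U w" "concat (replicate m zs) = prj ?U c'"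
      using comm_append_are_replicate by metis
    have cc: "count (mset (concat (replicate k zs))) l = k * count (mset zs) l" for k l
      by (induction k) auto
    have cw: "cnt l w = n * count (mset zs) l" "cnt l c' = m * count (mset zs) l" if "fst l \<in> ?U" for l
      using cc count_prj[OF that] zs by metis+
    have "expo x c' = int j * expo x w"
      using c(2) by (simp add: c'_def)
    then have "int m * (int (count (mset zs) (x, True)) - int (count (mset zs) (x, False)))
      = int (j * n) * (int (count (mset zs) (x, True)) - int (count (mset zs) (x, False)))"
      by (simp add: expo_eq_cnt cw algebra_simps)
    moreover have "int (count (mset zs) (x, True)) - int (count (mset zs) (x, False)) \<noteq> 0"
      using w(2) by (auto simp: expo_eq_cnt cw algebra_simps)
    ultimately have "m = j * n"
      by (simp only: mult_cancel_right of_nat_eq_iff) blast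
    then show ?thesis
      by (simp add: cw cnt_npow[OF w(1)])
  qed
  \<comment> \<open>Both are prefixes of one product, so what remains after the meet has mutually
    adjacent supports. Away from the neighbours of \<open>x\<close> the two remainders have equal
    letter counts, so a vertex there would be adjacent to itself.\<close>
  have "pre (npow j w) (npow j w + c')" "pre c' (npow j w + c')"
    using red[of j] by simp (use red'[of j] cm[of j] in \<open>simp add: cm_def\<close>)
  then obtain d s t where d: "npow j w = d + s" "c' = d + t" "red d s" "red d t"
    "\<forall>u \<in> supp s. \<forall>v \<in> supp t. adj u v"
    using pre_meet by blast
  have eq: "cnt (y, b) s = cnt (y, b) t" if "\<not> adj x y" for y b
    using cnt_eq[OF that, of b] d by (simp add: red_cnt)
  have "y \<in> supp s \<longleftrightarrow> y \<in> supp t" if "\<not> adj x y" for y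
  proof -
    have "y \<in> supp g \<longleftrightarrow> 0 < cnt (y, True) g \<or> 0 < cnt (y, False) g" for g
      unfolding cnt_pos_iff supp_def by (auto simp: image_iff) (metis (full_types), force+)
    then show ?thesis
      using eq[OF that] by simp
  qed
  then have "s \<in> gp {v. adj x v}" "t \<in> gp {v. adj x v}"
    using d(5) by (auto simp: gp_def) (metis adj_irrefl)+
  moreover have "c = - s + t"
  proof -
    have "c = - npow j w + c'"
      by (simp add: c'_def flip: add.assoc)
    also have "\<dots> = - s + (- d + (d + t))"
      by (simp only: d(1,2) minus_add add.assoc)
    finally show ?thesis
      by (simp flip: add.assoc)
  qed
  ultimately show ?thesis
    by (simp add: gp_add)
qed

section \<open>Conjugation and centralisers\<close>

lemma conj_add: "(h :: 'g::group_add) + x - h + (h + y - h) = h + (x + y) - h"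
  by (simp only: diff_conv_add_uminus add.assoc minus_add_cancel)

lemma conj_conj: "(h :: 'g::group_add) + (k + x - k) - h = (h + k) + x - (h + k)"
  by (simp only: diff_conv_add_uminus add.assoc minus_add)

lemma conj_cancel [simp]:
  "- h + (h + x - h) + h = (x :: 'g::group_add)" "h + (- h + x + h) - h = x"
  by (simp_all only: diff_conv_add_uminus add.assoc minus_add_cancel add_minus_cancel
      left_minus add.right_inverse add_0_right)

lemma cm_conj': "cm (- h + x + h) (- h + y + h) \<longleftrightarrow> cm x (y :: 'g::group_add)"
  using cm_conj[of "- h" x y] by simp

lemma centralizer_conj:
  assumes "minconj w" "g = h + w - h" "expo x g \<noteq> 0" "cm g c" "expo x c = 0"
  shows "- h + c + h \<in> gp {v. adj x v}"
proof (rule centralizer)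
  show "expo x w \<noteq> 0" "expo x (- h + c + h) = 0"
    using assms by simp_all
  have "w = - h + g + h"
    by (simp add: assms(2))
  then show "cm w (- h + c + h)"
    using assms(4) cm_conj'[of h g c] by simp
qed fact

text \<open>The retraction fixes the given conjugate and thus shows that \<open>retr U w\<close> is
  conjugate to \<open>w\<close>; it would be shorter than \<open>w\<close> if \<open>w\<close> were
  outside \<open>gp U\<close>.\<close>

lemma minconj_gp:
  assumes "minconj w" "- t + w + t \<in> gp U"
  shows "w \<in> gp U"
proof (rule ccontr)
  assume "w \<notin> gp U"
  let ?r = "retr U"
  have "?r (- t + w + t) = - t + w + t"
    using assms(2) by (rule retr_gp)
  then have "- ?r t + ?r w + ?r t = - t + w + t"
    by simp
  then have "?r t + (- ?r t + ?r w + ?r t) - ?r t = ?r t + (- t + w + t) - ?r t"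
    by simp
  then have "?r w = - (t - ?r t) + w + (t - ?r t)"
    by (simp only: conj_cancel) (simp only: minus_add minus_minus diff_conv_add_uminus add.assoc)
  then show False
    using len_retr_less[OF \<open>w \<notin> gp U\<close>] assms(1) unfolding minconj_def by (metis leD)
qed

text \<open>Geometrically: an element that is not conjugate into the stabiliser of a \<open>v\<close>-wall fixes at
  most one vertex of the tree dual to the \<open>v\<close>-walls.\<close>

lemma fixed_coset_unique:
  assumes z: "expo z a \<noteq> 0" "z \<noteq> v" "\<not> adj z v"
    and h: "- h + a + h \<in> gp (- {v})" "- h' + a + h' \<in> gp (- {v})"
  shows "- h + h' \<in> gp (- {v})"
proof -
  let ?U = "- {v}"
  let ?r = "retr ?U"
  define k where "k = - h + h'"
  define b where "b = - h' + a + h'"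
  have b: "b \<in> gp ?U" "expo z b \<noteq> 0"
    using h z by (simp_all add: b_def)
  have kb: "k + b - k = - h + a + h"
    by (simp add: k_def b_def diff_conv_add_uminus minus_add add.assoc del: add_uminus_conv_diff)
  have "?r k + b - ?r k = k + b - k"
  proof -
    have "?r (k + b - k) = k + b - k"
      using h(1) by (intro retr_gp) (simp only: kb)
    then show ?thesis
      by (simp only: retr_simps retr_gp[OF b(1)])
  qed
  then have "- ?r k + (?r k + b - ?r k) + ?r k = - ?r k + (k + b - k) + ?r k"
    by simp
  then have "b = - ?r k + (k + b - k) + ?r k"
    by simp
  then have "b = (- ?r k + k) + b - (- ?r k + k)"
    by (simp only: diff_conv_add_uminus minus_add minus_minus add.assoc)
  \<comment> \<open>The deviation of \<open>k\<close> from its retraction. It centralises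
    \<open>b\<close> and has trivial retraction; the centraliser theorem puts a conjugate of it into
    \<open>gp ?U\<close>, where the retraction is the identity, so it vanishes.\<close>
  define d where "d = - ?r k + k"
  have "b + d = d + b"
    using \<open>b = (- ?r k + k) + b - (- ?r k + k)\<close> unfolding d_def[symmetric]
    by (metis diff_add_cancel)
  then have cd: "cm b d"
    by (simp add: cm_def)
  obtain t w where w: "minconj w" "b = t + w - t"
    using minconj_exists by blast
  have "w \<in> gp ?U"
    using minconj_gp[OF w(1), of "- t"] b(1) w(2) by simp
  then have bt: "b = ?r t + w - ?r t"
    using retr_gp[OF b(1)] retr_gp[of w ?U] w(2) by simp
  have rd: "?r d = 0"
    by (simp add: d_def retr_gp[OF retr_in_gp])
  have "expo z d = 0"
    using expo_retr[of z ?U d] z(2) rd by simp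
  then have "- ?r t + d + ?r t \<in> gp {x. adj z x}"
    using centralizer_conj[OF w(1) bt b(2) cd] by simp
  moreover have "{x. adj z x} \<subseteq> ?U"
    using z(3) by auto
  ultimately have "- ?r t + d + ?r t \<in> gp ?U"
    using gp_mono by blast
  then have "?r (- ?r t + d + ?r t) = - ?r t + d + ?r t"
    by (rule retr_gp)
  then have "- ?r t + d + ?r t = - ?r t + 0 + ?r t"
    by (simp add: rd retr_gp[OF retr_in_gp])
  then have "d = 0"
    by (simp only: add_left_cancel add_right_cancel)
  then have "k = ?r k"
    unfolding d_def by (metis add.assoc add_minus_cancel add_0_right)
  then show ?thesis
    unfolding k_def[symmetric] using retr_in_gp by metis
qed

text \<open>\<open>centralizer\<close> asks for exponent zero at \<open>v\<close>, which is achieved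
  by splitting off the power \<open>m\<close> of \<open>gen v\<close>.\<close>

lemma centralizer_gen:
  assumes "cm (gen v) c"
  shows "c \<in> gp (insert v {w. adj v w})"
proof -
  define m where "m = (if expo v c \<ge> 0 then npow (nat (expo v c)) (gen v)
    else npow (nat (- expo v c)) (- gen v))"
  have npow_gp: "npow n g \<in> gp U" if "g \<in> gp U" for n U and g :: "'a raag"
    using that by (induction n) (auto intro: gp_add)
  have m: "m \<in> gp {v}"
    by (auto simp: m_def intro!: npow_gp)
  have "expo v m = expo v c"
    by (simp add: m_def expo_lett)
  moreover have "cm (gen v) m"
    unfolding m_def by (auto intro!: cm_sym[OF cm_npow])
  ultimately have "c - m \<in> gp {w. adj v w}"
    using assms by (intro centralizer[of "gen v" v])
      (auto simp: expo_lett diff_conv_add_uminus simp del: add_uminus_conv_diff intro!: cm_add)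
  then have "c - m + m \<in> gp (insert v {w. adj v w})"
    using m gp_mono[of "{v}" "insert v {w. adj v w}"] gp_mono[of "{w. adj v w}" "insert v {w. adj v w}"]
    by (intro gp_add) blast+
  then show ?thesis
    by simp
qed

text \<open>If \<open>l\<close> is joined to the rest of \<open>W\<close>, then \<open>gen l\<close>
  is central in \<open>gp W\<close>, and an element with exponent zero at \<open>l\<close> involves
  neighbours of \<open>l\<close> only.\<close>

lemma gp_remove_central:
  assumes "c \<in> gp W" "\<And>w. w \<in> W \<Longrightarrow> w \<noteq> l \<Longrightarrow> adj l w" "expo l c = 0"
  shows "c \<in> gp (W - {l})"
proof -
  have "cm c (gen l)"
    using assms(1)
  proof (rule cm_gp)
    fix a :: "'a \<times> bool"
    assume "fst a \<in> W"
    then show "cm (lett a) (gen l)"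
      using assms(2)[of "fst a"] cm_lett[of a "(l, True)"] by (cases a; cases "fst a = l"; cases "snd a") (auto simp: adj_commute)
  qed
  then have "c \<in> gp {w. adj l w}"
    by (intro centralizer[of "gen l" l]) (auto simp: expo_lett assms(3) intro: cm_sym)
  then have "c \<in> gp (W \<inter> {w. adj l w})"
    using assms(1) by (simp add: gp_Int)
  moreover have "W \<inter> {w. adj l w} \<subseteq> W - {l}"
    by auto
  ultimately show ?thesis
    using gp_mono by blast
qed

lemma conj_into_gp:
  assumes "\<And>p. p \<in> gp U \<Longrightarrow> - k + p + k \<in> gp U" "p \<in> gp U"
  shows "- k + p + k = - retr U k + p + retr U k"
  using retr_gp[OF assms(1)[OF assms(2)]] retr_gp[OF assms(2)] by simp

section \<open>Matrices of automorphisms\<close>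

text \<open>Gaussian elimination over arbitrary index sets: a row with a non-zero entry at
  \<open>c0\<close> is used to clear that column, and the value at \<open>c0\<close> is solved for
  at the end.\<close>

lemma kernel_exists:
  fixes a :: "'r \<Rightarrow> 'c \<Rightarrow> 'k::field"
  assumes "finite R" "finite C" "card R < card C"
  shows "\<exists>k. (\<exists>c \<in> C. k c \<noteq> 0) \<and> (\<forall>r \<in> R. (\<Sum>c \<in> C. a r c * k c) = 0)"
  using assms
proof (induction R arbitrary: C a rule: finite_induct)
  case empty
  then have "C \<noteq> {}"
    by auto
  then show ?case
    by (intro exI[of _ "\<lambda>_. 1"]) auto
next
  case (insert r R)
  show ?case
  proof (cases "\<forall>c \<in> C. a r c = 0")
    case True
    obtain k where "\<exists>c \<in> C. k c \<noteq> 0" "\<forall>s \<in> R. (\<Sum>c \<in> C. a s c * k c) = 0"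
      using insert.IH[of C a] insert.prems insert.hyps by auto
    then show ?thesis
      using True by (intro exI[of _ k]) simp
  next
    case False
    then obtain c0 where c0: "c0 \<in> C" "a r c0 \<noteq> 0"
      by blast
    let ?C = "C - {c0}"
    have "card R < card ?C"
      using insert c0 by simp
    then obtain k where k: "\<exists>c \<in> ?C. k c \<noteq> 0"
      "\<forall>s \<in> R. (\<Sum>c \<in> ?C. (a s c - a s c0 * a r c / a r c0) * k c) = 0"
      using insert.IH[of ?C "\<lambda>s c. a s c - a s c0 * a r c / a r c0"] insert.prems by auto
    define k' where "k' c = (if c = c0 then - (\<Sum>c \<in> ?C. a r c * k c) / a r c0 else k c)" for c
    have k0: "k' c0 = - (\<Sum>c \<in> ?C. a r c * k c) / a r c0"
      by (simp add: k'_def)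
    have sum: "(\<Sum>c \<in> C. a s c * k' c) = a s c0 * k' c0 + (\<Sum>c \<in> ?C. a s c * k c)" for s
      using c0(1) insert.prems(1) by (simp add: sum.remove k'_def)
    have "(\<Sum>c \<in> C. a s c * k' c) = 0" if "s \<in> R" for s
    proof -
      have "0 = (\<Sum>c \<in> ?C. (a s c - a s c0 * a r c / a r c0) * k c)"
        using k(2) that by simp
      also have "\<dots> = (\<Sum>c \<in> ?C. a s c * k c - a s c0 / a r c0 * (a r c * k c))"
        by (intro sum.cong refl) (simp add: algebra_simps)
      also have "\<dots> = (\<Sum>c \<in> ?C. a s c * k c) - a s c0 / a r c0 * (\<Sum>c \<in> ?C. a r c * k c)"
        by (simp add: sum_subtractf sum_distrib_left)
      finally show ?thesis
        by (simp add: sum k0)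
    qed
    moreover have "(\<Sum>c \<in> C. a r c * k' c) = 0"
      using c0(2) by (simp add: sum k0)
    moreover have "\<exists>c \<in> C. k' c \<noteq> 0"
      using k(1) by (auto simp: k'_def)
    ultimately show ?thesis
      by (intro exI[of _ k']) auto
  qed
qed

definition trivial_kernel :: "'r set \<Rightarrow> 'c set \<Rightarrow> ('r \<Rightarrow> 'c \<Rightarrow> 'k::field) \<Rightarrow> bool" where
  "trivial_kernel R C a \<longleftrightarrow>
    (\<forall>k. (\<forall>r \<in> R. (\<Sum>c \<in> C. a r c * k c) = 0) \<longrightarrow> (\<forall>c \<in> C. k c = 0))"

lemma trivial_kernel_card:
  "trivial_kernel R C a \<Longrightarrow> finite R \<Longrightarrow> finite C \<Longrightarrow> card C \<le> card R"
  using kernel_exists[of R C a] unfolding trivial_kernel_def by (metis not_le)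

lemma trivial_kernel_solve:
  assumes "trivial_kernel R C a" "finite R" "finite C" "card R = card C"
  shows "\<exists>k. \<forall>r \<in> R. (\<Sum>c \<in> C. a r c * k c) = b r"
proof -
  let ?C = "insert None (Some ` C)"
  define a' where "a' r c = (case c of None \<Rightarrow> - b r | Some c \<Rightarrow> a r c)" for r c
  have "card R < card ?C"
    using assms by (simp add: card_image)
  then obtain k where k: "\<exists>c \<in> ?C. k c \<noteq> 0" "\<forall>r \<in> R. (\<Sum>c \<in> ?C. a' r c * k c) = 0"
    using kernel_exists[of R ?C a'] assms by auto
  have eq: "(\<Sum>c \<in> C. a r c * k (Some c)) = b r * k None" if "r \<in> R" for r
    using k(2) that assms(3) by (auto simp: a'_def sum.reindex)
  have "k None \<noteq> 0"
  proof
    assume 0: "k None = 0"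
    then have "\<forall>c \<in> C. k (Some c) = 0"
      using assms(1)[unfolded trivial_kernel_def, THEN spec, of "\<lambda>c. k (Some c)"] eq by simp
    then show False
      using k(1) 0 by auto
  qed
  then have "(\<Sum>c \<in> C. a r c * (k (Some c) / k None)) = b r" if "r \<in> R" for r
  proof -
    have "(\<Sum>c \<in> C. a r c * (k (Some c) / k None)) = (\<Sum>c \<in> C. a r c * k (Some c)) / k None"
      unfolding sum_divide_distrib by (intro sum.cong) simp_all
    then show ?thesis
      using eq[OF that] \<open>k None \<noteq> 0\<close> by simp
  qed
  then show ?thesis
    by (intro exI[of _ "\<lambda>c. k (Some c) / k None"] ballI)
qed

text \<open>A non-singular matrix has a non-zero term in its Leibniz expansion. A column is split
  off together with a row such that the rest stays injective, so determinants are avoided.\<close>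

lemma trivial_kernel_matching:
  assumes "finite C" "finite R" "trivial_kernel R C a" "card R = card C"
  shows "\<exists>\<tau>. bij_betw \<tau> C R \<and> (\<forall>c \<in> C. a (\<tau> c) c \<noteq> 0)"
  using assms
proof (induction C arbitrary: R rule: finite_induct)
  case empty
  then show ?case
    by (auto simp: bij_betw_def)
next
  case (insert c C)
  have "\<exists>r \<in> R. a r c \<noteq> 0 \<and> trivial_kernel (R - {r}) C a"
  proof (rule ccontr)
    assume "\<not> ?thesis"
    then have "\<forall>r \<in> R. \<exists>k. a r c \<noteq> 0 \<longrightarrow>
        (\<forall>s \<in> R - {r}. (\<Sum>c \<in> C. a s c * k c) = 0) \<and> (\<exists>c \<in> C. k c \<noteq> 0)"
      unfolding trivial_kernel_def by blast
    then obtain k where k: "\<And>r. r \<in> R \<Longrightarrow> a r c \<noteq> 0 \<Longrightarrow>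
        (\<forall>s \<in> R - {r}. (\<Sum>c \<in> C. a s c * k r c) = 0) \<and> (\<exists>c \<in> C. k r c \<noteq> 0)"
      by metis
    define S where "S = {r \<in> R. a r c \<noteq> 0}"
    define l where "l r = (\<Sum>c \<in> C. a r c * k r c)" for r
    have l: "l r \<noteq> 0" if "r \<in> S" for r
    proof
      assume 0: "l r = 0"
      define k' where "k' c' = (if c' \<in> C then k r c' else 0)" for c'
      have "\<forall>s \<in> R. (\<Sum>c' \<in> insert c C. a s c' * k' c') = 0"
        using k[of r] 0 that insert.hyps insert.prems
        by (auto simp: S_def l_def k'_def cong: sum.cong)
      then have "\<forall>c' \<in> C. k r c' = 0"
        using insert.prems(2) unfolding trivial_kernel_def k'_def by auto
      then show False
        using k[of r] that by (auto simp: S_def)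
    qed
    have S: "finite S" "S \<subseteq> R"
      using insert.prems(1) by (auto simp: S_def)
    \<comment> \<open>Each row \<open>r\<close> in \<open>S\<close> comes with a vector
      \<open>k r\<close> killed by all other rows and with value \<open>l r\<close> on
      \<open>r\<close>. The combination cancels column \<open>c\<close> row by row, giving a kernel
      vector with entry 1 at \<open>c\<close>.\<close>
    define k' where "k' c' = (if c' = c then 1 else - (\<Sum>r \<in> S. a r c / l r * k r c'))" for c'
    have "(\<Sum>c' \<in> insert c C. a s c' * k' c') = 0" if "s \<in> R" for s
    proof -
      have "(\<Sum>c' \<in> C. a s c' * k' c') = - (\<Sum>c' \<in> C. \<Sum>r \<in> S. a r c / l r * (a s c' * k r c'))"
        using insert.hyps(2) unfolding sum_negf[symmetric]
        by (intro sum.cong) (auto simp: k'_def sum_distrib_left mult_ac simp flip: sum_negf)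
      also have "\<dots> = - (\<Sum>r \<in> S. a r c / l r * (\<Sum>c' \<in> C. a s c' * k r c'))"
        by (subst sum.swap) (simp add: sum_distrib_left)
      also have "(\<Sum>r \<in> S. a r c / l r * (\<Sum>c' \<in> C. a s c' * k r c')) =
          (\<Sum>r \<in> S. if r = s then a s c else 0)"
        using k that l by (intro sum.cong) (auto simp: S_def l_def)
      also have "\<dots> = a s c"
        using S that by (auto simp: S_def)
      finally show ?thesis
        using insert.hyps by (simp add: k'_def)
    qed
    then have "k' c = 0"
      using insert.prems(2) unfolding trivial_kernel_def by blast
    then show False
      by (simp add: k'_def)
  qed
  then obtain r where r: "r \<in> R" "a r c \<noteq> 0" "trivial_kernel (R - {r}) C a"
    by blast
  then obtain \<tau> where \<tau>: "bij_betw \<tau> C (R - {r})" "\<forall>c \<in> C. a (\<tau> c) c \<noteq> 0"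
    using insert.IH[of "R - {r}"] insert.prems insert.hyps by auto
  have "bij_betw (\<tau>(c := r)) (insert c C) (insert r (R - {r}))"
    using \<tau>(1) insert.hyps(2) by (auto simp: bij_betw_def inj_on_def)
  moreover have "insert r (R - {r}) = R"
    using r by auto
  moreover have "\<forall>c' \<in> insert c C. a ((\<tau>(c := r)) c') c' \<noteq> 0"
    using \<tau>(2) r(2) insert.hyps(2) by auto
  ultimately show ?case
    by metis
qed

section \<open>Matrices respecting the commutation relations of a graph\<close>

definition nb :: "'v::graph \<Rightarrow> 'v set" where
  "nb v = {w. adj v w}"

definition star :: "'v::graph \<Rightarrow> 'v set" where
  "star v = insert v (nb v)"

definition le :: "'v::graph \<Rightarrow> 'v \<Rightarrow> bool" where
  "le v x \<longleftrightarrow> nb v \<subseteq> star x"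

lemma in_nb [simp]: "w \<in> nb v \<longleftrightarrow> adj v w"
  by (simp add: nb_def)

lemma in_star: "w \<in> star v \<longleftrightarrow> w = v \<or> adj v w"
  by (simp add: star_def)

lemma self_in_star [simp]: "v \<in> star v"
  by (simp add: star_def)

text \<open>The minor conditions are the trace of the commutation relations: images of adjacent
  vertices commute, and commuting elements have proportional exponents at two non-adjacent vertices
  (\<open>cm_expo\<close>). The symmetry in \<open>N\<close> and \<open>N'\<close> transfers every
  consequence to the inverse.\<close>

locale graph_matrix =
  fixes V :: "'v::graph set" and N N' :: "'v \<Rightarrow> 'v \<Rightarrow> rat"
  assumes finV: "finite V" and closedV: "adj u w \<Longrightarrow> u \<in> V \<Longrightarrow> w \<in> V"
    and inverse1: "x \<in> V \<Longrightarrow> u \<in> V \<Longrightarrow> (\<Sum>y \<in> V. N x y * N' y u) = (if x = u then 1 else 0)"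
    and inverse2: "x \<in> V \<Longrightarrow> u \<in> V \<Longrightarrow> (\<Sum>y \<in> V. N' x y * N y u) = (if x = u then 1 else 0)"
    and minors1: "adj u w \<Longrightarrow> x \<noteq> y \<Longrightarrow> \<not> adj x y \<Longrightarrow> u \<in> V \<Longrightarrow> x \<in> V \<Longrightarrow> y \<in> V \<Longrightarrow>
      N x u * N y w = N y u * N x w"
    and minors2: "adj u w \<Longrightarrow> x \<noteq> y \<Longrightarrow> \<not> adj x y \<Longrightarrow> u \<in> V \<Longrightarrow> x \<in> V \<Longrightarrow> y \<in> V \<Longrightarrow>
      N' x u * N' y w = N' y u * N' x w"
begin

lemma star_subset: "v \<in> V \<Longrightarrow> star v \<subseteq> V"
  using closedV by (auto simp: star_def)

lemma finite_star: "v \<in> V \<Longrightarrow> finite (star v)"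
  using star_subset finV finite_subset by blast

lemma minors_star:
  assumes "l \<in> star v" "x \<in> V" "y \<in> V" "v \<in> V" "x = y \<or> \<not> adj x y"
  shows "N x v * N y l = N y v * N x l"
  using assms minors1[of v l x y] by (auto simp: in_star)

lemma minors_sum:
  assumes "x \<in> V" "y \<in> V" "v \<in> V" "x = y \<or> \<not> adj x y"
  shows "N x v * (\<Sum>l \<in> star v. N y l * k l) = N y v * (\<Sum>l \<in> star v. N x l * k l)"
  unfolding sum_distrib_left
  by (intro sum.cong refl) (use minors_star[OF _ assms(1,2,3,4)] in \<open>simp add: mult.assoc[symmetric]\<close>)

lemma kernel_zero:
  assumes "C \<subseteq> V" "\<And>y. y \<in> V \<Longrightarrow> (\<Sum>l \<in> C. N y l * k l) = 0" "c \<in> C"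
  shows "k c = 0"
proof -
  have "0 = (\<Sum>y \<in> V. N' c y * (\<Sum>l \<in> C. N y l * k l))"
    using assms(2) by simp
  also have "\<dots> = (\<Sum>l \<in> C. (\<Sum>y \<in> V. N' c y * N y l) * k l)"
    by (subst sum_distrib_left, subst sum.swap) (simp add: sum_distrib_right mult.assoc)
  also have "\<dots> = (\<Sum>l \<in> C. if l = c then k c else 0)"
    using assms by (intro sum.cong) (auto simp: inverse2 subset_eq)
  also have "\<dots> = k c"
    using assms(3) finite_subset[OF assms(1) finV] by simp
  finally show ?thesis
    by simp
qed

text \<open>On the columns of \<open>star v\<close> every row outside \<open>star x\<close> is a
  multiple of row \<open>x\<close>. A vector killed by the rows of \<open>star x\<close> is
  therefore killed by all rows, and \<open>N\<close> is invertible.\<close>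

lemma kernel_star:
  assumes "x \<in> V" "v \<in> V" "N x v \<noteq> 0"
  shows "trivial_kernel (star x) (star v) N"
  unfolding trivial_kernel_def
proof (intro allI impI ballI)
  fix k c
  assume k: "\<forall>r \<in> star x. (\<Sum>l \<in> star v. N r l * k l) = 0" and c: "c \<in> star v"
  have "(\<Sum>l \<in> star v. N y l * k l) = 0" if "y \<in> V" for y
  proof (cases "y \<in> star x")
    case False
    then have "N x v * (\<Sum>l \<in> star v. N y l * k l) = N y v * (\<Sum>l \<in> star v. N x l * k l)"
      using assms that by (intro minors_sum) (auto simp: in_star)
    moreover have "(\<Sum>l \<in> star v. N x l * k l) = 0"
      using k by (simp add: star_def)
    ultimately show ?thesis
      using assms(3) by simp
  qed (use k in simp)
  then show "k c = 0"
    using kernel_zero[OF star_subset[OF assms(2)] _ c] by blast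
qed

lemma deg_le:
  assumes "x \<in> V" "v \<in> V" "N x v \<noteq> 0"
  shows "card (star v) \<le> card (star x)"
  by (rule trivial_kernel_card[OF kernel_star[OF assms]]) (use assms finite_star in auto)

lemma matching_exists: "\<exists>\<tau>. bij_betw \<tau> V V \<and> (\<forall>v \<in> V. N (\<tau> v) v \<noteq> 0)"
proof -
  have "trivial_kernel V V N"
    unfolding trivial_kernel_def using kernel_zero[of V] by blast
  then show ?thesis
    using trivial_kernel_matching finV by blast
qed

end

sublocale graph_matrix \<subseteq> inv: graph_matrix V N' N
  by unfold_locales (fact finV closedV inverse1 inverse2 minors1 minors2)+

locale matched_graph_matrix = graph_matrix +
  fixes \<tau>
  assumes bij: "bij_betw \<tau> V V" and nonzero: "v \<in> V \<Longrightarrow> N (\<tau> v) v \<noteq> 0"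
begin

lemma tau_in [simp]: "v \<in> V \<Longrightarrow> \<tau> v \<in> V"
  using bij by (auto simp: bij_betw_def)

text \<open>\<open>deg_le\<close> gives one inequality at each vertex; the degree sums over
  \<open>V\<close> agree because \<tau> is a bijection.\<close>

lemma deg_eq:
  assumes "v \<in> V"
  shows "card (star (\<tau> v)) = card (star v)"
proof -
  have "(\<Sum>v \<in> V. card (star (\<tau> v))) = (\<Sum>v \<in> V. card (star v))"
    by (rule sum.reindex_bij_betw[OF bij])
  then show ?thesis
    using sum_mono_inv[of "\<lambda>v. card (star v)" V "\<lambda>v. card (star (\<tau> v))" v]
      deg_le nonzero finV assms by auto
qed

lemma solve_star:
  assumes "z \<in> V" "v \<in> V" "N z v \<noteq> 0" "card (star z) = card (star v)"
  shows "\<exists>k. \<forall>r \<in> star z. (\<Sum>l \<in> star v. N r l * k l) = b r"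
  using trivial_kernel_solve[OF kernel_star[OF assms(1-3)], of b] assms finite_star by blast

text \<open>If the images were not adjacent, the columns of \<open>v\<close> and \<open>w\<close>
  would be proportional, with factor \<mu>, on all rows of degree at most \<open>d\<close>, the
  common degree. Row \<open>w\<close> of the inverse is supported on such rows, so it could not tell
  the two columns apart.\<close>

lemma adj_tau:
  assumes "adj v w" "v \<in> V"
  shows "adj (\<tau> v) (\<tau> w)"
proof (rule ccontr)
  assume nadj: "\<not> adj (\<tau> v) (\<tau> w)"
  have w: "w \<in> V"
    using assms closedV by blast
  define x where "x = \<tau> v"
  define y where "y = \<tau> w"
  have V: "x \<in> V" "y \<in> V"
    using assms(2) w by (simp_all add: x_def y_def)
  have "v \<noteq> w"
    using assms(1) by auto
  then have xy: "x \<noteq> y"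
    using bij assms(2) w by (auto simp: x_def y_def bij_betw_def inj_on_def)
  have nz: "N x v \<noteq> 0" "N y w \<noteq> 0"
    using nonzero assms(2) w by (simp_all add: x_def y_def)
  have m: "N x v * N y w = N y v * N x w"
    using minors1[OF assms(1) xy] nadj assms(2) V by (simp add: x_def y_def)
  then have nz': "N y v \<noteq> 0" "N x w \<noteq> 0"
    using nz by auto
  define d where "d = card (star v)"
  have dx: "card (star x) = d" and dyw: "card (star y) = card (star w)"
    using deg_eq assms(2) w by (simp_all add: d_def x_def y_def)
  have dw: "card (star w) = d"
    using deg_le[OF V(2) assms(2) nz'(1)] deg_le[OF V(1) w nz'(2)] dx dyw by (simp add: d_def)
  define \<mu> where "\<mu> = N x w / N x v"
  have nadj': "\<not> adj x y"
    using nadj by (simp add: x_def y_def)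
  have row: "N z w = \<mu> * N z v" if z: "z \<in> V" "card (star z) = d" for z
  proof (cases "z \<in> star x")
    case False
    then have "N x v * N z w = N z v * N x w"
      using minors1[OF assms(1), of x z] z(1) V assms(2) by (auto simp: in_star)
    then show ?thesis
      using nz by (simp add: \<mu>_def nonzero_eq_divide_eq mult.commute)
  next
    case True
    show ?thesis
    proof (cases "z \<in> star y")
      case False
      then have "N y v * N z w = N z v * N y w"
        using minors1[OF assms(1), of y z] z(1) V assms(2) by (auto simp: in_star)
      moreover have "\<mu> = N y w / N y v"
        using m nz nz' by (simp add: \<mu>_def divide_simps mult.commute)
      ultimately have "N y v * N z w = N y v * (\<mu> * N z v)"
        using nz' by simp
      then show ?thesis
        using nz' by simp
    next
      case y: True
      have z': "x \<in> star z" "y \<in> star z"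
        using True y by (auto simp: in_star adj_commute)
      \<comment> \<open>Otherwise the columns of \<open>star v\<close> would realise every vector on
        the rows of \<open>star z\<close>, although rows \<open>x\<close> and \<open>y\<close> are
        proportional there.\<close>
      have "N z v = 0"
      proof (rule ccontr)
        assume "N z v \<noteq> 0"
        then obtain k where k: "\<forall>r \<in> star z.
            (\<Sum>l \<in> star v. N r l * k l) = (if r = x then 1 else 0)"
          using solve_star[OF z(1) assms(2), of "\<lambda>r. if r = x then 1 else 0"] z(2) dw by (auto simp: d_def)
        have "N x v * 0 = N y v * 1"
          using minors_sum[OF V assms(2), of k] nadj' bspec[OF k z'(1)] bspec[OF k z'(2)] xy by simp
        then show False
          using nz' by simp
      qed
      moreover have "N z w = 0"
      proof (rule ccontr)
        assume "N z w \<noteq> 0"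
        then obtain k where k: "\<forall>r \<in> star z.
            (\<Sum>l \<in> star w. N r l * k l) = (if r = y then 1 else 0)"
          using solve_star[OF z(1) w, of "\<lambda>r. if r = y then 1 else 0"] z(2) dw by (auto simp: d_def)
        have "N x w * 1 = N y w * 0"
          using minors_sum[OF V w, of k] nadj' bspec[OF k z'(1)] bspec[OF k z'(2)] xy by simp
        then show False
          using nz' by simp
      qed
      ultimately show ?thesis
        by simp
    qed
  qed
  have high: "N z w - \<mu> * N z v = 0 \<or> d < card (star z)" if "z \<in> V" for z
  proof (cases "card (star z)" d rule: linorder_cases)
    case less
    then have "N z v = 0" "N z w = 0"
      using deg_le[OF that assms(2)] deg_le[OF that w] dw by (auto simp: d_def)
    then show ?thesis
      by simp
  qed (use row[OF that] in auto)
  \<comment> \<open>Rows of degree above \<open>d\<close> drop out through \<open>N' w z\<close>,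
    the others through proportionality; but \<open>inverse2\<close> evaluates the sum to 1.\<close>
  have "(\<Sum>z \<in> V. N' w z * (N z w - \<mu> * N z v)) = 0"
  proof (rule sum.neutral, intro ballI)
    fix z
    assume z: "z \<in> V"
    show "N' w z * (N z w - \<mu> * N z v) = 0"
      using high[OF z] inv.deg_le[OF w z] dw by (cases "N' w z = 0") auto
  qed
  moreover have "(\<Sum>z \<in> V. N' w z * (N z w - \<mu> * N z v)) =
      (\<Sum>z \<in> V. N' w z * N z w) - \<mu> * (\<Sum>z \<in> V. N' w z * N z v)"
    unfolding sum_distrib_left sum_subtractf[symmetric] by (intro sum.cong refl) (simp add: algebra_simps)
  ultimately show False
    using inverse2[OF w w] inverse2[OF w assms(2)] \<open>v \<noteq> w\<close> by simp
qed

lemma graph_aut_tau: "\<forall>u \<in> V. \<forall>w \<in> V. adj u w \<longleftrightarrow> adj (\<tau> u) (\<tau> w)"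
proof (intro ballI iffI)
  fix u w
  assume uw: "u \<in> V" "w \<in> V" and a: "adj (\<tau> u) (\<tau> w)"
  have inj: "inj_on \<tau> V"
    using bij by (simp add: bij_betw_def)
  have sub: "\<tau> ` star u \<subseteq> star (\<tau> u)"
    using adj_tau uw(1) by (auto simp: in_star)
  have "card (\<tau> ` star u) = card (star (\<tau> u))"
    using inj_on_subset[OF inj star_subset[OF uw(1)]] deg_eq[OF uw(1)] by (simp add: card_image)
  then have "\<tau> ` star u = star (\<tau> u)"
    using card_subset_eq[OF finite_star sub] uw(1) by simp
  then obtain w' where w': "w' \<in> star u" "\<tau> w' = \<tau> w"
    using a by (metis (no_types, lifting) image_iff in_star)
  then have "w' = w"
    using inj uw star_subset by (metis inj_onD subsetD)
  moreover have "u \<noteq> w"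
    using a by auto
  ultimately show "adj u w"
    using w'(1) by (auto simp: in_star)
qed (auto intro: adj_tau)

text \<open>If a neighbour \<open>y\<close> of \<open>\<tau> u\<close> lay outside
  \<open>star x\<close>, take a combination of the columns of \<open>star u\<close> that is the unit
  vector at \<open>y\<close> on the rows of \<open>star (\<tau> u)\<close>. Proportionality of rows
  \<open>x\<close> and \<open>y\<close> makes it non-zero at \<open>x\<close>, contradicting either
  this choice or the proportionality of rows \<open>x\<close> and \<open>\<tau> u\<close>.\<close>

lemma le_tau:
  assumes "x \<in> V" "u \<in> V" "N x u \<noteq> 0"
  shows "le (\<tau> u) x"
  unfolding le_def
proof
  fix y
  assume "y \<in> nb (\<tau> u)"
  then have y: "adj (\<tau> u) y"
    by simp
  show "y \<in> star x"
  proof (rule ccontr)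
    assume n: "y \<notin> star x"
    define t where "t = \<tau> u"
    have t: "t \<in> V" "N t u \<noteq> 0" "adj t y"
      using assms(2) nonzero y by (simp_all add: t_def)
    have yV: "y \<in> V"
      using closedV[OF y] assms(2) by simp
    obtain k where k: "\<forall>r \<in> star t.
        (\<Sum>l \<in> star u. N r l * k l) = (if r = y then 1 else 0)"
      using solve_star[OF t(1) assms(2) t(2), of "\<lambda>r. if r = y then 1 else 0"]
        deg_eq[OF assms(2)] by (auto simp: t_def)
    let ?n = "\<lambda>r. \<Sum>l \<in> star u. N r l * k l"
    have ny: "?n y = 1"
      using bspec[OF k, of y] t(3) by (simp add: in_star)
    have "N x u * ?n y = N y u * ?n x"
      using n by (intro minors_sum assms yV) (auto simp: in_star)
    then have nx: "?n x \<noteq> 0"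
      using assms(3) ny by auto
    show False
    proof (cases "x \<in> star t")
      case True
      then have "?n x = (if x = y then 1 else 0)"
        using k by blast
      then show False
        using nx n by (auto simp: in_star split: if_splits)
    next
      case False
      then have "N t u * ?n x = N x u * ?n t"
        by (intro minors_sum assms t) (auto simp: in_star)
      moreover have "?n t = 0"
        using bspec[OF k, of t] t(3) by auto
      ultimately show False
        using t(2) nx by simp
    qed
  qed
qed

end

section \<open>Liftable automorphisms\<close>

definition closed :: "'v::graph set \<Rightarrow> bool" where
  "closed V \<longleftrightarrow> (\<forall>u \<in> V. \<forall>w. adj u w \<longrightarrow> w \<in> V)"

lemma closedD: "closed V \<Longrightarrow> adj u w \<Longrightarrow> u \<in> V \<longleftrightarrow> w \<in> V"
  unfolding closed_def using adj_sym by blast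

definition extV :: "'v::graph set \<Rightarrow> ('v \<Rightarrow> 'g::group_add) \<Rightarrow> 'v raag \<Rightarrow> 'g" where
  "extV V s = ext (\<lambda>v. if v \<in> V then s v else 0)"

definition compatV :: "'v::graph set \<Rightarrow> ('v \<Rightarrow> 'g::group_add) \<Rightarrow> bool" where
  "compatV V s \<longleftrightarrow> closed V \<and> (\<forall>u \<in> V. \<forall>w \<in> V. adj u w \<longrightarrow> cm (s u) (s w))"

lemma compatV_compat: "compatV V s \<Longrightarrow> compat (\<lambda>v. if v \<in> V then s v else 0)"
  by (auto simp: compat_def compatV_def dest: closedD)

lemma ghom_extV: "compatV V s \<Longrightarrow> ghom (extV V s)"
  unfolding extV_def by (intro ghom_ext compatV_compat)

lemma extV_gen [simp]: "compatV V s \<Longrightarrow> v \<in> V \<Longrightarrow> extV V s (gen v) = s v"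
  by (simp add: extV_def compatV_compat)

text \<open>The inverse is carried along as a total homomorphism, so that facts about
  \<open>f\<close> apply to it by symmetry.\<close>

definition aut_pair :: "'v::graph set \<Rightarrow> ('v raag \<Rightarrow> 'v raag) \<Rightarrow> ('v raag \<Rightarrow> 'v raag) \<Rightarrow> bool" where
  "aut_pair V f h \<longleftrightarrow> ghom f \<and> ghom h \<and>
    (\<forall>g \<in> gp V. f g \<in> gp V \<and> h g \<in> gp V \<and> h (f g) = g \<and> f (h g) = g)"

definition aut :: "'v::graph set \<Rightarrow> ('v raag \<Rightarrow> 'v raag) \<Rightarrow> bool" where
  "aut V f \<longleftrightarrow> (\<exists>h. aut_pair V f h)"

lemma aut_pair_sym: "aut_pair V f h \<Longrightarrow> aut_pair V h f"
  by (auto simp: aut_pair_def)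

lemma aut_ghom: "aut V f \<Longrightarrow> ghom f"
  by (auto simp: aut_def aut_pair_def)

lemma aut_gp: "aut V f \<Longrightarrow> g \<in> gp V \<Longrightarrow> f g \<in> gp V"
  by (auto simp: aut_def aut_pair_def)

lemma aut_pairD:
  assumes "aut_pair V f h"
  shows "ghom f" "ghom h" "g \<in> gp V \<Longrightarrow> f g \<in> gp V" "g \<in> gp V \<Longrightarrow> h g \<in> gp V"
    "g \<in> gp V \<Longrightarrow> h (f g) = g" "g \<in> gp V \<Longrightarrow> f (h g) = g"
  using assms by (auto simp: aut_pair_def)

lemma aut_pair_comp:
  "aut_pair V f h \<Longrightarrow> aut_pair V f' h' \<Longrightarrow> aut_pair V (\<lambda>g. f (f' g)) (\<lambda>g. h' (h g))"
  by (auto simp: aut_pair_def intro: ghom_comp)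

lemma aut_comp: "aut V f \<Longrightarrow> aut V f' \<Longrightarrow> aut V (\<lambda>g. f (f' g))"
  unfolding aut_def using aut_pair_comp by blast

lemma aut_pairI:
  assumes "ghom f" "ghom h"
    and "\<And>v. v \<in> V \<Longrightarrow> f (gen v) \<in> gp V" "\<And>v. v \<in> V \<Longrightarrow> h (gen v) \<in> gp V"
    and "\<And>v. v \<in> V \<Longrightarrow> h (f (gen v)) = gen v" "\<And>v. v \<in> V \<Longrightarrow> f (h (gen v)) = gen v"
  shows "aut_pair V f h"
  unfolding aut_pair_def
  using assms ghom_image_gp[OF assms(1), of V V] ghom_image_gp[OF assms(2), of V V]
    ghom_eq_on_gp[OF ghom_comp[OF assms(2,1)] ghom_id, of V]
    ghom_eq_on_gp[OF ghom_comp[OF assms(1,2)] ghom_id, of V]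
  by auto

section \<open>Regular coverings and moves that lift\<close>

locale cover =
  fixes VL :: "'v::graph set" and VG :: "'w::graph set" and \<phi> :: "'v \<Rightarrow> 'w"
  assumes finL: "finite VL" and finG: "finite VG"
    and closedL: "closed VL" and closedG: "closed VG"
    and image: "\<phi> ` VL = VG"
    and edge: "u \<in> VL \<Longrightarrow> adj u w \<Longrightarrow> adj (\<phi> u) (\<phi> w)"
    and local_bij: "u \<in> VL \<Longrightarrow> bij_betw \<phi> (nb u) (nb (\<phi> u))"
    and deck: "u \<in> VL \<Longrightarrow> w \<in> VL \<Longrightarrow> \<phi> u = \<phi> w \<Longrightarrow>
      \<exists>\<mu>. bij_betw \<mu> VL VL \<and> (\<forall>a \<in> VL. \<forall>b \<in> VL. adj a b \<longleftrightarrow> adj (\<mu> a) (\<mu> b)) \<and>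
        (\<forall>a \<in> VL. \<phi> (\<mu> a) = \<phi> a) \<and> \<mu> u = w"
    and no_isolated: "v \<in> VG \<Longrightarrow> nb v \<noteq> {}"
begin

lemma phi_in [simp]: "u \<in> VL \<Longrightarrow> \<phi> u \<in> VG"
  using image by blast

lemma lift_exists: "v \<in> VG \<Longrightarrow> \<exists>u \<in> VL. \<phi> u = v"
  using image by blast

lemma adjL: "adj u w \<Longrightarrow> u \<in> VL \<longleftrightarrow> w \<in> VL"
  using closedL closedD by blast

lemma adjG: "adj u w \<Longrightarrow> u \<in> VG \<longleftrightarrow> w \<in> VG"
  using closedG closedD by blast

lemma local_inj: "c \<in> VL \<Longrightarrow> adj c a \<Longrightarrow> adj c b \<Longrightarrow> \<phi> a = \<phi> b \<Longrightarrow> a = b"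
  using local_bij unfolding bij_betw_def inj_on_def by (metis in_nb)

lemma edge_lift: "u \<in> VL \<Longrightarrow> adj (\<phi> u) w \<Longrightarrow> \<exists>w'. adj u w' \<and> \<phi> w' = w"
  using local_bij[of u] unfolding bij_betw_def by (metis (no_types) imageE in_nb)

lemma not_adj_fibre: "u \<in> VL \<Longrightarrow> \<phi> u = \<phi> w \<Longrightarrow> \<not> adj u w"
  using edge by fastforce

lemma has_neighbour: "u \<in> VL \<Longrightarrow> \<exists>c. adj u c"
  using no_isolated[of "\<phi> u"] edge_lift[of u] by auto

lemma star_fibre: "c \<in> VL \<Longrightarrow> a \<in> star c \<Longrightarrow> b \<in> star c \<Longrightarrow> \<phi> a = \<phi> b \<Longrightarrow> a = b"
  using local_inj[of c a b] not_adj_fibre[of c a] not_adj_fibre[of c b] by (auto simp: in_star)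

text \<open>A neighbour \<open>c\<close> of \<open>u\<close> lies in the stars of both
  \<open>a\<close> and \<open>b\<close>, and \<phi> is injective on \<open>star c\<close>. The
  neighbour exists because no vertex is isolated.\<close>

lemma le_fibre:
  assumes "u \<in> VL" "le u a" "le u b" "\<phi> a = \<phi> b"
  shows "a = b"
proof -
  obtain c where c: "adj u c"
    using has_neighbour assms(1) by blast
  then have "c \<in> star a" "c \<in> star b"
    using assms unfolding le_def by auto
  then have "a \<in> star c" "b \<in> star c"
    by (auto simp: in_star adj_commute)
  then show ?thesis
    using star_fibre[of c a b] adjL[OF c] assms by blast
qed

lemma card_star: "u \<in> VL \<Longrightarrow> card (star (\<phi> u)) = card (star u)"
proof -
  assume u: "u \<in> VL"
  have "nb u \<subseteq> VL" "nb (\<phi> u) \<subseteq> VG"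
    using u adjL adjG phi_in by fastforce+
  then have "finite (nb u)" "finite (nb (\<phi> u))"
    using finL finG finite_subset by blast+
  then show ?thesis
    using bij_betw_same_card[OF local_bij[OF u]] by (simp add: star_def nb_def)
qed

text \<open>Domination witnessed upstairs. It implies domination downstairs
  (\<open>le'_imp_le\<close>), and by regularity every lift of \<open>v\<close> can serve as the
  witness (\<open>le'_lift\<close>).\<close>

definition le' :: "'w \<Rightarrow> 'w \<Rightarrow> bool" where
  "le' v x \<longleftrightarrow> (\<exists>u \<in> VL. \<exists>y \<in> VL. \<phi> u = v \<and> \<phi> y = x \<and> le u y)"

lemma le'_lift:
  assumes "le' v x" "u \<in> VL" "\<phi> u = v"
  shows "\<exists>y \<in> VL. \<phi> y = x \<and> le u y"
proof -
  obtain u0 y0 where 0: "u0 \<in> VL" "y0 \<in> VL" "\<phi> u0 = v" "\<phi> y0 = x" "le u0 y0"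
    using assms(1) by (auto simp: le'_def)
  obtain \<mu> where \<mu>: "bij_betw \<mu> VL VL" "\<forall>a \<in> VL. \<forall>b \<in> VL. adj a b \<longleftrightarrow> adj (\<mu> a) (\<mu> b)"
    "\<forall>a \<in> VL. \<phi> (\<mu> a) = \<phi> a" "\<mu> u0 = u"
    using deck[OF 0(1) assms(2)] 0(3) assms(3) by auto
  have "le u (\<mu> y0)"
    unfolding le_def
  proof
    fix c
    assume c: "c \<in> nb u"
    then have "c \<in> VL"
      using adjL assms(2) by simp
    then obtain c0 where c0: "c0 \<in> VL" "\<mu> c0 = c"
      using \<mu>(1) unfolding bij_betw_def by (metis imageE)
    then have "c0 \<in> star y0"
      using c \<mu>(2,4) 0(1,5) by (auto simp: le_def)
    then show "c \<in> star (\<mu> y0)"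
      using c0 \<mu>(2) 0(2) by (auto simp: in_star)
  qed
  moreover have "\<mu> y0 \<in> VL"
    using \<mu>(1) 0(2) by (auto simp: bij_betw_def)
  ultimately show ?thesis
    using \<mu>(3) 0(2,4) by auto
qed

lemma le_trans: "le a b \<Longrightarrow> le b c \<Longrightarrow> le a c"
  unfolding le_def star_def by (auto simp: subset_iff adj_commute) (metis adj_sym)+

lemma le_refl: "le a a"
  by (auto simp: le_def star_def)

lemma le'_refl: "v \<in> VG \<Longrightarrow> le' v v"
  unfolding le'_def using lift_exists le_refl by blast

lemma le'_trans: "le' a b \<Longrightarrow> le' b c \<Longrightarrow> le' a c"
proof -
  assume ab: "le' a b" and bc: "le' b c"
  obtain u y where u: "u \<in> VL" "y \<in> VL" "\<phi> u = a" "\<phi> y = b" "le u y"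
    using ab by (auto simp: le'_def)
  then obtain z where "z \<in> VL" "\<phi> z = c" "le y z"
    using le'_lift[OF bc] by blast
  then show ?thesis
    using u le_trans unfolding le'_def by blast
qed

lemma le'_imp_le: "le' v x \<Longrightarrow> le v x"
proof -
  assume "le' v x"
  then obtain u y where u: "u \<in> VL" "y \<in> VL" "\<phi> u = v" "\<phi> y = x" "le u y"
    by (auto simp: le'_def)
  have "\<phi> c \<in> star (\<phi> y)" if "c \<in> star y" for c
    using that edge[OF u(2), of c] by (auto simp: in_star)
  then have "\<phi> ` nb u \<subseteq> star (\<phi> y)"
    using u(5) by (auto simp: le_def)
  then show ?thesis
    using local_bij[OF u(1)] u by (simp add: le_def bij_betw_def)
qed

lemma le'_in: "le' v x \<Longrightarrow> v \<in> VG \<and> x \<in> VG"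
  by (auto simp: le'_def)

definition \<Phi> :: "'v raag \<Rightarrow> 'w raag" where
  "\<Phi> = extV VL (\<lambda>u. gen (\<phi> u))"

lemma compatV_\<Phi>: "compatV VL (\<lambda>u. gen (\<phi> u))"
  by (auto simp: compatV_def closedL edge intro: cm_lett)

lemma ghom_\<Phi>: "ghom \<Phi>"
  unfolding \<Phi>_def by (intro ghom_extV compatV_\<Phi>)

lemmas \<Phi>_simps [simp] = ghom_simps[OF ghom_\<Phi>]

lemma \<Phi>_lett [simp]: "fst a \<in> VL \<Longrightarrow> \<Phi> (lett a) = lett (\<phi> (fst a), snd a)"
  using ghom_lett[OF ghom_\<Phi>, of a] compatV_\<Phi> by (cases a) (auto simp: \<Phi>_def slet_def)

lemma \<Phi>_gp: "g \<in> gp U \<Longrightarrow> U \<subseteq> VL \<Longrightarrow> \<Phi> g \<in> gp (\<phi> ` U)"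
  by (rule ghom_image_gp[OF ghom_\<Phi>]) auto

lemma expo_\<Phi>:
  assumes "g \<in> gp VL"
  shows "expo x (\<Phi> g) = (\<Sum>y \<in> {y \<in> VL. \<phi> y = x}. expo y g)"
  using assms
proof (induction g rule: gp_induct)
  case (add a g)
  have "(\<Sum>y \<in> {y \<in> VL. \<phi> y = x}. expo y (lett a)) = expo x (lett (\<phi> (fst a), snd a))"
    using add.hyps(1) finL by (auto simp: expo_lett if_distrib sum.delta cong: if_cong)
  then show ?case
    using add by (simp add: sum.distrib)
qed simp

definition laut :: "('w raag \<Rightarrow> 'w raag) \<Rightarrow> ('v raag \<Rightarrow> 'v raag) \<Rightarrow> bool" where
  "laut f F \<longleftrightarrow> aut VG f \<and> aut VL F \<and> (\<forall>g \<in> gp VL. f (\<Phi> g) = \<Phi> (F g))"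

lemma lautI:
  assumes "aut VG f" "aut VL F" "\<And>u. u \<in> VL \<Longrightarrow> f (gen (\<phi> u)) = \<Phi> (F (gen u))"
  shows "laut f F"
proof -
  have "f (\<Phi> g) = \<Phi> (F g)" if "g \<in> gp VL" for g
  proof (rule ghom_eq_on_gp[OF _ _ _ that])
    show "ghom (\<lambda>g. f (\<Phi> g))" "ghom (\<lambda>g. \<Phi> (F g))"
      using assms aut_ghom ghom_\<Phi> ghom_comp by blast+
  qed (simp add: assms(3))
  then show ?thesis
    using assms by (simp add: laut_def)
qed

lemma laut_comp: "laut f F \<Longrightarrow> laut e E \<Longrightarrow> laut (\<lambda>g. f (e g)) (\<lambda>g. F (E g))"
  unfolding laut_def by (auto intro: aut_comp simp: aut_gp)

inductive elem :: "('w raag \<Rightarrow> 'w raag) \<Rightarrow> bool" where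
  symmetry: "bij_betw \<sigma> VG VG \<Longrightarrow> \<forall>u \<in> VG. \<forall>w \<in> VG. adj u w \<longleftrightarrow> adj (\<sigma> u) (\<sigma> w) \<Longrightarrow>
    elem (extV VG (\<lambda>v. gen (\<sigma> v)))"
| inversion: "S \<subseteq> VG \<Longrightarrow> elem (extV VG (\<lambda>v. lett (v, v \<notin> S)))"
| transvection: "a \<in> VG \<Longrightarrow> b \<in> VG \<Longrightarrow> b \<noteq> a \<Longrightarrow> le b a \<Longrightarrow>
    elem (extV VG (\<lambda>v. if v = b then gen b + gen a else gen v))"
| partial_conj: "v \<in> VG \<Longrightarrow> C \<subseteq> VG - star v \<Longrightarrow>
    (\<And>x y. x \<in> C \<Longrightarrow> adj x y \<Longrightarrow> y \<notin> star v \<Longrightarrow> y \<in> C) \<Longrightarrow>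
    elem (extV VG (\<lambda>w. if w \<in> C then gen v + gen w - gen v else gen w))"

text \<open>Automorphisms are total functions here of which only the values on \<open>gp VG\<close> matter. Hence
  \<open>GEN f\<close> says that moves make \<open>f\<close> equal to the identity there.\<close>

inductive GEN :: "('w raag \<Rightarrow> 'w raag) \<Rightarrow> bool" where
  GEN_id: "ghom f \<Longrightarrow> (\<And>v. v \<in> VG \<Longrightarrow> f (gen v) = gen v) \<Longrightarrow> GEN f"
| GEN_step: "GEN (\<lambda>g. f (e g)) \<Longrightarrow> ghom f \<Longrightarrow> elem e \<Longrightarrow> laut e E \<Longrightarrow> GEN f"

text \<open>A move together with a lift. The second clause, instead of being elementary, is what
  survives composition.\<close>

definition mv :: "('w raag \<Rightarrow> 'w raag) \<Rightarrow> ('v raag \<Rightarrow> 'v raag) \<Rightarrow> bool" where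
  "mv e E \<longleftrightarrow> laut e E \<and> (\<forall>f. ghom f \<longrightarrow> GEN (\<lambda>g. f (e g)) \<longrightarrow> GEN f)"

lemma mv_elem: "elem e \<Longrightarrow> laut e E \<Longrightarrow> mv e E"
  unfolding mv_def using GEN_step by blast

lemma mv_laut: "mv e E \<Longrightarrow> laut e E"
  by (simp add: mv_def)

lemma laut_ghom: "laut f F \<Longrightarrow> ghom f \<and> ghom F"
  by (auto simp: laut_def aut_ghom)

lemma mv_comp:
  assumes "mv e E" "mv e' E'"
  shows "mv (\<lambda>g. e (e' g)) (\<lambda>g. E (E' g))"
  unfolding mv_def
proof (intro conjI allI impI)
  show "laut (\<lambda>g. e (e' g)) (\<lambda>g. E (E' g))"
    using assms mv_laut laut_comp by blast
  fix f
  assume f: "ghom f" "GEN (\<lambda>g. f (e (e' g)))"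
  have "ghom (\<lambda>g. f (e g))"
    using f(1) assms(1) mv_laut laut_ghom ghom_comp by blast
  then have "GEN (\<lambda>g. f (e g))"
    using f(2) assms(2) unfolding mv_def by blast
  then show "GEN f"
    using f(1) assms(1) unfolding mv_def by blast
qed

lemma mv_id: "mv (\<lambda>g. g) (\<lambda>g. g)"
  by (auto simp: mv_def laut_def aut_def aut_pair_def ghom_def)

end

section \<open>Lifting symmetries and transvections\<close>

definition zm :: "int \<Rightarrow> 'g::group_add \<Rightarrow> 'g" where
  "zm k g = (if 0 \<le> k then npow (nat k) g else npow (nat (- k)) (- g))"

lemma zm_zero [simp]: "zm 0 g = 0"
  by (simp add: zm_def)

lemma zm_succ: "zm (k + 1) g = g + zm k g"
proof (cases "0 \<le> k")
  case True
  then have "nat (k + 1) = Suc (nat k)"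
    by simp
  then show ?thesis
    using True by (simp add: zm_def)
next
  case False
  then have "nat (- k) = Suc (nat (- (k + 1)))"
    by simp
  then have "npow (nat (- k)) (- g) = - g + npow (nat (- (k + 1))) (- g)"
    by (metis npow.simps(2))
  then have "g + zm k g = npow (nat (- (k + 1))) (- g)"
    using False by (simp add: zm_def flip: add.assoc)
  then show ?thesis
    using False by (auto simp: zm_def)
qed

lemma zm_pred: "zm (k - 1) g = - g + zm k g"
  using zm_succ[of "k - 1" g] by (simp flip: add.assoc)

lemma zm_add: "zm (j + k) g = zm j g + zm k g"
proof (induction j rule: int_induct[where k = 0])
  case (step1 i)
  have "zm (i + 1 + k) g = g + zm (i + k) g"
    using zm_succ[of "i + k" g] by (simp add: algebra_simps)
  then show ?case
    using step1 by (simp add: zm_succ add.assoc)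
next
  case (step2 i)
  have "zm (i - 1 + k) g = - g + zm (i + k) g"
    using zm_pred[of "i + k" g] by (simp add: algebra_simps)
  then show ?case
    using step2 by (simp add: zm_pred add.assoc)
qed simp

lemma zm_one [simp]: "zm 1 g = g"
  by (simp add: zm_def)

lemma zm_uminus: "zm (- k) g = - zm k g"
  using zm_add[of "- k" k g] by (simp add: eq_neg_iff_add_eq_0)

lemma ghom_zm: "ghom f \<Longrightarrow> f (zm k g) = zm k (f g)"
proof -
  assume f: "ghom f"
  have "f (npow n g) = npow n (f g)" for n g
    by (induction n) (simp_all add: ghom_zero[OF f] ghom_add[OF f])
  then show ?thesis
    by (simp add: zm_def ghom_uminus[OF f])
qed

lemma cm_zm: "cm g h \<Longrightarrow> cm (zm k g) h"
  by (simp add: zm_def cm_npow)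

lemma expo_zm [simp]: "expo x (zm k g) = k * expo x g"
  by (simp add: zm_def)

lemma gp_zm: "g \<in> gp U \<Longrightarrow> zm k g \<in> gp U"
proof -
  have "g \<in> gp U \<Longrightarrow> npow n g \<in> gp U" for n g
    by (induction n) (auto intro: gp_add)
  then show "g \<in> gp U \<Longrightarrow> zm k g \<in> gp U"
    by (simp add: zm_def)
qed

text \<open>A combination \<open>c\<close> of \<open>h\<close> and \<open>g\<close> with exponent
  zero at \<open>x\<close> still commutes with \<open>g\<close>. By the centraliser theorem it is
  conjugate into the subgroup over the neighbours of \<open>x\<close>, so its exponent at
  \<open>y\<close> vanishes too.\<close>

lemma cm_expo:
  assumes "cm g h" "x \<noteq> y" "\<not> adj x y"
  shows "expo x g * expo y h = expo y g * expo x h"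
proof -
  have *: "expo x g * expo y h = expo y g * expo x h" if "cm g h" "expo x g \<noteq> 0" for g h
  proof -
    obtain t w where w: "minconj w" "g = t + w - t"
      using minconj_exists by blast
    define c where "c = zm (expo x g) h + zm (- expo x h) g"
    have "cm g c"
      unfolding c_def using that(1) by (metis cm_add cm_sym cm_zm cm_refl)
    moreover have "expo x c = 0"
      by (simp add: c_def)
    ultimately have "- t + c + t \<in> gp {v. adj x v}"
      using centralizer_conj[OF w that(2)] by blast
    then have "expo y (- t + c + t) = 0"
      using assms(3) by (intro expo_notin_supp) (auto simp: gp_def)
    then show ?thesis
      by (simp add: c_def algebra_simps)
  qed
  show ?thesis
    using *[OF assms(1)] *[OF cm_sym[OF assms(1)]]
    by (metis mult.commute mult_zero_left)
qed

lemma cm_gen_lett: "w = fst a \<or> adj (fst a) w \<Longrightarrow> cm (gen w) (lett a)"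
  using cm_lett[of "(w, True)" a] by (cases a; cases "snd a") (auto simp: adj_commute)

lemma expo_ghom:
  assumes "ghom f" "finite V" "g \<in> gp V"
  shows "expo x (f g) = (\<Sum>v \<in> V. expo x (f (gen v)) * expo v g)"
  using assms(3)
proof (induction g rule: gp_induct)
  case zero
  then show ?case
    by (simp add: ghom_zero[OF assms(1)])
next
  case (add a g)
  have "(\<Sum>v \<in> V. expo x (f (gen v)) * expo v (lett a)) =
      (\<Sum>v \<in> V. if v = fst a then expo x (f (lett a)) else 0)"
    using ghom_lett[OF assms(1), of a] by (intro sum.cong) (auto simp: expo_lett slet_def)
  also have "\<dots> = expo x (f (lett a))"
    using add.hyps(1) assms(2) by simp
  finally show ?case
    using add.IH by (simp add: ghom_add[OF assms(1)] distrib_left sum.distrib)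
qed

lemma aut_pair_graph_matrix:
  assumes "aut_pair V f h" "finite V" "closed V"
  shows "graph_matrix V (\<lambda>x u. of_int (expo x (f (gen u)))) (\<lambda>x u. of_int (expo x (h (gen u))))"
proof
  show "finite V" "adj u w \<Longrightarrow> u \<in> V \<Longrightarrow> w \<in> V" for u w
    using assms closedD by blast+
  note D = aut_pairD[OF assms(1)]
  have *: "(\<Sum>y \<in> V. of_int (expo x (f (gen y))) * of_int (expo y (h (gen u)))) =
      (if x = u then 1 else (0 :: rat))" if "aut_pair V f h" "u \<in> V" for x u f h
  proof -
    have "(\<Sum>y \<in> V. expo x (f (gen y)) * expo y (h (gen u))) = expo x (f (h (gen u)))"
      using expo_ghom[of f V "h (gen u)" x] aut_pairD[OF that(1)] assms(2) that(2) by simp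
    also have "\<dots> = (if x = u then 1 else 0)"
      using aut_pairD(6)[OF that(1), of "gen u"] that(2) by (simp add: expo_lett)
    finally show ?thesis
      by (simp flip: of_int_mult of_int_sum)
  qed
  show "(\<Sum>y \<in> V. of_int (expo x (f (gen y))) * of_int (expo y (h (gen u)))) =
      (if x = u then 1 else (0 :: rat))" if "u \<in> V" for x u
    by (rule *[OF assms(1) that])
  show "(\<Sum>y \<in> V. of_int (expo x (h (gen y))) * of_int (expo y (f (gen u)))) =
      (if x = u then 1 else (0 :: rat))" if "u \<in> V" for x u
    by (rule *[OF aut_pair_sym[OF assms(1)] that])
  have m: "expo x (f (gen u)) * expo y (f (gen w)) = expo y (f (gen u)) * expo x (f (gen w))"
    if "ghom f" "adj u w" "x \<noteq> y" "\<not> adj x y" for f :: "'a raag \<Rightarrow> 'a raag" and u w x y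
    using that by (intro cm_expo ghom_cm[OF that(1)] cm_lett) auto
  show "of_int (expo x (f (gen u))) * of_int (expo y (f (gen w))) =
      of_int (expo y (f (gen u))) * (of_int (expo x (f (gen w))) :: rat)"
    if "adj u w" "x \<noteq> y" "\<not> adj x y" for u w x y
    using m[OF D(1) that] by (simp flip: of_int_mult)
  show "of_int (expo x (h (gen u))) * of_int (expo y (h (gen w))) =
      of_int (expo y (h (gen u))) * (of_int (expo x (h (gen w))) :: rat)"
    if "adj u w" "x \<noteq> y" "\<not> adj x y" for u w x y
    using m[OF D(2) that] by (simp flip: of_int_mult)
qed

lemma le_sym_card:
  assumes "le a z" "card (star a) = card (star z)" "finite (star z)"
  shows "le z a"
proof (cases "a = z \<or> adj a z")
  case True
  then have "star a \<subseteq> star z"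
    using assms(1) by (auto simp: le_def in_star star_def adj_commute)
  then have "star a = star z"
    using assms(2,3) card_subset_eq by blast
  then show ?thesis
    by (auto simp: le_def star_def)
next
  case False
  then have nb: "nb a \<subseteq> nb z"
    using assms(1) unfolding le_def star_def by auto
  have fin: "finite (nb z)" "finite (nb a)"
    using assms(3) finite_subset[OF nb] by (auto simp: star_def)
  have "card (nb a) = card (nb z)"
    using assms(2) fin by (simp add: star_def)
  then have "nb a = nb z"
    using card_subset_eq[OF fin(1) nb] by blast
  then show ?thesis
    by (auto simp: le_def star_def)
qed

context cover
begin

text \<open>For \<open>w\<close> in \<open>VL\<close> at most one vertex over \<open>u\<close>
  dominates \<open>w\<close> (\<open>le_fibre\<close>), so the choice is canonical.\<close>

definition lft :: "'w \<Rightarrow> 'v \<Rightarrow> 'v" where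
  "lft u w = (SOME y. y \<in> VL \<and> \<phi> y = u \<and> le w y)"

lemma lft:
  assumes "le' (\<phi> w) u" "w \<in> VL"
  shows "lft u w \<in> VL" "\<phi> (lft u w) = u" "le w (lft u w)"
proof -
  have "\<exists>y. y \<in> VL \<and> \<phi> y = u \<and> le w y"
    using le'_lift[OF assms refl] by blast
  from someI_ex[OF this] show "lft u w \<in> VL" "\<phi> (lft u w) = u" "le w (lft u w)"
    by (auto simp: lft_def)
qed

lemma mv_inversion:
  assumes "S \<subseteq> VG"
  shows "\<exists>e E. mv e E \<and> (\<forall>v \<in> VG. e (gen v) = lett (v, v \<notin> S)) \<and>
    (\<forall>u \<in> VL. E (gen u) = lett (u, \<phi> u \<notin> S))"
proof -
  let ?e = "extV VG (\<lambda>v. lett (v, v \<notin> S))"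
  let ?E = "extV VL (\<lambda>u. lett (u, \<phi> u \<notin> S))"
  have c: "compatV VG (\<lambda>v. lett (v, v \<notin> S))" "compatV VL (\<lambda>u. lett (u, \<phi> u \<notin> S))"
    by (auto simp: compatV_def closedL closedG intro: cm_lett)
  note gh = ghom_extV[OF c(1)] ghom_extV[OF c(2)]
  have inv: "?e (lett (v, v \<notin> S)) = gen v" if "v \<in> VG" for v
    using that ghom_lett[OF gh(1), of "(v, v \<notin> S)"] c by (cases "v \<in> S") (auto simp: slet_def)
  have inv': "?E (lett (u, \<phi> u \<notin> S)) = gen u" if "u \<in> VL" for u
    using that ghom_lett[OF gh(2), of "(u, \<phi> u \<notin> S)"] c by (cases "\<phi> u \<in> S") (auto simp: slet_def)
  have "aut_pair VG ?e ?e"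
    by (rule aut_pairI) (auto simp: c gh inv)
  moreover have "aut_pair VL ?E ?E"
    by (rule aut_pairI) (auto simp: c gh inv')
  ultimately have "laut ?e ?E"
    by (intro lautI) (auto simp: aut_def c)
  then have "mv ?e ?E"
    using assms by (intro mv_elem elem.inversion)
  then show ?thesis
    using c by (intro exI[of _ ?e] exI[of _ ?E]) simp
qed

lemma mv_symmetry:
  assumes \<sigma>: "bij_betw \<sigma> VG VG" "\<forall>u \<in> VG. \<forall>w \<in> VG. adj u w \<longleftrightarrow> adj (\<sigma> u) (\<sigma> w)"
    and \<tau>: "bij_betw \<tau> VL VL" "\<forall>u \<in> VL. \<forall>w \<in> VL. adj u w \<longleftrightarrow> adj (\<tau> u) (\<tau> w)"
    and comm: "\<And>u. u \<in> VL \<Longrightarrow> \<phi> (\<tau> u) = \<sigma> (\<phi> u)"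
  shows "\<exists>e E. mv e E \<and> (\<forall>v \<in> VG. e (gen (\<sigma> v)) = gen v) \<and> (\<forall>u \<in> VL. E (gen (\<tau> u)) = gen u)"
proof -
  define \<sigma>' where "\<sigma>' = inv_into VG \<sigma>"
  define \<tau>' where "\<tau>' = inv_into VL \<tau>"
  have s: "\<sigma>' v \<in> VG" "\<sigma> v \<in> VG" "\<sigma>' (\<sigma> v) = v" "\<sigma> (\<sigma>' v) = v" if "v \<in> VG" for v
    using \<sigma>(1) that unfolding \<sigma>'_def
    by (auto simp: bij_betw_def inv_into_into f_inv_into_f)
  have t: "\<tau>' v \<in> VL" "\<tau> v \<in> VL" "\<tau>' (\<tau> v) = v" "\<tau> (\<tau>' v) = v" if "v \<in> VL" for v
    using \<tau>(1) that unfolding \<tau>'_def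
    by (auto simp: bij_betw_def inv_into_into f_inv_into_f)
  have bs: "bij_betw \<sigma>' VG VG"
    unfolding \<sigma>'_def by (rule bij_betw_inv_into[OF \<sigma>(1)])
  have as: "\<forall>u \<in> VG. \<forall>w \<in> VG. adj u w \<longleftrightarrow> adj (\<sigma>' u) (\<sigma>' w)"
    using \<sigma>(2) s by metis
  have at: "\<forall>u \<in> VL. \<forall>w \<in> VL. adj u w \<longleftrightarrow> adj (\<tau>' u) (\<tau>' w)"
    using \<tau>(2) t by metis
  have c: "compatV VG (\<lambda>v. gen (\<sigma> v))" "compatV VG (\<lambda>v. gen (\<sigma>' v))"
    "compatV VL (\<lambda>v. gen (\<tau> v))" "compatV VL (\<lambda>v. gen (\<tau>' v))"
    using \<sigma>(2) \<tau>(2) as at by (auto simp: compatV_def closedL closedG intro!: cm_lett)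
  \<comment> \<open>The inverse permutation is the move: composing \<open>f\<close> with it sends
    the generator of \<open>\<sigma> v\<close> to \<open>f (gen v)\<close>, which brings the
    selected entries to the diagonal.\<close>
  let ?e = "extV VG (\<lambda>v. gen (\<sigma>' v))"
  let ?E = "extV VL (\<lambda>v. gen (\<tau>' v))"
  have "aut_pair VG ?e (extV VG (\<lambda>v. gen (\<sigma> v)))"
    by (rule aut_pairI) (auto simp: c ghom_extV s)
  moreover have "aut_pair VL ?E (extV VL (\<lambda>v. gen (\<tau> v)))"
    by (rule aut_pairI) (auto simp: c ghom_extV t)
  moreover have "\<phi> (\<tau>' u) = \<sigma>' (\<phi> u)" if "u \<in> VL" for u
    using comm[of "\<tau>' u"] t[OF that] s(3)[of "\<phi> (\<tau>' u)"] by simp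
  ultimately have "laut ?e ?E"
    by (intro lautI) (auto simp: aut_def c t)
  then have "mv ?e ?E"
    by (intro mv_elem elem.symmetry bs as)
  then show ?thesis
    using c s t by (intro exI[of _ ?e] exI[of _ ?E]) simp
qed

text \<open>The lift transvects all vertices over \<open>x\<close> at once, each by the vertex over
  \<open>u\<close> that dominates it; vertices of one fibre are never adjacent, so no edge is
  affected at both ends.\<close>

lemma mv_transvection_right:
  assumes le: "le' x u" "x \<noteq> u"
  shows "\<exists>e E. mv e E \<and> (\<forall>v \<in> VG. e (gen v) = (if v = x then gen v + gen u else gen v)) \<and>
    (\<forall>w \<in> VL. E (gen w) = (if \<phi> w = x then gen w + gen (lft u w) else gen w))"
proof -
  \<comment> \<open>The Boolean selects the sign, so that \<open>s True\<close> and
    \<open>s False\<close> are inverse to each other, and likewise for \<open>t\<close>.\<close>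
  define s where "s a v = (if v = x then gen x + lett (u, a) else gen v)" for a v
  define t where "t a w = (if \<phi> w = x then gen w + lett (lft u w, a) else gen w)" for a w
  have xu: "x \<in> VG" "u \<in> VG" "le x u"
    using le'_in le'_imp_le le(1) by blast+
  have lft': "lft u w \<in> VL" "\<phi> (lft u w) = u" "le w (lft u w)" if "w \<in> VL" "\<phi> w = x" for w
    using lft le(1) that by blast+
  have "cm (gen w) (gen x + lett (u, a))" if "adj x w" for w a
  proof -
    have "w = u \<or> adj u w"
      using xu(3) that by (auto simp: le_def in_star)
    then have "cm (gen w) (lett (u, a))"
      by (intro cm_gen_lett) simp
    moreover have "cm (gen w) (gen x)"
      using that by (intro cm_lett) (simp add: adj_commute)
    ultimately show ?thesis
      by (intro cm_add)
  qed
  then have cs: "compatV VG (s a)" for a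
    by (auto simp: compatV_def closedG s_def adj_commute intro: cm_sym intro!: cm_lett)
  have "cm (gen w) (gen y + lett (lft u y, a))" if y: "adj y w" "y \<in> VL" "\<phi> y = x" for w y a
  proof -
    have "w = lft u y \<or> adj (lft u y) w"
      using lft'(3)[OF y(2,3)] y(1) by (auto simp: le_def in_star)
    then have "cm (gen w) (lett (lft u y, a))"
      by (intro cm_gen_lett) simp
    moreover have "cm (gen w) (gen y)"
      using y(1) by (intro cm_lett) (simp add: adj_commute)
    ultimately show ?thesis
      by (intro cm_add)
  qed
  then have ct: "compatV VL (t a)" for a
    using not_adj_fibre by (auto simp: compatV_def closedL t_def adj_commute intro: cm_sym intro!: cm_lett)
  have gs: "ghom (extV VG (s a))" and gt: "ghom (extV VL (t a))" for a
    by (intro ghom_extV cs ct)+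
  have es: "extV VG (s a) (gen v) = s a v" if "v \<in> VG" for a v
    using extV_gen[OF cs that] .
  have et: "extV VL (t a) (gen v) = t a v" if "v \<in> VL" for a v
    using extV_gen[OF ct that] .
  have inv: "extV VG (s (\<not> a)) (s a v) = gen v" if "v \<in> VG" for a v
    using that es[of u "\<not> a"] es[of x "\<not> a"] es[of v "\<not> a"] xu le(2)
    by (cases a) (auto simp: s_def ghom_simps[OF gs] add.assoc)
  have inv': "extV VL (t (\<not> a)) (t a v) = gen v" if "v \<in> VL" for a v
    using that et[of "lft u v" "\<not> a"] et[of v "\<not> a"] lft'[of v] le(2)
    by (cases a) (auto simp: t_def ghom_simps[OF gt] add.assoc)
  have "aut_pair VG (extV VG (s True)) (extV VG (s False))"
    using inv[of _ True] inv[of _ False] xu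
    by (intro aut_pairI gs, auto simp: es) (auto simp: s_def intro: gp_add gp_diff)
  moreover have "aut_pair VL (extV VL (t True)) (extV VL (t False))"
    using inv'[of _ True] inv'[of _ False] lft'
    by (intro aut_pairI gt, auto simp: et) (auto simp: t_def intro: gp_add gp_diff)
  ultimately have "laut (extV VG (s True)) (extV VL (t True))"
    by (intro lautI) (auto simp: aut_def es et s_def t_def lft')
  moreover have "s True = (\<lambda>v. if v = x then gen x + gen u else gen v)"
    by (auto simp: s_def)
  then have "elem (extV VG (s True))"
    using elem.transvection[of u x] xu le(2) by simp
  ultimately have "mv (extV VG (s True)) (extV VL (t True))"
    by (intro mv_elem)
  then show ?thesis
    by (intro exI[of _ "extV VG (s True)"] exI[of _ "extV VL (t True)"])
      (auto simp: es et s_def t_def)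
qed

lemma mv_transvection:
  assumes le: "le' x (fst a)" "x \<noteq> fst a"
  shows "\<exists>e E. mv e E \<and>
    (\<forall>v \<in> VG. e (gen v) = (if v = x then if side then gen v + lett a else lett a + gen v else gen v)) \<and>
    (\<forall>w \<in> VL. E (gen w) = (if \<phi> w = x
      then if side then gen w + lett (lft (fst a) w, snd a) else lett (lft (fst a) w, snd a) + gen w
      else gen w))"
proof -
  have xu: "x \<in> VG" "fst a \<in> VG"
    using le'_in le(1) by blast+
  let ?b = "snd a = side"
  obtain e E where e: "mv e E" "\<forall>v \<in> VG. e (gen v) = (if v = x then gen v + gen (fst a) else gen v)"
    "\<forall>w \<in> VL. E (gen w) = (if \<phi> w = x then gen w + gen (lft (fst a) w) else gen w)"
    using mv_transvection_right[OF le] by blast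
  \<comment> \<open>Conjugating by the inversion of \<open>x\<close> turns right into left
    multiplication and flips the sign of the letter; inverting \<open>fst a\<close> flips the sign
    once more. Hence the test \<open>snd a = side\<close>.\<close>
  define S where "S = (if ?b then {} else {fst a}) \<union> (if side then {} else {x})"
  obtain i I where i: "mv i I" "\<forall>v \<in> VG. i (gen v) = lett (v, v \<notin> S)"
    "\<forall>u \<in> VL. I (gen u) = lett (u, \<phi> u \<notin> S)"
  proof -
    have "S \<subseteq> VG"
      using xu by (auto simp: S_def)
    from mv_inversion[OF this] that show thesis
      by blast
  qed
  have gh: "ghom e" "ghom E" "ghom i" "ghom I"
    using e(1) i(1) mv_laut laut_ghom by blast+
  note simps = ghom_simps[OF gh(1)] ghom_simps[OF gh(2)] ghom_simps[OF gh(3)] ghom_simps[OF gh(4)]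
  have il: "i (lett b) = (if fst b \<in> S then - lett b else lett b)" if "fst b \<in> VG" for b
    using ghom_lett[OF gh(3), of b] i(2) that by (cases b; cases "snd b") (auto simp: slet_def)
  have Il: "I (lett b) = (if \<phi> (fst b) \<in> S then - lett b else lett b)" if "fst b \<in> VL" for b
    using ghom_lett[OF gh(4), of b] i(3) that by (cases b; cases "snd b") (auto simp: slet_def)
  have el: "e (gen v) = gen v" if "v \<in> VG" "v \<noteq> x" for v
    using e(2) that by simp
  have El: "E (gen w) = gen w" if "w \<in> VL" "\<phi> w \<noteq> x" for w
    using e(3) that by simp
  have ex: "e (gen x) = gen x + gen (fst a)"
    using e(2) xu by simp
  have Ex: "E (gen w) = gen w + gen (lft (fst a) w)" if "w \<in> VL" "\<phi> w = x" for w
    using e(3) that by simp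
  have a: "lett a = (if snd a then gen (fst a) else - gen (fst a))"
    by (cases a) auto
  have a': "lett (y, snd a) = (if snd a then gen y else - gen y)" for y :: 'v
    by auto
  have G: "i (e (i (gen v))) =
      (if v = x then if side then gen v + lett a else lett a + gen v else gen v)" if "v \<in> VG" for v
    using that xu le(2) by (cases "v = x"; cases side; cases "snd a"; cases "v = fst a")
      (simp_all add: il el ex a simps S_def minus_add)
  have L: "I (E (I (gen w))) = (if \<phi> w = x
      then if side then gen w + lett (lft (fst a) w, snd a) else lett (lft (fst a) w, snd a) + gen w
      else gen w)" if "w \<in> VL" for w
    using that xu le lft[of w "fst a"]
    by (cases "\<phi> w = x"; cases side; cases "snd a"; cases "\<phi> w = fst a")
      (simp_all add: Il El Ex a' simps S_def minus_add)
  have "mv (\<lambda>g. i (e (i g))) (\<lambda>g. I (E (I g)))"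
    using mv_comp[OF i(1) mv_comp[OF e(1) i(1)]] .
  with G L show ?thesis
    by (intro exI[of _ "\<lambda>g. i (e (i g))"] exI[of _ "\<lambda>g. I (E (I g))"]) blast
qed

end

section \<open>Reduction on homology\<close>

context cover
begin

lemma finite_starL: "u \<in> VL \<Longrightarrow> finite (star u)"
  using finL adjL by (auto simp: star_def intro: finite_subset[of "nb u" VL])

lemma laut_gen: "laut f F \<Longrightarrow> u \<in> VL \<Longrightarrow> f (gen (\<phi> u)) = \<Phi> (F (gen u))"
  using \<Phi>_lett[of "(u, True)"] by (auto simp: laut_def dest: bspec[of _ _ "gen u"])

lemma expo_fibre_sum:
  assumes "laut f F" "u \<in> VL"
  shows "expo x (f (gen (\<phi> u))) = (\<Sum>y \<in> {y \<in> VL. \<phi> y = x}. expo y (F (gen u)))"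
proof -
  have "F (gen u) \<in> gp VL"
    using assms by (auto simp: laut_def aut_gp)
  then show ?thesis
    using expo_\<Phi>[of "F (gen u)" x] laut_gen[OF assms] by simp
qed

definition tri :: "('v raag \<Rightarrow> 'v raag) \<Rightarrow> bool" where
  "tri F \<longleftrightarrow> (\<forall>u \<in> VL. \<forall>z \<in> VL. expo z (F (gen u)) \<noteq> 0 \<longrightarrow> le u z)"

text \<open>By \<open>le_fibre\<close> the fibre sum has a single possibly non-zero term, so at
  dominating pairs the matrices upstairs and downstairs agree.\<close>

lemma tri_expo:
  assumes "laut f F" "tri F" "u \<in> VL" "z \<in> VL" "le u z"
  shows "expo (\<phi> z) (f (gen (\<phi> u))) = expo z (F (gen u))"
proof -
  have "(\<Sum>y \<in> {y \<in> VL. \<phi> y = \<phi> z}. expo y (F (gen u))) =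
      (\<Sum>y \<in> {y \<in> VL. \<phi> y = \<phi> z}. if y = z then expo z (F (gen u)) else 0)"
    using assms(2-5) le_fibre[OF assms(3)] by (intro sum.cong refl) (auto simp: tri_def)
  also have "\<dots> = expo z (F (gen u))"
    using assms(4) finL by simp
  finally show ?thesis
    using expo_fibre_sum[OF assms(1,3)] by simp
qed

lemma tri_le':
  assumes "laut f F" "tri F" "v \<in> VG" "expo x (f (gen v)) \<noteq> 0"
  shows "le' v x"
proof -
  obtain u where u: "u \<in> VL" "\<phi> u = v"
    using lift_exists assms(3) by blast
  have "(\<Sum>y \<in> {y \<in> VL. \<phi> y = x}. expo y (F (gen u))) \<noteq> 0"
    using expo_fibre_sum[OF assms(1) u(1), of x] assms(4) u by simp
  then have "\<exists>y \<in> {y \<in> VL. \<phi> y = x}. expo y (F (gen u)) \<noteq> 0"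
    by (rule contrapos_np) (auto intro: sum.neutral)
  then show ?thesis
    using assms(2) u by (auto simp: tri_def le'_def)
qed

text \<open>A permutation picked out by a non-zero term of the determinant of the action on homology
  is a graph automorphism; picking it downstairs determines a compatible one upstairs.\<close>

lemma symmetry_step:
  assumes "laut f F"
  shows "\<exists>e E \<sigma>. mv e E \<and> bij_betw \<sigma> VG VG \<and> (\<forall>v \<in> VG. expo (\<sigma> v) (f (gen v)) \<noteq> 0) \<and>
    (\<forall>v \<in> VG. e (gen (\<sigma> v)) = gen v) \<and> tri (\<lambda>g. F (E g))"
proof -
  obtain h H where h: "aut_pair VG f h" and H: "aut_pair VL F H"
    using assms by (auto simp: laut_def aut_def)
  interpret G: graph_matrix VG "\<lambda>x u. of_int (expo x (f (gen u)))" "\<lambda>x u. of_int (expo x (h (gen u)))"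
    by (rule aut_pair_graph_matrix[OF h finG closedG])
  interpret L: graph_matrix VL "\<lambda>x u. of_int (expo x (F (gen u)))" "\<lambda>x u. of_int (expo x (H (gen u)))"
    by (rule aut_pair_graph_matrix[OF H finL closedL])
  obtain \<sigma> where \<sigma>: "bij_betw \<sigma> VG VG" "\<forall>v \<in> VG. of_int (expo (\<sigma> v) (f (gen v))) \<noteq> (0 :: rat)"
    using G.matching_exists by blast
  interpret G: matched_graph_matrix VG "\<lambda>x u. of_int (expo x (f (gen u)))"
    "\<lambda>x u. of_int (expo x (h (gen u)))" \<sigma>
    by unfold_locales (use \<sigma> in blast)+
  obtain \<tau> where \<tau>: "bij_betw \<tau> VL VL" "\<forall>v \<in> VL. of_int (expo (\<tau> v) (F (gen v))) \<noteq> (0 :: rat)"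
    using L.matching_exists by blast
  interpret T: matched_graph_matrix VL "\<lambda>x u. of_int (expo x (F (gen u)))"
    "\<lambda>x u. of_int (expo x (H (gen u)))" \<tau>
    by unfold_locales (use \<tau> in blast)+
  \<comment> \<open>The non-zero entry downstairs is a sum over a fibre, so some entry upstairs over
    it is non-zero; this defines a map \<tau>' over \<sigma>.\<close>
  have "\<exists>z \<in> VL. \<phi> z = \<sigma> (\<phi> u) \<and> expo z (F (gen u)) \<noteq> 0" if "u \<in> VL" for u
  proof (rule ccontr)
    assume "\<not> ?thesis"
    then have "(\<Sum>y \<in> {y \<in> VL. \<phi> y = \<sigma> (\<phi> u)}. expo y (F (gen u))) = 0"
      by (intro sum.neutral) auto
    then show False
      using expo_fibre_sum[OF assms that, of "\<sigma> (\<phi> u)"] \<sigma>(2) that by simp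
  qed
  then obtain \<tau>' where \<tau>': "\<And>u. u \<in> VL \<Longrightarrow> \<tau>' u \<in> VL \<and> \<phi> (\<tau>' u) = \<sigma> (\<phi> u) \<and> expo (\<tau>' u) (F (gen u)) \<noteq> 0"
    by metis
  have card': "card (star (\<tau>' u)) = card (star u)" if "u \<in> VL" for u
  proof -
    have "card (star (\<tau>' u)) = card (star (\<sigma> (\<phi> u)))"
      using card_star[of "\<tau>' u"] \<tau>'[OF that] by simp
    also have "\<dots> = card (star u)"
      using G.deg_eq[of "\<phi> u"] card_star that by simp
    finally show ?thesis .
  qed
  \<comment> \<open>Injectivity comes from comparison with the arbitrary matching \<tau>. If \<tau>'
    identified \<open>u\<close> and \<open>u'\<close>, both \<open>\<tau> u\<close> and
    \<open>\<tau> u'\<close> would be dominated by the common value; equal degrees reverse the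
    second relation, so \<open>\<tau> u'\<close> dominates \<open>\<tau> u\<close>. Pulled back
    along \<tau> this gives \<open>le u u'\<close> within one fibre.\<close>
  have "inj_on \<tau>' VL"
  proof
    fix u u'
    assume u: "u \<in> VL" "u' \<in> VL" and eq: "\<tau>' u = \<tau>' u'"
    have "\<sigma> (\<phi> u) = \<sigma> (\<phi> u')"
      using \<tau>'[OF u(1)] \<tau>'[OF u(2)] eq by metis
    then have phi: "\<phi> u = \<phi> u'"
      using \<sigma>(1) u phi_in by (meson bij_betw_imp_inj_on inj_onD)
    have 1: "le (\<tau> u) (\<tau>' u)"
      using T.le_tau[OF _ u(1), of "\<tau>' u"] \<tau>'[OF u(1)] by simp
    have 2: "le (\<tau> u') (\<tau>' u)"
      using T.le_tau[OF _ u(2), of "\<tau>' u'"] \<tau>'[OF u(2)] by (simp add: eq)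
    have "card (star (\<tau> u')) = card (star (\<tau>' u))"
      using T.deg_eq[OF u(2)] card'[OF u(2)] eq by simp
    then have "le (\<tau>' u) (\<tau> u')"
      using le_sym_card[OF 2] finite_starL \<tau>'[OF u(1)] by blast
    then have le: "le (\<tau> u) (\<tau> u')"
      using 1 le_trans by blast
    have "le u u'"
      unfolding le_def
    proof
      fix c
      assume c: "c \<in> nb u"
      then have cV: "c \<in> VL"
        using adjL u(1) by simp
      then have "\<tau> c \<in> star (\<tau> u')"
        using le c T.graph_aut_tau u(1) unfolding le_def by auto
      then have "\<tau> c = \<tau> u' \<or> adj u' c"
        using T.graph_aut_tau u(2) cV by (auto simp: in_star)
      moreover have "\<tau> c = \<tau> u' \<Longrightarrow> c = u'"
        using \<tau>(1) cV u(2) by (meson bij_betw_imp_inj_on inj_onD)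
      ultimately show "c \<in> star u'"
        by (auto simp: in_star)
    qed
    then show "u = u'"
      using le_fibre[OF u(1) le_refl] phi by blast
  qed
  moreover have "\<tau>' ` VL \<subseteq> VL"
    using \<tau>' by blast
  ultimately have bij': "bij_betw \<tau>' VL VL"
    unfolding bij_betw_def using finL endo_inj_surj by blast
  interpret T': matched_graph_matrix VL "\<lambda>x u. of_int (expo x (F (gen u)))"
    "\<lambda>x u. of_int (expo x (H (gen u)))" \<tau>'
    by unfold_locales (use bij' \<tau>' in auto)
  obtain e E where e: "mv e E" "\<forall>v \<in> VG. e (gen (\<sigma> v)) = gen v" "\<forall>u \<in> VL. E (gen (\<tau>' u)) = gen u"
    using mv_symmetry[OF \<sigma>(1) G.graph_aut_tau bij' T'.graph_aut_tau] \<tau>' by blast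
  have "tri (\<lambda>g. F (E g))"
    unfolding tri_def
  proof (intro ballI impI)
    fix u z
    assume u: "u \<in> VL" "z \<in> VL" "expo z (F (E (gen u))) \<noteq> 0"
    obtain u0 where u0: "u0 \<in> VL" "u = \<tau>' u0"
      using bij' u(1) by (metis bij_betw_def imageE)
    then show "le u z"
      using T'.le_tau[OF u(2) u0(1)] u(3) e(3) by simp
  qed
  then show ?thesis
    using e \<sigma> by (intro exI[of _ e] exI[of _ E] exI[of _ \<sigma>]) simp
qed

text \<open>The columns of the vertices above \<open>v\<close> have their entries in the rows of
  such vertices, so this block is injective and the unit vector at \<open>v\<close> is a combination
  of its columns. That combination is column \<open>v\<close> of the inverse.\<close>

lemma inverse_le':
  assumes lf: "laut f F" and tri: "tri F" and h: "aut_pair VG f h"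
    and v: "v \<in> VG" and x: "x \<in> VG" "expo x (h (gen v)) \<noteq> 0"
  shows "le' v x"
proof (rule ccontr)
  assume n: "\<not> le' v x"
  interpret G: graph_matrix VG "\<lambda>x u. of_int (expo x (f (gen u)))" "\<lambda>x u. of_int (expo x (h (gen u)))"
    by (rule aut_pair_graph_matrix[OF h finG closedG])
  let ?M = "\<lambda>x u. of_int (expo x (f (gen u))) :: rat"
  let ?W = "{y. le' v y}"
  have W: "?W \<subseteq> VG" "finite ?W"
    using le'_in finG finite_subset[of ?W VG] by auto
  have zero: "?M r c = 0" if "c \<in> ?W" "r \<notin> ?W" for r c
    using tri_le'[OF lf tri, of c r] le'_trans[of v c r] that le'_in by auto
  have tk: "trivial_kernel ?W ?W ?M"
    unfolding trivial_kernel_def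
  proof (intro allI impI ballI)
    fix k c
    assume k: "\<forall>r \<in> ?W. (\<Sum>c \<in> ?W. ?M r c * k c) = 0" and c: "c \<in> ?W"
    have "(\<Sum>c \<in> ?W. ?M r c * k c) = 0" for r
    proof (cases "r \<in> ?W")
      case False
      then show ?thesis
        using zero by (intro sum.neutral) simp
    qed (use k in blast)
    then show "k c = 0"
      using G.kernel_zero[OF W(1) _ c] by blast
  qed
  obtain k where k: "\<forall>r \<in> ?W. (\<Sum>c \<in> ?W. ?M r c * k c) = (if r = v then 1 else 0)"
    using trivial_kernel_solve[OF tk W(2,2) refl, of "\<lambda>r. if r = v then 1 else 0"] by blast
  have k': "(\<Sum>c \<in> ?W. ?M r c * k c) = (if r = v then 1 else 0)" for r
  proof (cases "r \<in> ?W")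
    case False
    then have "r \<noteq> v"
      using le'_refl[OF v] by auto
    then show ?thesis
      using False zero by (simp add: sum.neutral)
  qed (use k in blast)
  let ?M' = "\<lambda>x u. of_int (expo x (h (gen u))) :: rat"
  have "?M' x v = (\<Sum>r \<in> VG. ?M' x r * (\<Sum>c \<in> ?W. ?M r c * k c))"
    using v finG by (simp add: k' if_distrib sum.delta cong: if_cong)
  also have "\<dots> = (\<Sum>c \<in> ?W. (\<Sum>r \<in> VG. ?M' x r * ?M r c) * k c)"
    by (subst sum_distrib_left, subst sum.swap) (simp add: sum_distrib_right mult.assoc)
  also have "\<dots> = 0"
    using n x(1) W(1) G.inverse2 by (intro sum.neutral) (auto simp: subset_eq)
  finally show False
    using x(2) by simp
qed

definition unitL :: "('v raag \<Rightarrow> 'v raag) \<Rightarrow> bool" where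
  "unitL F \<longleftrightarrow> (\<forall>u \<in> VL. \<forall>z \<in> VL. expo z (F (gen u)) = (if z = u then 1 else 0))"

lemma unitL_if_tri:
  assumes "laut f F" "tri F" "\<And>v x. v \<in> VG \<Longrightarrow> x \<in> VG \<Longrightarrow> expo x (f (gen v)) = (if x = v then 1 else 0)"
  shows "unitL F"
  unfolding unitL_def
proof (intro ballI)
  fix u z
  assume u: "u \<in> VL" "z \<in> VL"
  show "expo z (F (gen u)) = (if z = u then 1 else 0)"
  proof (cases "le u z")
    case True
    then have "expo z (F (gen u)) = (if \<phi> z = \<phi> u then 1 else 0)"
      using tri_expo[OF assms(1,2) u] assms(3) u by simp
    moreover have "\<phi> z = \<phi> u \<Longrightarrow> z = u"
      using le_fibre[OF u(1) True le_refl] by blast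
    ultimately show ?thesis
      by auto
  next
    case False
    then show ?thesis
      using assms(2) u le_refl by (auto simp: tri_def)
  qed
qed

lemma tri_transvection:
  assumes "laut f F" "tri F" "le' x u" "x \<noteq> u" "fst a = u"
  shows "\<exists>f' F'. laut f' F' \<and> tri F' \<and> (\<not> GEN f \<longrightarrow> \<not> GEN f') \<and>
    (\<forall>v \<in> VG. f' (gen v) = (if v = x then f (gen v) + f (lett a) else f (gen v)))"
proof -
  obtain e E where e: "mv e E"
    "\<forall>v \<in> VG. e (gen v) = (if v = x then gen v + lett a else gen v)"
    "\<forall>w \<in> VL. E (gen w) = (if \<phi> w = x then gen w + lett (lft u w, snd a) else gen w)"
    using mv_transvection[of x a True] assms(3,4,5) by auto
  have gh: "ghom f" "ghom F"
    using laut_ghom[OF assms(1)] by auto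
  have "tri (\<lambda>g. F (E g))"
    unfolding tri_def
  proof (intro ballI impI)
    fix w z
    assume w: "w \<in> VL" "z \<in> VL" "expo z (F (E (gen w))) \<noteq> 0"
    show "le w z"
    proof (cases "\<phi> w = x")
      case True
      note l = lft[of w u, OF _ w(1)]
      have "expo z (F (lett (lft u w, snd a))) \<noteq> 0 \<or> expo z (F (gen w)) \<noteq> 0"
        using w e(3) True by (auto simp: ghom_add[OF gh(2)])
      then have "expo z (F (gen (lft u w))) \<noteq> 0 \<or> expo z (F (gen w)) \<noteq> 0"
        by (cases "snd a") (auto simp: ghom_uminus[OF gh(2)])
      then have "le (lft u w) z \<or> le w z"
        using assms(2,3) True l w by (auto simp: tri_def)
      then show ?thesis
        using l assms(3) True le_trans by blast
    qed (use w e(3) assms(2) in \<open>auto simp: tri_def\<close>)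
  qed
  moreover have "\<not> GEN f \<longrightarrow> \<not> GEN (\<lambda>g. f (e g))"
    using e(1) gh unfolding mv_def by blast
  moreover have "laut (\<lambda>g. f (e g)) (\<lambda>g. F (E g))"
    using laut_comp assms(1) mv_laut[OF e(1)] by blast
  ultimately show ?thesis
    using e(2) by (intro exI[of _ "\<lambda>g. f (e g)"] exI[of _ "\<lambda>g. F (E g)"]) (simp add: ghom_add[OF gh(1)])
qed

definition row_sum :: "('w raag \<Rightarrow> 'w raag) \<Rightarrow> 'w \<Rightarrow> nat" where
  "row_sum f x = (\<Sum>v \<in> VG. nat \<bar>expo x (f (gen v))\<bar>)"

lemma row_sum_transvection:
  assumes "v \<in> VG" "v' \<in> VG" "v \<noteq> v'" "\<bar>expo r (f (gen v'))\<bar> \<le> \<bar>expo r (f (gen v))\<bar>"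
    "expo r (f (gen v')) \<noteq> 0" "ghom f"
  obtains a where "fst a = v'"
    "\<And>f'. (\<forall>w \<in> VG. f' (gen w) = (if w = v then f (gen w) + f (lett a) else f (gen w))) \<Longrightarrow>
      row_sum f' r < row_sum f r"
    "\<And>f' b. (\<forall>w \<in> VG. f' (gen w) = (if w = v then f (gen w) + f (lett a) else f (gen w))) \<Longrightarrow>
      expo b (f (gen v')) = 0 \<Longrightarrow> row_sum f' b = row_sum f b"
proof -
  \<comment> \<open>Column \<open>v'\<close> is added if the two entries in row \<open>r\<close>
    have opposite signs and subtracted otherwise, so the larger entry shrinks.\<close>
  define a where "a = (v', (expo r (f (gen v')) > 0) \<noteq> (expo r (f (gen v)) > 0))"
  have ea: "expo b (f (lett a)) = (if snd a then expo b (f (gen v')) else - expo b (f (gen v')))" for b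
    by (simp add: a_def ghom_uminus[OF assms(6)])
  have split: "row_sum f b = nat \<bar>expo b (f (gen v))\<bar> + (\<Sum>w \<in> VG - {v}. nat \<bar>expo b (f (gen w))\<bar>)" for f :: "'w raag \<Rightarrow> 'w raag" and b
    unfolding row_sum_def using assms(1) finG by (simp add: sum.remove)
  show thesis
  proof (rule that[of a])
    fix f' :: "'w raag \<Rightarrow> 'w raag"
    assume f': "\<forall>w \<in> VG. f' (gen w) = (if w = v then f (gen w) + f (lett a) else f (gen w))"
    have rest: "(\<Sum>w \<in> VG - {v}. nat \<bar>expo b (f' (gen w))\<bar>) = (\<Sum>w \<in> VG - {v}. nat \<bar>expo b (f (gen w))\<bar>)" for b
      using f' by (intro sum.cong) auto
    have v: "expo b (f' (gen v)) = expo b (f (gen v)) + expo b (f (lett a))" for b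
      using f' assms(1) by simp
    have "\<bar>expo r (f (gen v)) + expo r (f (lett a))\<bar> < \<bar>expo r (f (gen v))\<bar>"
      unfolding ea using assms(4,5) by (auto simp: a_def)
    then have "nat \<bar>expo r (f' (gen v))\<bar> < nat \<bar>expo r (f (gen v))\<bar>"
      by (simp add: v)
    then show "row_sum f' r < row_sum f r"
      unfolding split rest by simp
    show "row_sum f' b = row_sum f b" if "expo b (f (gen v')) = 0" for b
      unfolding split rest v ea using that by simp
  qed (simp add: a_def)
qed

text \<open>Euclid's algorithm in the form of a minimal counterexample: the row sums, in a fixed
  order of the rows, are compared lexicographically. At a minimum no admissible column operation
  lowers a row sum while keeping the earlier ones, and invertibility then forces one entry of
  absolute value 1 per row.\<close>

lemma elimination:
  assumes "laut f F" "tri F" "\<not> GEN f"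
  shows "\<exists>f F. laut f F \<and> tri F \<and> \<not> GEN f \<and>
    (\<forall>r \<in> VG. \<exists>c \<in> VG. \<bar>expo r (f (gen c))\<bar> = 1 \<and> (\<forall>v \<in> VG. v \<noteq> c \<longrightarrow> expo r (f (gen v)) = 0))"
proof -
  obtain rs where rs: "set rs = VG" "distinct rs"
    using finite_distinct_list[OF finG] by blast
  define ms where "ms f = map (row_sum f) rs" for f
  define B where "B = {f. \<exists>F. laut f F \<and> tri F \<and> \<not> GEN f}"
  have "wf (inv_image (lex less_than) ms)"
    by (intro wf_inv_image wf_lex wf_less_than)
  moreover have "f \<in> B"
    using assms by (auto simp: B_def)
  ultimately obtain f where f: "f \<in> B" and
    min: "\<And>f'. (f', f) \<in> inv_image (lex less_than) ms \<Longrightarrow> f' \<notin> B"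
    by (metis wfE_min)
  then obtain F where F: "laut f F" "tri F" "\<not> GEN f"
    by (auto simp: B_def)
  obtain h where h: "aut_pair VG f h"
    using F(1) by (auto simp: laut_def aut_def)
  have gh: "ghom f" "ghom h"
    using aut_pairD[OF h] by auto
  define M where "M x v = expo x (f (gen v))" for x v
  define M' where "M' x v = expo x (h (gen v))" for x v
  have Mle: "le' v x" if "v \<in> VG" "M x v \<noteq> 0" for x v
    using tri_le'[OF F(1,2)] that by (simp add: M_def)
  have M'le: "le' v x" if "v \<in> VG" "x \<in> VG" "M' x v \<noteq> 0" for x v
    using inverse_le'[OF F(1,2) h] that by (simp add: M'_def)
  have MM': "(\<Sum>y \<in> VG. M x y * M' y v) = (if x = v then 1 else 0)" if "v \<in> VG" for x v
  proof -
    have "(\<Sum>y \<in> VG. M x y * M' y v) = expo x (f (h (gen v)))"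
      using expo_ghom[OF gh(1) finG, of "h (gen v)" x] aut_pairD[OF h] that by (simp add: M_def M'_def)
    then show ?thesis
      using aut_pairD(6)[OF h, of "gen v"] that by (simp add: expo_lett)
  qed
  have reduce: False if i: "i < length rs" and v: "v \<in> VG" "v' \<in> VG" "v \<noteq> v'" "le' v v'"
    and abs: "\<bar>M (rs ! i) v'\<bar> \<le> \<bar>M (rs ! i) v\<bar>" "M (rs ! i) v' \<noteq> 0"
    and z: "\<And>j. j < i \<Longrightarrow> M (rs ! j) v' = 0" for i v v'
  proof -
    obtain a where a: "fst a = v'"
      "\<And>f'. (\<forall>w \<in> VG. f' (gen w) = (if w = v then f (gen w) + f (lett a) else f (gen w))) \<Longrightarrow>
        row_sum f' (rs ! i) < row_sum f (rs ! i)"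
      "\<And>f' b. (\<forall>w \<in> VG. f' (gen w) = (if w = v then f (gen w) + f (lett a) else f (gen w))) \<Longrightarrow>
        expo b (f (gen v')) = 0 \<Longrightarrow> row_sum f' b = row_sum f b"
    proof (rule row_sum_transvection[OF v(1-3) abs[unfolded M_def] gh(1)])
      fix a
      assume *: "fst a = v'"
        "\<And>f'. (\<forall>w \<in> VG. f' (gen w) = (if w = v then f (gen w) + f (lett a) else f (gen w))) \<Longrightarrow>
          row_sum f' (rs ! i) < row_sum f (rs ! i)"
        "\<And>f' b. (\<forall>w \<in> VG. f' (gen w) = (if w = v then f (gen w) + f (lett a) else f (gen w))) \<Longrightarrow>
          expo b (f (gen v')) = 0 \<Longrightarrow> row_sum f' b = row_sum f b"
      show thesis
        by (rule that[OF *])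
    qed
    obtain f' F' where f': "laut f' F'" "tri F'" "\<not> GEN f \<longrightarrow> \<not> GEN f'"
      "\<forall>w \<in> VG. f' (gen w) = (if w = v then f (gen w) + f (lett a) else f (gen w))"
      using tri_transvection[OF F(1,2) v(4,3) a(1)] by metis
    have lt: "row_sum f' (rs ! i) < row_sum f (rs ! i)"
      by (rule a(2)[OF f'(4)])
    have "row_sum f' (rs ! j) = row_sum f (rs ! j)" if "j < i" for j
      using a(3)[OF f'(4)] z[OF that] by (simp add: M_def)
    then have eq: "map (row_sum f') (take i rs) = map (row_sum f) (take i rs)"
      using i by (auto simp: list_eq_iff_nth_eq)
    have ms: "ms g = map (row_sum g) (take i rs) @ row_sum g (rs ! i) # map (row_sum g) (drop (Suc i) rs)" for g
      unfolding ms_def by (subst (1) id_take_nth_drop[OF i]) simp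
    have "(ms f', ms f) \<in> lex less_than"
      unfolding ms eq by (rule lex_append_leftI) (simp add: lt)
    moreover have "f' \<in> B"
      using f' F(3) by (auto simp: B_def)
    ultimately show False
      using min by simp
  qed
  have "\<exists>c \<in> VG. \<bar>M (rs ! i) c\<bar> = 1 \<and> (\<forall>v \<in> VG. v \<noteq> c \<longrightarrow> M (rs ! i) v = 0)" if "i < length rs" for i
    using that
  proof (induction i rule: less_induct)
    case (less i)
    define r where "r = rs ! i"
    have r: "r \<in> VG"
      using less.prems rs by (auto simp: r_def)
    \<comment> \<open>Adding a column that vanishes in the earlier rows keeps their sums, and
      between vertices equivalent to \<open>r\<close> transvections exist in both
      directions.\<close>
    define J where "J = {v \<in> VG. (\<forall>j < i. M (rs ! j) v = 0) \<and> le' v r \<and> le' r v}"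
    \<comment> \<open>A column with an entry in an earlier row carries the only entry of that row,
      so the product of this row with column \<open>r\<close> of the inverse, which is zero, has a
      single term.\<close>
    have "M r v * M' v r = 0" if v: "v \<in> VG" "v \<notin> J" for v
    proof (rule ccontr)
      assume n: "M r v * M' v r \<noteq> 0"
      then have "le' v r" "le' r v"
        using Mle M'le v(1) r by auto
      then obtain j where j: "j < i" "M (rs ! j) v \<noteq> 0"
        using v unfolding J_def by blast
      have "j < length rs"
        using j(1) less.prems by simp
      from less.IH[OF j(1) this] obtain c where c: "c \<in> VG" "\<bar>M (rs ! j) c\<bar> = 1"
        "\<forall>v \<in> VG. v \<noteq> c \<longrightarrow> M (rs ! j) v = 0"
        by blast
      have "c = v"
        using bspec[OF c(3) v(1)] j(2) by metis
      have "rs ! j \<noteq> r"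
        using j(1) less.prems rs(2) by (simp add: r_def nth_eq_iff_index_eq)
      then have "(\<Sum>y \<in> VG. M (rs ! j) y * M' y r) = 0"
        using MM'[OF r] by simp
      also have "(\<Sum>y \<in> VG. M (rs ! j) y * M' y r) = (\<Sum>y \<in> VG. if y = v then M (rs ! j) v * M' v r else 0)"
        using c(3) \<open>c = v\<close> by (intro sum.cong) auto
      also have "\<dots> = M (rs ! j) v * M' v r"
        using v finG by simp
      finally show False
        using n j(2) by simp
    qed
    then have "(\<Sum>v \<in> VG. M r v * M' v r) = (\<Sum>v \<in> J. M r v * M' v r)"
      using finG by (intro sum.mono_neutral_right) (auto simp: J_def)
    then have sumJ: "(\<Sum>v \<in> J. M r v * M' v r) = 1"
      using MM'[OF r] by simp
    have "\<exists>v \<in> J. M r v \<noteq> 0"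
    proof (rule ccontr)
      assume "\<not> ?thesis"
      then have "(\<Sum>v \<in> J. M r v * M' v r) = 0"
        by (intro sum.neutral) simp
      then show False
        using sumJ by simp
    qed
    then obtain v0 where "v0 \<in> J" "M r v0 \<noteq> 0"
      by blast
    then obtain c where c: "c \<in> J" "M r c \<noteq> 0" and
      cmin: "\<And>v. v \<in> J \<Longrightarrow> M r v \<noteq> 0 \<Longrightarrow> nat \<bar>M r c\<bar> \<le> nat \<bar>M r v\<bar>"
      using ex_has_least_nat[of "\<lambda>v. v \<in> J \<and> M r v \<noteq> 0" v0 "\<lambda>v. nat \<bar>M r v\<bar>"] by blast
    have cJ: "c \<in> VG" "\<And>j. j < i \<Longrightarrow> M (rs ! j) c = 0" "le' r c"
      using c(1) by (auto simp: J_def)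
    have J0: "M r v = 0" if "v \<in> J" "v \<noteq> c" for v
    proof (rule ccontr)
      assume n: "M r v \<noteq> 0"
      have "le' v c" "v \<in> VG"
        using that cJ le'_trans by (auto simp: J_def)
      moreover have "\<bar>M r c\<bar> \<le> \<bar>M r v\<bar>"
        using cmin[OF that(1) n] by linarith
      ultimately show False
        using reduce[OF less.prems, of v c] that(2) cJ c(2) by (simp add: r_def)
    qed
    have "(\<Sum>v \<in> J. M r v * M' v r) = (\<Sum>v \<in> J. if v = c then M r c * M' c r else 0)"
      using J0 by (intro sum.cong) auto
    also have "\<dots> = M r c * M' c r"
      using c(1) finite_subset[of J VG] finG by (auto simp: J_def)
    finally have "\<bar>M r c * M' c r\<bar> = 1"
      using sumJ by simp
    then have c1: "\<bar>M r c\<bar> = 1"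
      by (rule abs_zmult_eq_1)
    have "M r v = 0" if "v \<in> VG" "v \<noteq> c" for v
    proof (rule ccontr)
      assume n: "M r v \<noteq> 0"
      then have "le' v c"
        using Mle[OF that(1)] cJ(3) le'_trans by blast
      moreover have "\<bar>M r c\<bar> \<le> \<bar>M r v\<bar>"
        using c1 n by linarith
      ultimately show False
        using reduce[OF less.prems that(1) cJ(1) that(2)] cJ(2) c(2) by (simp add: r_def)
    qed
    then show ?case
      using c1 cJ(1) by (auto simp: r_def)
  qed
  then have "\<forall>r \<in> VG. \<exists>c \<in> VG. \<bar>M r c\<bar> = 1 \<and> (\<forall>v \<in> VG. v \<noteq> c \<longrightarrow> M r v = 0)"
    using rs(1) by (metis in_set_conv_nth)
  then show ?thesis
    using F unfolding M_def by blast
qed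

text \<open>A monomial matrix is cleared by a symmetry and an inversion. The explicit form of
  \<open>f'\<close> is recorded because \<open>cone_step\<close> has to see that conjugated
  generators stay conjugated.\<close>

lemma unit_reduction:
  assumes "laut f F" "\<not> GEN f"
    and mono: "\<forall>r \<in> VG. \<exists>c \<in> VG. \<bar>expo r (f (gen c))\<bar> = 1 \<and> (\<forall>v \<in> VG. v \<noteq> c \<longrightarrow> expo r (f (gen v)) = 0)"
  shows "\<exists>f' F' \<sigma>. laut f' F' \<and> \<not> GEN f' \<and> unitL F' \<and> bij_betw \<sigma> VG VG \<and>
    (\<forall>v \<in> VG. expo (\<sigma> v) (f (gen v)) \<noteq> 0 \<and>
      f' (gen (\<sigma> v)) = (if expo (\<sigma> v) (f (gen v)) = 1 then f (gen v) else - f (gen v)))"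
proof -
  obtain e E \<sigma> where e: "mv e E" "bij_betw \<sigma> VG VG" "\<forall>v \<in> VG. expo (\<sigma> v) (f (gen v)) \<noteq> 0"
    "\<forall>v \<in> VG. e (gen (\<sigma> v)) = gen v" "tri (\<lambda>g. F (E g))"
    using symmetry_step[OF assms(1)] by blast
  have s: "\<sigma> v \<in> VG" if "v \<in> VG" for v
    using e(2) that by (auto simp: bij_betw_def)
  have diag: "\<bar>expo (\<sigma> v) (f (gen v))\<bar> = 1" "\<And>w. w \<in> VG \<Longrightarrow> w \<noteq> v \<Longrightarrow> expo (\<sigma> v) (f (gen w)) = 0"
    if v: "v \<in> VG" for v
  proof -
    obtain c where c: "c \<in> VG" "\<bar>expo (\<sigma> v) (f (gen c))\<bar> = 1" "\<forall>w \<in> VG. w \<noteq> c \<longrightarrow> expo (\<sigma> v) (f (gen w)) = 0"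
      using mono s[OF v] by blast
    have "c = v"
      using bspec[OF c(3) v] bspec[OF e(3) v] by metis
    with c show "\<bar>expo (\<sigma> v) (f (gen v))\<bar> = 1" "\<And>w. w \<in> VG \<Longrightarrow> w \<noteq> v \<Longrightarrow> expo (\<sigma> v) (f (gen w)) = 0"
      by simp_all
  qed
  define S where "S = {\<sigma> v |v. v \<in> VG \<and> expo (\<sigma> v) (f (gen v)) \<noteq> 1}"
  have inS: "\<sigma> v \<in> S \<longleftrightarrow> expo (\<sigma> v) (f (gen v)) \<noteq> 1" if "v \<in> VG" for v
    using that e(2) by (auto simp: S_def bij_betw_def inj_on_def)
  obtain i I where i: "mv i I" "\<forall>v \<in> VG. i (gen v) = lett (v, v \<notin> S)" "\<forall>u \<in> VL. I (gen u) = lett (u, \<phi> u \<notin> S)"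
    using mv_inversion[of S] s unfolding S_def by blast
  let ?f = "\<lambda>g. f (e (i g))"
  let ?F = "\<lambda>g. F (E (I g))"
  have mvei: "mv (\<lambda>g. e (i g)) (\<lambda>g. E (I g))"
    by (rule mv_comp[OF e(1) i(1)])
  have gh: "ghom f" "ghom e" "ghom i" "ghom F" "ghom E" "ghom I"
    using laut_ghom assms(1) e(1) i(1) mv_laut by blast+
  have l: "laut ?f ?F"
    using laut_comp[OF assms(1) mv_laut[OF mvei]] .
  have G: "\<not> GEN ?f"
    using mvei assms(2) gh(1) unfolding mv_def by blast
  have "expo z (F (E (I (gen u)))) \<noteq> 0 \<longleftrightarrow> expo z (F (E (gen u))) \<noteq> 0" if "u \<in> VL" for u z
    using i(3) that by (cases "\<phi> u \<in> S") (simp_all add: ghom_uminus[OF gh(4)] ghom_uminus[OF gh(5)])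
  then have tri: "tri ?F"
    using e(5) by (auto simp: tri_def)
  have val: "?f (gen (\<sigma> v)) = (if expo (\<sigma> v) (f (gen v)) = 1 then f (gen v) else - f (gen v))"
    if "v \<in> VG" for v
    using i(2) s[OF that] inS[OF that] e(4) that
    by (simp add: ghom_uminus[OF gh(1)] ghom_uminus[OF gh(2)])
  have "unitL ?F"
  proof (rule unitL_if_tri[OF l tri])
    fix v x
    assume "v \<in> VG" "x \<in> VG"
    then obtain w y where w: "w \<in> VG" "v = \<sigma> w" "y \<in> VG" "x = \<sigma> y"
      using e(2) by (metis bij_betw_def imageE)
    show "expo x (?f (gen v)) = (if x = v then 1 else 0)"
      using diag(1)[OF w(1)] diag(2)[OF w(3), of w] e(2) w val[OF w(1)]
      by (cases "w = y") (auto simp: bij_betw_def inj_on_def)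
  qed
  then show ?thesis
    using l G val e(2,3) by (intro exI[of _ ?f] exI[of _ ?F] exI[of _ \<sigma>]) simp
qed

lemma homology_reduction:
  assumes "laut f F" "\<not> GEN f"
  shows "\<exists>f' F'. laut f' F' \<and> \<not> GEN f' \<and> unitL F'"
proof -
  obtain e E where e: "mv e E" "tri (\<lambda>g. F (E g))"
    using symmetry_step[OF assms(1)] by blast
  have "laut (\<lambda>g. f (e g)) (\<lambda>g. F (E g))"
    using laut_comp assms(1) mv_laut[OF e(1)] by blast
  moreover have "\<not> GEN (\<lambda>g. f (e g))"
    using e(1) assms laut_ghom unfolding mv_def by blast
  ultimately obtain f' F' where "laut f' F'" "\<not> GEN f'"
    "\<forall>r \<in> VG. \<exists>c \<in> VG. \<bar>expo r (f' (gen c))\<bar> = 1 \<and> (\<forall>v \<in> VG. v \<noteq> c \<longrightarrow> expo r (f' (gen v)) = 0)"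
    using elimination[OF _ e(2)] by blast
  then show ?thesis
    using unit_reduction by blast
qed

end

section \<open>Lifting partial conjugations\<close>

definition joined :: "'v::graph set \<Rightarrow> 'v set \<Rightarrow> ('v \<times> 'v) set" where
  "joined V S = {(x, y). x \<in> V - S \<and> y \<in> V - S \<and> adj x y}\<^sup>*"

lemma joined_refl [simp]: "(x, x) \<in> joined V S"
  by (simp add: joined_def)

lemma joined_trans: "(x, y) \<in> joined V S \<Longrightarrow> (y, z) \<in> joined V S \<Longrightarrow> (x, z) \<in> joined V S"
  unfolding joined_def by (rule rtrancl_trans)

lemma joined_sym: "(x, y) \<in> joined V S \<Longrightarrow> (y, x) \<in> joined V S"
proof -
  have "sym {(x, y). x \<in> V - S \<and> y \<in> V - S \<and> adj x y}"
    by (auto simp: sym_def adj_commute)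
  then show "(x, y) \<in> joined V S \<Longrightarrow> (y, x) \<in> joined V S"
    unfolding joined_def by (rule symD[OF sym_rtrancl])
qed

lemma joined_edge: "x \<in> V - S \<Longrightarrow> y \<in> V - S \<Longrightarrow> adj x y \<Longrightarrow> (x, y) \<in> joined V S"
  unfolding joined_def by blast

lemma joined_in: "(x, y) \<in> joined V S \<Longrightarrow> x \<in> V - S \<Longrightarrow> y \<in> V - S"
  unfolding joined_def by (induction rule: rtrancl_induct) auto

lemma joined_induct [consumes 1, case_names refl step]:
  assumes "(x, y) \<in> joined V S" "P x"
    and "\<And>y z. (x, y) \<in> joined V S \<Longrightarrow> y \<in> V - S \<Longrightarrow> z \<in> V - S \<Longrightarrow> adj y z \<Longrightarrow> P y \<Longrightarrow> P z"
  shows "P y"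
  using assms(1) unfolding joined_def
proof (induction rule: rtrancl_induct)
  case (step y z)
  then show ?case
    using assms(3)[of y z] unfolding joined_def by blast
qed (rule assms(2))

text \<open>Follow the path up to its first vertex in \<open>T\<close>, if there is one.\<close>

lemma joined_hits:
  assumes "(x, y) \<in> joined V S" "x \<in> V - T"
  shows "(x, y) \<in> joined V T \<or> (\<exists>s \<in> T. (x, s) \<in> joined V S)"
  using assms(1)
proof (induction rule: joined_induct)
  case (step y z)
  show ?case
  proof (cases "(x, y) \<in> joined V T")
    case True
    then have y: "y \<in> V - T"
      using joined_in assms(2) by metis
    have z: "(x, z) \<in> joined V S"
      using joined_trans[OF step(1) joined_edge[OF step(2,3,4)]] .
    show ?thesis
    proof (cases "z \<in> T")
      case False
      then have "(y, z) \<in> joined V T"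
        using step(3,4) y by (intro joined_edge) auto
      then show ?thesis
        using joined_trans[OF True] by blast
    qed (use z in blast)
  qed (use step in blast)
qed simp

text \<open>The sets \<open>S i\<close> separate the graph in a tree-like fashion, since each of them is connected and
  disjoint from the others.\<close>

lemma separation_decomposition:
  fixes h :: "'v::graph \<Rightarrow> int"
  assumes "finite I" "I \<noteq> {}"
    and "\<And>i j. i \<in> I \<Longrightarrow> j \<in> I \<Longrightarrow> i \<noteq> j \<Longrightarrow> S i \<inter> S j = {}"
    and "\<And>i s T. i \<in> I \<Longrightarrow> s \<in> S i \<Longrightarrow> T \<inter> S i = {} \<Longrightarrow> (z i, s) \<in> joined V T"
    and "\<And>i. i \<in> I \<Longrightarrow> S i \<subseteq> V"
    and "\<And>w w'. w \<in> V - \<Union> (S ` I) \<Longrightarrow> w' \<in> V - \<Union> (S ` I) \<Longrightarrow>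
      (\<And>i. i \<in> I \<Longrightarrow> (w, w') \<in> joined V (S i)) \<Longrightarrow> h w = h w'"
  shows "\<exists>n. (\<forall>i \<in> I. \<forall>w w'. w \<in> V - S i \<longrightarrow> (w, w') \<in> joined V (S i) \<longrightarrow> n i w = (n i w' :: int)) \<and>
    (\<forall>w \<in> V - \<Union> (S ` I). (\<Sum>i \<in> I. n i w) = h w)"
  using assms
proof (induction I arbitrary: h rule: finite_ne_induct)
  case (singleton i)
  have "h w = h w'" if "w \<in> V - S i" "(w, w') \<in> joined V (S i)" for w w'
    using that joined_in by (intro singleton(4)) auto
  then show ?case
    by (intro exI[of _ "\<lambda>i. h"]) auto
next
  case (insert k I)
  let ?U = "\<Union> (S ` I)"
  \<comment> \<open>The piece left by the sets \<open>S i\<close>, for \<open>i\<close> in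
    \<open>I\<close>, that contains \<open>S k\<close>. Vertices lying in different parts with
    respect to \<open>S k\<close> alone must belong to this piece.\<close>
  define E where "E = {w \<in> V. \<forall>i \<in> I. (z k, w) \<in> joined V (S i)}"
  have disj: "S i \<inter> S k = {}" if "i \<in> I" for i
    using insert.prems(1)[of i k] insert.hyps that by auto
  have SkE: "S k \<subseteq> E"
  proof
    fix s
    assume s: "s \<in> S k"
    then have "s \<in> V"
      using insert.prems(3)[of k] by blast
    then show "s \<in> E"
      using insert.prems(2)[of k s] s disj by (simp add: E_def)
  qed
  define P where "P w w' \<longleftrightarrow> w' \<in> E - S k - ?U \<and> (w, w') \<in> joined V (S k)" for w w'
  \<comment> \<open>The values of \<open>h\<close> on \<open>E\<close> are spread over the
    components outside \<open>S k\<close>, with 0 on components not reaching \<open>E\<close> away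
    from the separating sets. Subtracting \<open>m\<close> leaves a function that vanishes on
    \<open>E\<close> and so no longer sees \<open>S k\<close>.\<close>
  define m where "m w = (if \<exists>w'. P w w' then h (SOME w'. P w w') else 0)" for w
  define h' where "h' w = (if w \<in> E then 0 else h w - m w)" for w
  have m: "m w = m w'" if "(w, w') \<in> joined V (S k)" for w w'
  proof -
    have "(w, v) \<in> joined V (S k) \<longleftrightarrow> (w', v) \<in> joined V (S k)" for v
      using joined_trans[OF that] joined_trans[OF joined_sym[OF that]] by metis
    then have "P w = P w'"
      by (intro ext) (simp add: P_def)
    then show ?thesis
      by (simp only: m_def)
  qed
  have mE: "m w = h w" if w: "w \<in> E - S k - ?U" for w
  proof -
    have "P w w"
      using w by (simp add: P_def)
    then have Pw: "P w (SOME w'. P w w')"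
      by (rule someI)
    have "h (SOME w'. P w w') = h w"
    proof (rule insert.prems(4))
      let ?w = "SOME w'. P w w'"
      show "?w \<in> V - \<Union> (S ` insert k I)" "w \<in> V - \<Union> (S ` insert k I)"
        using Pw w by (auto simp: P_def E_def)
      show "(?w, w) \<in> joined V (S i)" if "i \<in> insert k I" for i
      proof (cases "i = k")
        case True
        then show ?thesis
          using Pw joined_sym unfolding P_def by metis
      next
        case False
        then have "(z k, ?w) \<in> joined V (S i)" "(z k, w) \<in> joined V (S i)"
          using Pw w that unfolding P_def E_def by auto
        then show ?thesis
          using joined_sym joined_trans by metis
      qed
    qed
    then show ?thesis
      using \<open>P w w\<close> by (auto simp: m_def)
  qed
  have "\<exists>n. (\<forall>i \<in> I. \<forall>w w'. w \<in> V - S i \<longrightarrow> (w, w') \<in> joined V (S i) \<longrightarrow> n i w = (n i w' :: int)) \<and>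
    (\<forall>w \<in> V - ?U. (\<Sum>i \<in> I. n i w) = h' w)"
  proof (rule insert.IH)
    fix w w'
    assume w: "w \<in> V - ?U" "w' \<in> V - ?U" and j: "\<And>i. i \<in> I \<Longrightarrow> (w, w') \<in> joined V (S i)"
    have EE: "w \<in> E \<longleftrightarrow> w' \<in> E"
    proof -
      have "(z k, w) \<in> joined V (S i) \<longleftrightarrow> (z k, w') \<in> joined V (S i)" if "i \<in> I" for i
        using joined_trans[OF _ j[OF that]] joined_trans[OF _ joined_sym[OF j[OF that]]] by metis
      then show ?thesis
        using w unfolding E_def by blast
    qed
    show "h' w = h' w'"
    proof (cases "w \<in> E")
      case False
      then have nS: "w \<notin> S k" "w' \<notin> S k"
        using SkE EE by auto
      \<comment> \<open>If \<open>S k\<close> separated \<open>w\<close> from \<open>w'\<close>, a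
        path avoiding any \<open>S i\<close> would run through \<open>S k\<close> and so connect
        \<open>w\<close> with \<open>z k\<close>, putting \<open>w\<close> into
        \<open>E\<close>.\<close>
      have jk: "(w, w') \<in> joined V (S k)"
      proof (rule ccontr)
        assume n: "(w, w') \<notin> joined V (S k)"
        have "(z k, w) \<in> joined V (S i)" if i: "i \<in> I" for i
        proof -
          obtain s where s: "s \<in> S k" "(w, s) \<in> joined V (S i)"
            using joined_hits[OF j[OF i], of "S k"] n w nS by blast
          moreover have "(z k, s) \<in> joined V (S i)"
            using insert.prems(2) s disj[OF i] by blast
          ultimately show ?thesis
            using joined_trans joined_sym by metis
        qed
        then show False
          using False w by (auto simp: E_def)
      qed
      have "h w = h w'"
        using w nS jk j by (intro insert.prems(4)) auto
      then show ?thesis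
        using m[OF jk] EE by (simp add: h'_def)
    qed (use EE in \<open>simp add: h'_def\<close>)
  qed (use insert.prems in auto)
  then obtain n where n: "\<forall>i \<in> I. \<forall>w w'. w \<in> V - S i \<longrightarrow> (w, w') \<in> joined V (S i) \<longrightarrow> n i w = n i w'"
    "\<forall>w \<in> V - ?U. (\<Sum>i \<in> I. n i w) = h' w"
    by blast
  define n' where "n' i = (if i = k then m else n i)" for i
  have "(\<Sum>i \<in> insert k I. n' i w) = h w" if "w \<in> V - \<Union> (S ` insert k I)" for w
  proof -
    have "(\<Sum>i \<in> insert k I. n' i w) = m w + (\<Sum>i \<in> I. n' i w)"
      using insert.hyps by (simp add: n'_def)
    also have "(\<Sum>i \<in> I. n' i w) = (\<Sum>i \<in> I. n i w)"
      using insert.hyps by (intro sum.cong) (auto simp: n'_def)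
    also have "\<dots> = h' w"
      using n(2) that by blast
    finally show ?thesis
      using mE[of w] that by (auto simp: h'_def)
  qed
  then show ?case
    using n(1) m by (intro exI[of _ n']) (auto simp: n'_def)
qed

text \<open>A product of partial conjugations by powers of \<open>u\<close>: the exponent is
  constant along edges outside the star, and on the star conjugation is trivial. Arbitrary integers
  occur because the separation lemma yields integer exponents.\<close>

lemma conj_aut:
  fixes k :: "'v::graph \<Rightarrow> int"
  assumes V: "closed V" "u \<in> V"
    and k: "\<And>w. w \<in> star u \<Longrightarrow> k w = 0"
      "\<And>w w'. w \<in> V \<Longrightarrow> adj w w' \<Longrightarrow> w \<notin> star u \<Longrightarrow> w' \<notin> star u \<Longrightarrow> k w = k w'"
  defines "s \<equiv> \<lambda>w. zm (k w) (gen u) + gen w - zm (k w) (gen u)"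
  shows "compatV V s" "aut V (extV V s)"
proof -
  have c: "compatV V (\<lambda>w. zm (k w) (gen u) + gen w - zm (k w) (gen u))"
    if k: "\<And>w. w \<in> star u \<Longrightarrow> k w = 0"
      "\<And>w w'. w \<in> V \<Longrightarrow> adj w w' \<Longrightarrow> w \<notin> star u \<Longrightarrow> w' \<notin> star u \<Longrightarrow> k w = k w'" for k :: "'v \<Rightarrow> int"
  proof -
    have mixed: "cm (gen w) (zm (k w') (gen u) + gen w' - zm (k w') (gen u))"
      if "adj w w'" "w \<in> star u" "w' \<notin> star u" for w w'
    proof -
      have "adj w u"
        using that by (auto simp: in_star adj_commute)
      then have "cm (gen w) (gen u)"
        by (intro cm_lett) simp
      then have "cm (gen w) (zm (k w') (gen u))"
        by (intro cm_sym[OF cm_zm[OF cm_sym]])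
      moreover have "cm (gen w) (gen w')"
        using that(1) by (intro cm_lett) simp
      ultimately show ?thesis
        by (simp add: diff_conv_add_uminus cm_add del: add_uminus_conv_diff)
    qed
    have "cm (zm (k w) (gen u) + gen w - zm (k w) (gen u))
        (zm (k w') (gen u) + gen w' - zm (k w') (gen u))" if "adj w w'" "w \<in> V" for w w'
    proof (cases "w \<in> star u"; cases "w' \<in> star u")
      assume "w \<in> star u" "w' \<in> star u"
      then show ?thesis
        using k(1) that(1) by (simp add: cm_lett)
    next
      assume "w \<in> star u" "w' \<notin> star u"
      then show ?thesis
        using mixed that(1) k(1) by simp
    next
      assume "w \<notin> star u" "w' \<in> star u"
      then show ?thesis
        using mixed[of w' w] that(1) k(1) by (simp add: adj_commute cm_sym)
    next
      assume "w \<notin> star u" "w' \<notin> star u"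
      then have "k w = k w'"
        using k(2) that by blast
      then show ?thesis
        using that(1) by (simp add: cm_conj cm_lett)
    qed
    then show ?thesis
      using V(1) by (auto simp: compatV_def)
  qed
  show cs: "compatV V s"
    unfolding s_def by (rule c[OF k])
  define s' where "s' w = zm (- k w) (gen u) + gen w - zm (- k w) (gen u)" for w
  have cs': "compatV V s'"
    unfolding s'_def using k by (intro c) auto
  note gs = ghom_extV[OF cs] ghom_extV[OF cs']
  have su: "extV V s (gen u) = gen u" "extV V s' (gen u) = gen u"
    using extV_gen[OF cs V(2)] extV_gen[OF cs' V(2)] k(1)[of u] by (simp_all add: s_def s'_def)
  have i1: "extV V s' (s w) = gen w" if "w \<in> V" for w
    using extV_gen[OF cs' that]
    by (simp add: s_def ghom_simps[OF gs(2)] ghom_zm[OF gs(2)] su)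
      (simp add: s'_def zm_uminus diff_conv_add_uminus add.assoc del: add_uminus_conv_diff)
  have i2: "extV V s (s' w) = gen w" if "w \<in> V" for w
    using extV_gen[OF cs that]
    by (simp add: s'_def ghom_simps[OF gs(1)] ghom_zm[OF gs(1)] su)
      (simp add: s_def zm_uminus diff_conv_add_uminus add.assoc del: add_uminus_conv_diff)
  have gps: "s w \<in> gp V" "s' w \<in> gp V" if "w \<in> V" for w
    using that V(2) by (auto simp: s_def s'_def intro!: gp_diff gp_add gp_zm)
  have "aut_pair V (extV V s) (extV V s')"
    using i1 i2 gps by (intro aut_pairI gs) (simp_all add: extV_gen[OF cs] extV_gen[OF cs'])
  then show "aut V (extV V s)"
    by (auto simp: aut_def)
qed

section \<open>Partial conjugations by a vertex and by the vertices of its fibre\<close>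

context cover
begin

definition fib :: "'w \<Rightarrow> 'v set" where
  "fib u = {y \<in> VL. \<phi> y = u}"

text \<open>Vertices with lifts that no single lift of \<open>u\<close> separates must be conjugated alike: partial
  conjugations by \<open>u\<close> with a support closed under this relation are the liftable ones.\<close>

definition sat :: "'w \<Rightarrow> ('w \<times> 'w) set" where
  "sat u = {(\<phi> x, \<phi> y) |x y. x \<in> VL \<and> y \<in> VL \<and> \<phi> x \<notin> star u \<and> \<phi> y \<notin> star u \<and>
    (\<forall>i \<in> fib u. (x, y) \<in> joined VL (star i))}"

definition saturated :: "'w \<Rightarrow> 'w set \<Rightarrow> bool" where
  "saturated u C \<longleftrightarrow> C \<subseteq> VG - star u \<and> (\<forall>x y. (x, y) \<in> sat u \<longrightarrow> x \<in> C \<longrightarrow> y \<in> C)"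

lemma star_phi: "i \<in> VL \<Longrightarrow> y \<in> star i \<Longrightarrow> \<phi> y \<in> star (\<phi> i)"
  using edge by (auto simp: in_star)

lemma saturated_edge:
  assumes "saturated u C" "x \<in> C" "adj x y" "y \<notin> star u"
  shows "y \<in> C"
proof -
  have x: "x \<in> VG" "x \<notin> star u"
    using assms by (auto simp: saturated_def)
  obtain x' where x': "x' \<in> VL" "\<phi> x' = x"
    using lift_exists x(1) by blast
  obtain y' where y': "adj x' y'" "\<phi> y' = y"
    using edge_lift[OF x'(1)] assms(3) x'(2) by blast
  have "y' \<in> VL"
    using adjL y'(1) x'(1) by blast
  moreover have "(x', y') \<in> joined VL (star i)" if "i \<in> fib u" for i
    using that star_phi[of i x'] star_phi[of i y'] x x' y' \<open>y' \<in> VL\<close> assms(4)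
    by (intro joined_edge) (auto simp: fib_def)
  ultimately have "(x, y) \<in> sat u"
    using x x' y' assms(4) unfolding sat_def by blast
  then show ?thesis
    using assms(1,2) by (auto simp: saturated_def)
qed

text \<open>The partial conjugations about the vertices \<open>i\<close> over \<open>u\<close> are
  composed. Downstairs each becomes conjugation by a power of \<open>gen u\<close>, and the powers
  add up. Over \<open>star u\<close> the exponent is left open, since \<open>gen u\<close> commutes
  with the generators there.\<close>

lemma lift_conj:
  assumes u: "u \<in> VG" and I: "finite I" "I \<subseteq> fib u"
    and n: "\<And>i w w'. i \<in> I \<Longrightarrow> w \<in> VL - star i \<Longrightarrow> (w, w') \<in> joined VL (star i) \<Longrightarrow> n i w = (n i w' :: int)"
  shows "\<exists>E. aut VL E \<and> (\<forall>w \<in> VL. (\<exists>g \<in> gp VL. E (gen w) = g + gen w - g) \<and>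
    (\<exists>k. (\<phi> w \<notin> star u \<longrightarrow> k = (\<Sum>i \<in> I. n i w)) \<and>
      \<Phi> (E (gen w)) = zm k (gen u) + gen (\<phi> w) - zm k (gen u)))"
  using I n
proof (induction I rule: finite_induct)
  case empty
  have "aut VL (\<lambda>g. g)"
    by (auto simp: aut_def aut_pair_def ghom_def)
  then show ?case
    by (intro exI[of _ "\<lambda>g. g"]) (auto intro!: bexI[of _ 0] exI[of _ 0])
next
  case (insert i I)
  obtain E where E: "aut VL E" "\<And>w. w \<in> VL \<Longrightarrow> (\<exists>g \<in> gp VL. E (gen w) = g + gen w - g)"
    "\<And>w. w \<in> VL \<Longrightarrow> \<exists>k. (\<phi> w \<notin> star u \<longrightarrow> k = (\<Sum>i \<in> I. n i w)) \<and>
      \<Phi> (E (gen w)) = zm k (gen u) + gen (\<phi> w) - zm k (gen u)"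
    using insert by auto
  have i: "i \<in> VL" "\<phi> i = u"
    using insert.prems by (auto simp: fib_def)
  define k where "k w = (if w \<in> star i then 0 else n i w)" for w
  define s where "s w = zm (k w) (gen i) + gen w - zm (k w) (gen i)" for w
  have k: "k w = k w'" if "w \<in> VL" "adj w w'" "w \<notin> star i" "w' \<notin> star i" for w w'
    using insert.prems(2)[of i w w'] joined_edge[of w VL "star i" w'] that adjL[of w w']
    by (simp add: k_def)
  have cs: "compatV VL s" and aut: "aut VL (extV VL s)"
    using conj_aut[OF closedL i(1), of k] k unfolding s_def by (auto simp: k_def)
  have ghE: "ghom E" and ghP: "ghom (extV VL s)"
    using aut_ghom E(1) aut by blast+
  have "\<exists>g \<in> gp VL. E (s w) = g + gen w - g" if w: "w \<in> VL" for w
  proof -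
    obtain g where g: "g \<in> gp VL" "E (gen w) = g + gen w - g"
      using E(2)[OF w] by blast
    have "E (zm (k w) (gen i)) \<in> gp VL"
      using aut_gp[OF E(1)] i(1) gp_zm[of "gen i" VL "k w"] by simp
    then show ?thesis
      using g(1) by (intro bexI[of _ "E (zm (k w) (gen i)) + g"])
        (auto simp: s_def ghom_simps[OF ghE] g(2) conj_conj gp_add)
  qed
  moreover have "\<exists>k. (\<phi> w \<notin> star u \<longrightarrow> k = (\<Sum>i \<in> insert i I. n i w)) \<and>
      \<Phi> (E (s w)) = zm k (gen u) + gen (\<phi> w) - zm k (gen u)" if w: "w \<in> VL" for w
  proof -
    obtain j where j: "\<phi> w \<notin> star u \<longrightarrow> j = (\<Sum>i \<in> I. n i w)"
      "\<Phi> (E (gen w)) = zm j (gen u) + gen (\<phi> w) - zm j (gen u)"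
      using E(3)[OF w] by blast
    obtain j' where j': "\<Phi> (E (gen i)) = zm j' (gen u) + gen u - zm j' (gen u)"
      using E(3)[OF i(1)] i(2) by blast
    have "cm (zm j' (gen u)) (gen u)"
      by (intro cm_zm) simp
    then have "\<Phi> (E (gen i)) = gen u"
      unfolding j' by (simp add: cm_def)
    then have "\<Phi> (E (s w)) = zm (k w) (gen u) + (zm j (gen u) + gen (\<phi> w) - zm j (gen u)) - zm (k w) (gen u)"
      by (simp add: s_def ghom_simps[OF ghE] ghom_zm[OF ghE] ghom_zm[OF ghom_\<Phi>] j(2))
    then have "\<Phi> (E (s w)) = zm (k w + j) (gen u) + gen (\<phi> w) - zm (k w + j) (gen u)"
      by (simp only: conj_conj zm_add)
    moreover have "k w + j = (\<Sum>i \<in> insert i I. n i w)" if "\<phi> w \<notin> star u"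
      using that star_phi[OF i(1), of w] i(2) j(1) insert.hyps by (auto simp: k_def)
    ultimately show ?thesis
      by (intro exI[of _ "k w + j"]) blast
  qed
  moreover have "aut VL (\<lambda>g. E (extV VL s g))"
    using E(1) aut by (rule aut_comp)
  ultimately show ?case
    by (intro exI[of _ "\<lambda>g. E (extV VL s g)"]) (simp add: extV_gen[OF cs])
qed

text \<open>The stars of the vertices over \<open>u\<close> are disjoint, since \<phi> is injective
  on stars. The indicator of \<open>C\<close> respects the classes that no single one of them
  separates, so \<open>separation_decomposition\<close> writes it as a sum of exponents about the
  single lifts, which \<open>lift_conj\<close> realises.\<close>

lemma mv_partial_conj_pos:
  assumes u: "u \<in> VG" and C: "saturated u C"
  shows "\<exists>e E. mv e E \<and> (\<forall>w \<in> VG. e (gen w) = (if w \<in> C then gen u + gen w - gen u else gen w)) \<and>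
    (\<forall>w \<in> VL. \<exists>g \<in> gp VL. E (gen w) = g + gen w - g)"
proof -
  define h where "h w = (if \<phi> w \<in> C then 1 else 0 :: int)" for w
  have fib: "finite (fib u)" "fib u \<noteq> {}"
    using finL lift_exists[OF u] by (auto simp: fib_def)
  have "\<exists>n. (\<forall>i \<in> fib u. \<forall>w w'. w \<in> VL - star i \<longrightarrow> (w, w') \<in> joined VL (star i) \<longrightarrow> n i w = (n i w' :: int)) \<and>
    (\<forall>w \<in> VL - \<Union> (star ` fib u). (\<Sum>i \<in> fib u. n i w) = h w)"
  proof (rule separation_decomposition[OF fib])
    show "star i \<inter> star j = {}" if ij: "i \<in> fib u" "j \<in> fib u" "i \<noteq> j" for i j
    proof (rule ccontr)
      assume "star i \<inter> star j \<noteq> {}"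
      then obtain c where c: "c \<in> star i" "c \<in> star j"
        by blast
      then have "i \<in> star c" "j \<in> star c"
        by (auto simp: in_star adj_commute)
      moreover from c have "c \<in> VL"
        using ij(1) adjL by (auto simp: in_star fib_def)
      ultimately show False
        using star_fibre[of c i j] ij by (auto simp: fib_def)
    qed
    show sub: "star i \<subseteq> VL" if "i \<in> fib u" for i
      using that adjL by (auto simp: star_def fib_def)
    show "(i, s) \<in> joined VL T" if "i \<in> fib u" "s \<in> star i" "T \<inter> star i = {}" for i s T
    proof (cases "s = i")
      case False
      then show ?thesis
        using that sub[OF that(1)] by (intro joined_edge) (auto simp: in_star)
    qed simp
    fix w w'
    assume w: "w \<in> VL - \<Union> (star ` fib u)" "w' \<in> VL - \<Union> (star ` fib u)"
      and j: "\<And>i. i \<in> fib u \<Longrightarrow> (w, w') \<in> joined VL (star i)"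
    have nst: "\<phi> w \<notin> star u" if x: "w \<in> VL - \<Union> (star ` fib u)" for w
    proof
      assume "\<phi> w \<in> star u"
      then consider "\<phi> w = u" | "adj (\<phi> w) u"
        by (auto simp: in_star adj_commute)
      then have "\<exists>i \<in> fib u. w \<in> star i"
      proof cases
        case 1
        then show ?thesis
          using x by (auto simp: fib_def)
      next
        case 2
        then obtain i where "adj w i" "\<phi> i = u"
          using edge_lift[of w u] x by blast
        then show ?thesis
          using x adjL by (auto simp: fib_def in_star adj_commute)
      qed
      then show False
        using x by blast
    qed
    have "(\<phi> w, \<phi> w') \<in> sat u"
      unfolding sat_def using w nst j by blast
    moreover have "(\<phi> w', \<phi> w) \<in> sat u"
      unfolding sat_def using w nst joined_sym[OF j] by blast
    ultimately have "\<phi> w \<in> C \<longleftrightarrow> \<phi> w' \<in> C"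
      using C unfolding saturated_def by blast
    then show "h w = h w'"
      by (simp add: h_def)
  qed
  then obtain n where n: "\<And>i w w'. i \<in> fib u \<Longrightarrow> w \<in> VL - star i \<Longrightarrow> (w, w') \<in> joined VL (star i) \<Longrightarrow> n i w = (n i w' :: int)"
    "\<And>w. w \<in> VL - \<Union> (star ` fib u) \<Longrightarrow> (\<Sum>i \<in> fib u. n i w) = h w"
    by blast
  have "\<exists>E. aut VL E \<and> (\<forall>w \<in> VL. (\<exists>g \<in> gp VL. E (gen w) = g + gen w - g) \<and>
    (\<exists>k. (\<phi> w \<notin> star u \<longrightarrow> k = (\<Sum>i \<in> fib u. n i w)) \<and>
      \<Phi> (E (gen w)) = zm k (gen u) + gen (\<phi> w) - zm k (gen u)))"
    by (rule lift_conj[OF u fib(1) subset_refl]) (rule n(1))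
  then obtain E where E: "aut VL E" "\<And>w. w \<in> VL \<Longrightarrow> \<exists>g \<in> gp VL. E (gen w) = g + gen w - g"
    "\<And>w. w \<in> VL \<Longrightarrow> \<exists>k. (\<phi> w \<notin> star u \<longrightarrow> k = (\<Sum>i \<in> fib u. n i w)) \<and>
      \<Phi> (E (gen w)) = zm k (gen u) + gen (\<phi> w) - zm k (gen u)"
    by blast
  define s where "s w = (if w \<in> C then gen u + gen w - gen u else gen w)" for w
  define k where "k w = (if w \<in> C then 1 else 0 :: int)" for w
  have sk: "s = (\<lambda>w. zm (k w) (gen u) + gen w - zm (k w) (gen u))"
    by (auto simp: s_def k_def)
  have Cst: "w \<notin> star u" if "w \<in> C" for w
    using C that by (auto simp: saturated_def)
  have kadj: "k w = k w'" if "adj w w'" "w \<notin> star u" "w' \<notin> star u" for w w'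
    using saturated_edge[OF C, of w w'] saturated_edge[OF C, of w' w] that
    by (auto simp: k_def adj_commute)
  have "compatV VG s \<and> aut VG (extV VG s)"
    unfolding sk using Cst kadj by (intro conjI conj_aut[OF closedG u, of k]) (auto simp: k_def)
  then have cs: "compatV VG s" and auts: "aut VG (extV VG s)"
    by auto
  have "s (\<phi> w) = \<Phi> (E (gen w))" if w: "w \<in> VL" for w
  proof -
    obtain j where j: "\<phi> w \<notin> star u \<longrightarrow> j = (\<Sum>i \<in> fib u. n i w)"
      "\<Phi> (E (gen w)) = zm j (gen u) + gen (\<phi> w) - zm j (gen u)"
      using E(3)[OF w] by blast
    show ?thesis
    proof (cases "\<phi> w \<in> star u")
      case True
      then have "cm (gen (\<phi> w)) (gen u)"
        using cm_gen_lett[of "\<phi> w" "(u, True)"] by (auto simp: in_star)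
      then have "cm (zm j (gen u)) (gen (\<phi> w))"
        by (intro cm_zm) (rule cm_sym)
      then show ?thesis
        using True Cst by (auto simp: j(2) s_def cm_def)
    next
      case False
      then have "w \<notin> star i" if "i \<in> fib u" for i
        using that star_phi[of i w] by (auto simp: fib_def)
      then have "j = h w"
        using j(1) False n(2)[of w] w by auto
      then show ?thesis
        by (simp add: j(2) s_def h_def)
    qed
  qed
  then have "laut (extV VG s) E"
    using auts E(1) by (intro lautI) (auto simp: extV_gen[OF cs])
  moreover have "elem (extV VG s)"
    unfolding s_def using C saturated_edge[OF C] u
    by (intro elem.partial_conj) (auto simp: saturated_def)
  ultimately have "mv (extV VG s) E"
    by (intro mv_elem)
  then show ?thesis
    using E(2) by (intro exI[of _ "extV VG s"] exI[of _ E]) (simp add: extV_gen[OF cs] s_def)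
qed

lemma mv_partial_conj:
  assumes u: "fst a \<in> VG" and C: "saturated (fst a) C"
  shows "\<exists>e E. mv e E \<and> (\<forall>w \<in> VG. e (gen w) = (if w \<in> C then lett a + gen w - lett a else gen w)) \<and>
    (\<forall>w \<in> VL. \<exists>g \<in> gp VL. E (gen w) = g + gen w - g)"
proof (cases "snd a")
  case True
  then have a: "lett a = gen (fst a)"
    by (cases a) simp
  show ?thesis
    unfolding a by (rule mv_partial_conj_pos[OF assms])
next
  case False
  let ?u = "fst a"
  have a: "lett a = - gen ?u"
    using False by (cases a) simp
  obtain e E where e: "mv e E" "\<forall>w \<in> VG. e (gen w) = (if w \<in> C then gen ?u + gen w - gen ?u else gen w)"
    "\<forall>w \<in> VL. \<exists>g \<in> gp VL. E (gen w) = g + gen w - g"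
    using mv_partial_conj_pos[OF assms] by blast
  obtain i I where i: "mv i I" "\<forall>v \<in> VG. i (gen v) = lett (v, v \<notin> {?u})"
    "\<forall>w \<in> VL. I (gen w) = lett (w, \<phi> w \<notin> {?u})"
    using mv_inversion[of "{?u}"] u by blast
  have gh: "ghom e" "ghom E" "ghom i" "ghom I"
    using e(1) i(1) mv_laut laut_ghom by blast+
  note simps = ghom_simps[OF gh(1)] ghom_simps[OF gh(2)] ghom_simps[OF gh(3)] ghom_simps[OF gh(4)]
  have uC: "?u \<notin> C"
    using C by (auto simp: saturated_def)
  have "i (e (i (gen w))) = (if w \<in> C then lett a + gen w - lett a else gen w)" if "w \<in> VG" for w
    using that u uC e(2) i(2) by (cases "w = ?u"; cases "w \<in> C") (simp_all add: simps a)
  moreover have "\<exists>g \<in> gp VL. I (E (I (gen w))) = g + gen w - g" if w: "w \<in> VL" for w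
  proof -
    obtain g where g: "g \<in> gp VL" "E (gen w) = g + gen w - g"
      using e(3) w by blast
    have "I g \<in> gp VL"
      using mv_laut[OF i(1)] g(1) by (auto simp: laut_def aut_gp)
    moreover have "I (E (I (gen w))) = I g + gen w - I g"
      using i(3) w by (cases "\<phi> w = ?u") (simp_all add: simps g(2), simp_all add: diff_conv_add_uminus add.assoc minus_add del: add_uminus_conv_diff)
    ultimately show ?thesis
      by blast
  qed
  moreover have "mv (\<lambda>g. i (e (i g))) (\<lambda>g. I (E (I g)))"
    using mv_comp[OF i(1) mv_comp[OF e(1) i(1)]] .
  ultimately show ?thesis
    by (intro exI[of _ "\<lambda>g. i (e (i g))"] exI[of _ "\<lambda>g. I (E (I g))"]) simp
qed

end

section \<open>Nielsen reduction\<close>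

text \<open>A Nielsen-type argument: if in each \<open>f (lett b)\<close> one letter, the centre, is never absorbed by a
  neighbouring factor, then the centre of the last factor survives in \<open>f z\<close>. Applied to the
  preimages of the letters this shows that every \<open>f (lett b)\<close> consists of its centre only.\<close>

lemma letters_from_centres:
  fixes f :: "'v::graph raag \<Rightarrow> 'v raag"
  assumes U: "finite U" and f: "ghom f" "\<And>g. g \<in> gp U \<Longrightarrow> \<exists>z \<in> gp U. f z = g"
    and fb: "\<And>b. fst b \<in> U \<Longrightarrow> f (lett b) = P b + lett (C b) - P (linv b)"
    and C: "\<And>b. fst b \<in> U \<Longrightarrow> C (linv b) = linv (C b)" "\<And>b. fst b \<in> U \<Longrightarrow> irr (P b) (C b)"
    and ns: "\<And>a b. fst a \<in> U \<Longrightarrow> fst b \<in> U \<Longrightarrow> a \<noteq> b \<Longrightarrow> \<not> adj (fst a) (fst b) \<Longrightarrow>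
      \<not> pre (P a + lett (C a)) (P b + lett (C b))"
    and adjC: "\<And>a b. fst a \<in> U \<Longrightarrow> fst b \<in> U \<Longrightarrow> adj (fst (C a)) (fst (C b)) \<Longrightarrow> adj (fst a) (fst b)"
    and conj: "\<And>a b. fst a \<in> U \<Longrightarrow> fst b \<in> U \<Longrightarrow> adj (fst a) (fst b) \<Longrightarrow>
      - P a + f (lett b) + P a \<in> gp {v. adj (fst (C a)) v}"
    and b: "fst b \<in> U"
  shows "f (lett b) = lett (C b)"
proof -
  define hd where "hd b = P b + lett (C b)" for b
  have redP: "red (P b) (lett (C b))" if "fst b \<in> U" for b
    using C(2)[OF that] by (simp add: irr_def)
  have key: "pre (hd (linv a)) (- f z)" if "z \<in> gp U" "ends a z" for a z
    using that
  proof (induction "len z" arbitrary: a z rule: less_induct)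
    case less
    obtain z' where z': "z = z' + lett a" "len z = Suc (len z')"
      using less.prems(2) by (rule ends_obtain)
    have rz: "red z' (lett a)"
      using z' by (simp add: red_def)
    have zU: "z' \<in> gp U" "fst a \<in> U"
      using less.prems(1) red_gp[OF rz] z'(1) by auto
    have fa: "- f z = f (lett (linv a)) + - f z'"
      by (simp only: z'(1) ghom_add[OF f(1)] minus_add lett_linv ghom_uminus[OF f(1)])
    \<comment> \<open>The centre of the factor belonging to \<open>a\<close> can be cancelled by
      what follows only if the whole head of \<open>a\<close> is a prefix of it, by
      \<open>irr_pre_iff\<close>.\<close>
    have split: "pre (hd (linv a)) (- f z)" if "\<not> pre (hd a) (- f z')"
    proof -
      have "\<not> starts (C a) (- P a + - f z')"
        using that irr_pre_iff[OF C(2)[OF zU(2)]] by (simp add: hd_def)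
      then have "starts (linv (C a)) (lett (linv (C a)) + (- P a + - f z'))"
        by (simp del: add_uminus_conv_diff lett_linv)
      moreover have "- P (linv a) + - f z = lett (linv (C a)) + (- P a + - f z')"
        using fb[of "linv a"] C(1)[of a] zU(2) unfolding fa
        by (simp add: diff_conv_add_uminus add.assoc del: add_uminus_conv_diff)
      ultimately have "starts (C (linv a)) (- P (linv a) + - f z)"
        using C(1)[of a] zU(2) by simp
      then show ?thesis
        using irr_pre_iff[OF C(2), of "linv a"] zU(2) by (simp add: hd_def)
    qed
    show ?case
    proof (cases "z' = 0")
      case True
      have "\<not> pre (hd a) 0"
      proof
        assume "pre (hd a) 0"
        then have "len (hd a) = 0"
          using pre_len by fastforce
        then show False
          using redP[OF zU(2)] unfolding hd_def red_def by simp
      qed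
      then show ?thesis
        using split True by (simp add: ghom_zero[OF f(1)])
    next
      case False
      show ?thesis
      proof (cases "\<exists>b. ends b z' \<and> \<not> adj (fst a) (fst b)")
        case True
        then obtain b where b: "ends b z'" "\<not> adj (fst a) (fst b)"
          by blast
        have bU: "fst b \<in> U"
          using zU(1) ends_imp_supp[OF b(1)] by (auto simp: gp_def)
        have ba: "b \<noteq> linv a"
          using rz b(1) red_lett_right by blast
        have IH: "pre (hd (linv b)) (- f z')"
          using less.hyps[of z' b] z'(2) zU(1) b(1) by simp
        have "\<not> pre (hd a) (- f z')"
        proof
          assume pa: "pre (hd a) (- f z')"
          have "\<not> adj (fst (C a)) (fst (C (linv b)))"
            using adjC[of a "linv b"] zU(2) bU b(2) unfolding fst_linv by blast
          then have "pre (hd a) (hd (linv b)) \<or> pre (hd (linv b)) (hd a)"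
            using irr_comparable[OF C(2) C(2), of a "linv b"] pa IH zU(2) bU unfolding hd_def by simp
          moreover have "a \<noteq> linv b"
            using ba by auto
          ultimately show False
            using ns[of a "linv b"] ns[of "linv b" a] zU(2) bU b(2) unfolding hd_def
            by (auto simp: adj_commute)
        qed
        then show ?thesis
          by (rule split)
      next
        \<comment> \<open>All last letters of \<open>z'\<close> are adjacent to \<open>a\<close>.
          Such a letter \<open>b\<close> is moved behind \<open>a\<close>; the induction hypothesis
          applies to the shorter \<open>?w\<close>, and the conjugated factor of \<open>b\<close>
          lies over neighbours of the centre, so it cannot absorb it.\<close>
        case all: False
        obtain b where b: "ends b z'"
          using ends_exists[OF False] by blast
        obtain z'' where z'': "z' = z'' + lett b" "len z' = Suc (len z'')"
          using b by (rule ends_obtain)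
        have adj: "adj (fst a) (fst b)"
          using all b by blast
        have rb: "red z'' (lett b)"
          using z'' by (simp add: red_def)
        have bU: "fst b \<in> U" "z'' \<in> gp U"
          using zU(1) red_gp[OF rb] z''(1) by auto
        have "\<not> ends (linv a) z''"
        proof
          assume "ends (linv a) z''"
          then have "ends (linv a) z'"
            using starts_adj[of a "linv b" "- z''"] adj unfolding z''(1) ends_def minus_add by simp
          then show False
            using all by fastforce
        qed
        then have ea: "ends a (z'' + lett a)"
          by simp
        let ?w = "z'' + lett a"
        have "len ?w < len z"
          using len_add_le[of z'' "lett a"] z'(2) z''(2) by simp
        then have IH: "pre (hd (linv a)) (- f ?w)"
          using less.hyps[of ?w a] bU(2) zU(2) ea by simp
        have zw: "z = ?w + lett b"
          using lett_commute[OF adj] by (simp add: z'(1) z''(1) add.assoc)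
        let ?c = "- P (linv a) + f (lett b) + P (linv a)"
        have c: "- ?c \<in> gp {v. adj (fst (C (linv a))) v}"
          using conj[of "linv a" b] zU(2) bU(1) adj by simp
        have st: "starts (C (linv a)) (- P (linv a) + - f ?w)"
          using IH irr_pre_iff[OF C(2), of "linv a"] zU(2) by (simp add: hd_def)
        have "starts (C (linv a)) (- ?c + (- P (linv a) + - f ?w))"
          using starts_gp_adj[OF c, of "C (linv a)"] st by simp
        moreover have "- ?c + (- P (linv a) + - f ?w) = - P (linv a) + - f z"
          by (simp only: zw ghom_add[OF f(1)] minus_add minus_minus add.assoc add_minus_cancel)
        ultimately show ?thesis
          using irr_pre_iff[OF C(2), of "linv a"] zU(2) by (simp add: hd_def)
      qed
    qed
  qed
  define L where "L = {b :: 'v \<times> bool. fst b \<in> U}"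
  have "L = U \<times> UNIV"
    by (auto simp: L_def)
  then have finL: "finite L"
    using U by simp
  \<comment> \<open>By surjectivity \<open>- lett c\<close> has a preimage, and a head is a prefix
    of the single letter \<open>c\<close>; it must be this letter. As there are finitely many
    letters, this accounts for all of them.\<close>
  have "\<exists>a \<in> L. P a = 0 \<and> C a = c" if "c \<in> L" for c
  proof -
    have "- lett c \<in> gp U"
      using that by (simp add: L_def)
    then obtain z where z: "z \<in> gp U" "f z = - lett c"
      using f(2) by blast
    have "z \<noteq> 0"
    proof
      assume "z = 0"
      then have "len (lett c) = 0"
        using z(2) by (simp add: ghom_zero[OF f(1)])
      then show False
        by (simp only: len_lett)
    qed
    then obtain a where a: "ends a z"
      using ends_exists by blast
    have aU: "fst a \<in> U"
      using z(1) ends_imp_supp[OF a] by (auto simp: gp_def)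
    have pre: "pre (hd (linv a)) (lett c)"
      using key[OF z(1) a] z(2) by simp
    have len: "len (hd (linv a)) = Suc (len (P (linv a)))"
      using redP[of "linv a"] aU by (simp add: hd_def red_def)
    then have "len (hd (linv a)) = len (lett c)"
      using pre_len[OF pre] by simp
    then have "hd (linv a) = lett c" "len (P (linv a)) = 0"
      using pre_len_eq[OF pre] len by auto
    then have "P (linv a) = 0" "lett (C (linv a)) = lett c"
      by (auto simp: hd_def)
    moreover from this have "C (linv a) = c"
      using starts_lett[of "C (linv a)" c] starts_lett[of "C (linv a)" "C (linv a)"] by simp
    ultimately show ?thesis
      using aU by (intro bexI[of _ "linv a"]) (auto simp: L_def)
  qed
  then obtain k where k: "\<And>c. c \<in> L \<Longrightarrow> k c \<in> L \<and> P (k c) = 0 \<and> C (k c) = c"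
    by metis
  have "inj_on k L"
    using k by (metis inj_on_inverseI)
  then have "k ` L = L"
    using k finL by (intro endo_inj_surj) auto
  then have "P b = 0" if "b \<in> L" for b
    using k that by (metis imageE)
  then show ?thesis
    using fb[OF b] b by (simp add: L_def)
qed

lemma cancellation:
  "\<exists>q' s r'. q = q' + s \<and> r = - s + r' \<and> red q' s \<and> red (- s) r' \<and> red q' r'"
proof (induction "len q" arbitrary: q r)
  case 0
  then have "q = 0"
    by simp
  then show ?case
    by (intro exI[of _ 0] exI[of _ r]) auto
next
  case (Suc n)
  show ?case
  proof (cases "red q r")
    case True
    then show ?thesis
      by (intro exI[of _ q] exI[of _ 0] exI[of _ r]) auto
  next
    case False
    then obtain a where a: "ends a q" "starts (linv a) r"
      using not_red by blast
    obtain q1 where q1: "q = q1 + lett a" "len q = Suc (len q1)"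
      using a(1) by (rule ends_obtain)
    obtain r1 where r1: "r = lett (linv a) + r1" "\<not> starts (linv (linv a)) r1"
      using a(2) by (rule starts_obtain)
    obtain q' s r' where s: "q1 = q' + s" "r1 = - s + r'" "red q' s" "red (- s) r'" "red q' r'"
      using Suc.hyps(1)[of q1 r1] Suc.hyps(2) q1(2) by auto
    have "red q1 (lett a)"
      using q1 by (simp add: red_def)
    then have "red q' (s + lett a)"
      using s(1,3) red_assoc by blast
    moreover have "red (lett (linv a)) r1"
      using r1(2) by (simp add: red_lett del: linv_linv lett_linv)
    then have "red (lett (linv a) + - s) r'"
      using s(2,4) red_assoc2 by blast
    then have "red (- (s + lett a)) r'"
      by (simp add: minus_add del: add_uminus_conv_diff)
    moreover have "q = q' + (s + lett a)" "r = - (s + lett a) + r'"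
      using q1(1) r1(1) s(1,2) by (simp_all add: minus_add add.assoc del: add_uminus_conv_diff)
    ultimately show ?thesis
      using s(5) by (intro exI[of _ q'] exI[of _ "s + lett a"] exI[of _ r']) simp
  qed
qed

text \<open>Over a finite \<open>U\<close> there are finitely many elements of each length, which
  are numbered length by length. Injectivity turns distinct prefixes of equal length into strictly
  comparable ones.\<close>

lemma rank_exists:
  assumes "finite U"
  shows "\<exists>rk :: 'v::graph raag \<Rightarrow> nat. inj_on rk (gp U) \<and>
    (\<forall>g \<in> gp U. \<forall>h \<in> gp U. len g < len h \<longrightarrow> rk g < rk h)"
proof -
  have fin: "finite {g \<in> gp U. len g \<le> n}" for n
  proof -
    have "{g \<in> gp U. len g \<le> n} \<subseteq> val ` {w. set w \<subseteq> U \<times> UNIV \<and> length w \<le> n}"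
    proof
      fix g
      assume g: "g \<in> {g \<in> gp U. len g \<le> n}"
      have "set (rep g) \<subseteq> U \<times> UNIV"
      proof
        fix a
        assume "a \<in> set (rep g)"
        then have "fst a \<in> supp g"
          by (simp add: supp_def)
        then show "a \<in> U \<times> UNIV"
          using g by (cases a) (auto simp: gp_def)
      qed
      then have "rep g \<in> {w. set w \<subseteq> U \<times> UNIV \<and> length w \<le> n}"
        using g by (simp add: len_def)
      then have "val (rep g) \<in> val ` {w. set w \<subseteq> U \<times> UNIV \<and> length w \<le> n}"
        by (rule imageI)
      then show "g \<in> val ` {w. set w \<subseteq> U \<times> UNIV \<and> length w \<le> n}"
        by (simp only: val_rep)
    qed
    then show ?thesis
      by (rule finite_subset) (intro finite_imageI finite_lists_length_le finite_cartesian_product assms finite)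
  qed
  define S where "S n = {g \<in> gp U. len g < n}" for n
  define T where "T n = {g \<in> gp U. len g = n}" for n
  have finS: "finite (S n)" "finite (T n)" for n
    using fin[of n] by (auto simp: S_def T_def elim!: finite_subset[rotated])
  have "\<forall>n. \<exists>i. bij_betw i (T n) {0..<card (T n)}"
    using ex_bij_betw_finite_nat finS(2) by blast
  then obtain i where i: "\<And>n. bij_betw (i n) (T n) {0..<card (T n)}"
    by metis
  define rk where "rk g = card (S (len g)) + i (len g) g" for g
  have bound: "card (S (len g)) \<le> rk g" "rk g < card (S (Suc (len g)))" if "g \<in> gp U" for g
  proof -
    have "S (Suc n) = S n \<union> T n" "S n \<inter> T n = {}" for n
      by (auto simp: S_def T_def)
    then have "card (S (Suc n)) = card (S n) + card (T n)" for n
      using finS by (simp add: card_Un_disjoint)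
    moreover have "i (len g) g < card (T (len g))"
      using i[of "len g"] that by (force simp: bij_betw_def T_def)
    ultimately show "card (S (len g)) \<le> rk g" "rk g < card (S (Suc (len g)))"
      by (simp_all add: rk_def)
  qed
  have less: "rk g < rk h" if "g \<in> gp U" "h \<in> gp U" "len g < len h" for g h
  proof -
    have "card (S (Suc (len g))) \<le> card (S (len h))"
      using that(3) finS by (intro card_mono) (auto simp: S_def)
    then show ?thesis
      using bound(2)[OF that(1)] bound(1)[OF that(2)] by linarith
  qed
  have "inj_on rk (gp U)"
  proof
    fix g h
    assume gh: "g \<in> gp U" "h \<in> gp U" "rk g = rk h"
    then have len: "len g = len h"
      using less by (metis less_irrefl linorder_neqE_nat)
    then have "i (len g) g = i (len g) h"
      using gh(3) by (simp add: rk_def)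
    then show "g = h"
      using i[of "len g"] gh len by (auto simp: bij_betw_def inj_on_def T_def)
  qed
  then show ?thesis
    using less by blast
qed

lemma lex_nth:
  "(xs, ys) \<in> lex less_than \<longleftrightarrow> length xs = length ys \<and>
    (\<exists>i < length xs. (\<forall>j < i. xs ! j = ys ! j) \<and> xs ! i < ys ! i)"
proof
  assume "(xs, ys) \<in> lex less_than"
  then obtain zs x xs' y ys' where *: "length xs = length ys" "xs = zs @ x # xs'" "ys = zs @ y # ys'" "x < y"
    by (auto simp: lex_conv)
  then show "length xs = length ys \<and> (\<exists>i < length xs. (\<forall>j < i. xs ! j = ys ! j) \<and> xs ! i < ys ! i)"
    by (intro conjI exI[of _ "length zs"]) (auto simp: nth_append)
next
  assume *: "length xs = length ys \<and> (\<exists>i < length xs. (\<forall>j < i. xs ! j = ys ! j) \<and> xs ! i < ys ! i)"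
  then obtain i where i: "i < length xs" "\<forall>j < i. xs ! j = ys ! j" "xs ! i < ys ! i"
    by blast
  have "take i xs = take i ys"
    using i * by (intro nth_equalityI) auto
  then have "xs = take i xs @ xs ! i # drop (Suc i) xs" "ys = take i xs @ ys ! i # drop (Suc i) ys"
    using i * id_take_nth_drop by metis+
  then show "(xs, ys) \<in> lex less_than"
    using i(3) * unfolding lex_conv by force
qed

lemma lex_total: "length xs = length ys \<Longrightarrow> xs \<noteq> ys \<Longrightarrow>
  (xs, ys) \<in> lex less_than \<or> (ys, xs) \<in> lex less_than"
proof (induction xs ys rule: list_induct2)
  case (Cons x xs y ys)
  then show ?case
    using linorder_less_linear[of x y] by auto
qed simp

lemma lex_asym: "(xs, ys) \<in> lex less_than \<Longrightarrow> (ys, xs) \<notin> lex less_than"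
  using wf_lex[OF wf_less_than] by (meson wf_asym)

section \<open>Letters over an isolated set of vertices\<close>

text \<open>Under these assumptions \<open>gp U\<close> is the free product of the free group on
  \<open>S\<close> with \<open>gp (U - S)\<close>. Nielsen's method is carried out by counting
  \<open>S\<close>-letters only.\<close>

locale free_part =
  fixes U S :: "'v::graph set"
  assumes finU: "finite U" and SU: "S \<subseteq> U"
    and isolated: "x \<in> S \<Longrightarrow> u \<in> U \<Longrightarrow> \<not> adj x u"
begin

definition kx :: "'v raag \<Rightarrow> nat" where
  "kx g = size {#l \<in># mset (rep g). fst l \<in> S#}"

lemma kx_red: "red g h \<Longrightarrow> kx (g + h) = kx g + kx h"
  by (simp add: kx_def red_rep_mset)

lemma kx_lett [simp]: "kx (lett a) = (if fst a \<in> S then 1 else 0)"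
proof -
  have "reduced [a]"
    by (rule reduced_if_len) simp
  then have "mset (rep (lett a)) = {#a#}"
    using mset_rep_val[of "[a]"] by simp
  then show ?thesis
    by (simp add: kx_def)
qed

lemma kx_zero [simp]: "kx 0 = 0"
  using kx_red[of 0 0] by simp

lemma kx_uminus [simp]: "kx (- g) = kx g"
proof (induction g rule: raag_induct)
  case (add a g)
  have r: "red (lett a) g"
    using add(1) by (simp add: red_lett)
  have "kx (- g + - lett a) = kx (- g) + kx (- lett a)"
    using kx_red[of "- g" "- lett a"] r red_uminus by blast
  moreover have "kx (- lett a) = kx (lett a)"
    using kx_lett[of "linv a"] kx_lett[of a] by simp
  ultimately have "kx (- (lett a + g)) = kx (lett a) + kx g"
    using add(2) by (simp add: minus_add del: add_uminus_conv_diff)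
  then show ?case
    using kx_red[OF r] by simp
qed simp

lemma kx_add_le: "kx (g + h) \<le> kx g + kx h"
proof -
  obtain q' s r' where s: "g = q' + s" "h = - s + r'" "red q' s" "red (- s) r'" "red q' r'"
    using cancellation[of g h] by blast
  have "kx g = kx q' + kx s" "kx h = kx s + kx r'"
    using kx_red[OF s(3)] kx_red[OF s(4)] by (simp_all only: s(1,2) kx_uminus)
  moreover have "kx (g + h) = kx q' + kx r'"
    using kx_red[OF s(5)] by (simp add: s(1,2) add.assoc)
  ultimately show ?thesis
    by simp
qed

lemma kx_add_eq_obtain:
  assumes "kx (q + r) = kx q + kx r"
  obtains q' s r' where "q = q' + s" "r = - s + r'" "red q' s" "red (- s) r'" "red q' r'" "kx s = 0"
proof -
  obtain q' s r' where s: "q = q' + s" "r = - s + r'" "red q' s" "red (- s) r'" "red q' r'"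
    using cancellation[of q r] by blast
  have "kx q = kx q' + kx s" "kx r = kx s + kx r'"
    using kx_red[OF s(3)] kx_red[OF s(4)] by (simp_all only: s(1,2) kx_uminus)
  moreover have "kx (q + r) = kx q' + kx r'"
    using kx_red[OF s(5)] by (simp add: s(1,2) add.assoc)
  ultimately show ?thesis
    using that[OF s] assms by simp
qed

lemma expo_kx_zero: "kx g = 0 \<Longrightarrow> x \<in> S \<Longrightarrow> expo x g = 0"
proof (rule expo_notin_supp)
  assume *: "kx g = 0" "x \<in> S"
  show "x \<notin> supp g"
  proof
    assume "x \<in> supp g"
    then obtain l where "l \<in># mset (rep g)" "fst l = x"
      by (auto simp: supp_def)
    then have "l \<in># {#l \<in># mset (rep g). fst l \<in> S#}"
      using *(2) by simp
    then show False
      using *(1) unfolding kx_def by (metis size_eq_0_iff_empty empty_not_add_mset multi_member_split)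
  qed
qed

definition xend :: "'v raag \<Rightarrow> bool" where
  "xend h \<longleftrightarrow> h \<in> gp U \<and> (\<exists>a. ends a h \<and> fst a \<in> S)"

lemma xend_ends: "xend h \<Longrightarrow> ends a h \<Longrightarrow> ends b h \<Longrightarrow> a = b"
proof (rule ccontr)
  assume h: "xend h" "ends a h" "ends b h" "a \<noteq> b"
  obtain c where c: "ends c h" "fst c \<in> S" "h \<in> gp U"
    using h(1) by (auto simp: xend_def)
  have "d = c" if "ends d h" for d
  proof (rule ccontr)
    assume "d \<noteq> c"
    then have "linv c \<noteq> linv d"
      by (metis linv_linv)
    then have "adj (fst c) (fst d)"
      using starts_two[of "linv c" "- h" "linv d"] c(1) that unfolding ends_def fst_linv by blast
    moreover have "fst d \<in> U"
      using ends_imp_supp[OF that] c(3) by (auto simp: gp_def)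
    ultimately show False
      using isolated[OF c(2)] by blast
  qed
  then show False
    using h by metis
qed

lemma xend_irr:
  assumes "xend h"
  obtains p c where "h = p + lett c" "irr p c" "fst c \<in> S"
proof -
  obtain c where c: "ends c h" "fst c \<in> S"
    using assms by (auto simp: xend_def)
  obtain p where p: "h = p + lett c" "len h = Suc (len p)"
    using c(1) by (rule ends_obtain)
  have "irr p c"
    unfolding irr_def red_def using p xend_ends[OF assms c(1)] by (simp add: p(1)[symmetric])
  then show ?thesis
    using that p c by blast
qed

lemma xend_gp: "xend h \<Longrightarrow> h \<in> gp U"
  by (simp add: xend_def)

text \<open>Vertices of \<open>S\<close> are pairwise non-adjacent, so prefixes ending in an
  \<open>S\<close>-letter form a chain and are indexed by their number of \<open>S\<close>-letters.
  General prefixes may fail to be comparable.\<close>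

lemma xend_comparable:
  assumes "xend h" "xend h'" "pre h g" "pre h' g"
  shows "pre h h' \<or> pre h' h"
proof -
  obtain p c where c: "h = p + lett c" "irr p c" "fst c \<in> S"
    using assms(1) by (rule xend_irr)
  obtain p' c' where c': "h' = p' + lett c'" "irr p' c'" "fst c' \<in> S"
    using assms(2) by (rule xend_irr)
  have "\<not> adj (fst c) (fst c')"
    using isolated c(3) c'(3) SU by blast
  then show ?thesis
    using irr_comparable[OF c(2) c'(2)] assms(3,4) unfolding c(1) c'(1) by blast
qed

lemma xend_pre_less:
  assumes "xend h'" "pre h h'" "h \<noteq> h'"
  shows "kx h < kx h'"
proof -
  obtain r where r: "h' = h + r" "red h r"
    using assms(2) by (rule pre_obtain)
  then have "r \<noteq> 0"
    using assms(3) by auto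
  then obtain b where b: "ends b r"
    using ends_exists by blast
  obtain r' where r': "r = r' + lett b" "len r = Suc (len r')"
    using b by (rule ends_obtain)
  have "ends b h'"
    using ends_red[OF r(2) b] r(1) by simp
  then have "fst b \<in> S"
    using assms(1) xend_ends unfolding xend_def by blast
  then have "0 < kx r"
    using kx_red[of r' "lett b"] r' by (simp add: red_def)
  then show ?thesis
    using kx_red[OF r(2)] r(1) by simp
qed

lemma xpre_unique:
  assumes "xend h" "xend h'" "pre h g" "pre h' g" "kx h = kx h'"
  shows "h = h'"
  using xend_comparable[OF assms(1-4)] xend_pre_less[OF assms(1)] xend_pre_less[OF assms(2)] assms(5)
  by (metis less_irrefl)

lemma xpre_exists:
  assumes "g \<in> gp U" "1 \<le> j" "j \<le> kx g"
  shows "\<exists>h. xend h \<and> pre h g \<and> kx h = j"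
  using assms
proof (induction "len g" arbitrary: g)
  case 0
  then show ?case
    by simp
next
  case (Suc n)
  have "g \<noteq> 0"
    using Suc.hyps(2) by auto
  then obtain a where a: "ends a g"
    using ends_exists by blast
  obtain g' where g': "g = g' + lett a" "len g = Suc (len g')"
    using a by (rule ends_obtain)
  have r: "red g' (lett a)"
    using g' by (simp add: red_def)
  have kx: "kx g = kx g' + (if fst a \<in> S then 1 else 0)"
    using kx_red[OF r] g'(1) by simp
  have g'U: "g' \<in> gp U"
    using red_gp[OF r] g'(1) Suc.prems(1) by simp
  show ?case
  proof (cases "j \<le> kx g'")
    case True
    then obtain h where "xend h" "pre h g'" "kx h = j"
      using Suc.hyps(1)[of g'] Suc.hyps(2) g'(2) g'U Suc.prems(2) by auto
    moreover have "pre g' g"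
      using r g'(1) by simp
    ultimately show ?thesis
      using pre_trans by blast
  next
    case False
    then have "kx g = j" "fst a \<in> S"
      using kx Suc.prems(3) by (auto split: if_splits)
    moreover from this have "xend g"
      using a Suc.prems(1) unfolding xend_def by blast
    ultimately show ?thesis
      using pre_refl by blast
  qed
qed

text \<open>The shortest prefix containing \<open>j\<close> of the \<open>S\<close>-letters, well
  defined for \<open>1 \<le> j\<close> and \<open>j \<le> kx g\<close>.\<close>

definition xpre :: "nat \<Rightarrow> 'v raag \<Rightarrow> 'v raag" where
  "xpre j g = (THE h. xend h \<and> pre h g \<and> kx h = j)"

lemma xpre_eq: "xend h \<Longrightarrow> pre h g \<Longrightarrow> xpre (kx h) g = h"
  unfolding xpre_def using xpre_unique by (intro the_equality) auto

lemma xpre: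
  assumes "g \<in> gp U" "1 \<le> j" "j \<le> kx g"
  shows "xend (xpre j g)" "pre (xpre j g) g" "kx (xpre j g) = j"
proof -
  obtain h where h: "xend h" "pre h g" "kx h = j"
    using xpre_exists[OF assms] by blast
  then have "xpre j g = h"
    using xpre_eq by blast
  then show "xend (xpre j g)" "pre (xpre j g) g" "kx (xpre j g) = j"
    using h by auto
qed

lemma xpre_pre:
  assumes "pre h g" "g \<in> gp U" "1 \<le> j" "j \<le> kx h"
  shows "xpre j g = xpre j h"
proof -
  have h: "h \<in> gp U"
    using assms(1,2) pre_gp by blast
  show ?thesis
    using xpre_eq[OF xpre(1)[OF h assms(3,4)] pre_trans[OF xpre(2)[OF h assms(3,4)] assms(1)]]
      xpre(3)[OF h assms(3,4)] by simp
qed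

lemma xpre_red:
  assumes "red q r" "r \<in> gp U" "q \<in> gp U" "1 \<le> j" "j \<le> kx r"
  shows "xpre (kx q + j) (q + r) = q + xpre j r"
proof -
  have x: "xend (xpre j r)" "pre (xpre j r) r" "kx (xpre j r) = j"
    using xpre[OF assms(2,4,5)] by auto
  have p: "pre (q + xpre j r) (q + r)"
    using pre_left[OF assms(1) x(2)] .
  obtain t where t: "r = xpre j r + t" "red (xpre j r) t"
    using x(2) by (rule pre_obtain)
  have rq: "red q (xpre j r)"
    using assms(1) t red_assoc2 by metis
  have "xend (q + xpre j r)"
    using x(1) assms(3) ends_red[OF rq] by (auto simp: xend_def)
  moreover have "kx (q + xpre j r) = kx q + j"
    using kx_red[OF rq] x(3) by simp
  ultimately show ?thesis
    using xpre_eq p by metis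
qed

lemma xpre_add_left:
  assumes "kx (q + r) = kx q + kx r" "q \<in> gp U" "r \<in> gp U" "1 \<le> j" "j \<le> kx q"
  shows "xpre j (q + r) = xpre j q"
proof -
  obtain q' s r' where s: "q = q' + s" "r = - s + r'" "red q' s" "red (- s) r'" "red q' r'" "kx s = 0"
    using assms(1) by (rule kx_add_eq_obtain)
  have k: "kx q = kx q'"
    using kx_red[OF s(3)] s(1,6) by simp
  have e: "q + r = q' + r'"
    by (simp add: s(1,2) add.assoc)
  have "xpre j q = xpre j q'"
    using xpre_pre[of q' q j] s(1,3) assms(2,4,5) k by simp
  moreover have "xpre j (q + r) = xpre j q'"
    using xpre_pre[of q' "q + r" j] s(5) assms(2-5) k e gp_add[OF assms(2,3)] by simp
  ultimately show ?thesis
    by simp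
qed

lemma xpre_add_right:
  assumes "kx (q + r) = kx q + kx r" "q \<in> gp U" "r \<in> gp U" "1 \<le> j" "j \<le> kx r"
  shows "xpre (kx q + j) (q + r) = q + xpre j r"
proof -
  obtain q' s r' where s: "q = q' + s" "r = - s + r'" "red q' s" "red (- s) r'" "red q' r'" "kx s = 0"
    using assms(1) by (rule kx_add_eq_obtain)
  have k: "kx q = kx q'"
    using kx_red[OF s(3)] s(1,6) by simp
  have k': "kx r = kx r'"
    using kx_red[OF s(4)] s(2,6) by simp
  have e: "q + r = q' + r'"
    by (simp add: s(1,2) add.assoc)
  have g: "q' \<in> gp U" "s \<in> gp U" "r' \<in> gp U"
    using red_gp[OF s(3)] red_gp[OF s(4)] s(1,2) assms(2,3) by auto
  have "xpre (kx (- s) + j) (- s + r') = - s + xpre j r'"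
    using xpre_red[OF s(4)] g assms(4,5) k' by simp
  then have "xpre j r = - s + xpre j r'"
    by (simp only: s(2,6) kx_uminus add_0)
  moreover have "xpre (kx q' + j) (q' + r') = q' + xpre j r'"
    using xpre_red[OF s(5)] g assms(4,5) k' by simp
  ultimately show ?thesis
    unfolding e k by (simp add: s(1) add.assoc)
qed

text \<open>Read from the other end, the \<open>j\<close>-th of \<open>kx g\<close> letters over
  \<open>S\<close> is number \<open>kx g + 1 - j\<close>.\<close>

lemma xpre_flip:
  assumes "g \<in> gp U" "1 \<le> j" "j \<le> kx g" "xpre j g = p + lett c" "g = p + lett c + r"
    "red p (lett c)"
  shows "xpre (Suc (kx g) - j) (- g) = - r - lett c"
proof -
  have x: "xend (xpre j g)" "pre (xpre j g) g" "kx (xpre j g) = j"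
    using xpre[OF assms(1-3)] by auto
  have r: "red (p + lett c) r"
    using x(2) assms(4,5) by simp
  have rc: "red (lett c) r" "red p (lett c + r)"
    using red_assoc[OF assms(6)] r by auto
  have ec: "ends c (p + lett c)"
    using assms(6) by (simp add: red_lett_right)
  have "fst c \<in> S"
    using x(1) xend_ends[OF x(1)] ec assms(4) unfolding xend_def by metis
  have "red (- (lett c + r)) (- p)"
    using rc(2) by (simp only: red_uminus)
  then have "red (- r - lett c) (- p)"
    by (simp only: minus_add diff_conv_add_uminus)
  moreover have "- g = - r - lett c + - p"
    by (simp only: assms(5) minus_add diff_conv_add_uminus add.assoc)
  ultimately have p: "pre (- r - lett c) (- g)"
    by (simp only: pre_add_iff)
  have "red (- r) (lett (linv c))"
    using rc(1) red_uminus[of r "lett c"] by simp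
  then have "ends (linv c) (- r + lett (linv c))"
    by (simp only: ends_add_lett_iff red_lett_right not_False_eq_True)
  then have "ends (linv c) (- r - lett c)"
    by simp
  moreover have "- r - lett c \<in> gp U"
    using p assms(1) pre_gp[OF p] by simp
  ultimately have "xend (- r - lett c)"
    using \<open>fst c \<in> S\<close> unfolding xend_def by (metis fst_linv)
  moreover have "kx (- r - lett c) = kx (lett c + r)"
    using kx_uminus[of "lett c + r"] by (simp add: minus_add)
  moreover have "kx g = kx p + kx (lett c + r)" "j = kx p + kx (lett c)"
    using kx_red[OF rc(2)] kx_red[OF assms(6)] x(3) assms(4,5) by (simp_all add: add.assoc)
  moreover have "kx (lett c) = 1"
    using \<open>fst c \<in> S\<close> by simp
  ultimately show ?thesis
    using xpre_eq[OF _ p] by simp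
qed

definition rk :: "'v raag \<Rightarrow> nat" where
  "rk = (SOME rk. inj_on rk (gp U) \<and> (\<forall>g \<in> gp U. \<forall>h \<in> gp U. len g < len h \<longrightarrow> rk g < rk h))"

lemma rk: "inj_on rk (gp U)" "g \<in> gp U \<Longrightarrow> h \<in> gp U \<Longrightarrow> len g < len h \<Longrightarrow> rk g < rk h"
  using someI_ex[OF rank_exists[OF finU]] unfolding rk_def by blast+

definition xlist :: "nat \<Rightarrow> 'v raag \<Rightarrow> nat list" where
  "xlist n g = map (\<lambda>j. rk (xpre j g)) [1..<Suc n]"

lemma length_xlist [simp]: "length (xlist n g) = n"
  by (simp add: xlist_def)

lemma nth_xlist: "i < n \<Longrightarrow> xlist n g ! i = rk (xpre (Suc i) g)"
  by (simp add: xlist_def del: upt_Suc)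

lemma xlist_cong: "(\<And>j. 1 \<le> j \<Longrightarrow> j \<le> n \<Longrightarrow> xpre j g = xpre j h) \<Longrightarrow> xlist n g = xlist n h"
  unfolding xlist_def by (intro map_cong) (auto simp del: upt_Suc)

lemma xlist_eqD:
  assumes "xlist n g = xlist n h" "g \<in> gp U" "h \<in> gp U" "n \<le> kx g" "n \<le> kx h" "1 \<le> j" "j \<le> n"
  shows "xpre j g = xpre j h"
proof -
  have "rk (xpre j g) = rk (xpre j h)"
    using assms(1,6,7) nth_xlist[of "j - 1" n g] nth_xlist[of "j - 1" n h] by simp
  moreover have "xpre j g \<in> gp U" "xpre j h \<in> gp U"
    using xpre(1)[of g j] xpre(1)[of h j] assms xend_gp by auto
  ultimately show ?thesis
    using rk(1) by (simp add: inj_on_def)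
qed

text \<open>The weight in the Nielsen reduction: the number of \<open>S\<close>-letters, with ties broken by an order on
  the initial halves.\<close>

definition key :: "'v raag \<Rightarrow> nat \<times> nat list" where
  "key g = (kx g, xlist (kx g div 2) g)"

definition keyrel :: "((nat \<times> nat list) \<times> (nat \<times> nat list)) set" where
  "keyrel = less_than <*lex*> lex less_than"

lemma wf_keyrel: "wf keyrel"
  unfolding keyrel_def by (intro wf_lex_prod wf_lex wf_less_than)

lemma key_drop: "kx g < kx h \<Longrightarrow> (key g, key h) \<in> keyrel"
  by (simp add: key_def keyrel_def)

text \<open>Prefixes ending before the deleted letter are unchanged, and those ending behind it
  become shorter and drop in rank. No entry grows, which suffices for the lexicographic
  comparison.\<close>

lemma xlist_shorten:
  assumes "red q (lett a + r)" "red (lett a) r" "fst a \<notin> S" "q + lett a + r \<in> gp U"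
    and 2: "kx (q + r) = kx q + kx r" and n: "n \<le> kx q + kx r"
  shows "xlist n (q + r) = xlist n (q + lett a + r) \<or>
    (xlist n (q + r), xlist n (q + lett a + r)) \<in> lex less_than"
proof -
  let ?g = "q + r" and ?h = "q + lett a + r"
  have h: "?h = q + (lett a + r)"
    by (simp add: add.assoc)
  have gpU: "q \<in> gp U" "r \<in> gp U" "fst a \<in> U"
    using red_gp[OF assms(1)] red_gp[OF assms(2)] assms(4) unfolding h by auto
  have kh: "kx ?h = kx q + kx r"
    unfolding h using kx_red[OF assms(1)] kx_red[OF assms(2)] assms(3) by simp
  have rqa: "red q (lett a)" "red (q + lett a) r"
    using assms(1) red_assoc2[OF assms(2)] by auto
    have "rk (xpre j ?g) \<le> rk (xpre j ?h)" if "1 \<le> j" "j \<le> kx q + kx r" for j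
    proof (cases "j \<le> kx q")
      case True
      have "xpre j ?g = xpre j q"
        using xpre_add_left[OF 2 gpU(1,2) that(1) True] .
      moreover have "xpre j ?h = xpre j q"
        using xpre_add_left[of q "lett a + r" j] kh gpU that(1) True kx_red[OF assms(2)] assms(3)
        unfolding h by simp
      ultimately show ?thesis
        by simp
    next
      case False
      define i where "i = j - kx q"
      have i: "j = kx q + i" "1 \<le> i" "i \<le> kx r"
        using False that by (simp_all add: i_def)
      have x: "xend (xpre i r)" "pre (xpre i r) r"
        using xpre[OF gpU(2) i(2,3)] by auto
      obtain t where t: "r = xpre i r + t" "red (xpre i r) t"
        using x(2) by (rule pre_obtain)
      have 3: "xpre j ?g = q + xpre i r"
        using xpre_add_right[OF 2 gpU(1,2) i(2,3)] i(1) by simp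
      have "kx (q + lett a) = kx q"
        using kx_red[OF rqa(1)] assms(3) by simp
      then have 4: "xpre j ?h = q + lett a + xpre i r"
        using xpre_red[OF rqa(2) gpU(2) _ i(2,3)] gpU i(1) by simp
      have "red (q + lett a) (xpre i r)"
        using rqa(2) t red_assoc2 by metis
      then have "len (xpre j ?h) = len q + 1 + len (xpre i r)"
        using rqa(1) unfolding 4 red_def by simp
      then have "len (xpre j ?g) < len (xpre j ?h)"
        using len_add_le[of q "xpre i r"] unfolding 3 by simp
      moreover have "xpre j ?g \<in> gp U" "xpre j ?h \<in> gp U"
        unfolding 3 4 using gpU xend_gp[OF x(1)] by simp_all
      ultimately show ?thesis
        using rk(2) less_imp_le by blast
    qed
    note le = this
  show ?thesis
    proof (rule ccontr)
      assume "\<not> ?thesis"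
      then have "(xlist n ?h, xlist n ?g) \<in> lex less_than"
        using lex_total[of "xlist n ?g" "xlist n ?h"] by simp
      then obtain i where "i < n" "xlist n ?h ! i < xlist n ?g ! i"
        unfolding lex_nth by auto
      moreover from this(1) have "Suc i \<le> kx q + kx r"
        using n by linarith
      ultimately show False
        using le[of "Suc i"] by (simp add: nth_xlist)
    qed
qed

lemma key_shorten:
  assumes "red q (lett a + r)" "red (lett a) r" "fst a \<notin> S" "q + lett a + r \<in> gp U"
  shows "key (q + r) = key (q + lett a + r) \<or> (key (q + r), key (q + lett a + r)) \<in> keyrel"
proof -
  have kh: "kx (q + lett a + r) = kx q + kx r"
    using kx_red[OF assms(1)] kx_red[OF assms(2)] assms(3) by (simp add: add.assoc)
  consider "kx (q + r) < kx (q + lett a + r)" | "kx (q + r) = kx q + kx r"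
    using kx_add_le[of q r] kh by linarith
  then show ?thesis
  proof cases
    case 1
    then show ?thesis
      using key_drop by blast
  next
    case 2
    then show ?thesis
      using xlist_shorten[OF assms 2, of "(kx q + kx r) div 2"] kh by (auto simp: key_def keyrel_def)
  qed
qed

text \<open>The exchanged head lies within the first half of the \<open>S\<close>-letters, so the
  smaller list is visible in the key; if \<open>S\<close>-letters get lost on the way, the key drops
  even faster.\<close>

lemma key_exchange:
  assumes p: "kx p = i" "kx s = i" "(xlist i p, xlist i s) \<in> lex less_than"
    and r: "kx r \<le> kx r'" "red s r'" "i \<le> kx (s + r') div 2"
    and U: "p \<in> gp U" "s \<in> gp U" "r \<in> gp U" "r' \<in> gp U"
  shows "(key (p + r), key (s + r')) \<in> keyrel"
proof -
  have k: "kx (s + r') = i + kx r'"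
    using kx_red[OF r(2)] p(2) by simp
  consider "kx (p + r) < kx (s + r')" | "kx (p + r) = kx (s + r')" "kx (p + r) = kx p + kx r"
    using kx_add_le[of p r] k p(1) r(1) by linarith
  then show ?thesis
  proof cases
    case 1
    then show ?thesis
      using key_drop by blast
  next
    case 2
    let ?n = "kx (s + r') div 2"
    obtain m where m: "m < i" "\<forall>j < m. xlist i p ! j = xlist i s ! j" "xlist i p ! m < xlist i s ! m"
      using p(3) unfolding lex_nth by auto
    have a: "xlist ?n (p + r) ! j = xlist i p ! j" if "j < i" for j
      using xpre_add_left[OF 2(2) U(1,3), of "Suc j"] that p(1) r(3) by (simp add: nth_xlist)
    have b: "xlist ?n (s + r') ! j = xlist i s ! j" if "j < i" for j
      using xpre_add_left[OF kx_red[OF r(2)] U(2,4), of "Suc j"] that p(2) r(3) by (simp add: nth_xlist)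
    have "(xlist ?n (p + r), xlist ?n (s + r')) \<in> lex less_than"
      unfolding lex_nth using m a b r(3) by (auto intro!: exI[of _ m])
    then show ?thesis
      using 2(1) by (simp add: key_def keyrel_def)
  qed
qed

text \<open>Complementary to \<open>key_exchange\<close>: the head covers the first half, so the
  list in the key depends on the head alone.\<close>

lemma key_prefix:
  assumes r: "red s m'" "kx p \<le> kx s" "kx m \<le> kx m'" "kx (s + m') div 2 \<le> kx s"
    and U: "p \<in> gp U" "s \<in> gp U" "m \<in> gp U" "m' \<in> gp U"
    and x: "kx p = kx s \<Longrightarrow> xlist (kx (s + m') div 2) p = xlist (kx (s + m') div 2) s \<or>
      (xlist (kx (s + m') div 2) p, xlist (kx (s + m') div 2) s) \<in> lex less_than"
  shows "key (p + m) = key (s + m') \<or> (key (p + m), key (s + m')) \<in> keyrel"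
proof -
  consider "kx (p + m) < kx (s + m')" | "kx (p + m) = kx (s + m')" "kx (p + m) = kx p + kx m" "kx p = kx s"
    using kx_add_le[of p m] kx_red[OF r(1)] r(2,3) by linarith
  then show ?thesis
  proof cases
    case 1
    then show ?thesis
      using key_drop by blast
  next
    case 2
    let ?n = "kx (s + m') div 2"
    have "xlist ?n (p + m) = xlist ?n p"
      using xpre_add_left[OF 2(2) U(1,3)] r(4) 2(3) by (intro xlist_cong) simp
    moreover have "xlist ?n (s + m') = xlist ?n s"
      using xpre_add_left[OF kx_red[OF r(1)] U(2,4)] r(4) by (intro xlist_cong) simp
    ultimately show ?thesis
      using x[OF 2(3)] 2(1) by (auto simp: key_def keyrel_def)
  qed
qed

text \<open>If \<open>g\<close> and \<open>- g\<close> had the same first half, then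
  \<open>g\<close> would be a conjugate of an element \<open>m\<close> without
  \<open>S\<close>-letters, and all its exponents at \<open>S\<close> would vanish.\<close>

lemma xlist_flip_neq:
  assumes g: "g \<in> gp U" "even (kx g)" "x \<in> S" "expo x g \<noteq> 0"
  shows "xlist (kx g div 2) g \<noteq> xlist (kx g div 2) (- g)"
proof
  assume eq: "xlist (kx g div 2) g = xlist (kx g div 2) (- g)"
  have "kx g \<noteq> 0"
    using expo_kx_zero g(3,4) by blast
  then obtain n where n: "kx g = 2 * n" "1 \<le> n"
    using g(2) by (metis One_nat_def Suc_leI dvdE gr0I mult_0_right)
  let ?h = "xpre n g" and ?h' = "xpre (Suc n) g"
  have h: "xend ?h" "pre ?h g" "kx ?h = n"
    using xpre[OF g(1), of n] n by auto
  have h': "xend ?h'" "pre ?h' g" "kx ?h' = Suc n"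
    using xpre[OF g(1), of "Suc n"] n by auto
  obtain p c where c: "?h' = p + lett c" "irr p c" "fst c \<in> S"
    using h'(1) by (rule xend_irr)
  obtain r where r: "g = ?h' + r" "red ?h' r"
    using h'(2) by (rule pre_obtain)
  have rpc: "red p (lett c)"
    using c(2) by (simp add: irr_def)
  have "xpre n (- g) = - r - lett c"
    using xpre_flip[OF g(1) _ _ c(1) _ rpc, of r] n r(1) c(1) by simp
  moreover have "xpre n (- g) = ?h"
    using xlist_eqD[OF eq g(1), of n] n g(1) by simp
  ultimately have "lett c + r = - ?h"
    by (metis minus_add minus_minus diff_conv_add_uminus)
  then have gq: "g = p - ?h"
    using r(1) c(1) by (simp add: add.assoc)
  have kp: "kx p = n"
    using h'(3) kx_red[OF rpc] c by simp
  have pp: "pre p g"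
    using rpc c(1) h'(2) pre_trans pre_add_iff by metis
  have pU: "p \<in> gp U"
    using pp g(1) pre_gp by blast
  have "xpre n g = xpre n p"
    using xpre_pre[OF pp g(1) n(2)] kp by simp
  then have "pre ?h p"
    using xpre(2)[OF pU n(2)] kp by simp
  then obtain m where m: "p = ?h + m" "red ?h m"
    by (rule pre_obtain)
  have "kx m = 0"
    using kx_red[OF m(2)] m(1) kp h(3) by simp
  moreover have "expo x g = expo x m"
    using arg_cong[OF gq, of "expo x"] arg_cong[OF m(1), of "expo x"] by simp
  ultimately show False
    using expo_kx_zero g(3,4) by simp
qed

text \<open>The position of the central letter; the side with the smaller list gets the longer head, so
  that a letter whose head is only half of its \<open>S\<close>-letters can be exchanged with profit.\<close>

definition idx :: "'v raag \<Rightarrow> nat" where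
  "idx g = (if odd (kx g) then Suc (kx g) div 2
    else if (xlist (kx g div 2) (- g), xlist (kx g div 2) g) \<in> lex less_than then kx g div 2
    else Suc (kx g div 2))"

text \<open>The third fact says that \<open>g\<close> and \<open>- g\<close> select the same letter,
  counted from opposite ends. The non-zero exponent excludes a tie of the two halves through
  \<open>xlist_flip_neq\<close>.\<close>

lemma idx:
  assumes g: "g \<in> gp U" "x \<in> S" "expo x g \<noteq> 0"
  shows "1 \<le> idx g" "idx g \<le> kx g" "idx (- g) = Suc (kx g) - idx g" "kx g \<le> 2 * idx g"
    "idx g \<le> Suc (kx g div 2)"
    "kx g = 2 * idx g \<Longrightarrow> (xlist (idx g) (- g), xlist (idx g) g) \<in> lex less_than"
proof -
  have k: "kx g \<noteq> 0"
    using expo_kx_zero g by blast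
  have "even (kx g) \<Longrightarrow> xlist (kx g div 2) (- g) \<in> {l. l \<noteq> xlist (kx g div 2) g}"
    using xlist_flip_neq[OF g(1) _ g(2,3)] by auto
  then have even: "(xlist (kx g div 2) (- g), xlist (kx g div 2) g) \<in> lex less_than \<longleftrightarrow>
    (xlist (kx g div 2) g, xlist (kx g div 2) (- g)) \<notin> lex less_than" if "even (kx g)"
    using that lex_total[of "xlist (kx g div 2) (- g)" "xlist (kx g div 2) g"] lex_asym by auto
  show "1 \<le> idx g" "idx g \<le> kx g" "kx g \<le> 2 * idx g" "idx g \<le> Suc (kx g div 2)"
    using k unfolding idx_def by (auto elim!: evenE oddE)
  show "idx (- g) = Suc (kx g) - idx g"
    using even k unfolding idx_def by (auto elim!: evenE oddE)
  show "kx g = 2 * idx g \<Longrightarrow> (xlist (idx g) (- g), xlist (idx g) g) \<in> lex less_than"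
    unfolding idx_def by (auto split: if_splits elim!: evenE oddE)
qed

end

section \<open>Reduction over one class of vertices\<close>

lemma gp_surj:
  assumes "ghom f" "\<And>v. v \<in> W \<Longrightarrow> \<exists>z \<in> gp U. f z = gen v" "g \<in> gp W"
  shows "\<exists>z \<in> gp U. f z = g"
  using assms(3)
proof (induction g rule: gp_induct)
  case zero
  show ?case
    using ghom_zero[OF assms(1)] gp_zero by blast
next
  case (add a g)
  obtain z where z: "z \<in> gp U" "f z = g"
    using add by blast
  obtain y where y: "y \<in> gp U" "f y = gen (fst a)"
    using assms(2) add(1) by blast
  have "\<exists>y' \<in> gp U. f y' = lett a"
  proof (cases "snd a")
    case True
    then show ?thesis
      using y by (metis prod.collapse)
  next
    case False
    then have "lett a = - gen (fst a)"
      by (metis lett_False prod.collapse)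
    then show ?thesis
      using y by (intro bexI[of _ "- y"]) (simp_all add: ghom_uminus[OF assms(1)])
  qed
  then obtain y' where "y' \<in> gp U" "f y' = lett a"
    by blast
  then show ?case
    using z by (intro bexI[of _ "y' + z"]) (simp_all add: ghom_add[OF assms(1)] gp_add)
qed

lemma (in cover) aut_matching:
  assumes "aut V f" "finite V" "closed V"
  shows "\<exists>\<tau>. \<forall>v \<in> V. \<tau> v \<in> V \<and> expo (\<tau> v) (f (gen v)) \<noteq> 0 \<and> card (star (\<tau> v)) = card (star v)"
proof -
  obtain h where "aut_pair V f h"
    using assms(1) by (auto simp: aut_def)
  then interpret graph_matrix V "\<lambda>x u. of_int (expo x (f (gen u)))" "\<lambda>x u. of_int (expo x (h (gen u)))"
    using aut_pair_graph_matrix assms(2,3) by blast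
  obtain \<tau> where \<tau>: "bij_betw \<tau> V V" "\<forall>v \<in> V. (of_int (expo (\<tau> v) (f (gen v))) :: rat) \<noteq> 0"
    using matching_exists by blast
  interpret matched_graph_matrix V "\<lambda>x u. of_int (expo x (f (gen u)))" "\<lambda>x u. of_int (expo x (h (gen u)))" \<tau>
    using \<tau> by unfold_locales auto
  show ?thesis
    using \<tau>(2) deg_eq tau_in by (intro exI[of _ \<tau>]) simp
qed

text \<open>Here \<open>S\<close> is the part of \<open>U\<close> of one degree and \<open>D\<close>
  contains generators known to be conjugated. \<open>D\<close> avoids \<open>S\<close> because the
  generators of \<open>S\<close> are the ones that get transvected. The last application takes
  \<open>S\<close> empty and \<open>U = D = VG\<close>.\<close>

locale stage = cover VL VG \<phi> + free_part U S
  for VL :: "'v::graph set" and VG :: "'w::graph set" and \<phi> and U S :: "'w set" +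
  fixes D :: "'w set"
  assumes UV: "U \<subseteq> VG" and DV: "D \<subseteq> VG" and UD: "U - S \<subseteq> D" and DS: "D \<inter> S = {}"
    and dom: "x \<in> S \<Longrightarrow> u \<in> U \<Longrightarrow> le' x u"
    and deg: "x \<in> S \<Longrightarrow> u \<in> U \<Longrightarrow> u \<in> S \<longleftrightarrow> card (star u) = card (star x)"
begin

text \<open>Transvections destroy the unit matrix in the columns over \<open>S\<close>; there only
  the position of the non-zero entries is preserved. Surjectivity on \<open>gp U\<close> is included
  for \<open>letters_from_centres\<close>.\<close>

definition good :: "('w raag \<Rightarrow> 'w raag) \<Rightarrow> ('v raag \<Rightarrow> 'v raag) \<Rightarrow> bool" where
  "good f F \<longleftrightarrow> laut f F \<and> \<not> GEN f \<and>
    (\<forall>u \<in> VL. \<forall>z \<in> VL. if \<phi> u \<in> S then expo z (F (gen u)) \<noteq> 0 \<longrightarrow> le u z \<and> \<not> adj u z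
      else expo z (F (gen u)) = (if z = u then 1 else 0)) \<and>
    (\<forall>d \<in> D. \<exists>h \<in> gp VG. f (gen d) = h + gen d - h) \<and>
    (\<forall>g \<in> gp U. f g \<in> gp U \<and> (\<exists>z \<in> gp U. f z = g))"

lemma goodD:
  assumes "good f F"
  shows "laut f F" "\<not> GEN f" "ghom f" "ghom F"
    and "u \<in> VL \<Longrightarrow> z \<in> VL \<Longrightarrow> \<phi> u \<notin> S \<Longrightarrow> expo z (F (gen u)) = (if z = u then 1 else 0)"
    and "u \<in> VL \<Longrightarrow> z \<in> VL \<Longrightarrow> \<phi> u \<in> S \<Longrightarrow> expo z (F (gen u)) \<noteq> 0 \<Longrightarrow> le u z \<and> \<not> adj u z"
    and "d \<in> D \<Longrightarrow> \<exists>h \<in> gp VG. f (gen d) = h + gen d - h"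
    and "g \<in> gp U \<Longrightarrow> f g \<in> gp U" "g \<in> gp U \<Longrightarrow> \<exists>z \<in> gp U. f z = g"
  using assms laut_ghom[of f F] unfolding good_def by (auto split: if_splits)

lemma S_VG: "x \<in> S \<Longrightarrow> x \<in> VG"
  using SU UV by blast

lemma laut_gp:
  assumes "laut f F"
  shows "g \<in> gp VG \<Longrightarrow> f g \<in> gp VG" "k \<in> gp VL \<Longrightarrow> F k \<in> gp VL"
  using assms aut_gp unfolding laut_def by blast+

lemma good_comp:
  assumes f: "good f F" and e: "mv e E"
    and E: "\<And>u z. u \<in> VL \<Longrightarrow> z \<in> VL \<Longrightarrow> if \<phi> u \<in> S then expo z (F (E (gen u))) \<noteq> 0 \<longrightarrow> le u z \<and> \<not> adj u z
      else expo z (F (E (gen u))) = expo z (F (gen u))"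
    and D: "\<And>d. d \<in> D \<Longrightarrow> \<exists>h \<in> gp VG. e (gen d) = h + gen d - h"
    and U: "\<And>u. u \<in> U \<Longrightarrow> e (gen u) \<in> gp U" "\<And>u. u \<in> U \<Longrightarrow> \<exists>z \<in> gp U. e z = gen u"
  shows "good (\<lambda>g. f (e g)) (\<lambda>g. F (E g))"
proof -
  note g = goodD[OF f]
  have le: "laut e E" "ghom e"
    using mv_laut[OF e] laut_ghom by blast+
  have "\<not> GEN (\<lambda>g. f (e g))"
    using e g(2,3) unfolding mv_def by blast
  moreover have "\<exists>h \<in> gp VG. f (e (gen d)) = h + gen d - h" if "d \<in> D" for d
  proof -
    obtain h where h: "h \<in> gp VG" "e (gen d) = h + gen d - h"
      using D \<open>d \<in> D\<close> by blast
    obtain k where k: "k \<in> gp VG" "f (gen d) = k + gen d - k"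
      using g(7) \<open>d \<in> D\<close> by blast
    have "f (e (gen d)) = f h + f (gen d) - f h"
      by (simp add: h(2) ghom_add[OF g(3)] ghom_diff[OF g(3)])
    also have "\<dots> = (f h + k) + gen d - (f h + k)"
      by (simp only: k(2) conj_conj)
    finally show ?thesis
      using laut_gp(1)[OF g(1) h(1)] k(1) gp_add by blast
  qed
  moreover have "f (e g) \<in> gp U \<and> (\<exists>z \<in> gp U. f (e z) = g)" if gU: "g \<in> gp U" for g
  proof
    show "f (e g) \<in> gp U"
      using ghom_image_gp[OF le(2) U(1) gU] g(8) by blast
    obtain z where z: "z \<in> gp U" "f z = g"
      using g(9) gU by blast
    then show "\<exists>z \<in> gp U. f (e z) = g"
      using gp_surj[OF le(2) U(2) z(1)] by blast
  qed
  moreover have "if \<phi> u \<in> S then expo z (F (E (gen u))) \<noteq> 0 \<longrightarrow> le u z \<and> \<not> adj u z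
      else expo z (F (E (gen u))) = (if z = u then 1 else 0)" if "u \<in> VL" "z \<in> VL" for u z
    using E[OF that] g(5)[OF that] by (cases "\<phi> u \<in> S") simp_all
  ultimately show ?thesis
    unfolding good_def using laut_comp[OF g(1) le(1)] by blast
qed

lemma good_transvection:
  assumes f: "good f F" and b: "fst b \<in> S" and a: "fst a \<in> U" "fst a \<noteq> fst b"
  shows "\<exists>f' F'. good f' F' \<and> f' (lett b) = - f (lett a) + f (lett b) \<and>
    (\<forall>c. fst c \<in> VG \<longrightarrow> fst c \<noteq> fst b \<longrightarrow> f' (lett c) = f (lett c))"
proof -
  note g = goodD[OF f]
  \<comment> \<open>For a negative letter \<open>b\<close>, putting \<open>- lett a\<close> in front
    of \<open>lett b\<close> means putting \<open>lett a\<close> behind the generator; for a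
    positive one the generator itself is multiplied on the left by the inverse of
    \<open>a\<close>.\<close>
  let ?x = "fst b" and ?s = "\<not> snd b"
  let ?a = "if ?s then a else linv a"
  have l: "le' ?x (fst ?a)" "?x \<noteq> fst ?a"
    using dom[OF b a(1)] a(2) by auto
  obtain e E where mv: "mv e E"
    and e: "\<And>v. v \<in> VG \<Longrightarrow> e (gen v) = (if v = ?x then if ?s then gen v + lett ?a else lett ?a + gen v else gen v)"
    and E: "\<And>w. w \<in> VL \<Longrightarrow> E (gen w) = (if \<phi> w = ?x
      then if ?s then gen w + lett (lft (fst ?a) w, snd ?a) else lett (lft (fst ?a) w, snd ?a) + gen w
      else gen w)"
    using mv_transvection[OF l, of ?s] by auto
  have le: "ghom e" "ghom E"
    using mv_laut[OF mv] laut_ghom by blast+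
  have xU: "?x \<in> U" "?x \<in> VG" "fst a \<in> VG"
    using b SU UV a(1) by auto
  have fa: "fst ?a = fst a"
    by simp
  have good: "good (\<lambda>g. f (e g)) (\<lambda>g. F (E g))"
  proof (rule good_comp[OF f mv])
    fix u z
    assume u: "u \<in> VL" "z \<in> VL"
    show "if \<phi> u \<in> S then expo z (F (E (gen u))) \<noteq> 0 \<longrightarrow> le u z \<and> \<not> adj u z
      else expo z (F (E (gen u))) = expo z (F (gen u))"
    proof (cases "\<phi> u = ?x")
      case False
      then show ?thesis
        using g(6)[OF u] E[OF u(1)] by simp
    next
      case True
      let ?l = "lft (fst a) u"
      have l': "le' (\<phi> u) (fst a)"
        using dom[OF b a(1)] True by simp
      note lf = lft[OF l' u(1)]
      have lz: "le u z \<and> \<not> adj u z" if "expo z (F (gen ?l)) \<noteq> 0"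
      proof -
        have na: "\<not> adj u ?l"
          using edge[OF u(1)] lf(2) isolated[OF b a(1)] True by metis
        have "le ?l z \<and> \<not> adj ?l z"
        proof (cases "fst a \<in> S")
          case True
          then show ?thesis
            using g(6)[OF lf(1) u(2)] lf(2) that by simp
        next
          case False
          then have "z = ?l"
            using g(5)[OF lf(1) u(2)] lf(2) that by (auto split: if_splits)
          then show ?thesis
            using le_refl adj_irrefl by blast
        qed
        then show ?thesis
          using le_trans lf(3) na unfolding le_def by (metis in_nb in_star subsetD adj_commute)
      qed
      have s: "expo z (F (lett (?l, s))) = (if s then expo z (F (gen ?l)) else - expo z (F (gen ?l)))" for s
        by (cases s) (simp_all add: ghom_uminus[OF g(4)])
      define t where "t = lett (?l, snd ?a)"
      have Eu: "E (gen u) = (if ?s then gen u + t else t + gen u)"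
        unfolding E[OF u(1)] t_def fa using True by simp
      have "expo z (F (E (gen u))) = expo z (F (gen u)) + expo z (F t)"
        unfolding Eu by (simp add: ghom_add[OF g(4)])
      then have "expo z (F (E (gen u))) \<noteq> 0 \<Longrightarrow> expo z (F (gen u)) \<noteq> 0 \<or> expo z (F (gen ?l)) \<noteq> 0"
        using s[of "snd ?a"] unfolding t_def by (auto split: if_splits)
      then show ?thesis
        using lz g(6)[OF u] True b by metis
    qed
  next
    fix d
    assume "d \<in> D"
    then have "d \<in> VG" "d \<noteq> ?x"
      using DV DS b by blast+
    then show "\<exists>h \<in> gp VG. e (gen d) = h + gen d - h"
      using e[of d] by (intro bexI[of _ 0]) simp_all
  next
    fix u
    assume u: "u \<in> U"
    show "e (gen u) \<in> gp U"
      using e[of u] u UV a xU by (auto intro!: gp_add)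
    have ea: "e (lett c) = lett c" if "fst c = fst a" for c
    proof -
      have "e (gen (fst a)) = gen (fst a)"
        using e[of "fst a"] xU a(2) by simp
      then show ?thesis
        using that ghom_uminus[OF le(1), of "gen (fst a)"] by (cases c; cases "snd c") auto
    qed
    show "\<exists>z \<in> gp U. e z = gen u"
    proof (cases "u = ?x")
      case False
      then show ?thesis
        using e[of u] u UV by (intro bexI[of _ "gen u"]) auto
    next
      case True
      have ex: "e (gen ?x) = (if ?s then gen ?x + lett ?a else lett ?a + gen ?x)"
        using e[OF xU(2)] by simp
      let ?z = "if ?s then gen ?x - lett ?a else - lett ?a + gen ?x"
      have "e ?z = gen ?x"
        using ea[OF fa] ex by (auto simp: ghom_add[OF le(1)] ghom_diff[OF le(1)] ghom_uminus[OF le(1)] add.assoc)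
      moreover have "?z \<in> gp U"
        using xU(1) a(1) by (auto intro!: gp_add gp_diff)
      ultimately show ?thesis
        using True by blast
    qed
  qed
  have "f (e (lett b)) = - f (lett a) + f (lett b)"
    using e[OF xU(2)]
    by (cases b; cases "snd b") (auto simp: ghom_add[OF g(3)] ghom_diff[OF g(3)] ghom_uminus[OF g(3)]
      ghom_uminus[OF le(1)] minus_add simp del: add_uminus_conv_diff)
  moreover have "f (e (lett c)) = f (lett c)" if "fst c \<in> VG" "fst c \<noteq> ?x" for c
    using e[OF that(1)] that(2) by (cases c; cases "snd c") (auto simp: ghom_uminus[OF le(1)])
  ultimately show ?thesis
    using good by blast
qed

lemma good_conj:
  assumes f: "good f F" and a: "fst a \<in> U" and C: "saturated (fst a) C"
  shows "\<exists>f' F'. good f' F' \<and> (\<forall>c. fst c \<in> VG \<longrightarrow> f' (lett c) =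
    (if fst c \<in> C then - f (lett a) + f (lett c) + f (lett a) else f (lett c)))"
proof -
  note g = goodD[OF f]
  have aV: "fst (linv a) \<in> VG" "saturated (fst (linv a)) C"
    using a UV C by auto
  obtain e E where mv: "mv e E"
    and e: "\<And>w. w \<in> VG \<Longrightarrow> e (gen w) = (if w \<in> C then lett (linv a) + gen w - lett (linv a) else gen w)"
    and E: "\<And>w. w \<in> VL \<Longrightarrow> \<exists>g \<in> gp VL. E (gen w) = g + gen w - g"
    using mv_partial_conj[OF aV] by blast
  have le: "ghom e" "ghom E"
    using mv_laut[OF mv] laut_ghom by blast+
  have aC: "fst a \<notin> C"
    using C unfolding saturated_def by (auto simp: in_star)
  have ea: "e (lett a) = lett a"
    using e[of "fst a"] aV(1) aC ghom_uminus[OF le(1), of "gen (fst a)"] by (cases a; cases "snd a") auto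
  have el: "e (lett c) = (if fst c \<in> C then - lett a + lett c + lett a else lett c)" if "fst c \<in> VG" for c
    using e[OF that] by (cases c; cases "snd c")
      (auto simp: ghom_uminus[OF le(1)] minus_add add.assoc diff_conv_add_uminus simp del: add_uminus_conv_diff)
  have "good (\<lambda>g. f (e g)) (\<lambda>g. F (E g))"
  proof (rule good_comp[OF f mv])
    fix u z
    assume u: "u \<in> VL" "z \<in> VL"
    obtain k where "E (gen u) = k + gen u - k"
      using E[OF u(1)] by blast
    then have "expo z (F (E (gen u))) = expo z (F (gen u))"
      by (simp add: ghom_add[OF g(4)] ghom_diff[OF g(4)])
    then show "if \<phi> u \<in> S then expo z (F (E (gen u))) \<noteq> 0 \<longrightarrow> le u z \<and> \<not> adj u z
      else expo z (F (E (gen u))) = expo z (F (gen u))"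
      using g(6)[OF u] by simp
  next
    fix d
    assume d: "d \<in> D"
    then have "d \<in> VG"
      using DV by blast
    then show "\<exists>h \<in> gp VG. e (gen d) = h + gen d - h"
    proof (cases "d \<in> C")
      case True
      then show ?thesis
        using e[OF \<open>d \<in> VG\<close>] aV(1) by (intro bexI[of _ "lett (linv a)"]) auto
    next
      case False
      then show ?thesis
        using e[OF \<open>d \<in> VG\<close>] by (intro bexI[of _ 0]) auto
    qed
  next
    fix u
    assume u: "u \<in> U"
    then have uV: "u \<in> VG"
      using UV by blast
    show "e (gen u) \<in> gp U"
      using el[of "(u, True)"] u uV a by (auto intro!: gp_add)
    show "\<exists>z \<in> gp U. e z = gen u"
    proof (cases "u \<in> C")
      case True
      have "e (lett a + gen u - lett a) = gen u"
        using el[of "(u, True)"] uV True ea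
        by (simp add: ghom_add[OF le(1)] ghom_diff[OF le(1)] add.assoc)
      moreover have "lett a + gen u - lett a \<in> gp U"
        using a u by (auto intro!: gp_add gp_diff)
      ultimately show ?thesis
        by blast
    next
      case False
      then show ?thesis
        using el[of "(u, True)"] u uV by (intro bexI[of _ "gen u"]) auto
    qed
  qed
  moreover have "f (e (lett c)) = (if fst c \<in> C then - f (lett a) + f (lett c) + f (lett a) else f (lett c))"
    if "fst c \<in> VG" for c
    using el[OF that] by (simp add: ghom_add[OF g(3)] ghom_uminus[OF g(3)] del: add_uminus_conv_diff)
  ultimately show ?thesis
    by blast
qed

end

section \<open>Vertices that no single lift separates have conjugators agreeing modulo words without
  the separating vertex\<close>

context stage
begin

text \<open>Supplies the exponent required by \<open>centralizer_conj\<close>. Outside the columns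
  over \<open>S\<close> it is the diagonal entry; over \<open>S\<close> the matching gives a vertex
  \<open>z\<close> of equal degree that dominates \<open>a\<close> and hence has the same
  link.\<close>

lemma good_witness:
  assumes f: "good f F" and a: "a \<in> VL"
  shows "\<exists>z \<in> VL. expo z (F (gen a)) \<noteq> 0 \<and> nb z = nb a \<and> (\<forall>b. adj a b \<longrightarrow> expo z (F (gen b)) = 0)"
proof (cases "\<phi> a \<in> S")
  case False
  have "expo a (F (gen b)) = 0" if "adj a b" for b
  proof -
    have b: "b \<in> VL" "a \<noteq> b"
      using that a adjL adj_irrefl by blast+
    show ?thesis
    proof (cases "\<phi> b \<in> S")
      case True
      then show ?thesis
        using goodD(6)[OF f b(1) a] that adj_sym by blast
    next
      case False
      then show ?thesis
        using goodD(5)[OF f b(1) a] b(2) by simp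
    qed
  qed
  then show ?thesis
    using goodD(5)[OF f a a] a False by (intro bexI[of _ a]) auto
next
  case True
  have "aut VL F"
    using goodD(1)[OF f] by (simp add: laut_def)
  then obtain z where z: "z \<in> VL" "expo z (F (gen a)) \<noteq> 0" "card (star z) = card (star a)"
    using aut_matching[OF _ finL closedL] a by blast
  have le: "le a z" "\<not> adj a z"
    using goodD(6)[OF f a z(1) True z(2)] by auto
  have "nb a \<subseteq> nb z"
    using le unfolding le_def by (auto simp: in_star)
  moreover have "finite (nb z)" "card (nb a) = card (nb z)"
  proof -
    have fin: "finite (star z)" "finite (star a)"
      using finite_starL z(1) a by blast+
    then show "finite (nb z)"
      unfolding star_def by simp
    have "finite (nb a)"
      using fin unfolding star_def by simp
    then show "card (nb a) = card (nb z)"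
      using z(3) \<open>finite (nb z)\<close> adj_irrefl unfolding star_def by (simp add: card_insert_if)
  qed
  ultimately have nb: "nb z = nb a"
    using card_subset_eq by metis
  have "expo z (F (gen b)) = 0" if "adj a b" for b
  proof -
    have b: "b \<in> VL"
      using that a adjL by blast
    have "\<phi> b \<notin> S"
      using edge[OF a that] isolated[OF True] SU by blast
    moreover have "z \<noteq> b"
      using le(2) that by blast
    ultimately show ?thesis
      using goodD(5)[OF f b z(1)] by simp
  qed
  then show ?thesis
    using z nb by blast
qed

text \<open>The images commute, so each conjugator moves the other image into the subgroup over the
  link of \<open>a\<close> or \<open>b\<close>, which avoids \<open>i\<close>. Both
  \<open>Ta\<close> and \<open>Tb\<close> thus bring \<open>F (gen b)\<close> into
  \<open>gp (- {i})\<close>, and \<open>fixed_coset_unique\<close> compares them.\<close>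

lemma good_adj:
  assumes f: "good f F" and ab: "adj a b" "a \<in> VL" and i: "a \<notin> star i" "b \<notin> star i"
    and Ta: "F (gen a) = Ta + Wa - Ta" "minconj Wa" and Tb: "F (gen b) = Tb + Wb - Tb" "minconj Wb"
  shows "Wa \<in> gp (- {i})" "- Ta + Tb \<in> gp (- {i})"
proof -
  have b: "b \<in> VL" "adj b a"
    using ab adjL adj_sym by blast+
  obtain z where z: "z \<in> VL" "expo z (F (gen a)) \<noteq> 0" "nb z = nb a" "expo z (F (gen b)) = 0"
    using good_witness[OF f ab(2)] ab(1) by blast
  obtain y where y: "y \<in> VL" "expo y (F (gen b)) \<noteq> 0" "nb y = nb b" "expo y (F (gen a)) = 0"
    using good_witness[OF f b(1)] b(2) by blast
  have c: "cm (F (gen a)) (F (gen b))"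
    using ghom_cm[OF goodD(4)[OF f] cm_lett] ab(1) by simp
  have ni: "\<not> adj i a" "\<not> adj i b" "a \<noteq> i" "b \<noteq> i"
    using i by (auto simp: in_star)
  have "- Ta + F (gen b) + Ta \<in> gp (nb z)"
    using centralizer_conj[OF Ta(2,1) z(2) c z(4)] by (simp add: nb_def)
  then have A: "- Ta + F (gen b) + Ta \<in> gp (- {i})"
    using gp_mono[of "nb z" "- {i}"] ni(1) unfolding z(3) by (auto simp: adj_commute)
  have "- Tb + F (gen a) + Tb \<in> gp (nb y)"
    using centralizer_conj[OF Tb(2,1) y(2) cm_sym[OF c] y(4)] by (simp add: nb_def)
  then have B: "- Tb + F (gen a) + Tb \<in> gp (- {i})"
    using gp_mono[of "nb y" "- {i}"] ni(2) unfolding y(3) by (auto simp: adj_commute)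
  have WB: "Wb \<in> gp (- {i})"
    by (rule minconj_gp[OF Tb(2), of "- Tb + Ta"])
      (use A in \<open>simp add: Tb(1) minus_add add.assoc diff_conv_add_uminus del: add_uminus_conv_diff\<close>)
  show "Wa \<in> gp (- {i})"
    by (rule minconj_gp[OF Ta(2), of "- Ta + Tb"])
      (use B in \<open>simp add: Ta(1) minus_add add.assoc diff_conv_add_uminus del: add_uminus_conv_diff\<close>)
  have "y \<noteq> i"
    using y(3) b(2) ni(1) by (metis in_nb)
  moreover have "\<not> adj y i"
    using y(3) ni(2) by (metis in_nb adj_commute)
  moreover have "- Tb + F (gen b) + Tb \<in> gp (- {i})"
    using WB by (simp add: Tb(1))
  ultimately show "- Ta + Tb \<in> gp (- {i})"
    using fixed_coset_unique[OF y(2) _ _ A] by blast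
qed

text \<open>For each \<open>i\<close> over \<open>u\<close>, \<open>good_adj\<close> is applied
  along a path outside \<open>star i\<close>, which has an edge as \<open>w \<noteq> w'\<close>. The
  conjugator at \<open>x\<close> serves for all \<open>i\<close> simultaneously; retracted to
  \<open>gp VL\<close> it moves both images into words avoiding the whole fibre, and
  \<open>\<Phi>\<close> sends these to words without \<open>u\<close>.\<close>

lemma good_link:
  assumes f: "good f F" and w: "(w, w') \<in> sat u" "w \<noteq> w'"
  shows "\<exists>h. - h + f (gen w) + h \<in> gp (- {u}) \<and> - h + f (gen w') + h \<in> gp (- {u})"
proof -
  obtain x y where xy: "w = \<phi> x" "w' = \<phi> y" "x \<in> VL" "y \<in> VL"
    and j: "\<And>i. i \<in> fib u \<Longrightarrow> (x, y) \<in> joined VL (star i)" and u: "\<phi> x \<notin> star u" "\<phi> y \<notin> star u"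
    using w(1) unfolding sat_def by blast
  have "\<forall>a. \<exists>T W. minconj W \<and> F (gen a) = T + W - T"
    using minconj_exists by blast
  then obtain T W where TW: "\<And>a. minconj (W a)" "\<And>a. F (gen a) = T a + W a - T a"
    by metis
  have fib: "i \<in> VL" "x \<notin> star i" if "i \<in> fib u" for i
    using that star_phi[of i x] u(1) unfolding fib_def by auto
  have key: "- T x + F (gen a) + T x \<in> gp (- {i})" if i: "i \<in> fib u" and a: "a = x \<or> a = y" for i a
  proof -
    note adjTW = good_adj[OF f _ _ _ _ TW(2,1) TW(2,1), of _ _ i]
    have step: "c \<notin> star i \<and> - T x + T c \<in> gp (- {i}) \<and> (c \<noteq> x \<longrightarrow> W c \<in> gp (- {i}) \<and> W x \<in> gp (- {i}))"
      if "(x, c) \<in> joined VL (star i)" for c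
      using that
    proof (induction rule: joined_induct)
      case refl
      show ?case
        using fib(2)[OF i] by simp
    next
      case (step b c)
      have bc: "b \<in> VL" "b \<notin> star i" "c \<in> VL" "c \<notin> star i" "adj b c" "adj c b"
        using step adj_sym by blast+
      have "W b \<in> gp (- {i})" "- T b + T c \<in> gp (- {i})" "W c \<in> gp (- {i})"
        using adjTW[OF bc(5,1,2,4)] adjTW[OF bc(6,3,4,2)] by auto
      moreover have "- T x + T c = (- T x + T b) + (- T b + T c)"
        by (simp add: add.assoc)
      moreover have "- T x + T b \<in> gp (- {i})"
        using step by blast
      ultimately show ?case
        using bc step by (metis gp_add)
    qed
    have "x \<noteq> y"
      using w(2) xy by blast
    then have y: "- T x + T y \<in> gp (- {i})" "W y \<in> gp (- {i})" "W x \<in> gp (- {i})"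
      using step[OF j[OF i]] by auto
    show ?thesis
      using a
    proof
      assume "a = x"
      then show ?thesis
        using y(3) by (simp add: TW(2))
    next
      assume "a = y"
      moreover have "- T x + F (gen y) + T x = (- T x + T y) + W y - (- T x + T y)"
        unfolding TW(2)[of y] by (simp add: minus_add add.assoc diff_conv_add_uminus del: add_uminus_conv_diff)
      ultimately show ?thesis
        using y(1,2) by (metis gp_add gp_diff)
    qed
  qed
  define R where "R = retr VL (T x)"
  have main: "- \<Phi> R + f (gen (\<phi> a)) + \<Phi> R \<in> gp (- {u})" if a: "a = x \<or> a = y" for a
  proof -
    have aV: "a \<in> VL"
      using a xy by blast
    have Fa: "F (gen a) \<in> gp VL"
      using laut_gp(2)[OF goodD(1)[OF f]] aV by simp
    have RV: "R \<in> gp VL"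
      by (simp add: R_def retr_in_gp)
    have "- R + F (gen a) + R \<in> gp (VL - fib u)"
    proof -
      have eq: "- R + F (gen a) + R = retr VL (- T x + F (gen a) + T x)"
        using retr_gp[OF Fa] by (simp only: R_def ghom_add[OF ghom_retr] ghom_uminus[OF ghom_retr])
      have "retr VL g \<in> gp (- {i})" if "g \<in> gp (- {i})" for g i
        by (rule ghom_image_gp[OF ghom_retr _ that]) simp
      then have "- R + F (gen a) + R \<in> gp (- {i})" if "i \<in> fib u" for i
        unfolding eq using key[OF that a] by blast
      moreover have "- R + F (gen a) + R \<in> gp VL"
        unfolding eq by (rule retr_in_gp)
      ultimately show ?thesis
        unfolding gp_def by blast
    qed
    then have "\<Phi> (- R + F (gen a) + R) \<in> gp (\<phi> ` (VL - fib u))"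
      by (rule \<Phi>_gp) blast
    moreover have "\<phi> ` (VL - fib u) \<subseteq> - {u}"
      unfolding fib_def by blast
    moreover have "\<Phi> (- R + F (gen a) + R) = - \<Phi> R + f (gen (\<phi> a)) + \<Phi> R"
      using laut_gen[OF goodD(1)[OF f] aV] ghom_\<Phi> by (simp add: ghom_add ghom_uminus del: add_uminus_conv_diff)
    ultimately show ?thesis
      using gp_mono by (metis subsetD)
  qed
  show ?thesis
    using main[of x] main[of y] xy by blast
qed

lemma good_expo:
  assumes f: "good f F" and v: "v \<in> VG" "v \<notin> S"
  shows "expo v (f (gen v)) = 1"
proof -
  obtain u where u: "u \<in> VL" "\<phi> u = v"
    using v(1) lift_exists by blast
  have "expo v (f (gen v)) = (\<Sum>y \<in> {y \<in> VL. \<phi> y = v}. expo y (F (gen u)))"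
    using expo_fibre_sum[OF goodD(1)[OF f] u(1)] u(2) by simp
  also have "\<dots> = (\<Sum>y \<in> {y \<in> VL. \<phi> y = v}. if y = u then 1 else 0)"
    using goodD(5)[OF f u(1)] u(2) v(2) by (intro sum.cong) auto
  also have "\<dots> = 1"
    using u finL by (subst sum.delta) auto
  finally show ?thesis .
qed

text \<open>All neighbours of a lift \<open>a\<close> of a vertex of \<open>S\<close> lie in the
  star of \<open>lft u a\<close>, so \<open>a\<close> is isolated outside that star.\<close>

lemma sat_S:
  assumes "u \<in> U" "(w, w') \<in> sat u" "w \<in> S \<or> w' \<in> S"
  shows "w = w'"
proof -
  obtain x y where xy: "w = \<phi> x" "w' = \<phi> y" "x \<in> VL" "y \<in> VL"
    and j: "\<And>i. i \<in> fib u \<Longrightarrow> (x, y) \<in> joined VL (star i)"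
    using assms(2) unfolding sat_def by blast
  have iso: "b = a" if a: "a \<in> VL" "\<phi> a \<in> S" "\<And>i. i \<in> fib u \<Longrightarrow> (a, b) \<in> joined VL (star i)" for a b
  proof -
    have l: "le' (\<phi> a) u"
      using dom[OF a(2) assms(1)] .
    note lf = lft[OF l a(1)]
    have "(a, b) \<in> joined VL (star (lft u a))"
      using a(3) lf(1,2) unfolding fib_def by blast
    then show "b = a"
    proof (induction rule: joined_induct)
      case (step y z)
      then have "adj a z"
        by simp
      then have "z \<in> star (lft u a)"
        using lf(3) unfolding le_def by auto
      then show ?case
        using step by blast
    qed simp
  qed
  show ?thesis
    using assms(3)
  proof
    assume "w \<in> S"
    then show ?thesis
      using iso[of x y] xy j by simp
  next
    assume "w' \<in> S"
    moreover have "(y, x) \<in> joined VL (star i)" if "i \<in> fib u" for i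
      using j[OF that] by (rule joined_sym)
    ultimately show ?thesis
      using iso[of y x] xy by simp
  qed
qed

lemma nb_S: 
  assumes "x \<in> S" "y \<in> S"
  shows "nb x = nb y"
proof -
  have "le x y" "\<not> adj x y"
    using le'_imp_le[OF dom] isolated assms SU by blast+
  then have "nb x \<subseteq> nb y"
    unfolding le_def by (auto simp: in_star)
  moreover have "le y x" "\<not> adj y x"
    using le'_imp_le[OF dom] isolated assms SU by blast+
  then have "nb y \<subseteq> nb x"
    unfolding le_def by (auto simp: in_star)
  ultimately show ?thesis
    by blast
qed

text \<open>Vertices of \<open>S\<close> share their link, and so does each lift \<open>i'\<close>
  of \<open>x'\<close> with the lift of \<open>x\<close> dominating it. The two stars differ only in
  their centres, and a path avoiding one star cannot reach \<open>i'\<close>, whose neighbours all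
  lie in that star.\<close>

lemma sat_twin:
  assumes x: "x \<in> S" "x' \<in> S" and w: "(w, w') \<in> sat x" "w \<notin> S" "w' \<notin> S"
  shows "(w, w') \<in> sat x'"
proof -
  obtain a b where ab: "w = \<phi> a" "w' = \<phi> b" "a \<in> VL" "b \<in> VL" "w \<notin> star x" "w' \<notin> star x"
    and j: "\<And>i. i \<in> fib x \<Longrightarrow> (a, b) \<in> joined VL (star i)"
    using w(1) unfolding sat_def by blast
  have "(a, b) \<in> joined VL (star i')" if i': "i' \<in> fib x'" for i'
  proof -
    have i'V: "i' \<in> VL" "\<phi> i' = x'"
      using i' by (auto simp: fib_def)
    have l: "le' (\<phi> i') x"
      using dom[OF x(2)] x(1) SU i'V(2) by auto
    define i where "i = lft x i'"
    have i: "i \<in> VL" "\<phi> i = x" "le i' i"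
      using lft[OF l i'V(1)] by (auto simp: i_def)
    have na: "\<not> adj i' i"
      using edge[OF i'V(1), of i] i(2) i'V(2) isolated[OF x(2)] x(1) SU by blast
    then have sub: "nb i' \<subseteq> nb i"
      using i(3) unfolding le_def by (auto simp: in_star)
    have "\<phi> ` nb i' = \<phi> ` nb i"
      using local_bij[OF i(1)] local_bij[OF i'V(1)] nb_S[OF x] i(2) i'V(2) unfolding bij_betw_def by simp
    moreover have "inj_on \<phi> (nb i)"
      using local_bij[OF i(1)] unfolding bij_betw_def by blast
    ultimately have nb: "nb i' = nb i"
      using sub by (metis inj_on_image_eq_iff order_refl)
    have "(a, b) \<in> joined VL (star i)"
      using j i unfolding fib_def by blast
    moreover have a: "a \<noteq> i'"
      using ab(1) w(2) x(2) i'V(2) by auto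
    ultimately have "(a, b) \<in> joined VL (star i') \<and> b \<noteq> i'"
    proof (induction rule: joined_induct)
      case (step y z)
      have yz: "y \<in> VL" "z \<in> VL" "y \<notin> star i" "z \<notin> star i" "adj y z" "y \<noteq> i'"
        using step by auto
      have z: "z \<noteq> i'"
      proof
        assume "z = i'"
        then have "y \<in> nb i'"
          using yz(5) adj_sym by simp
        then have "y \<in> nb i"
          using nb by simp
        then show False
          using yz(3) by (simp add: in_star)
      qed
      have "y \<notin> star i'" "z \<notin> star i'"
        using yz z nb unfolding star_def by auto
      then have "(y, z) \<in> joined VL (star i')"
        using joined_edge yz by blast
      then show ?case
        using step.IH[OF a] z joined_trans by blast
    qed simp
    then show ?thesis
      by blast
  qed
  moreover have "w \<notin> star x'" "w' \<notin> star x'"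
    using ab(5,6) w(2,3) x nb_S[OF x] unfolding star_def by auto
  ultimately show ?thesis
    using ab(1-4) unfolding sat_def by blast
qed

lemma sat_rtrancl:
  assumes "x \<in> U" "x' = x \<or> x \<in> S \<and> x' \<in> S" "(t, t') \<in> (sat x)\<^sup>*" "t \<notin> S"
  shows "(t, t') \<in> (sat x')\<^sup>* \<and> t' \<notin> S"
  using assms(3)
proof (induction rule: rtrancl_induct)
  case (step y z)
  have "z \<notin> S"
    using sat_S[OF assms(1) step(2)] step(3) by blast
  moreover have "(y, z) \<in> sat x'"
    using assms(2) sat_twin[OF _ _ step(2)] step(2,3) \<open>z \<notin> S\<close> by blast
  ultimately show ?case
    using step(3) by (meson rtrancl.rtrancl_into_rtrancl)
qed (simp add: assms(4))

text \<open>Along a chain of \<open>sat\<close>-related vertices \<open>good_link\<close> offers a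
  common conjugator for neighbouring members; at each vertex the two conjugators in play agree
  modulo \<open>gp (- {u})\<close> by \<open>fixed_coset_unique\<close>, applicable because the
  exponent there is 1.\<close>

lemma class_conj:
  assumes f: "good f F" and u: "u \<in> U" and t: "(t, t') \<in> (sat u)\<^sup>*" "t \<in> VG" "t \<notin> S" "t \<notin> star u"
    and g: "f (gen t) = g + gen t - g" "f (gen t') = g' + gen t' - g'"
  shows "- g + g' \<in> gp (- {u})"
proof -
  have lam: "- k + f (gen s) + k \<in> gp (- {u})" if "f (gen s) = k + gen s - k" "s \<notin> star u" for s k
    using that by (simp add: in_star)
  have unique: "- h + k \<in> gp (- {u})"
    if "s \<in> VG" "s \<notin> S" "s \<notin> star u" "- h + f (gen s) + h \<in> gp (- {u})" "- k + f (gen s) + k \<in> gp (- {u})" for s h k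
  proof (rule fixed_coset_unique[of s])
    show "expo s (f (gen s)) \<noteq> 0"
      using good_expo[OF f that(1,2)] by simp
    show "s \<noteq> u" "\<not> adj s u"
      using that(3) by (auto simp: in_star adj_commute)
  qed (use that in auto)
  have "\<exists>h. t' \<in> VG \<and> t' \<notin> S \<and> t' \<notin> star u \<and> - h + f (gen t') + h \<in> gp (- {u}) \<and> - g + h \<in> gp (- {u})"
    using t(1)
  proof (induction rule: rtrancl_induct)
    case base
    show ?case
      using t lam[OF g(1)] by (intro exI[of _ g]) auto
  next
    case (step y z)
    obtain h where h: "y \<in> VG" "y \<notin> S" "y \<notin> star u" "- h + f (gen y) + h \<in> gp (- {u})" "- g + h \<in> gp (- {u})"
      using step.IH by blast
    show ?case
    proof (cases "y = z")
      case True
      then show ?thesis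
        using h by blast
    next
      case False
      obtain k where k: "- k + f (gen y) + k \<in> gp (- {u})" "- k + f (gen z) + k \<in> gp (- {u})"
        using good_link[OF f step(2) False] by blast
      have "- h + k \<in> gp (- {u})"
        using unique[OF h(1-4) k(1)] .
      then have "(- g + h) + (- h + k) \<in> gp (- {u})"
        using h(5) gp_add by blast
      then have "- g + k \<in> gp (- {u})"
        by (simp add: add.assoc)
      moreover have "z \<in> VG" "z \<notin> star u"
        using step(2) unfolding sat_def by auto
      moreover have "z \<notin> S"
        using sat_S[OF u step(2)] False by blast
      ultimately show ?thesis
        using k by blast
    qed
  qed
  then obtain h where h: "t' \<in> VG" "t' \<notin> S" "t' \<notin> star u" "- h + f (gen t') + h \<in> gp (- {u})" "- g + h \<in> gp (- {u})"
    by blast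
  have "- h + g' \<in> gp (- {u})"
    using unique[OF h(1-4) lam[OF g(2) h(3)]] .
  then have "(- g + h) + (- h + g') \<in> gp (- {u})"
    using h(5) gp_add by blast
  then show ?thesis
    by (simp add: add.assoc)
qed

lemma saturated_class:
  assumes "t \<in> VG" "t \<notin> star u"
  shows "saturated u ((sat u)\<^sup>* `` {t})"
proof -
  have "t' \<in> VG - star u" if "(t, t') \<in> (sat u)\<^sup>*" for t'
    using that
  proof (induction rule: rtrancl_induct)
    case (step y z)
    then show ?case
      unfolding sat_def by auto
  qed (use assms in blast)
  then show ?thesis
    unfolding saturated_def by (auto intro: rtrancl.rtrancl_into_rtrancl)
qed

end

lemma irr_pre_proper:
  assumes "irr q c" "pre s (q + lett c)" "s \<noteq> q + lett c"
  shows "pre s q"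
proof -
  obtain r where r: "q + lett c = s + r" "red s r"
    using assms(2) by (rule pre_obtain)
  have "r \<noteq> 0"
    using r(1) assms(3) by auto
  then obtain b where b: "ends b r"
    using ends_exists by blast
  have "b = c"
    using ends_red[OF r(2) b] assms(1) r(1) unfolding irr_def by metis
  obtain r' where r': "r = r' + lett b" "len r = Suc (len r')"
    using b by (rule ends_obtain)
  have "q + lett c = (s + r') + lett c"
    using r(1) r'(1) \<open>b = c\<close> by (simp add: add.assoc)
  then have "q = s + r'"
    by simp
  moreover have "red s r'"
    using r(2) r' red_assoc2[of r' "lett b" s] by (simp add: red_def)
  ultimately show ?thesis
    by simp
qed

lemma irr_eqD: "irr p c \<Longrightarrow> irr q d \<Longrightarrow> p + lett c = q + lett d \<Longrightarrow> c = d"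
  unfolding irr_def by (metis ends_add_lett_iff red_lett_right)

text \<open>A last letter of the conjugator that is equal or adjacent to \<open>y\<close> could be
  dropped. For a shortest conjugator there is none, and this makes the centre its only last letter
  and the product free of cancellation.\<close>

lemma minimal_conjugator:
  assumes "f = h + gen y - h"
  shows "\<exists>g. f = g + gen y - g \<and> (\<forall>s. irr g (y, s) \<and> red (g + lett (y, s)) (- g))"
proof -
  define g where "g = (ARG_MIN len g. f = g + gen y - g)"
  have g: "f = g + gen y - g"
    unfolding g_def by (rule arg_min_natI) (rule assms)
  have min: "len g \<le> len k" if "f = k + gen y - k" for k
    unfolding g_def using arg_min_nat_le[of "\<lambda>g. f = g + gen y - g" k len, OF that] .
  have no: "fst a \<noteq> y \<and> \<not> adj y (fst a)" if ea: "ends a g" for a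
  proof (rule ccontr)
    assume "\<not> ?thesis"
    then have "y = fst a \<or> adj (fst a) y"
      using adj_commute[of y "fst a"] by argo
    then have cm: "cm (gen y) (lett a)"
      by (rule cm_gen_lett)
    obtain k where k: "g = k + lett a" "len g = Suc (len k)"
      using ea by (rule ends_obtain)
    have "lett a + gen y - lett a = gen y"
      using cm by (metis cm_def add_diff_cancel)
    then have "k + (lett a + gen y - lett a) - k = k + gen y - k"
      by simp
    then have "f = k + gen y - k"
      by (simp only: g k(1) conj_conj)
    then show False
      using min[of k] k(2) by simp
  qed
  have irr: "irr g (y, s)" for s
  proof -
    have r: "red g (lett (y, s))"
      using no[of "linv (y, s)"] red_lett_right by fastforce
    have "b = (y, s)" if b: "ends b (g + lett (y, s))" for b
    proof (rule ccontr)
      assume ne: "b \<noteq> (y, s)"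
      then have ne': "linv b \<noteq> linv (y, s)"
        by (metis linv_linv)
      have st: "starts (linv b) (lett (linv (y, s)) + - g)"
        using b by (simp only: ends_def minus_add lett_linv)
      moreover have "starts (linv (y, s)) (lett (linv (y, s)) + - g)"
        using r by (simp only: starts_lett_add_iff red_lett_right ends_def linv_linv not_False_eq_True)
      ultimately have adj: "adj (fst b) y"
        using starts_two[OF _ _ ne'] by (metis fst_linv fst_conv)
      then have "starts (linv b) (- g)"
        using st starts_adj[of "linv b" "linv (y, s)" "- g"] by (metis fst_linv fst_conv)
      then have "ends b g"
        by (simp add: ends_def)
      then show False
        using no adj adj_sym by blast
    qed
    then show ?thesis
      using r unfolding irr_def by blast
  qed
  have "red (g + lett (y, s)) (- g)" for s
  proof (rule ccontr)
    assume "\<not> ?thesis"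
    then obtain a where a: "ends a (g + lett (y, s))" "starts (linv a) (- g)"
      using not_red by blast
    then have "a = (y, s)" "ends a g"
      using irr unfolding irr_def ends_def by blast+
    then show False
      using no by fastforce
  qed
  then show ?thesis
    using g irr by blast
qed

section \<open>A centre in the image of every letter over \<open>U\<close>\<close>

context stage
begin

text \<open>The centre is the middle letter of a conjugate outside \<open>S\<close> and the
  \<open>S\<close>-letter at position \<open>idx\<close> otherwise. The part behind it is
  \<open>- P (linv b)\<close>, so that a letter and its inverse share their centre up to
  sign.\<close>

definition centred :: "('w raag \<Rightarrow> 'w raag) \<Rightarrow> ('w \<times> bool \<Rightarrow> 'w raag) \<Rightarrow> ('w \<times> bool \<Rightarrow> 'w \<times> bool) \<Rightarrow> bool" where
  "centred f P C \<longleftrightarrow> (\<forall>b. fst b \<in> U \<longrightarrow>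
    f (lett b) = P b + lett (C b) - P (linv b) \<and> red (P b + lett (C b)) (- P (linv b)) \<and>
    irr (P b) (C b) \<and> C (linv b) = linv (C b) \<and>
    (if fst b \<in> S then fst (C b) \<in> S \<and> P b + lett (C b) = xpre (idx (f (lett b))) (f (lett b))
     else C b = b \<and> P (linv b) = P b))"

lemma good_expo_S:
  assumes f: "good f F" and b: "fst b \<in> S"
  shows "\<exists>x \<in> S. expo x (f (lett b)) \<noteq> 0"
proof -
  have "aut VG f"
    using goodD(1)[OF f] by (simp add: laut_def)
  then obtain z where z: "expo z (f (gen (fst b))) \<noteq> 0" "card (star z) = card (star (fst b))"
    using aut_matching[OF _ finG closedG] S_VG[OF b] by blast
  have "f (gen (fst b)) \<in> gp U"
    using goodD(8)[OF f] b SU by auto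
  then have "z \<in> U"
    using z(1) expo_notin_supp by (auto simp: gp_def)
  then have "z \<in> S"
    using deg[OF b] z(2) by blast
  moreover have "expo z (f (lett b)) \<noteq> 0"
    using z(1) by (cases b; cases "snd b") (auto simp: ghom_uminus[OF goodD(3)[OF f]])
  ultimately show ?thesis
    by blast
qed

lemma good_letter_gp: "good f F \<Longrightarrow> fst b \<in> U \<Longrightarrow> f (lett b) \<in> gp U"
  using goodD(8) by simp

lemma good_linv: "good f F \<Longrightarrow> f (lett (linv b)) = - f (lett b)"
  using ghom_uminus[OF goodD(3)] by simp

lemma centred_exists:
  assumes f: "good f F"
  shows "\<exists>P C. centred f P C"
proof -
  have "\<exists>p c q. (let b = (v, True) in
    f (lett b) = p + lett c - q \<and> red (p + lett c) (- q) \<and> irr p c \<and> irr q (linv c) \<and>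
    (if v \<in> S then fst c \<in> S \<and> p + lett c = xpre (idx (f (lett b))) (f (lett b)) \<and>
        q - lett c = xpre (idx (- f (lett b))) (- f (lett b))
     else c = b \<and> q = p \<and> red (p - lett c) (- p)))" if v: "v \<in> U" for v
  proof (cases "v \<in> S")
    case False
    then obtain h where "f (gen v) = h + gen v - h"
      using goodD(7)[OF f] UD v by blast
    then obtain g where g: "f (gen v) = g + gen v - g" "\<And>s. irr g (v, s)" "\<And>s. red (g + lett (v, s)) (- g)"
      using minimal_conjugator by blast
    have "red (g - gen v) (- g)"
      using g(3)[of False] by simp
    then show ?thesis
      using g False by (intro exI[of _ g] exI[of _ "(v, True)"] exI[of _ g]) (auto simp: Let_def)
  next
    case True
    let ?g = "f (gen v)"
    have gU: "?g \<in> gp U"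
      using good_letter_gp[OF f] v by simp
    obtain x where x: "x \<in> S" "expo x ?g \<noteq> 0"
      using good_expo_S[OF f, of "(v, True)"] True by auto
    note id = idx[OF gU x]
    note xp = xpre[OF gU id(1,2)]
    obtain p c where c: "xpre (idx ?g) ?g = p + lett c" "irr p c" "fst c \<in> S"
      using xp(1) by (rule xend_irr)
    obtain r where r: "?g = p + lett c + r" "red (p + lett c) r"
      using xp(2) unfolding c(1) by (rule pre_obtain)
    have pc: "red p (lett c)"
      using c(2) by (simp add: irr_def)
    have fl: "xpre (Suc (kx ?g) - idx ?g) (- ?g) = - r - lett c"
      using xpre_flip[OF gU id(1,2) c(1) r(1) pc] .
    have gU': "- ?g \<in> gp U" "expo x (- ?g) \<noteq> 0"
      using gU x(2) by auto
    note id' = idx[OF gU'(1) x(1) gU'(2)]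
    have xe: "xend (- r - lett c)"
      using xpre(1)[OF gU'(1) id'(1,2)] fl id(3) by simp
    have rc: "red (- r) (lett (linv c))"
      using r(2) red_assoc[OF pc, of r] red_uminus[of r "lett c"] by simp
    then have "ends (linv c) (- r + lett (linv c))"
      by (simp only: ends_add_lett_iff red_lett_right not_False_eq_True)
    then have "irr (- r) (linv c)"
      unfolding irr_def using rc xend_ends[OF xe] by simp
    then show ?thesis
      using True c r fl id(3) by (intro exI[of _ p] exI[of _ c] exI[of _ "- r"]) (auto simp: Let_def)
  qed
  then obtain p c q where pcq: "\<And>v. v \<in> U \<Longrightarrow> (let b = (v, True) in
    f (lett b) = p v + lett (c v) - q v \<and> red (p v + lett (c v)) (- q v) \<and> irr (p v) (c v) \<and> irr (q v) (linv (c v)) \<and>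
    (if v \<in> S then fst (c v) \<in> S \<and> p v + lett (c v) = xpre (idx (f (lett b))) (f (lett b)) \<and>
        q v - lett (c v) = xpre (idx (- f (lett b))) (- f (lett b))
     else c v = b \<and> q v = p v \<and> red (p v - lett (c v)) (- p v)))"
    by metis
  define P where "P b = (if snd b then p (fst b) else q (fst b))" for b
  define C where "C b = (if snd b then c (fst b) else linv (c (fst b)))" for b
  have "f (lett b) = P b + lett (C b) - P (linv b) \<and> red (P b + lett (C b)) (- P (linv b)) \<and>
    irr (P b) (C b) \<and> C (linv b) = linv (C b) \<and>
    (if fst b \<in> S then fst (C b) \<in> S \<and> P b + lett (C b) = xpre (idx (f (lett b))) (f (lett b))
     else C b = b \<and> P (linv b) = P b)" if b: "fst b \<in> U" for b
  proof -
    obtain v s where vs: "b = (v, s)"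
      by (cases b)
    have v: "v \<in> U"
      using b vs by simp
    note d = pcq[OF v, unfolded Let_def]
    show ?thesis
    proof (cases s)
      case True
      then have "s = True"
        by simp
      then show ?thesis
        using d unfolding vs P_def C_def \<open>s = True\<close> linv.simps fst_conv snd_conv if_True if_False
          not_True_eq_False if_bool_eq_conj by argo
    next
      case False
      then have "s = False"
        by simp
      have "red (- (- q v)) (- (p v + lett (c v)))"
        using d red_uminus by blast
      then have "red (q v) (- lett (c v) + - p v)"
        by (simp only: minus_minus minus_add)
      moreover have "red (- lett (c v)) (- p v)"
        using d red_uminus unfolding irr_def by blast
      ultimately have r: "red (q v - lett (c v)) (- p v)"
        using red_assoc2 unfolding diff_conv_add_uminus by blast
      have "f (lett b) = - (p v + lett (c v) - q v)"
        using d ghom_uminus[OF goodD(3)[OF f]] vs False by simp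
      also have "\<dots> = q v - lett (c v) - p v"
        by (simp add: minus_add add.assoc diff_conv_add_uminus del: add_uminus_conv_diff)
      finally have fb: "f (lett (v, False)) = q v - lett (c v) - p v"
        using vs False by simp
      have fb': "f (lett (v, False)) = - f (gen v)"
        using ghom_uminus[OF goodD(3)[OF f]] by simp
      have cv: "v \<notin> S \<longrightarrow> linv (c v) = (v, False)"
      proof
        assume "v \<notin> S"
        then have "c v = (v, True)"
          using d by argo
        then show "linv (c v) = (v, False)"
          by simp
      qed
      show ?thesis
        using d r fb[unfolded fb'] cv unfolding vs P_def C_def \<open>s = False\<close> linv.simps fst_conv snd_conv if_True
          if_False not_False_eq_True if_bool_eq_conj linv_linv fst_linv lett_linv fb' add_uminus_conv_diff by argo
    qed
  qed
  then show ?thesis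
    unfolding centred_def by blast
qed

end

section \<open>Descent: a head absorbed by another letter allows a lowering move\<close>

context stage
begin

lemma centredD:
  assumes f: "good f F" "centred f P C" and b: "fst b \<in> U"
  shows "f (lett b) = P b + lett (C b) - P (linv b)" "red (P b + lett (C b)) (- P (linv b))"
    "irr (P b) (C b)" "C (linv b) = linv (C b)" "P b \<in> gp U" "fst (C b) \<in> U"
    "f (lett b) \<in> gp U" "red (P b) (lett (C b))"
    and "fst b \<in> S \<Longrightarrow> fst (C b) \<in> S" "fst b \<in> S \<Longrightarrow> P b + lett (C b) = xpre (idx (f (lett b))) (f (lett b))"
    and "fst b \<notin> S \<Longrightarrow> C b = b" "fst b \<notin> S \<Longrightarrow> P (linv b) = P b"
    and "fst b \<notin> S \<Longrightarrow> f (gen (fst b)) = P b + gen (fst b) - P b"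
proof -
  show c: "f (lett b) = P b + lett (C b) - P (linv b)" "red (P b + lett (C b)) (- P (linv b))"
    "irr (P b) (C b)" "C (linv b) = linv (C b)" 
    and "fst b \<in> S \<Longrightarrow> fst (C b) \<in> S" "fst b \<in> S \<Longrightarrow> P b + lett (C b) = xpre (idx (f (lett b))) (f (lett b))"
    and y: "fst b \<notin> S \<Longrightarrow> C b = b" "fst b \<notin> S \<Longrightarrow> P (linv b) = P b"
    using f(2) b unfolding centred_def by meson+
  show fU: "f (lett b) \<in> gp U"
    using good_letter_gp[OF f(1) b] .
  show r: "red (P b) (lett (C b))"
    using c(3) by (simp add: irr_def)
  have "P b + lett (C b) \<in> gp U"
    using red_gp[OF c(2)] fU c(1) by simp
  then show "P b \<in> gp U" "fst (C b) \<in> U"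
    using red_gp[OF r] by auto
  show "f (gen (fst b)) = P b + gen (fst b) - P b" if "fst b \<notin> S"
  proof -
    have fb: "f (lett b) = P b + lett b - P b"
      using c(1) y that by simp
    show ?thesis
    proof (cases "snd b")
      case True
      then show ?thesis
        using fb by (metis prod.collapse)
    next
      case False
      then have "lett b = - gen (fst b)"
        by (metis lett_False prod.collapse)
      then have "- f (gen (fst b)) = P b - gen (fst b) - P b"
        using fb ghom_uminus[OF goodD(3)[OF f(1)]] by simp
      then have "f (gen (fst b)) = - (P b - gen (fst b) - P b)"
        by (metis minus_minus)
      then show ?thesis
        by (simp add: minus_add add.assoc diff_conv_add_uminus del: add_uminus_conv_diff)
    qed
  qed
qed

text \<open>Deleting letters outside \<open>S\<close> may leave all keys as they are; the total
  length then decides.\<close>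

definition lower :: "('w raag \<Rightarrow> 'w raag) \<Rightarrow> ('w raag \<Rightarrow> 'w raag) \<Rightarrow> bool" where
  "lower f' f \<longleftrightarrow>
    (\<forall>b. fst b \<in> U \<longrightarrow> key (f' (lett b)) = key (f (lett b)) \<or> (key (f' (lett b)), key (f (lett b))) \<in> keyrel) \<and>
    ((\<exists>b. fst b \<in> U \<and> (key (f' (lett b)), key (f (lett b))) \<in> keyrel) \<or>
     (\<forall>b. fst b \<in> U \<longrightarrow> len (f' (lett b)) \<le> len (f (lett b))) \<and>
     (\<exists>b. fst b \<in> U \<and> len (f' (lett b)) < len (f (lett b))))"

text \<open>The keys of all letters over \<open>U\<close> form a multiset, ordered by the multiset
  extension of \<open>keyrel\<close>, with the total length as a second component. A lowering move
  descends in this well-founded order.\<close>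

lemma lowest_exists:
  assumes "good f F"
  shows "\<exists>f F. good f F \<and> (\<forall>f' F'. good f' F' \<longrightarrow> \<not> lower f' f)"
proof -
  let ?L = "U \<times> (UNIV :: bool set)"
  define W where "W f = (image_mset (\<lambda>b. key (f (lett b))) (mset_set ?L), \<Sum>b \<in> ?L. len (f (lett b)))"
    for f :: "'w raag \<Rightarrow> 'w raag"
  define R where "R = inv_image (mult keyrel <*lex*> less_than) W"
  have finL: "finite ?L"
    using finU by simp
  have "wf R"
    unfolding R_def by (intro wf_inv_image wf_lex_prod wf_mult wf_keyrel wf_less_than)
  moreover have "f \<in> {f. \<exists>F. good f F}"
    using assms by blast
  ultimately obtain f0 where f0: "f0 \<in> {f. \<exists>F. good f F}" "\<And>f'. (f', f0) \<in> R \<Longrightarrow> f' \<notin> {f. \<exists>F. good f F}"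
    using wfE_min[of R f "{f. \<exists>F. good f F}"] by metis
  have "(f', f) \<in> R" if low: "lower f' f" for f' f
  proof -
    let ?k = "\<lambda>f b. key (f (lett b))"
    let ?A = "{b \<in> ?L. (?k f' b, ?k f b) \<in> keyrel}"
    have irrefl: "(x, x) \<notin> keyrel" for x
      using wf_keyrel by simp
    show ?thesis
    proof (cases "?A = {}")
      case False
      let ?I = "image_mset (?k f) (mset_set (?L - ?A))"
      have split: "mset_set ?L = mset_set (?L - ?A) + mset_set ?A"
        using finL by (subst mset_set_Union[symmetric]) (auto intro!: arg_cong[of _ _ mset_set])
      have "image_mset (?k f') (mset_set (?L - ?A)) = ?I"
        using low finL unfolding lower_def by (intro image_mset_cong) fastforce
      moreover have "(?I + image_mset (?k f') (mset_set ?A), ?I + image_mset (?k f) (mset_set ?A)) \<in> mult keyrel"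
      proof (rule one_step_implies_mult)
        show "image_mset (?k f) (mset_set ?A) \<noteq> {#}"
          using False finL by (simp add: mset_set_empty_iff)
        show "\<forall>k \<in># image_mset (?k f') (mset_set ?A). \<exists>j \<in># image_mset (?k f) (mset_set ?A). (k, j) \<in> keyrel"
          using finL by auto
      qed
      ultimately have "(fst (W f'), fst (W f)) \<in> mult keyrel"
        unfolding W_def fst_conv split image_mset_union by simp
      then show ?thesis
        unfolding R_def by (simp add: in_inv_image lex_prod_def split_beta)
    next
      case True
      then have eq: "?k f' b = ?k f b" if "b \<in> ?L" for b
        using low that unfolding lower_def by auto
      have "fst (W f') = fst (W f)"
        unfolding W_def using eq finL by (auto intro!: image_mset_cong)
      moreover have "\<not> (\<exists>b. fst b \<in> U \<and> (?k f' b, ?k f b) \<in> keyrel)"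
        using True by auto
      then have "snd (W f') < snd (W f)"
        unfolding W_def snd_conv using low finL unfolding lower_def by (intro sum_strict_mono_ex1) auto
      ultimately show ?thesis
        unfolding R_def by (simp add: in_inv_image lex_prod_def split_beta)
    qed
  qed
  then show ?thesis
    using f0 by blast
qed

text \<open>By \<open>class_conj\<close> the conjugators of the class of \<open>b\<close> agree
  modulo words without the vertex of the centre \<open>C a\<close>, and right multiplication by such
  words does not remove the first letter \<open>C a\<close> of \<open>- P a + P b\<close>. For
  \<open>a\<close> over \<open>S\<close> the centre may be another vertex of \<open>S\<close>, which
  \<open>sat_twin\<close> takes care of.\<close>

lemma class_head:
  assumes f: "good f F" "centred f P C" and ab: "fst a \<in> U" "fst b \<in> U" "fst b \<notin> star (fst a)" "fst b \<notin> S"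
    and pre: "pre (P a + lett (C a)) (P b)"
    and c: "fst c \<in> U" "(fst b, fst c) \<in> (sat (fst a))\<^sup>*"
  shows "fst c \<notin> S \<and> pre (P a + lett (C a)) (P c)"
proof -
  note A = centredD[OF f ab(1)] and B = centredD[OF f ab(2)] and C' = centredD[OF f c(1)]
  let ?x = "fst (C a)"
  have x: "?x = fst a \<or> fst a \<in> S \<and> ?x \<in> S"
    using A(9,11) by (cases "fst a \<in> S") auto
  have s: "(fst b, fst c) \<in> (sat ?x)\<^sup>* \<and> fst c \<notin> S"
    using sat_rtrancl[OF ab(1) _ c(2) ab(4), of ?x] x by blast
  have st: "fst b \<notin> star ?x"
    using x
  proof
    assume *: "fst a \<in> S \<and> ?x \<in> S"
    then have "\<not> adj ?x (fst b)"
      using isolated[OF _ ab(2)] by simp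
    moreover have "fst b \<noteq> ?x"
      using * ab(4) by metis
    ultimately show ?thesis
      by (simp add: in_star)
  qed (simp add: ab(3))
  have "fst b \<in> VG"
    using ab(2) UV by blast
  then have "- P b + P c \<in> gp (- {?x})"
    using class_conj[OF f(1) A(6) conjunct1[OF s] _ ab(4) st B(13)[OF ab(4)] C'(13)[OF conjunct2[OF s]]]
    by simp
  moreover have "starts (C a) (- P a + P b)"
    using pre irr_pre_iff[OF A(3)] by blast
  ultimately have "starts (C a) ((- P a + P b) + (- P b + P c))"
    using starts_add_gp by blast
  then have "starts (C a) (- P a + P c)"
    by (simp add: add.assoc)
  then show ?thesis
    using s irr_pre_iff[OF A(3)] by blast
qed

text \<open>The suffix tells whether \<open>a\<close> and \<open>b\<close> lie over \<open>S\<close>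
  or over the rest \<open>Y\<close> of \<open>U\<close>. Here the whole class of \<open>b\<close> is
  conjugated by the inverse of \<open>lett a\<close>, which deletes the letter \<open>a\<close> from
  all its conjugators.\<close>

lemma swallow_YY:
  assumes f: "good f F" "centred f P C" and ab: "fst a \<in> U" "fst b \<in> U" "fst b \<notin> star (fst a)"
    and Y: "fst a \<notin> S" "fst b \<notin> S"
    and pre: "pre (P a + lett (C a)) (P b)"
  shows "\<exists>f' F'. good f' F' \<and> lower f' f"
proof -
  note A = centredD[OF f ab(1)]
  let ?K = "(sat (fst a))\<^sup>* `` {fst b}"
  have "saturated (fst a) ?K"
    using saturated_class ab(2,3) UV by blast
  then obtain f' F' where f': "good f' F'" "\<And>c. fst c \<in> VG \<Longrightarrow> f' (lett c) =
      (if fst c \<in> ?K then - f (lett a) + f (lett c) + f (lett a) else f (lett c))"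
    using good_conj[OF f(1) ab(1)] by blast
  have fa: "f (lett a) = P a + lett a - P a"
    using A(1,11,12) Y by simp
  have K: "(key (f' (lett c)) = key (f (lett c)) \<or> (key (f' (lett c)), key (f (lett c))) \<in> keyrel) \<and>
    len (f' (lett c)) < len (f (lett c))" if c: "fst c \<in> U" "fst c \<in> ?K" for c
  proof -
    note B = centredD[OF f c(1)]
    have cS: "fst c \<notin> S" "pre (P a + lett a) (P c)"
      using class_head[OF f ab Y(2) pre c(1)] c(2) A(11) Y(1) by auto
    obtain r where r: "P c = P a + lett a + r" "red (P a + lett a) r"
      using cS(2) by (rule pre_obtain)
    have Pa: "red (P a) (lett a)"
      using A(8,11) Y(1) by simp
    let ?Q = "P a + r"
    have fc: "f (lett c) = P c + (lett c - P c)"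
      using B(1,11,12) cS(1) by (simp add: add.assoc diff_conv_add_uminus del: add_uminus_conv_diff)
    have "f' (lett c) = - f (lett a) + f (lett c) + f (lett a)"
      using f'(2)[of c] c UV by auto
    also have "\<dots> = ?Q + (lett c - ?Q)"
      unfolding fc fa r(1)
      by (simp add: minus_add add.assoc diff_conv_add_uminus del: add_uminus_conv_diff)
    finally have f'c: "f' (lett c) = ?Q + (lett c - ?Q)" .
    have rc: "red (P c) (lett c)" "red (P c + lett c) (- P c)"
      using B(2,8,11,12) cS(1) by auto
    have rc': "red (P c) (lett c - P c)" "red (lett c) (- P c)"
      using red_assoc[OF rc(1), of "- P c"] rc(2) by auto
    have gpU: "P c \<in> gp U" "P a \<in> gp U" "r \<in> gp U" "lett c \<in> gp U"
      using B(5) A(5) red_gp[OF r(2)] r(1) c(1) by auto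
    have Q: "?Q \<in> gp U"
      using gpU gp_add by blast
    have m: "lett c - ?Q \<in> gp U" "lett c - P c \<in> gp U"
      using gp_diff gpU Q by blast+
    have ra: "red (P a) (lett a + r)" "red (lett a) r"
      using red_assoc[OF Pa, of r] r(2) by auto
    have kP: "kx (P c) = kx (P a) + kx r"
      unfolding r(1) using kx_red[OF r(2)] kx_red[OF Pa] Y(1) by simp
    then have kQ: "kx ?Q \<le> kx (P c)"
      using kx_add_le[of "P a" r] by simp
    have k0: "kx (lett c) = 0"
      using cS(1) by simp
    have km': "kx (lett c - P c) = kx (P c)"
      using kx_red[OF rc'(2)] k0 by simp
    have "kx (lett c - ?Q) \<le> kx (lett c) + kx (- ?Q)"
      using kx_add_le[of "lett c" "- ?Q"] by simp
    then have km: "kx (lett c - ?Q) \<le> kx (lett c - P c)"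
      unfolding km' k0 kx_uminus using kQ by linarith
    have half: "kx (P c + (lett c - P c)) div 2 = kx (P c)"
      using kx_red[OF rc'(1)] km' by simp
    have "key (?Q + (lett c - ?Q)) = key (P c + (lett c - P c)) \<or>
      (key (?Q + (lett c - ?Q)), key (P c + (lett c - P c))) \<in> keyrel"
    proof (rule key_prefix[OF rc'(1) kQ km _ Q gpU(1) m])
      assume eq: "kx ?Q = kx (P c)"
      show "xlist (kx (P c + (lett c - P c)) div 2) ?Q = xlist (kx (P c + (lett c - P c)) div 2) (P c) \<or>
        (xlist (kx (P c + (lett c - P c)) div 2) ?Q, xlist (kx (P c + (lett c - P c)) div 2) (P c)) \<in> lex less_than"
        unfolding half using xlist_shorten[OF ra Y(1), of "kx (P c)"] gpU(1) eq kP r(1) by simp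
    qed (simp add: half)
    moreover have "len (P c) = len (P a) + 1 + len r"
      using r Pa unfolding red_def by simp
    then have "len ?Q < len (P c)"
      using len_add_le[of "P a" r] by simp
    moreover have "len (lett c - ?Q) \<le> 1 + len ?Q"
      using len_add_le[of "lett c" "- ?Q"] by simp
    then have "len (?Q + (lett c - ?Q)) \<le> 2 * len ?Q + 1"
      using len_add_le[of ?Q "lett c - ?Q"] by linarith
    moreover have "len (P c + (lett c - P c)) = 2 * len (P c) + 1"
      using rc'(1) rc'(2) unfolding red_def by simp
    ultimately show ?thesis
      unfolding f'c fc by auto
  qed
  have N: "f' (lett c) = f (lett c)" if "fst c \<in> U" "fst c \<notin> ?K" for c
    using f'(2)[of c] that UV by auto
  have "fst b \<in> ?K"
    by simp
  then have "lower f' f"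
    unfolding lower_def using K N ab(2) by (metis less_imp_le order_refl)
  then show ?thesis
    using f'(1) by blast
qed

text \<open>A transvection of \<open>b\<close> deletes one letter \<open>a\<close> from
  \<open>f (lett b)\<close>. Both \<open>f (lett b)\<close> and its inverse are checked, as each
  contributes a key.\<close>

lemma swallow_YS:
  assumes f: "good f F" "centred f P C" and ab: "fst a \<in> U" "fst a \<notin> S" "fst b \<in> S"
    and pre: "pre (P a + lett (C a)) (P b + lett (C b))"
  shows "\<exists>f' F'. good f' F' \<and> lower f' f"
proof -
  have bU: "fst b \<in> U"
    using ab(3) SU by blast
  note A = centredD[OF f ab(1)] and B = centredD[OF f bU]
  obtain f' F' where f': "good f' F'" "f' (lett b) = - f (lett a) + f (lett b)"
    "\<And>c. fst c \<in> VG \<Longrightarrow> fst c \<noteq> fst b \<Longrightarrow> f' (lett c) = f (lett c)"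
    using good_transvection[OF f(1) ab(3) ab(1)] ab by metis
  have Ca: "C a = a" "red (P a) (lett a)" "f (lett a) = P a + lett a - P a"
    using A(1,8,11,12) ab(2) by auto
  have "pre (P b + lett (C b)) (f (lett b))"
    using B(1,2) by (metis pre_add_iff diff_conv_add_uminus)
  then have "pre (P a + lett a) (f (lett b))"
    using pre_trans pre Ca(1) by metis
  then obtain r where r: "f (lett b) = P a + lett a + r" "red (P a + lett a) r"
    by (rule pre_obtain)
  have f'b: "f' (lett b) = P a + r"
    unfolding f'(2) r(1) Ca(3) by (simp add: minus_add add.assoc diff_conv_add_uminus del: add_uminus_conv_diff)
  have ra: "red (P a) (lett a + r)" "red (lett a) r"
    using red_assoc[OF Ca(2), of r] r(2) by auto
  have key1: "key (f' (lett b)) = key (f (lett b)) \<or> (key (f' (lett b)), key (f (lett b))) \<in> keyrel"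
    unfolding f'b r(1) using key_shorten[OF ra ab(2)] B(7) r(1) by simp
  have nb: "- f (lett b) = - r + lett (linv a) + - P a"
    unfolding r(1) by (simp add: minus_add add.assoc diff_conv_add_uminus del: add_uminus_conv_diff)
  have nb': "- f' (lett b) = - r + - P a"
    unfolding f'b by (simp only: minus_add)
  have "red (- r) (- (P a + lett a))"
    using r(2) red_uminus by blast
  then have ra': "red (- r) (lett (linv a) + - P a)"
    by (simp only: minus_add lett_linv)
  have ra'': "red (lett (linv a)) (- P a)"
    using Ca(2) red_uminus[of "lett a" "P a"] by simp
  have key2: "key (- f' (lett b)) = key (- f (lett b)) \<or> (key (- f' (lett b)), key (- f (lett b))) \<in> keyrel"
  proof -
    have "- f (lett b) \<in> gp U"
      using B(7) by simp
    then have "- r + lett (linv a) + - P a \<in> gp U"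
      unfolding nb .
    then show ?thesis
      unfolding nb nb' using key_shorten[OF ra' ra''] ab(2) by simp
  qed
  have len: "len (f (lett b)) = len (P a) + 1 + len r" "len (f' (lett b)) \<le> len (P a) + len r"
    using r Ca(2) len_add_le[of "P a" r] unfolding f'b red_def by auto
  have linv: "f' (lett (linv b)) = - f' (lett b)" "f (lett (linv b)) = - f (lett b)"
    using good_linv f'(1) f(1) by blast+
  have K: "(key (f' (lett c)) = key (f (lett c)) \<or> (key (f' (lett c)), key (f (lett c))) \<in> keyrel) \<and>
    len (f' (lett c)) \<le> len (f (lett c))" if "fst c \<in> U" for c
  proof (cases "fst c = fst b")
    case True
    then have "c = b \<or> c = linv b"
      by (rule letter_same_vertex)
    then show ?thesis
      using key1 key2 len linv by (elim disjE) simp_all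
  next
    case False
    moreover have "fst c \<in> VG"
      using that UV by blast
    ultimately show ?thesis
      using f'(3)[of c] by simp
  qed
  have "len (f' (lett b)) < len (f (lett b))"
    using len by simp
  then have "lower f' f"
    unfolding lower_def using K bU by blast
  then show ?thesis
    using f'(1) by blast
qed

text \<open>The head \<open>h\<close> carries at least half of the \<open>S\<close>-letters of the
  image. If it carries exactly half, its list exceeds that of \<open>- r\<close>, so replacing
  \<open>h\<close> by \<open>- r\<close> pays in either case.\<close>

lemma head_S:
  assumes f: "good f F" "centred f P C" and a: "fst a \<in> S"
  defines "h \<equiv> P a + lett (C a)" and "r \<equiv> - P (linv a)"
  shows "f (lett a) = h + r" "red h r" "h \<in> gp U" "r \<in> gp U" "xend h"
    "kx (f (lett a)) = kx h + kx r" "kx (f (lett a)) \<le> 2 * kx h" "kx h \<le> Suc (kx (f (lett a)) div 2)"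
    "kx (f (lett a)) = 2 * kx h \<Longrightarrow> (xlist (kx h) (- r), xlist (kx h) h) \<in> lex less_than"
    "idx (f (lett a)) = kx h"
proof -
  have aU: "fst a \<in> U"
    using a SU by blast
  note A = centredD[OF f aU]
  obtain x where x: "x \<in> S" "expo x (f (lett a)) \<noteq> 0"
    using good_expo_S[OF f(1) a] by blast
  note id = idx[OF A(7) x]
  have hx: "h = xpre (idx (f (lett a))) (f (lett a))"
    unfolding h_def by (rule A(10)[OF a])
  show fa: "f (lett a) = h + r"
    using A(1) unfolding h_def r_def by (simp only: diff_conv_add_uminus)
  show hr: "red h r"
    using A(2) unfolding h_def r_def .
  show U: "h \<in> gp U" "r \<in> gp U"
    using red_gp[OF hr] A(7) fa by auto
  show "xend h" and i: "idx (f (lett a)) = kx h"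
    using xpre[OF A(7) id(1,2)] hx by auto
  show k: "kx (f (lett a)) = kx h + kx r"
    unfolding fa by (rule kx_red[OF hr])
  show "kx (f (lett a)) \<le> 2 * kx h" "kx h \<le> Suc (kx (f (lett a)) div 2)"
    using id(4,5) i by simp_all
  assume half: "kx (f (lett a)) = 2 * kx h"
  have "(xlist (kx h) (- f (lett a)), xlist (kx h) (f (lett a))) \<in> lex less_than"
    using id(6) half i by simp
  moreover have "xlist (kx h) (f (lett a)) = xlist (kx h) h"
    unfolding fa using xpre_add_left[OF kx_red[OF hr] U] by (intro xlist_cong) simp
  moreover have "xlist (kx h) (- f (lett a)) = xlist (kx h) (- r)"
  proof -
    have "red (- r) (- h)"
      using hr red_uminus by blast
    moreover have "- f (lett a) = - r + - h"
      unfolding fa by (simp only: minus_add)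
    moreover have "kx (- r) = kx h"
      using half k by simp
    ultimately show ?thesis
      using xpre_add_left[OF kx_red, of "- r" "- h"] U by (intro xlist_cong) simp
  qed
  ultimately show "(xlist (kx h) (- r), xlist (kx h) h) \<in> lex less_than"
    by simp
qed

text \<open>Conjugation of the class replaces the head \<open>?h\<close> by \<open>- ?r\<close> at
  the front of all its conjugators: either \<open>S\<close>-letters are lost or
  \<open>key_exchange\<close> applies.\<close>

lemma swallow_SY:
  assumes f: "good f F" "centred f P C" and ab: "fst a \<in> S" "fst b \<in> U" "fst b \<notin> star (fst a)" "fst b \<notin> S"
    and pre: "pre (P a + lett (C a)) (P b)"
  shows "\<exists>f' F'. good f' F' \<and> lower f' f"
proof -
  have aU: "fst a \<in> U"
    using ab(1) SU by blast
  let ?h = "P a + lett (C a)" and ?r = "- P (linv a)"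
  note A = centredD[OF f aU] and H = head_S[OF f ab(1)]
  let ?K = "(sat (fst a))\<^sup>* `` {fst b}"
  have "saturated (fst a) ?K"
    using saturated_class ab(2,3) UV by blast
  then obtain f' F' where f': "good f' F'" "\<And>c. fst c \<in> VG \<Longrightarrow> f' (lett c) =
      (if fst c \<in> ?K then - f (lett a) + f (lett c) + f (lett a) else f (lett c))"
    using good_conj[OF f(1) aU] by blast
  have K: "(key (f' (lett c)), key (f (lett c))) \<in> keyrel" if c: "fst c \<in> U" "fst c \<in> ?K" for c
  proof -
    note B = centredD[OF f c(1)]
    have cS: "fst c \<notin> S" "pre ?h (P c)"
      using class_head[OF f aU ab(2-4) pre c(1)] c(2) by auto
    obtain s where s: "P c = ?h + s" "red ?h s"
      using cS(2) by (rule pre_obtain)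
    let ?Q = "- ?r + s"
    have fc: "f (lett c) = P c + lett c - P c"
      using B(1,11,12) cS(1) by simp
    have fc': "f (lett c) = ?h + (s + lett c - P c)"
      unfolding fc using s(1) by (simp only: add.assoc diff_conv_add_uminus)
    have "f' (lett c) = - f (lett a) + f (lett c) + f (lett a)"
      using f'(2)[of c] c UV by auto
    also have "\<dots> = - (?h + ?r) + (?h + s + lett c - (?h + s)) + (?h + ?r)"
      unfolding fc H(1) s(1) ..
    also have "\<dots> = ?Q + lett c - ?Q"
      by (simp add: minus_add add.assoc diff_conv_add_uminus del: add_uminus_conv_diff)
    finally have f'c: "f' (lett c) = ?Q + lett c - ?Q" .
    have f'c': "f' (lett c) = - ?r + (s + lett c - ?Q)"
      unfolding f'c by (simp only: add.assoc diff_conv_add_uminus)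
    have rc: "red (P c) (lett c)" "red (P c + lett c) (- P c)"
      using B(2,8,11,12) cS(1) by auto
    have rs: "red s (lett c)" "red (s + lett c) (- P c)" "red ?h (s + lett c - P c)"
    proof -
      have "red s (lett c) \<and> red ?h (s + lett c)"
        using red_assoc[OF s(2), of "lett c"] rc(1) s(1) by simp
      then show "red s (lett c)"
        by simp
      have *: "red ?h (s + lett c)"
        using red_assoc[OF s(2), of "lett c"] rc(1) s(1) by simp
      have "red (?h + (s + lett c)) (- P c)"
        using rc(2) s(1) by (simp only: add.assoc)
      then have "red (s + lett c) (- P c) \<and> red ?h (s + lett c + - P c)"
        using red_assoc[OF *, of "- P c"] by simp
      then show "red (s + lett c) (- P c)" "red ?h (s + lett c - P c)"
        by auto
    qed
    have gpU: "P c \<in> gp U" "s \<in> gp U" "lett c \<in> gp U" "?Q \<in> gp U"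
      using B(5) red_gp[OF s(2)] s(1) c(1) H(4) gp_add[of "- ?r" U s] by auto
    have k0: "kx (lett c) = 0"
      using cS(1) by simp
    have kP: "kx (P c) = kx ?h + kx s"
      unfolding s(1) by (rule kx_red[OF s(2)])
    have kQ: "kx ?Q \<le> kx ?r + kx s"
      using kx_add_le[of "- ?r" s] by simp
    have kfc: "kx (f (lett c)) = 2 * kx (P c)"
      unfolding fc using kx_red[OF rc(2)] kx_red[OF rc(1)] k0 by simp
    have kf'c: "kx (f' (lett c)) \<le> 2 * kx ?Q"
      unfolding f'c using kx_add_le[of "?Q + lett c" "- ?Q"] kx_add_le[of ?Q "lett c"] k0 by simp
    have kr: "kx ?r \<le> kx ?h"
      using H(6,7) by linarith
    show ?thesis
    proof (cases "kx ?r = kx ?h")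
      case False
      then have "kx (f' (lett c)) < kx (f (lett c))"
        using kf'c kfc kQ kP kr by linarith
      then show ?thesis
        by (rule key_drop)
    next
      case True
      then have half: "kx (f (lett a)) = 2 * kx ?h"
        using H(6) by simp
      show ?thesis
        unfolding f'c' fc'
      proof (rule key_exchange[OF _ _ H(9)[OF half]])
        show "kx (- ?r) = kx ?h"
          using True by simp
        have "kx (s + lett c - ?Q) \<le> kx s + kx ?Q"
          using kx_add_le[of "s + lett c" "- ?Q"] kx_add_le[of s "lett c"] k0 by simp
        moreover have "kx (s + lett c - P c) = kx s + kx (P c)"
          using kx_red[OF rs(2)] kx_red[OF rs(1)] k0 by simp
        ultimately show "kx (s + lett c - ?Q) \<le> kx (s + lett c - P c)"
          using kQ kP True by linarith
        show "kx ?h \<le> kx (?h + (s + lett c - P c)) div 2"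
          using kfc kP unfolding fc' by simp
        show "s + lett c - ?Q \<in> gp U" "s + lett c - P c \<in> gp U"
          using gpU gp_add gp_diff by blast+
      qed (use H rs in auto)
    qed
  qed
  have N: "f' (lett c) = f (lett c)" if "fst c \<in> U" "fst c \<notin> ?K" for c
    using f'(2)[of c] that UV by auto
  have "fst b \<in> ?K"
    by simp
  then have "lower f' f"
    unfolding lower_def using K N ab(2) by metis
  then show ?thesis
    using f'(1) by blast
qed

text \<open>A transvection replaces the head of \<open>a\<close> inside \<open>f (lett b)\<close> by
  \<open>- ?r\<close>. If the head is exactly half of \<open>f (lett a)\<close>, the gain is visible
  only when the head lies in the first half of \<open>f (lett b)\<close>, which assumption
  \<open>k\<close> guarantees.\<close>

lemma swallow_SS:
  assumes f: "good f F" "centred f P C" and ab: "fst a \<in> S" "fst b \<in> S" "fst a \<noteq> fst b"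
    and pre: "pre (P a + lett (C a)) (P b + lett (C b))"
    and k: "kx (f (lett a)) < 2 * kx (P a + lett (C a)) \<or> kx (f (lett a)) \<le> kx (f (lett b))"
  shows "\<exists>f' F'. good f' F' \<and> lower f' f"
proof -
  have U: "fst a \<in> U" "fst b \<in> U"
    using ab SU by auto
  let ?h = "P a + lett (C a)" and ?r = "- P (linv a)"
  note A = centredD[OF f U(1)] and H = head_S[OF f ab(1)]
  note B = centredD[OF f U(2)] and HB = head_S[OF f ab(2)]
  obtain f' F' where f': "good f' F'" "f' (lett b) = - f (lett a) + f (lett b)"
    "\<And>c. fst c \<in> VG \<Longrightarrow> fst c \<noteq> fst b \<Longrightarrow> f' (lett c) = f (lett c)"
    using good_transvection[OF f(1) ab(2) U(1) ab(3)] by metis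
  have "pre (P b + lett (C b)) (f (lett b))"
    unfolding HB(1) pre_add_iff by (rule HB(2))
  then have "pre ?h (f (lett b))"
    using pre_trans pre by blast
  then obtain s where s: "f (lett b) = ?h + s" "red ?h s"
    by (rule pre_obtain)
  have sU: "s \<in> gp U"
    using red_gp[OF s(2)] s(1) B(7) by simp
  have f'b: "f' (lett b) = - ?r + s"
    unfolding f'(2) s(1) H(1) by (simp only: minus_add add.assoc minus_minus minus_add_cancel)
  have kb: "kx (f (lett b)) = kx ?h + kx s"
    unfolding s(1) by (rule kx_red[OF s(2)])
  have kb': "kx (f' (lett b)) \<le> kx ?r + kx s"
    unfolding f'b using kx_add_le[of "- ?r" s] by simp
  have linv: "f' (lett (linv b)) = - f' (lett b)" "f (lett (linv b)) = - f (lett b)"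
    using good_linv f'(1) f(1) by blast+
  have key: "(key (f' (lett b)), key (f (lett b))) \<in> keyrel \<and>
    (key (- f' (lett b)) = key (- f (lett b)) \<or> (key (- f' (lett b)), key (- f (lett b))) \<in> keyrel)"
  proof (cases "kx ?r = kx ?h")
    case False
    then have "kx (f' (lett b)) < kx (f (lett b))"
      using kb kb' H(6,7) by linarith
    then show ?thesis
      using key_drop kx_uminus by metis
  next
    case True
    then have half: "kx (f (lett a)) = 2 * kx ?h"
      using H(6) by simp
    then have le: "2 * kx ?h \<le> kx (f (lett b))"
      using k by linarith
    have "(key (- ?r + s), key (?h + s)) \<in> keyrel"
    proof (rule key_exchange[OF _ _ H(9)[OF half]])
      show "kx ?h \<le> kx (?h + s) div 2"
        using le s(1) by simp
    qed (use True H s sU in auto)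
    moreover have "key (- s + ?r) = key (- s + - ?h) \<or> (key (- s + ?r), key (- s + - ?h)) \<in> keyrel"
    proof (rule key_prefix)
      have rs: "red (- s) (- ?h)"
        using s(2) red_uminus by blast
      then show "red (- s) (- ?h)" .
      show "kx (- s + - ?h) div 2 \<le> kx (- s)"
        unfolding kx_red[OF rs] kx_uminus using le kb by simp
    qed (use True H sU in auto)
    moreover have "- f' (lett b) = - s + ?r"
      unfolding f'b by (simp only: minus_add minus_minus)
    moreover have "- f (lett b) = - s + - ?h"
      unfolding s(1) by (simp only: minus_add)
    ultimately show ?thesis
      unfolding f'b s(1) by simp
  qed
  have "key (f' (lett c)) = key (f (lett c)) \<or> (key (f' (lett c)), key (f (lett c))) \<in> keyrel"
    if "fst c \<in> U" for c
  proof (cases "fst c = fst b")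
    case True
    then have "c = b \<or> c = linv b"
      by (rule letter_same_vertex)
    then show ?thesis
      using key linv by (elim disjE) simp_all
  next
    case False
    moreover have "fst c \<in> VG"
      using that UV by blast
    ultimately show ?thesis
      using f'(3)[of c] by simp
  qed
  then have "lower f' f"
    unfolding lower_def using key U by blast
  then show ?thesis
    using f'(1) by blast
qed

lemma no_swallow:
  assumes f: "good f F" "centred f P C" and low: "\<And>f' F'. good f' F' \<Longrightarrow> \<not> lower f' f"
    and ab: "fst a \<in> U" "fst b \<in> U" "a \<noteq> b" "\<not> adj (fst a) (fst b)"
  shows "\<not> pre (P a + lett (C a)) (P b + lett (C b))"
proof
  assume pre: "pre (P a + lett (C a)) (P b + lett (C b))"
  note A = centredD[OF f ab(1)] and B = centredD[OF f ab(2)]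
  have no: "\<not> (\<exists>f' F'. good f' F' \<and> lower f' f)"
    using low by blast
  show False
  proof (cases "fst b \<in> S")
    case False
    have ne: "P a + lett (C a) \<noteq> P b + lett (C b)"
    proof
      assume "P a + lett (C a) = P b + lett (C b)"
      then have "C a = C b"
        using irr_eqD A(3) B(3) by blast
      then show False
        using A(9,11) B(11) False ab(3) by (cases "fst a \<in> S") auto
    qed
    have preP: "pre (P a + lett (C a)) (P b)"
      using irr_pre_proper[OF B(3) pre ne] .
    have "fst b \<noteq> fst a"
    proof
      assume eq: "fst b = fst a"
      then have "b = linv a"
        using letter_same_vertex[OF eq] ab(3) by simp
      then have "P b = P a"
        using A(12) False eq by simp
      then have "len (P a + lett (C a)) \<le> len (P a)"
        using pre_len[OF preP] by simp
      then show False
        using A(8) unfolding red_def by simp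
    qed
    then have st: "fst b \<notin> star (fst a)"
      using ab(4) by (simp add: in_star)
    show False
    proof (cases "fst a \<in> S")
      case True
      then show ?thesis
        using swallow_SY[OF f True ab(2) st False preP] no by blast
    next
      case aS: False
      then show ?thesis
        using swallow_YY[OF f ab(1,2) st aS False preP] no by blast
    qed
  next
    case bS: True
    show False
    proof (cases "fst a \<in> S")
      case False
      then show ?thesis
        using swallow_YS[OF f ab(1) False bS pre] no by blast
    next
      case aS: True
      let ?h = "P a + lett (C a)" and ?h' = "P b + lett (C b)"
      note H = head_S[OF f aS] and H' = head_S[OF f bS]
      have kle: "kx ?h \<le> kx ?h'"
        using xend_pre_less[OF H'(5) pre] by fastforce
      have eq: "?h = ?h'" if "kx ?h = kx ?h'"
        using xend_pre_less[OF H'(5) pre] that by fastforce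
      have pb: "pre ?h' (f (lett b))"
        unfolding H'(1) pre_add_iff by (rule H'(2))
      show ?thesis
      proof (cases "fst a = fst b")
        case False
        show ?thesis
        proof (cases "kx (f (lett a)) < 2 * kx ?h \<or> kx (f (lett a)) \<le> kx (f (lett b))")
          case True
          then show ?thesis
            using swallow_SS[OF f aS bS False pre] no by blast
        next
          \<comment> \<open>Then the head of \<open>a\<close> is exactly half of
            \<open>f (lett a)\<close>, which has more \<open>S\<close>-letters than
            \<open>f (lett b)\<close>. Counting shows that both heads have equally many and
            therefore coincide, so the roles of \<open>a\<close> and \<open>b\<close> can be
            exchanged.\<close>
          case k: False
          then have "kx ?h = kx ?h'" "kx (f (lett b)) < 2 * kx ?h'"
            using kle H(7) H'(7,8) by linarith+
          then show ?thesis
            using swallow_SS[OF f bS aS False[symmetric]] eq no by simp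
        qed
      next
        \<comment> \<open>A letter and its inverse select the same centre. Equal heads would make
          the centre its own inverse; an exact half would make the list of the head equal to that of
          \<open>- r\<close>, against the strict inequality in \<open>head_S\<close>.\<close>
        case True
        then have b: "b = linv a"
          using letter_same_vertex[OF True] ab(3) by (metis linv_linv)
        obtain x where x: "x \<in> S" "expo x (f (lett a)) \<noteq> 0"
          using good_expo_S[OF f(1) aS] by blast
        note id = idx[OF A(7) x]
        have fb: "f (lett b) = - f (lett a)"
          using b good_linv[OF f(1)] by simp
        have "kx ?h' = Suc (kx (f (lett a))) - kx ?h"
          using id(3) H(10) H'(10) fb by simp
        then consider "kx ?h = kx ?h'" | "kx (f (lett a)) = 2 * kx ?h"
          using kle H(7) by linarith
        then show ?thesis
        proof cases
          case 1
          then have "C a = C b"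
            using eq irr_eqD A(3) B(3) by blast
          then show ?thesis
            using A(4) b by simp
        next
          case 2
          have "xlist (kx ?h) ?h = xlist (kx ?h) (- f (lett a))"
          proof (rule xlist_cong)
            fix j
            assume "1 \<le> j" "j \<le> kx ?h"
            then show "xpre j ?h = xpre j (- f (lett a))"
              using xpre_pre[OF pre_trans[OF pre pb] B(7)] fb by simp
          qed
          moreover have "xlist (kx ?h) (- f (lett a)) = xlist (kx ?h) (- (- P (linv a)))"
          proof (rule xlist_cong)
            fix j
            assume j: "1 \<le> j" "j \<le> kx ?h"
            have r: "red (- (- P (linv a))) (- ?h)"
              using H(2) by (simp only: red_uminus)
            have e: "- f (lett a) = - (- P (linv a)) + - ?h"
              unfolding H(1) by (simp only: minus_add)
            have "j \<le> kx (- (- P (linv a)))"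
              using 2 H(6) j(2) by simp
            then show "xpre j (- f (lett a)) = xpre j (- (- P (linv a)))"
              unfolding e using xpre_add_left[OF kx_red[OF r] _ _ j(1)] H(3,4) by simp
          qed
          ultimately show ?thesis
            using H(9)[OF 2] lex_asym by metis
        qed
      qed
    qed
  qed
qed

text \<open>At a lowest \<open>f\<close> nothing is absorbed, which is the main hypothesis of
  \<open>letters_from_centres\<close>. For adjacent \<open>a\<close> and \<open>b\<close> the
  conjugate of \<open>f (lett b)\<close> by \<open>P a\<close> commutes with the generator of
  \<open>a\<close> and has exponent zero there, so it lies over the link.\<close>

lemma stage_letters:
  assumes "good f F"
  shows "\<exists>f F. good f F \<and> (\<forall>b. fst b \<in> U \<longrightarrow> (\<exists>c. f (lett b) = lett c \<and>
    (if fst b \<in> S then fst c \<in> S else c = b)))"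
proof -
  obtain f F where f: "good f F" and low: "\<And>f' F'. good f' F' \<Longrightarrow> \<not> lower f' f"
    using lowest_exists[OF assms] by blast
  obtain P C where c: "centred f P C"
    using centred_exists[OF f] by blast
  note D = centredD[OF f c]
  have sgn: "fst (C b) = fst b \<and> fst b \<notin> S \<or> fst (C b) \<in> S \<and> fst b \<in> S" if "fst b \<in> U" for b
    using D(9,11)[OF that] by (cases "fst b \<in> S") auto
  have "f (lett b) = lett (C b)" if b: "fst b \<in> U" for b
  proof (rule letters_from_centres[OF finU goodD(3)[OF f] goodD(9)[OF f], where P = P])
    show "f (lett b) = P b + lett (C b) - P (linv b)" "irr (P b) (C b)" "C (linv b) = linv (C b)" if "fst b \<in> U" for b
      using D(1,3,4)[OF that] by auto
    show "\<not> pre (P a + lett (C a)) (P b + lett (C b))"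
      if "fst a \<in> U" "fst b \<in> U" "a \<noteq> b" "\<not> adj (fst a) (fst b)" for a b
      using no_swallow[OF f c low that] .
    have noadj: "fst a \<notin> S \<and> fst b \<notin> S" if "fst a \<in> U" "fst b \<in> U" "adj (fst a) (fst b)" for a b :: "'w \<times> bool"
      using that isolated adj_sym by blast
    show "adj (fst a) (fst b)" if ab: "fst a \<in> U" "fst b \<in> U" "adj (fst (C a)) (fst (C b))" for a b
    proof -
      have "fst (C a) \<notin> S" "fst (C b) \<notin> S"
        using noadj[OF D(6)[OF ab(1)] D(6)[OF ab(2)] ab(3)] by auto
      then have "fst (C a) = fst a" "fst (C b) = fst b"
        using sgn ab(1,2) by blast+
      then show ?thesis
        using ab(3) by simp
    qed
    show "- P a + f (lett b) + P a \<in> gp {v. adj (fst (C a)) v}"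
      if ab: "fst a \<in> U" "fst b \<in> U" "adj (fst a) (fst b)" for a b
    proof -
      have S: "fst a \<notin> S" "fst b \<notin> S"
        using noadj[OF ab] by auto
      let ?y = "fst a"
      let ?c = "- P a + f (lett b) + P a"
      have fa: "f (gen ?y) = P a + gen ?y - P a"
        using D(13)[OF ab(1) S(1)] .
      have "cm (f (gen ?y)) (f (lett b))"
        by (rule ghom_cm[OF goodD(3)[OF f] cm_lett]) (simp add: ab(3))
      then have "cm (- P a + f (gen ?y) + P a) ?c"
        using cm_conj' by blast
      then have "cm (gen ?y) ?c"
        unfolding fa conj_cancel .
      then have "?c \<in> gp (insert ?y {w. adj ?y w})"
        by (rule centralizer_gen)
      moreover have "expo ?y ?c = 0"
      proof -
        have "?y \<noteq> fst b"
          using ab(3) adj_irrefl by metis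
        then show ?thesis
          using D(1,11,12)[OF ab(2)] S(2) by (simp add: expo_lett)
      qed
      ultimately have "?c \<in> gp (insert ?y {w. adj ?y w} - {?y})"
        by (intro gp_remove_central) auto
      moreover have "insert ?y {w. adj ?y w} - {?y} \<subseteq> {w. adj (fst (C a)) w}"
        using D(11)[OF ab(1) S(1)] by auto
      ultimately show ?thesis
        using gp_mono by blast
    qed
  qed (use b in auto)
  then show ?thesis
    using f D(9,11) by (intro exI[of _ f] exI[of _ F]) (metis (full_types))
qed

end

section \<open>Descending degree\<close>

context cover
begin

lemma mv_inner:
  assumes "k \<in> gp VG"
  shows "\<exists>e E. mv e E \<and> (\<forall>g \<in> gp VG. e g = k + g - k) \<and>
    (\<forall>w \<in> VL. \<exists>g \<in> gp VL. E (gen w) = g + gen w - g)"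
  using assms
proof (induction k rule: gp_induct)
  case zero
  show ?case
    using mv_id by (intro exI[of _ "\<lambda>g. g"]) (auto intro!: bexI[of _ 0])
next
  case (add a k)
  obtain e E where e: "mv e E" "\<And>g. g \<in> gp VG \<Longrightarrow> e g = k + g - k"
    "\<And>w. w \<in> VL \<Longrightarrow> \<exists>g \<in> gp VL. E (gen w) = g + gen w - g"
    using add.IH by blast
  have "saturated (fst a) (VG - star (fst a))"
    unfolding saturated_def sat_def by auto
  then obtain e' E' where e': "mv e' E'"
    "\<And>w. w \<in> VG \<Longrightarrow> e' (gen w) = (if w \<in> VG - star (fst a) then lett a + gen w - lett a else gen w)"
    "\<And>w. w \<in> VL \<Longrightarrow> \<exists>g \<in> gp VL. E' (gen w) = g + gen w - g"
    using mv_partial_conj[OF add(1)] by blast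
  have g': "ghom e'" "ghom E'"
    using mv_laut[OF e'(1)] laut_ghom by blast+
  have conj: "e' g = lett a + g - lett a" if "g \<in> gp VG" for g
  proof (rule ghom_eq_on_gp[OF g'(1) _ _ that])
    show "ghom (\<lambda>g. lett a + g - lett a)"
      unfolding ghom_def by (simp add: conj_add)
    fix w
    assume w: "w \<in> VG"
    show "e' (gen w) = lett a + gen w - lett a"
    proof (cases "w \<in> star (fst a)")
      case True
      then have "cm (gen w) (lett a)"
        by (intro cm_gen_lett) (simp add: in_star)
      then have "lett a + gen w - lett a = gen w"
        by (metis cm_def add_diff_cancel)
      then show ?thesis
        using e'(2)[OF w] True by simp
    next
      case False
      then show ?thesis
        using e'(2)[OF w] w by simp
    qed
  qed
  have k: "k \<in> gp VG"
    by (rule add(2))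
  have "e' (e g) = (lett a + k) + g - (lett a + k)" if "g \<in> gp VG" for g
  proof -
    have "k + g - k \<in> gp VG"
      using k that gp_add gp_diff by blast
    then have "e' (e g) = lett a + (k + g - k) - lett a"
      using conj e(2)[OF that] by simp
    then show ?thesis
      by (simp only: conj_conj)
  qed
  moreover have "\<exists>g \<in> gp VL. E' (E (gen w)) = g + gen w - g" if w: "w \<in> VL" for w
  proof -
    obtain g where g: "g \<in> gp VL" "E (gen w) = g + gen w - g"
      using e(3)[OF w] by blast
    obtain h where h: "h \<in> gp VL" "E' (gen w) = h + gen w - h"
      using e'(3)[OF w] by blast
    have "E' (E (gen w)) = E' g + (h + gen w - h) - E' g"
      unfolding g(2) ghom_diff[OF g'(2)] ghom_add[OF g'(2)] h(2) ..
    also have "\<dots> = (E' g + h) + gen w - (E' g + h)"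
      by (rule conj_conj)
    finally have "E' (E (gen w)) = (E' g + h) + gen w - (E' g + h)" .
    moreover have "E' g \<in> gp VL"
      using mv_laut[OF e'(1)] aut_gp g(1) unfolding laut_def by blast
    ultimately show ?thesis
      using h(1) gp_add by blast
  qed
  ultimately show ?case
    using mv_comp[OF e'(1) e(1)] by blast
qed

section \<open>The subgroup over the vertices dominating \<open>x\<close> outside its link\<close>

definition cone :: "'v \<Rightarrow> 'v set" where
  "cone x = {z \<in> VL. le x z \<and> \<not> adj x z}"

definition cone' :: "'w \<Rightarrow> 'w set" where
  "cone' x = {u. le' x u \<and> \<not> adj x u}"

lemma phi_cone:
  assumes x: "x \<in> VL"
  shows "\<phi> ` cone x = cone' (\<phi> x)"
proof
  show "\<phi> ` cone x \<subseteq> cone' (\<phi> x)"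
  proof
    fix u
    assume "u \<in> \<phi> ` cone x"
    then obtain z where z: "u = \<phi> z" "z \<in> VL" "le x z" "\<not> adj x z"
      unfolding cone_def by blast
    have "\<not> adj (\<phi> x) (\<phi> z)"
    proof
      assume "adj (\<phi> x) (\<phi> z)"
      then obtain l where l: "adj x l" "\<phi> l = \<phi> z"
        using edge_lift[OF x] by blast
      then have "l \<in> star z"
        using z(3) unfolding le_def by auto
      moreover have "\<not> adj z l"
        using not_adj_fibre[OF z(2)] l(2) by simp
      ultimately show False
        using l(1) z(4) by (simp add: in_star)
    qed
    then show "u \<in> cone' (\<phi> x)"
      using z x unfolding cone'_def le'_def by blast
  qed
  show "cone' (\<phi> x) \<subseteq> \<phi> ` cone x"
  proof
    fix u
    assume "u \<in> cone' (\<phi> x)"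
    then have u: "le' (\<phi> x) u" "\<not> adj (\<phi> x) u"
      unfolding cone'_def by auto
    obtain z where z: "z \<in> VL" "\<phi> z = u" "le x z"
      using le'_lift[OF u(1) x refl] by blast
    moreover have "\<not> adj x z"
      using edge[OF x] u(2) z(2) by blast
    ultimately show "u \<in> \<phi> ` cone x"
      unfolding cone_def by blast
  qed
qed

text \<open>After conjugation \<open>F\<close> maps the generators of the link of \<open>x\<close>
  into \<open>gp (nb x)\<close>, with which every \<open>p\<close> in the cone commutes. Applying
  the inverse \<open>H\<close>, the image of \<open>p\<close> commutes with all generators of the
  link, so its support dominates \<open>x\<close>; vertices of the link itself are central there and
  are excluded by their exponent.\<close>

lemma cone_absorbs:
  assumes FH: "aut_pair VL F H" and x: "x \<in> VL"
    and F: "\<And>u. u \<in> VL \<Longrightarrow> expo x (F (gen u)) = (if x = u then 1 else 0)"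
    and H: "\<And>u z. u \<in> VL \<Longrightarrow> z \<in> VL \<Longrightarrow> expo z (H (gen u)) = (if z = u then 1 else 0)"
  shows "\<exists>T \<in> gp VL. \<forall>g \<in> gp (cone x). H (T + g - T) \<in> gp (cone x)"
proof -
  note D = aut_pairD[OF FH]
  obtain T W where T: "minconj W" "F (gen x) = T + W - T"
    using minconj_exists by blast
  \<comment> \<open>Retracting the conjugator keeps it inside \<open>gp VL\<close>; the conjugated
    images of the link are fixed by the retraction.\<close>
  define R where "R = retr VL T"
  have R: "R \<in> gp VL"
    by (simp add: R_def retr_in_gp)
  have xG: "gen x \<in> gp VL"
    using x by simp
  have L: "- R + F (gen l) + R \<in> gp (nb x)" if l: "adj x l" for l
  proof -
    have lV: "l \<in> VL"
      using adjL l x by blast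
    have c: "cm (F (gen x)) (F (gen l))"
      using ghom_cm[OF D(1) cm_lett] l by simp
    have "expo x (F (gen x)) \<noteq> 0" "expo x (F (gen l)) = 0"
      using F x lV l adj_irrefl by auto
    then have *: "- T + F (gen l) + T \<in> gp (nb x)"
      using centralizer_conj[OF T _ c] by (simp add: nb_def)
    have "nb x \<subseteq> VL"
      using adjL x by auto
    then have "- T + F (gen l) + T = retr VL (- T + F (gen l) + T)"
      using * gp_mono retr_gp by (metis subsetD)
    also have "\<dots> = - R + F (gen l) + R"
      using retr_gp[OF D(3)[of "gen l"]] lV
      by (simp only: R_def ghom_add[OF ghom_retr] ghom_uminus[OF ghom_retr] gp_lett fst_conv)
    finally show ?thesis
      using * by simp
  qed
  have "H (R + gen p - R) \<in> gp (cone x)" if p: "p \<in> cone x" for p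
  proof -
    let ?q = "H (R + gen p - R)"
    have pV: "p \<in> VL" "le x p" "\<not> adj x p"
      using p by (auto simp: cone_def)
    have padj: "adj p l" if "adj x l" for l
      using that pV(2,3) unfolding le_def by (metis in_nb in_star subsetD)
    have conjV: "R + gen p - R \<in> gp VL"
      using R pV(1) by (intro gp_diff gp_add) auto
    have qV: "?q \<in> gp VL"
      using D(4)[OF conjV] .
    have star: "?q \<in> gp (star l)" if l: "adj x l" for l
    proof -
      have "l \<in> VL"
        using adjL l x by blast
      have "cm (gen p) (- R + F (gen l) + R)"
      proof (rule cm_sym, rule cm_gp[OF L[OF l]])
        fix a :: "'v \<times> bool"
        assume "fst a \<in> nb x"
        then show "cm (lett a) (gen p)"
          using adj_sym[OF padj[of "fst a"]] cm_lett[of a "(p, True)"] by simp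
      qed
      then have "cm (R + gen p - R) (R + (- R + F (gen l) + R) - R)"
        using cm_conj by blast
      then have "cm (R + gen p - R) (F (gen l))"
        unfolding conj_cancel .
      then have "cm ?q (H (F (gen l)))"
        by (rule ghom_cm[OF D(2)])
      then have "cm (gen l) ?q"
        using D(5)[of "gen l"] \<open>l \<in> VL\<close> cm_sym by simp
      then have "?q \<in> gp (insert l {w. adj l w})"
        by (rule centralizer_gen)
      then show ?thesis
        unfolding star_def nb_def .
    qed
    have W: "le x z" if "z \<in> supp ?q" for z
    proof -
      have "l \<in> star z" if "adj x l" for l
      proof -
        have "z \<in> star l"
          using star[OF that] \<open>z \<in> supp ?q\<close> unfolding gp_def by blast
        then show ?thesis
          unfolding in_star using adj_sym by metis
      qed
      then show ?thesis
        unfolding le_def by auto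
    qed
    have "\<not> adj x l" if "l \<in> supp ?q" for l
    proof
      assume l: "adj x l"
      have lV: "l \<in> VL"
        using adjL l x by blast
      let ?W = "{z \<in> VL. le x z}"
      have "?q \<in> gp ?W"
        using W qV unfolding gp_def by blast
      moreover have "adj l w" if "w \<in> ?W" "w \<noteq> l" for w
      proof -
        have "l \<in> star w"
          using that(1) l unfolding le_def by auto
        then show ?thesis
          using that(2) adj_sym unfolding in_star by metis
      qed
      moreover have "expo l ?q = 0"
      proof -
        have "l \<noteq> p"
          using l pV(3) by blast
        then have "expo l (H (gen p)) = 0"
          using H[OF pV(1) lV] by simp
        then show ?thesis
          by (simp add: ghom_add[OF D(2)] ghom_diff[OF D(2)])
      qed
      ultimately have "?q \<in> gp (?W - {l})"
        using gp_remove_central by blast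
      then show False
        using \<open>l \<in> supp ?q\<close> unfolding gp_def by blast
    qed
    then show ?thesis
      using W qV unfolding gp_def cone_def by blast
  qed
  moreover have "ghom (\<lambda>g. H (R + g - R))"
    unfolding ghom_def by (simp add: conj_add flip: ghom_add[OF D(2)])
  ultimately have "H (R + g - R) \<in> gp (cone x)" if "g \<in> gp (cone x)" for g
    using ghom_image_gp[of "\<lambda>g. H (R + g - R)" "cone x" "cone x" g] that by blast
  then show ?thesis
    using R by blast
qed

text \<open>\<open>cone_absorbs\<close> for \<open>H\<close> and for \<open>F\<close> yields
  inclusions. Their composite is conjugation by \<open>?k\<close> mapping \<open>gp (cone x)\<close>
  into itself; by \<open>conj_into_gp\<close> it acts there as conjugation by an element of that
  subgroup and so is onto.\<close>

lemma cone_image: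
  assumes FH: "aut_pair VL F H" and F: "unitL F" and x: "x \<in> VL"
  shows "\<exists>T \<in> gp VL. (\<forall>g \<in> gp (cone x). F (T + g - T) \<in> gp (cone x)) \<and>
    (\<forall>g \<in> gp (cone x). \<exists>z \<in> gp (cone x). F (T + z - T) = g)"
proof -
  note D = aut_pairD[OF FH]
  have Fu: "expo z (F (gen u)) = (if z = u then 1 else 0)" if "u \<in> VL" "z \<in> VL" for z u
    using F that unfolding unitL_def by blast
  have Hu: "expo z (H (gen u)) = (if z = u then 1 else 0)" if u: "u \<in> VL" and z: "z \<in> VL" for z u
  proof -
    have "expo z (H (F (gen u))) = (\<Sum>v \<in> VL. expo z (H (gen v)) * expo v (F (gen u)))"
      using expo_ghom[OF D(2) finL] D(3)[of "gen u"] u by simp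
    also have "\<dots> = (\<Sum>v \<in> VL. if v = u then expo z (H (gen v)) else 0)"
      using Fu[OF u] by (intro sum.cong) auto
    also have "\<dots> = expo z (H (gen u))"
      using u finL by (simp add: sum.delta)
    finally show ?thesis
      using D(5)[of "gen u"] u expo_lett[of z "(u, True)"] by auto
  qed
  obtain T where T: "T \<in> gp VL" "\<And>g. g \<in> gp (cone x) \<Longrightarrow> H (T + g - T) \<in> gp (cone x)"
    using cone_absorbs[OF FH x _ Hu] Fu[OF _ x] by blast
  obtain T' where T': "T' \<in> gp VL" "\<And>g. g \<in> gp (cone x) \<Longrightarrow> F (T' + g - T') \<in> gp (cone x)"
    using cone_absorbs[OF aut_pair_sym[OF FH] x _ Fu] Hu[OF _ x] by blast
  let ?k = "F T' + T"
  have sub: "gp (cone x) \<subseteq> gp VL"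
    by (rule gp_mono) (auto simp: cone_def)
  have key: "F (T' + H (T + g - T) - T') = ?k + g - ?k" if g: "g \<in> gp (cone x)" for g
  proof -
    have "T + g - T \<in> gp VL"
      using T(1) g sub by (intro gp_diff gp_add) auto
    then have "F (T' + H (T + g - T) - T') = F T' + (T + g - T) - F T'"
      by (simp only: ghom_diff[OF D(1)] ghom_add[OF D(1)] D(6))
    then show ?thesis
      by (simp only: conj_conj)
  qed
  have stable: "- (- ?k) + g + - ?k \<in> gp (cone x)" if "g \<in> gp (cone x)" for g
    using T'(2)[OF T(2)[OF that]] unfolding key[OF that] by simp
  let ?r = "retr (cone x) (- ?k)"
  have onto: "\<exists>z \<in> gp (cone x). F (T' + z - T') = g" if g: "g \<in> gp (cone x)" for g
  proof -
    have r: "?r \<in> gp (cone x)"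
      by (rule retr_in_gp)
    let ?g = "?r + g - ?r"
    have g': "?g \<in> gp (cone x)"
      using r g gp_add gp_diff by blast
    have "- (- ?k) + ?g + - ?k = - ?r + ?g + ?r"
      using conj_into_gp[of "cone x" "- ?k" ?g] stable g' by blast
    also have "\<dots> = g"
      by (rule conj_cancel(1))
    finally have "?k + ?g - ?k = g"
      by (simp only: minus_minus diff_conv_add_uminus)
    then have "F (T' + H (T + ?g - T) - T') = g"
      using key[OF g'] by simp
    then show ?thesis
      using T(2)[OF g'] by blast
  qed
  then show ?thesis
    using T' by blast
qed

definition conjT :: "('w raag \<Rightarrow> 'w raag) \<Rightarrow> 'w \<Rightarrow> bool" where
  "conjT f v \<longleftrightarrow> (\<exists>h \<in> gp VG. f (gen v) = h + gen v - h)"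

text \<open>The conjugator found upstairs is projected by \<open>\<Phi>\<close> and realised as an
  inner move downstairs. Inner moves preserve the homology matrix and all conjugated
  generators.\<close>

lemma cone_reduction:
  assumes f: "laut f F" "\<not> GEN f" "unitL F" and x: "x \<in> VG"
  shows "\<exists>f' F'. laut f' F' \<and> \<not> GEN f' \<and> unitL F' \<and> (\<forall>v \<in> VG. conjT f v \<longrightarrow> conjT f' v) \<and>
    (\<forall>g \<in> gp (cone' x). f' g \<in> gp (cone' x) \<and> (\<exists>z \<in> gp (cone' x). f' z = g))"
proof -
  obtain y where y: "y \<in> VL" "\<phi> y = x"
    using lift_exists x by blast
  obtain H where FH: "aut_pair VL F H"
    using f(1) unfolding laut_def aut_def by blast
  note gh = conjunct1[OF laut_ghom[OF f(1)]] conjunct2[OF laut_ghom[OF f(1)]]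
  obtain T where T: "T \<in> gp VL" "\<And>g. g \<in> gp (cone y) \<Longrightarrow> F (T + g - T) \<in> gp (cone y)"
    "\<And>g. g \<in> gp (cone y) \<Longrightarrow> \<exists>z \<in> gp (cone y). F (T + z - T) = g"
    using cone_image[OF FH f(3) y(1)] by blast
  have sub: "cone y \<subseteq> VL"
    by (auto simp: cone_def)
  have img: "\<phi> ` cone y = cone' x"
    using phi_cone[OF y(1)] y(2) by simp
  have \<Phi>T: "\<Phi> T \<in> gp VG"
    using \<Phi>_gp[OF T(1)] image by simp
  obtain e E where e: "mv e E" "\<And>g. g \<in> gp VG \<Longrightarrow> e g = \<Phi> T + g - \<Phi> T"
    "\<And>w. w \<in> VL \<Longrightarrow> \<exists>g \<in> gp VL. E (gen w) = g + gen w - g"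
    using mv_inner[OF \<Phi>T] by blast
  have le: "laut e E" "ghom e" "ghom E"
    using mv_laut[OF e(1)] laut_ghom by blast+
  have 1: "laut (\<lambda>g. f (e g)) (\<lambda>g. F (E g))"
    using laut_comp[OF f(1) le(1)] .
  have 2: "\<not> GEN (\<lambda>g. f (e g))"
    using e(1) f(2) gh(1) unfolding mv_def by blast
  have 3: "unitL (\<lambda>g. F (E g))"
    unfolding unitL_def
  proof (intro ballI)
    fix u z
    assume u: "u \<in> VL" "z \<in> VL"
    obtain k where "E (gen u) = k + gen u - k"
      using e(3)[OF u(1)] by blast
    then have "expo z (F (E (gen u))) = expo z (F (gen u))"
      by (simp add: ghom_add[OF gh(2)] ghom_diff[OF gh(2)])
    then show "expo z (F (E (gen u))) = (if z = u then 1 else 0)"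
      using f(3) u unfolding unitL_def by simp
  qed
  have 4: "conjT (\<lambda>g. f (e g)) v" if v: "v \<in> VG" "conjT f v" for v
  proof -
    obtain h where h: "h \<in> gp VG" "f (gen v) = h + gen v - h"
      using v(2) unfolding conjT_def by blast
    have "f (e (gen v)) = f (\<Phi> T + gen v - \<Phi> T)"
      using e(2)[of "gen v"] v(1) by simp
    also have "\<dots> = f (\<Phi> T) + (h + gen v - h) - f (\<Phi> T)"
      unfolding ghom_diff[OF gh(1)] ghom_add[OF gh(1)] h(2) ..
    also have "\<dots> = (f (\<Phi> T) + h) + gen v - (f (\<Phi> T) + h)"
      by (rule conj_conj)
    finally have "f (e (gen v)) = (f (\<Phi> T) + h) + gen v - (f (\<Phi> T) + h)" .
    moreover have "f (\<Phi> T) \<in> gp VG"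
      using f(1) \<Phi>T aut_gp unfolding laut_def by blast
    ultimately show ?thesis
      using h(1) gp_add unfolding conjT_def by blast
  qed
  have down: "f (e (\<Phi> g)) = \<Phi> (F (T + g - T))" if "g \<in> gp VL" for g
  proof -
    have "\<Phi> g \<in> gp VG"
      using \<Phi>_gp[OF that] image by simp
    then have "f (e (\<Phi> g)) = f (\<Phi> (T + g - T))"
      by (simp only: e(2) ghom_add[OF ghom_\<Phi>] ghom_diff[OF ghom_\<Phi>])
    moreover have "T + g - T \<in> gp VL"
      using T(1) that gp_add gp_diff by blast
    ultimately show ?thesis
      using f(1) unfolding laut_def by metis
  qed
  have lift: "\<exists>z \<in> gp (cone y). \<Phi> z = g" if "g \<in> gp (cone' x)" for g
  proof (rule gp_surj[OF ghom_\<Phi> _ that])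
    fix v
    assume "v \<in> cone' x"
    then have "v \<in> \<phi> ` cone y"
      by (simp only: img)
    then obtain z where z: "v = \<phi> z" "z \<in> cone y"
      by (rule imageE)
    then have "z \<in> VL"
      using sub by blast
    then have "\<Phi> (gen z) = gen v"
      using z(1) by simp
    moreover have "gen z \<in> gp (cone y)"
      using z(2) by simp
    ultimately show "\<exists>z \<in> gp (cone y). \<Phi> z = gen v"
      by blast
  qed
  have sub': "gp (cone y) \<subseteq> gp VL"
    using gp_mono[OF sub] .
  have 5: "f (e g) \<in> gp (cone' x) \<and> (\<exists>z \<in> gp (cone' x). f (e z) = g)" if g: "g \<in> gp (cone' x)" for g
  proof -
    obtain z where z: "z \<in> gp (cone y)" "\<Phi> z = g"
      using lift[OF g] by blast
    have "f (e g) = \<Phi> (F (T + z - T))"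
      using down z sub' by blast
    then have "f (e g) \<in> gp (cone' x)"
      using \<Phi>_gp[OF T(2)[OF z(1)] sub] img by simp
    moreover obtain z' where z': "z' \<in> gp (cone y)" "F (T + z' - T) = z"
      using T(3)[OF z(1)] by blast
    then have "f (e (\<Phi> z')) = g"
      using down[of z'] sub' z(2) by auto
    moreover have "\<Phi> z' \<in> gp (cone' x)"
      using \<Phi>_gp[OF z'(1) sub] img by simp
    ultimately show ?thesis
      by blast
  qed
  show ?thesis
    using 1 2 3 4 5 by blast
qed

lemma card_star_cone':
  assumes "x \<in> VG" "u \<in> cone' x"
  shows "card (star x) \<le> card (star u)"
proof -
  have u: "le x u" "\<not> adj x u" "u \<in> VG"
    using assms(2) le'_imp_le le'_in unfolding cone'_def by blast+
  have "nb x \<subseteq> nb u"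
    using u(1,2) unfolding le_def by (auto simp: in_star)
  moreover have "nb u \<subseteq> VG" "nb x \<subseteq> VG"
    using adjG u(3) assms(1) by auto
  then have "finite (nb u)" "finite (nb x)"
    using finG finite_subset by blast+
  ultimately show ?thesis
    unfolding star_def using adj_irrefl card_mono[of "nb u" "nb x"] by (simp add: card_insert_if)
qed

lemma generated_if_conjugating:
  assumes f: "laut f F" "unitL F" and D: "\<And>v. v \<in> VG \<Longrightarrow> conjT f v"
  shows "GEN f"
proof (rule ccontr)
  assume nG: "\<not> GEN f"
  interpret stage VL VG \<phi> VG "{}" VG
    using finG by unfold_locales auto
  obtain h where h: "aut_pair VG f h"
    using f(1) unfolding laut_def aut_def by blast
  have "f g \<in> gp VG \<and> (\<exists>z \<in> gp VG. f z = g)" if "g \<in> gp VG" for g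
    using aut_pairD(3,4,6)[OF h that] by blast
  then have "good f F"
    unfolding good_def using f nG D unfolding unitL_def conjT_def by simp
  then obtain f' F' where f': "good f' F'" and l: "\<forall>b. fst b \<in> VG \<longrightarrow> (\<exists>c. f' (lett b) = lett c \<and>
      (if fst b \<in> {} then fst c \<in> {} else c = b))"
    using stage_letters by blast
  have "f' (gen v) = gen v" if "v \<in> VG" for v
    using l[rule_format, of "(v, True)"] that by auto
  then have "GEN f'"
    using goodD(3)[OF f'] by (intro GEN_id) auto
  then show False
    using goodD(2)[OF f'] by blast
qed

text \<open>After the stage \<open>f\<close> permutes the generators of \<open>S\<close> up to sign,
  so its matrix is monomial. \<open>unit_reduction\<close> then makes these generators fixed and
  leaves the images of the others unchanged, so nothing that was conjugated is lost and
  \<open>x\<close> is gained.\<close>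

lemma cone_step:
  assumes f: "laut f F" "\<not> GEN f" "unitL F" and x: "x \<in> VG"
    and max: "\<And>v. v \<in> VG \<Longrightarrow> \<not> conjT f v \<Longrightarrow> card (star v) \<le> card (star x)"
  shows "\<exists>f' F'. laut f' F' \<and> \<not> GEN f' \<and> unitL F' \<and> (\<forall>v \<in> VG. conjT f v \<longrightarrow> conjT f' v) \<and> conjT f' x"
proof -
  obtain f1 F1 where f1: "laut f1 F1" "\<not> GEN f1" "unitL F1" "\<And>v. v \<in> VG \<Longrightarrow> conjT f v \<Longrightarrow> conjT f1 v"
    "\<And>g. g \<in> gp (cone' x) \<Longrightarrow> f1 g \<in> gp (cone' x) \<and> (\<exists>z \<in> gp (cone' x). f1 z = g)"
    using cone_reduction[OF f x] by blast
  define S where "S = {u \<in> cone' x. card (star u) = card (star x)}"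
  define D where "D = {v \<in> VG. conjT f v} - S"
  have UV: "cone' x \<subseteq> VG"
    using le'_in unfolding cone'_def by blast
  have xS: "x \<in> S"
    using le'_refl[OF x] adj_irrefl unfolding S_def cone'_def by blast
  have UD: "u \<in> D" if u: "u \<in> cone' x" "u \<notin> S" for u
  proof -
    have "card (star x) \<le> card (star u)"
      using card_star_cone'[OF x u(1)] .
    moreover have "card (star u) \<noteq> card (star x)"
      using u unfolding S_def by blast
    ultimately have "conjT f u"
      using max[of u] u(1) UV by fastforce
    then show ?thesis
      using u UV unfolding D_def by blast
  qed
  have fin: "finite (star u)" if "u \<in> VG" for u
    using that adjG finite_subset[OF _ finG] by (metis in_star subsetI)
  have up: "le' s x" "nb s = nb x" if s: "s \<in> S" for s
  proof -
    obtain y where y: "y \<in> VL" "\<phi> y = x"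
      using lift_exists x by blast
    have sx: "le' x s" "\<not> adj x s" "card (star s) = card (star x)" "s \<in> VG"
      using s UV unfolding S_def cone'_def by auto
    obtain z where z: "z \<in> VL" "\<phi> z = s" "le y z"
      using le'_lift[OF sx(1) y] by blast
    have "card (star y) = card (star z)"
      using card_star[OF y(1)] card_star[OF z(1)] y(2) z(2) sx(3) by simp
    then have "le z y"
      using le_sym_card[OF z(3)] finite_starL z(1) by blast
    then show l: "le' s x"
      using y z unfolding le'_def by blast
    have "\<not> adj s x"
      using sx(2) adj_sym by blast
    then have "nb x \<subseteq> nb s" "nb s \<subseteq> nb x"
      using le'_imp_le[OF sx(1)] le'_imp_le[OF l] sx(2) unfolding le_def star_def by auto
    then show "nb s = nb x"
      by blast
  qed
  interpret stage VL VG \<phi> "cone' x" S D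
  proof unfold_locales
    show "finite (cone' x)"
      using finite_subset[OF UV finG] .
    show "S \<subseteq> cone' x"
      unfolding S_def by blast
    show "\<not> adj s u" if "s \<in> S" "u \<in> cone' x" for s u
    proof -
      have "\<not> adj x u"
        using that(2) unfolding cone'_def by blast
      then show ?thesis
        using up(2)[OF that(1)] by (metis in_nb)
    qed
    show "cone' x \<subseteq> VG"
      by (rule UV)
    show "D \<subseteq> VG" "D \<inter> S = {}"
      unfolding D_def by blast+
    show "cone' x - S \<subseteq> D"
      using UD by blast
    show "le' s u" if "s \<in> S" "u \<in> cone' x" for s u
      using le'_trans[OF up(1)[OF that(1)]] that(2) unfolding cone'_def by blast
    show "u \<in> S \<longleftrightarrow> card (star u) = card (star s)" if "s \<in> S" "u \<in> cone' x" for s u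
      using that unfolding S_def by auto
  qed
  have "good f1 F1"
    unfolding good_def
  proof (intro conjI ballI)
    fix u z
    assume u: "u \<in> VL" "z \<in> VL"
    have "expo z (F1 (gen u)) = (if z = u then 1 else 0)"
      using f1(3) u unfolding unitL_def by blast
    then show "if \<phi> u \<in> S then expo z (F1 (gen u)) \<noteq> 0 \<longrightarrow> le u z \<and> \<not> adj u z
      else expo z (F1 (gen u)) = (if z = u then 1 else 0)"
      using le_refl[of u] adj_irrefl[of u] by auto
  qed (use f1 in \<open>auto simp: D_def conjT_def\<close>)
  then obtain f2 F2 where f2: "good f2 F2" and l: "\<And>b. fst b \<in> cone' x \<Longrightarrow> \<exists>c. f2 (lett b) = lett c \<and>
      (if fst b \<in> S then fst c \<in> S else c = b)"
    using stage_letters by blast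
  have "\<exists>c. fst c \<in> S \<and> f2 (gen s) = lett c" if "s \<in> S" for s
    using l[of "(s, True)"] that SU by auto
  then obtain c where c: "\<And>s. s \<in> S \<Longrightarrow> fst (c s) \<in> S \<and> f2 (gen s) = lett (c s)"
    by metis
  note g2 = goodD[OF f2]
  obtain h2 where h2: "aut_pair VG f2 h2"
    using g2(1) unfolding laut_def aut_def by blast
  have inj: "s = t" if "s \<in> S" "t \<in> S" "fst (c s) = fst (c t)" for s t
  proof -
    have "c s = c t \<or> c s = linv (c t)"
      using letter_same_vertex[OF that(3)] .
    then have "lett (c s) = lett (c t) \<or> lett (c s) = - lett (c t)"
      by (elim disjE) simp_all
    moreover have "f2 (gen s) = lett (c s)" "f2 (gen t) = lett (c t)"
      using c that(1,2) by simp_all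
    ultimately have "f2 (gen s) = f2 (gen t) \<or> f2 (gen s) = f2 (- gen t)"
      unfolding ghom_uminus[OF g2(3)] by simp
    then have "h2 (f2 (gen s)) = h2 (f2 (gen t)) \<or> h2 (f2 (gen s)) = h2 (f2 (- gen t))"
      by (elim disjE) simp_all
    then have "gen s = gen t \<or> gen s = - gen t"
      using aut_pairD(5)[OF h2] S_VG that(1,2) by simp
    then have "gen s = gen t \<or> gen s = lett (t, False)"
      by simp
    then show ?thesis
      by (metis starts_lett fst_conv)
  qed
  have onto: "\<exists>s \<in> S. fst (c s) = t" if "t \<in> S" for t
  proof -
    have "finite S"
      using finite_subset[OF SU finU] .
    then have "(\<lambda>s. fst (c s)) ` S = S"
      using c inj by (intro endo_inj_surj) (auto intro!: inj_onI)
    then show ?thesis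
      using that by (metis imageE)
  qed
  \<comment> \<open>Outside \<open>S\<close> the columns upstairs are unit vectors, so each fibre
    sum has at most one term; this keeps the signed permutation confined to
    \<open>S\<close>.\<close>
  have col: "expo r (f2 (gen v)) = (if r = v then 1 else 0)" if v: "v \<in> VG" "v \<notin> S" and r: "r \<in> VG" for v r
  proof -
    obtain u where u: "u \<in> VL" "\<phi> u = v"
      using v(1) lift_exists by blast
    have "expo r (f2 (gen v)) = (\<Sum>y \<in> {y \<in> VL. \<phi> y = r}. expo y (F2 (gen u)))"
      using expo_fibre_sum[OF g2(1) u(1)] u(2) by simp
    also have "\<dots> = (\<Sum>y \<in> {y \<in> VL. \<phi> y = r}. if y = u then 1 else 0)"
      using g2(5)[OF u(1)] u(2) v(2) by (intro sum.cong) auto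
    also have "\<dots> = (if r = v then 1 else 0)"
      using u finL by (subst sum.delta) auto
    finally show ?thesis .
  qed
  have colS: "expo r (f2 (gen s)) = (if fst (c s) = r then if snd (c s) then 1 else - 1 else 0)"
    if "s \<in> S" for s r
    using c[OF that] expo_lett by metis
  have "\<forall>r \<in> VG. \<exists>t \<in> VG. \<bar>expo r (f2 (gen t))\<bar> = 1 \<and> (\<forall>v \<in> VG. v \<noteq> t \<longrightarrow> expo r (f2 (gen v)) = 0)"
  proof
    fix r
    assume r: "r \<in> VG"
    show "\<exists>t \<in> VG. \<bar>expo r (f2 (gen t))\<bar> = 1 \<and> (\<forall>v \<in> VG. v \<noteq> t \<longrightarrow> expo r (f2 (gen v)) = 0)"
    proof (cases "r \<in> S")
      case True
      then obtain s where s: "s \<in> S" "fst (c s) = r"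
        using onto by blast
      have "expo r (f2 (gen v)) = 0" if v: "v \<in> VG" "v \<noteq> s" for v
      proof (cases "v \<in> S")
        case True
        then have "fst (c v) \<noteq> r"
          using inj s v(2) by blast
        then show ?thesis
          using colS[OF True] by simp
      next
        case False
        then show ?thesis
          using col[OF v(1) False r] \<open>r \<in> S\<close> by auto
      qed
      moreover have "\<bar>expo r (f2 (gen s))\<bar> = 1"
        using colS[OF s(1), of r] s(2) by simp
      ultimately show ?thesis
        using s(1) S_VG by blast
    next
      case False
      have "expo r (f2 (gen v)) = 0" if v: "v \<in> VG" "v \<noteq> r" for v
      proof (cases "v \<in> S")
        case True
        then have "fst (c v) \<noteq> r"
          using c False by blast
        then show ?thesis
          using colS[OF True] by simp
      next
        case vS: False
        then show ?thesis
          using col[OF v(1) vS r] v(2) by simp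
      qed
      moreover have "\<bar>expo r (f2 (gen r))\<bar> = 1"
        using col[OF r False r] by simp
      ultimately show ?thesis
        using r by blast
    qed
  qed
  then obtain f3 F3 \<sigma> where f3: "laut f3 F3" "\<not> GEN f3" "unitL F3" "bij_betw \<sigma> VG VG"
    "\<And>v. v \<in> VG \<Longrightarrow> expo (\<sigma> v) (f2 (gen v)) \<noteq> 0 \<and>
      f3 (gen (\<sigma> v)) = (if expo (\<sigma> v) (f2 (gen v)) = 1 then f2 (gen v) else - f2 (gen v))"
    using unit_reduction[OF g2(1,2)] by blast
  have \<sigma>V: "\<sigma> v \<in> VG" if "v \<in> VG" for v
    using f3(4) that bij_betwE by blast
  have S3: "f3 (gen t) = gen t" if t: "t \<in> S" for t
  proof -
    obtain s where s: "s \<in> S" "fst (c s) = t"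
      using onto t by blast
    note * = f3(5)[OF S_VG[OF s(1)]]
    have st: "\<sigma> s = t"
      using * colS[OF s(1), of "\<sigma> s"] s(2) by metis
    have e: "expo t (f2 (gen s)) = (if snd (c s) then 1 else - 1)" "f2 (gen s) = lett (c s)"
      using colS[OF s(1), of t] s(2) c[OF s(1)] by auto
    show ?thesis
    proof (cases "snd (c s)")
      case True
      then have "c s = (t, True)"
        using s(2) by (metis prod.collapse)
      then show ?thesis
        using * e True unfolding st by simp
    next
      case False
      then have "c s = (t, False)"
        using s(2) by (metis prod.collapse)
      then show ?thesis
        using * e False unfolding st by simp
    qed
  qed
  have D3: "f3 (gen v) = f2 (gen v)" if v: "v \<in> VG" "v \<notin> S" for v
  proof -
    note * = f3(5)[OF v(1)]
    have "\<sigma> v = v"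
      using * col[OF v \<sigma>V[OF v(1)]] by metis
    then show ?thesis
      using * col[OF v v(1)] by simp
  qed
  have SC: "conjT f3 s" if "s \<in> S" for s
    using S3[OF that] unfolding conjT_def by (intro bexI[of _ 0]) auto
  have "conjT f3 v" if v: "v \<in> VG" "conjT f v" for v
  proof (cases "v \<in> S")
    case False
    then have "v \<in> D"
      using v unfolding D_def by blast
    then show ?thesis
      using g2(7) D3[OF v(1) False] unfolding conjT_def by simp
  qed (rule SC)
  then show ?thesis
    using f3(1-3) SC[OF xS] by blast
qed

lemma laut_GEN:
  assumes "laut f F"
  shows "GEN f"
proof (rule ccontr)
  assume "\<not> GEN f"
  then obtain f0 F0 where f0: "laut f0 F0" "\<not> GEN f0" "unitL F0"
    using homology_reduction[OF assms] by blast
  have "False" if "laut f F" "\<not> GEN f" "unitL F" for f F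
    using that
  proof (induction "card {v \<in> VG. \<not> conjT f v}" arbitrary: f F rule: less_induct)
    case less
    let ?B = "\<lambda>f. {v \<in> VG. \<not> conjT f v}"
    have finB: "finite (?B f)"
      using finG by simp
    have "?B f \<noteq> {}"
      using generated_if_conjugating[OF less.prems(1,3)] less.prems(2) by blast
    then have "Max ((\<lambda>v. card (star v)) ` ?B f) \<in> (\<lambda>v. card (star v)) ` ?B f"
      using finB by (intro Max_in) simp_all
    then obtain x where x: "x \<in> ?B f" "Max ((\<lambda>v. card (star v)) ` ?B f) = card (star x)"
      by blast
    have max: "card (star v) \<le> card (star x)" if "v \<in> VG" "\<not> conjT f v" for v
      unfolding x(2)[symmetric] using that finB by (intro Max_ge) simp_all
    obtain f' F' where f': "laut f' F'" "\<not> GEN f'" "unitL F'" "\<And>v. v \<in> VG \<Longrightarrow> conjT f v \<Longrightarrow> conjT f' v" "conjT f' x"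
      using cone_step[OF less.prems _ max] x(1) by blast
    have "?B f' \<subset> ?B f"
      using f'(4,5) x(1) by blast
    then show False
      using less.hyps[OF psubset_card_mono[OF finB] f'(1-3)] by blast
  qed
  then show False
    using f0 by blast
qed

end

section \<open>Comparison with the word model\<close>

text \<open>All graphs on subsets of \<open>'a\<close> are disjoint parts of one graph on \<open>'a vertex\<close>: a vertex remembers
  its graph. In this way the groups of arbitrary graphs become the parabolic subgroups of the
  group of a single type class instance.\<close>

datatype 'a vertex = Vertex (point: 'a) (edges: "'a \<Rightarrow> 'a \<Rightarrow> bool")

instantiation vertex :: (type) graph
begin

definition adj_vertex :: "'a vertex \<Rightarrow> 'a vertex \<Rightarrow> bool" where
  "adj_vertex x y \<longleftrightarrow> edges x = edges y \<and> point x \<noteq> point y \<and>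
    edges x (point x) (point y) \<and> edges x (point y) (point x)"

instance
  by standard (auto simp: adj_vertex_def)

end

lemma adj_Vertex: "sgraph V E \<Longrightarrow> adj (Vertex u E) (Vertex w E) \<longleftrightarrow> E u w"
  by (auto simp: adj_vertex_def sgraph_def)

definition emb :: "('a \<Rightarrow> 'a \<Rightarrow> bool) \<Rightarrow> 'a \<times> bool \<Rightarrow> 'a vertex \<times> bool" where
  "emb E a = (Vertex (fst a) E, snd a)"

definition ev :: "('a \<Rightarrow> 'a \<Rightarrow> bool) \<Rightarrow> 'a word \<Rightarrow> 'a vertex raag" where
  "ev E w = val (map (emb E) w)"

lemma ev_simps [simp]: "ev E [] = 0" "ev E (a # w) = lett (emb E a) + ev E w" "ev E (u @ w) = ev E u + ev E w"
  by (simp_all add: ev_def)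

lemma ev_inv_word [simp]: "ev E (inv_word w) = - ev E w"
proof -
  have "map (emb E) (inv_word w) = inv_word (map (emb E) w)"
    by (auto simp: inv_word_def rev_map emb_def)
  then show ?thesis
    by (simp add: ev_def)
qed

text \<open>Letters belonging to other graphs are dropped, so that every shuffle or cancellation in
  the big graph becomes one in \<open>E\<close> or nothing at all.\<close>

definition dec :: "('a \<Rightarrow> 'a \<Rightarrow> bool) \<Rightarrow> 'a vertex word \<Rightarrow> 'a word" where
  "dec E w = map (\<lambda>a. (point (fst a), snd a)) (filter (\<lambda>a. edges (fst a) = E) w)"

lemma dec_emb [simp]: "dec E (map (emb E) w) = w"
  by (induction w) (simp_all add: dec_def emb_def)

lemma raag_rel_refl [simp]: "(w, w) \<in> raag_rel E"
  by (simp add: raag_rel_def)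

lemma raag_rel_trans: "(u, v) \<in> raag_rel E \<Longrightarrow> (v, w) \<in> raag_rel E \<Longrightarrow> (u, w) \<in> raag_rel E"
  unfolding raag_rel_def by (rule rtrancl_trans)

lemma raag_rel_sym: "(u, v) \<in> raag_rel E \<Longrightarrow> (v, u) \<in> raag_rel E"
proof -
  have "sym (raag_step E \<union> (raag_step E)\<inverse>)"
    by (auto intro: symI)
  then show "(u, v) \<in> raag_rel E \<Longrightarrow> (v, u) \<in> raag_rel E"
    unfolding raag_rel_def using sym_rtrancl symD by metis
qed

lemma raag_step_rel: "(u, v) \<in> raag_step E \<Longrightarrow> (u, v) \<in> raag_rel E"
  by (auto simp: raag_rel_def)

lemma raag_step_Cons:
  assumes "(u, v) \<in> raag_step E"
  shows "(a # u, a # v) \<in> raag_step E"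
  using assms unfolding raag_step_def
proof (elim UnE CollectE exE conjE)
  fix xs ys v' b
  assume "(u, v) = (xs @ [(v', b), (v', \<not> b)] @ ys, xs @ ys)"
  then show "(a # u, a # v) \<in> {(xs @ [(v, b), (v, \<not> b)] @ ys, xs @ ys) |xs ys v b. True} \<union>
      {(xs @ [x, y] @ ys, xs @ [y, x] @ ys) |xs ys x y. E (fst x) (fst y)}"
    by (intro UnI1 CollectI exI[of _ "a # xs"] exI[of _ ys] exI[of _ v'] exI[of _ b]) simp
next
  fix xs ys x y
  assume "(u, v) = (xs @ [x, y] @ ys, xs @ [y, x] @ ys)" "E (fst x) (fst y)"
  then show "(a # u, a # v) \<in> {(xs @ [(v, b), (v, \<not> b)] @ ys, xs @ ys) |xs ys v b. True} \<union>
      {(xs @ [x, y] @ ys, xs @ [y, x] @ ys) |xs ys x y. E (fst x) (fst y)}"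
    by (intro UnI2 CollectI exI[of _ "a # xs"] exI[of _ ys] exI[of _ x] exI[of _ y]) simp
qed

lemma raag_rel_Cons: "(u, v) \<in> raag_rel E \<Longrightarrow> (a # u, a # v) \<in> raag_rel E"
  unfolding raag_rel_def
proof (induction rule: rtrancl_induct)
  case (step v w)
  then have "(a # v, a # w) \<in> raag_step E \<union> (raag_step E)\<inverse>"
    using raag_step_Cons by blast
  then show ?case
    using step.IH by (meson rtrancl.rtrancl_into_rtrancl)
qed simp

lemma swp_dec: "swp u v \<Longrightarrow> (dec E u, dec E v) \<in> raag_rel E"
proof (induction rule: swp.induct)
  case (swp_here x y ys)
  then have e: "edges (fst x) = edges (fst y)" "edges (fst x) (point (fst x)) (point (fst y))"
    by (auto simp: adj_vertex_def)
  show ?case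
  proof (cases "edges (fst x) = E")
    case True
    let ?d = "\<lambda>a. (point (fst a), snd a)"
    have "([] @ [?d x, ?d y] @ dec E ys, [] @ [?d y, ?d x] @ dec E ys) \<in> raag_step E"
      unfolding raag_step_def using e True
      by (intro UnI2 CollectI exI[of _ "[]"] exI[of _ "dec E ys"] exI[of _ "?d x"] exI[of _ "?d y"]) simp
    then show ?thesis
      using raag_step_rel e True by (fastforce simp: dec_def)
  next
    case False
    then show ?thesis
      using e by (simp add: dec_def)
  qed
next
  case (swp_there u v a)
  then show ?case
    using raag_rel_Cons by (auto simp: dec_def)
qed

lemma shuf_dec: "shuf u v \<Longrightarrow> (dec E u, dec E v) \<in> raag_rel E"
  by (induction rule: rtranclp_induct) (auto intro: raag_rel_trans swp_dec)

lemma dec_Cons_rel: "(dec E u, dec E v) \<in> raag_rel E \<Longrightarrow> (dec E (a # u), dec E (a # v)) \<in> raag_rel E"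
  using raag_rel_Cons by (auto simp: dec_def)

lemma dec_cancel: "(dec E (a # linv a # w), dec E w) \<in> raag_rel E"
proof (cases "edges (fst a) = E")
  case True
  let ?v = "point (fst a)"
  have "([] @ [(?v, snd a), (?v, \<not> snd a)] @ dec E w, [] @ dec E w) \<in> raag_step E"
    unfolding raag_step_def
    by (intro UnI1 CollectI exI[of _ "[]"] exI[of _ "dec E w"] exI[of _ ?v] exI[of _ "snd a"]) simp
  then have "([] @ [(?v, snd a), (?v, \<not> snd a)] @ dec E w, [] @ dec E w) \<in> raag_rel E"
    by (rule raag_step_rel)
  moreover have "snd (linv a) = (\<not> snd a)"
    by (cases a) simp
  ultimately show ?thesis
    using True by (simp add: dec_def)
next
  case False
  then show ?thesis
    by (simp add: dec_def)
qed

lemma act_dec: "(dec E (act a w), dec E (a # w)) \<in> raag_rel E"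
proof (cases "pull (linv a) w")
  case (Some w')
  have "(dec E (a # w), dec E (a # linv a # w')) \<in> raag_rel E"
    using shuf_dec[OF pull_shuf[OF Some]] by (rule dec_Cons_rel)
  then have "(dec E (a # w), dec E w') \<in> raag_rel E"
    using dec_cancel raag_rel_trans by blast
  then show ?thesis
    using raag_rel_sym by (auto simp: act_def Some)
qed (simp add: act_def)

lemma nf_dec: "(dec E (nf w), dec E w) \<in> raag_rel E"
proof (induction w)
  case (Cons a w)
  have "(dec E (act a (nf w)), dec E (a # nf w)) \<in> raag_rel E"
    by (rule act_dec)
  moreover have "(dec E (a # nf w), dec E (a # w)) \<in> raag_rel E"
    using Cons by (rule dec_Cons_rel)
  ultimately show ?case
    using raag_rel_trans by (fastforce simp: nf_def)
qed (simp add: nf_def)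

text \<open>Each step of the relation preserves values. Conversely, computing the normal form is a
  sequence of such steps (\<open>nf_dec\<close>), and equal values have normal forms that are
  shuffles of each other.\<close>

lemma raag_rel_iff:
  assumes "sgraph V E"
  shows "(u, w) \<in> raag_rel E \<longleftrightarrow> ev E u = ev E w"
proof
  have step: "ev E u = ev E w" if "(u, w) \<in> raag_step E" for u w
    using that unfolding raag_step_def
  proof (elim UnE CollectE exE conjE)
    fix xs ys v b
    assume *: "(u, w) = (xs @ [(v, b), (v, \<not> b)] @ ys, xs @ ys)"
    have "emb E (v, \<not> b) = linv (emb E (v, b))"
      by (simp add: emb_def)
    then have "lett (emb E (v, b)) + (lett (emb E (v, \<not> b)) + ev E ys) = ev E ys"
      by (simp only: lett_linv add_minus_cancel)
    then show ?thesis
      using * by simp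
  next
    fix xs ys x y
    assume *: "(u, w) = (xs @ [x, y] @ ys, xs @ [y, x] @ ys)" "E (fst x) (fst y)"
    then have "adj (fst (emb E x)) (fst (emb E y))"
      using adj_Vertex[OF assms] by (simp add: emb_def)
    then have "lett (emb E x) + lett (emb E y) = lett (emb E y) + lett (emb E x)"
      by (rule lett_commute)
    then have "lett (emb E x) + (lett (emb E y) + ev E ys) = lett (emb E y) + (lett (emb E x) + ev E ys)"
      by (simp only: add.assoc[symmetric])
    then show ?thesis
      using * by simp
  qed
  assume "(u, w) \<in> raag_rel E"
  then show "ev E u = ev E w"
    unfolding raag_rel_def
  proof (induction rule: rtrancl_induct)
    case (step v w)
    then show ?case
      using \<open>\<And>u w. (u, w) \<in> raag_step E \<Longrightarrow> ev E u = ev E w\<close> by fastforce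
  qed simp
next
  assume "ev E u = ev E w"
  then have "shuf (nf (map (emb E) u)) (nf (map (emb E) w))"
    unfolding ev_def val_eq_iff weq_def .
  then have "(dec E (nf (map (emb E) u)), dec E (nf (map (emb E) w))) \<in> raag_rel E"
    by (rule shuf_dec)
  then show "(u, w) \<in> raag_rel E"
    using nf_dec[of E "map (emb E) u"] nf_dec[of E "map (emb E) w"] raag_rel_trans raag_rel_sym
    by (metis dec_emb)
qed

section \<open>The groups \<open>RAAG V E\<close> as parabolic subgroups of one big group\<close>

definition wcl :: "('a \<Rightarrow> 'a \<Rightarrow> bool) \<Rightarrow> 'a vertex raag \<Rightarrow> 'a word set" where
  "wcl E g = {w. ev E w = g}"

definition elt :: "('a \<Rightarrow> 'a \<Rightarrow> bool) \<Rightarrow> 'a word set \<Rightarrow> 'a vertex raag" where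
  "elt E Z = ev E (SOME w. w \<in> Z)"

definition verts :: "'a set \<Rightarrow> ('a \<Rightarrow> 'a \<Rightarrow> bool) \<Rightarrow> 'a vertex set" where
  "verts V E = (\<lambda>v. Vertex v E) ` V"

lemma Vertex_in_verts [simp]: "Vertex v E \<in> verts V E \<longleftrightarrow> v \<in> V"
  by (auto simp: verts_def)

lemma raag_rel_class: "sgraph V E \<Longrightarrow> raag_rel E `` {w} = wcl E (ev E w)"
  by (auto simp: wcl_def raag_rel_iff)

lemma ev_gp: "w \<in> words V \<Longrightarrow> ev E w \<in> gp (verts V E)"
  unfolding ev_def words_def by (intro val_in_gp) (auto simp: emb_def)

lemma ev_onto:
  assumes "g \<in> gp (verts V E)"
  shows "\<exists>w \<in> words V. ev E w = g"
  using assms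
proof (induction g rule: gp_induct)
  case zero
  show ?case
    by (intro bexI[of _ "[]"]) (auto simp: words_def)
next
  case (add a g)
  obtain w where w: "w \<in> words V" "ev E w = g"
    using add.IH by (rule bexE)
  obtain v where v: "fst a = Vertex v E" "v \<in> V"
    using add.hyps(1) unfolding verts_def by (rule imageE)
  have "emb E (v, snd a) = a"
    using v(1) by (cases a) (simp add: emb_def)
  then show ?case
    using w v(2) by (intro bexI[of _ "(v, snd a) # w"]) (simp_all add: words_def)
qed

lemma elt_wcl [simp]:
  assumes "g \<in> gp (verts V E)"
  shows "elt E (wcl E g) = g"
proof -
  obtain w where "ev E w = g"
    using ev_onto[OF assms] by blast
  then have "\<exists>w. w \<in> wcl E g"
    by (auto simp: wcl_def)
  then have "(SOME w. w \<in> wcl E g) \<in> wcl E g"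
    by (rule someI_ex)
  then show ?thesis
    by (simp add: elt_def wcl_def)
qed

lemma wcl_inject: "g \<in> gp (verts V E) \<Longrightarrow> h \<in> gp (verts V E) \<Longrightarrow> wcl E g = wcl E h \<longleftrightarrow> g = h"
  by (metis elt_wcl)

lemma carrier_RAAG:
  assumes "sgraph V E"
  shows "carrier (RAAG V E) = wcl E ` gp (verts V E)"
proof
  show "carrier (RAAG V E) \<subseteq> wcl E ` gp (verts V E)"
  proof
    fix Z
    assume "Z \<in> carrier (RAAG V E)"
    then obtain w where "w \<in> words V" "Z = raag_rel E `` {w}"
      by (auto simp: RAAG_def quotient_def)
    then show "Z \<in> wcl E ` gp (verts V E)"
      using raag_rel_class[OF assms] ev_gp by (metis imageI)
  qed
  show "wcl E ` gp (verts V E) \<subseteq> carrier (RAAG V E)"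
  proof
    fix Z
    assume "Z \<in> wcl E ` gp (verts V E)"
    then obtain g where g: "Z = wcl E g" "g \<in> gp (verts V E)"
      by blast
    then obtain w where "w \<in> words V" "ev E w = g"
      using ev_onto by blast
    then have "w \<in> words V" "Z = raag_rel E `` {w}"
      using raag_rel_class[OF assms] g(1) by auto
    then show "Z \<in> carrier (RAAG V E)"
      by (auto simp: RAAG_def quotient_def)
  qed
qed

lemma wcl_nonempty:
  assumes "g \<in> gp (verts V E)"
  shows "\<exists>w. w \<in> wcl E g"
  using ev_onto[OF assms] by (auto simp: wcl_def)

lemma mult_RAAG:
  assumes "sgraph V E" "g \<in> gp (verts V E)" "h \<in> gp (verts V E)"
  shows "wcl E g \<otimes>\<^bsub>RAAG V E\<^esub> wcl E h = wcl E (g + h)"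
proof -
  obtain u w where uw: "ev E u = g" "ev E w = h"
    using ev_onto assms(2,3) by metis
  have "wcl E g \<otimes>\<^bsub>RAAG V E\<^esub> wcl E h = raag_rel E `` {x @ y |x y. x \<in> wcl E g \<and> y \<in> wcl E h}"
    by (simp add: RAAG_def)
  also have "\<dots> = (\<Union>z \<in> {x @ y |x y. x \<in> wcl E g \<and> y \<in> wcl E h}. raag_rel E `` {z})"
    by blast
  also have "\<dots> = (\<Union>z \<in> {x @ y |x y. x \<in> wcl E g \<and> y \<in> wcl E h}. wcl E (g + h))"
    by (intro SUP_cong refl) (auto simp: raag_rel_class[OF assms(1)] wcl_def)
  also have "\<dots> = wcl E (g + h)"
    using uw by (auto simp: wcl_def)
  finally show ?thesis .
qed

lemma one_RAAG: "sgraph V E \<Longrightarrow> \<one>\<^bsub>RAAG V E\<^esub> = wcl E 0"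
  using raag_rel_class[of V E "[]"] by (simp add: RAAG_def)

lemma group_RAAG:
  assumes "sgraph V E"
  shows "group (RAAG V E)"
proof (rule groupI)
  note s = carrier_RAAG[OF assms] mult_RAAG[OF assms] one_RAAG[OF assms]
  show "\<one>\<^bsub>RAAG V E\<^esub> \<in> carrier (RAAG V E)"
    by (auto simp: s)
  fix x
  assume "x \<in> carrier (RAAG V E)"
  then obtain g where g: "x = wcl E g" "g \<in> gp (verts V E)"
    by (auto simp: s)
  then show "\<one>\<^bsub>RAAG V E\<^esub> \<otimes>\<^bsub>RAAG V E\<^esub> x = x"
    by (simp add: s)
  show "\<exists>y \<in> carrier (RAAG V E). y \<otimes>\<^bsub>RAAG V E\<^esub> x = \<one>\<^bsub>RAAG V E\<^esub>"
    using g by (intro bexI[of _ "wcl E (- g)"]) (simp_all add: s)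
  fix y
  assume "y \<in> carrier (RAAG V E)"
  then obtain h where h: "y = wcl E h" "h \<in> gp (verts V E)"
    by (auto simp: s)
  show "x \<otimes>\<^bsub>RAAG V E\<^esub> y \<in> carrier (RAAG V E)"
    using g h by (simp add: s)
  fix z
  assume "z \<in> carrier (RAAG V E)"
  then obtain k where k: "z = wcl E k" "k \<in> gp (verts V E)"
    by (auto simp: s)
  show "x \<otimes>\<^bsub>RAAG V E\<^esub> y \<otimes>\<^bsub>RAAG V E\<^esub> z = x \<otimes>\<^bsub>RAAG V E\<^esub> (y \<otimes>\<^bsub>RAAG V E\<^esub> z)"
    using g h k by (simp add: s add.assoc)
qed

text \<open>Transports a total map to the carrier of word classes. Restriction to the carrier
  forgets the values outside \<open>gp (verts V E)\<close>, so maps agreeing there become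
  equal.\<close>

definition onc :: "'a set \<Rightarrow> ('a \<Rightarrow> 'a \<Rightarrow> bool) \<Rightarrow> ('b \<Rightarrow> 'b \<Rightarrow> bool) \<Rightarrow> ('a vertex raag \<Rightarrow> 'b vertex raag) \<Rightarrow>
    'a word set \<Rightarrow> 'b word set" where
  "onc V E E' f = (\<lambda>Z \<in> carrier (RAAG V E). wcl E' (f (elt E Z)))"

lemma onc_wcl: "sgraph V E \<Longrightarrow> g \<in> gp (verts V E) \<Longrightarrow> onc V E E' f (wcl E g) = wcl E' (f g)"
  by (simp add: onc_def carrier_RAAG)

lemma onc_eqI:
  assumes "sgraph V E" "h \<in> extensional (carrier (RAAG V E))"
    and "\<And>g. g \<in> gp (verts V E) \<Longrightarrow> h (wcl E g) = wcl E' (f g)"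
  shows "h = onc V E E' f"
proof
  fix Z
  show "h Z = onc V E E' f Z"
  proof (cases "Z \<in> carrier (RAAG V E)")
    case True
    then obtain g where "Z = wcl E g" "g \<in> gp (verts V E)"
      using carrier_RAAG[OF assms(1)] by blast
    then show ?thesis
      using onc_wcl[OF assms(1)] assms(3) by metis
  next
    case False
    then show ?thesis
      using assms(2) by (simp add: onc_def extensional_def)
  qed
qed

text \<open>\<open>raag_ext\<close> substitutes words without checking that relations are respected;
  a homomorphism with the right values on generators guarantees it.\<close>

lemma raag_ext_eq:
  fixes V :: "'a set" and V' :: "'b set"
  assumes E: "sgraph V E" "sgraph V' E'" and F: "ghom F"
    and g: "\<And>v. v \<in> V \<Longrightarrow> F (gen (Vertex v E)) = ev E' (g v)"
  shows "raag_ext V E E' g = onc V E E' F"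
proof (rule onc_eqI[OF E(1)])
  show "raag_ext V E E' g \<in> extensional (carrier (RAAG V E))"
    by (simp add: raag_ext_def)
  fix x
  assume x: "x \<in> gp (verts V E)"
  \<comment> \<open>A class also contains words with cancelling letters outside \<open>V\<close>, so
    \<open>s\<close> follows \<open>g\<close> on every vertex carrying \<open>E\<close>. Points
    outside \<open>V\<close> have no neighbours, hence impose no relation.\<close>
  define s where "s z = (if edges z = E then ev E' (g (point z)) else 0)" for z :: "'a vertex"
  have "compat s"
    unfolding compat_def
  proof (intro allI impI)
    fix y z :: "'a vertex"
    assume yz: "adj y z"
    show "cm (s y) (s z)"
    proof (cases "edges y = E")
      case True
      then have e: "edges z = E" "E (point y) (point z)"
        using yz by (auto simp: adj_vertex_def)
      then have "point y \<in> V" "point z \<in> V"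
        using E(1) by (auto simp: sgraph_def)
      moreover have "y = Vertex (point y) E" "z = Vertex (point z) E"
        using True e(1) by (metis vertex.collapse)+
      ultimately have "s y = F (gen y)" "s z = F (gen z)"
        using g True e(1) unfolding s_def by metis+
      moreover have "cm (gen y) (gen z)"
        by (rule cm_lett) (simp add: yz)
      ultimately show ?thesis
        using ghom_cm[OF F] by simp
    qed (simp add: s_def)
  qed
  note h = ghom_ext[OF this] ext_lett[OF this]
  have sub: "ev E' (word_subst g w) = ext s (ev E w)" for w
  proof (induction w)
    case Nil
    show ?case
      by (simp add: word_subst_def ghom_zero[OF h(1)])
  next
    case (Cons a w)
    obtain v b where a: "a = (v, b)"
      by (cases a)
    have "ext s (lett (emb E a)) = (if b then ev E' (g v) else - ev E' (g v))"
      unfolding h(2) by (simp add: a slet_def emb_def s_def)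
    moreover have "word_subst g (a # w) = (if b then g v else inv_word (g v)) @ word_subst g w"
      by (simp add: word_subst_def a)
    ultimately show ?case
      using Cons by (simp add: ghom_add[OF h(1)])
  qed
  have "ext s x = F x"
  proof (rule ghom_eq_on_gp[OF h(1) F _ x])
    fix z
    assume "z \<in> verts V E"
    then obtain v where v: "z = Vertex v E" "v \<in> V"
      by (auto simp: verts_def)
    show "ext s (gen z) = F (gen z)"
      using g[OF v(2)] unfolding h(2) by (simp add: v(1) s_def)
  qed
  moreover have "wcl E x \<in> carrier (RAAG V E)"
    using x carrier_RAAG[OF E(1)] by blast
  moreover have "raag_rel E' `` (word_subst g ` wcl E x) = (\<Union>w \<in> wcl E x. raag_rel E' `` {word_subst g w})"
    by blast
  moreover have "\<dots> = (\<Union>w \<in> wcl E x. wcl E' (ext s x))"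
    by (intro SUP_cong refl) (simp add: raag_rel_class[OF E(2)] sub wcl_def)
  moreover have "\<dots> = wcl E' (ext s x)"
    using wcl_nonempty[OF x] by auto
  ultimately show "raag_ext V E E' g (wcl E x) = wcl E' (F x)"
    by (simp add: raag_ext_def)
qed

lemma onc_auto:
  assumes E: "sgraph V E" and f: "aut (verts V E) f"
  shows "onc V E E f \<in> auto (RAAG V E)"
proof -
  obtain h where h: "aut_pair (verts V E) f h"
    using f by (auto simp: aut_def)
  note d = aut_pairD[OF h]
  note s = carrier_RAAG[OF E] onc_wcl[OF E]
  have c: "onc V E E k \<in> carrier (RAAG V E) \<rightarrow> carrier (RAAG V E)"
    if "\<And>g. g \<in> gp (verts V E) \<Longrightarrow> k g \<in> gp (verts V E)" for k
    using that by (auto simp: s)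
  have "onc V E E f \<in> hom (RAAG V E) (RAAG V E)"
    unfolding hom_def using c[OF d(3)] d(3) by (auto simp: s mult_RAAG[OF E] ghom_add[OF d(1)])
  moreover have "bij_betw (onc V E E f) (carrier (RAAG V E)) (carrier (RAAG V E))"
    by (rule bij_betwI[OF c[OF d(3)] c[OF d(4)]]) (auto simp: s d)
  moreover have "onc V E E f \<in> extensional (carrier (RAAG V E))"
    by (simp add: onc_def)
  ultimately show ?thesis
    by (simp add: auto_def Bij_def)
qed

lemma auto_onc:
  assumes E: "sgraph V E" and f: "f \<in> auto (RAAG V E)"
  shows "\<exists>h. aut (verts V E) h \<and> f = onc V E E h"
proof -
  let ?G = "RAAG V E" and ?U = "verts V E"
  note s = carrier_RAAG[OF E] mult_RAAG[OF E]
  have f': "f \<in> hom ?G ?G" "bij_betw f (carrier ?G) (carrier ?G)" "f \<in> extensional (carrier ?G)"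
    using f by (auto simp: auto_def Bij_def)
  define k where "k = restrict (inv_into (carrier ?G) f) (carrier ?G)"
  have k: "k \<in> hom ?G ?G" "k \<in> carrier ?G \<rightarrow> carrier ?G"
    using group.restrict_inv_into_hom[OF group_RAAG[OF E]] f f' unfolding k_def auto_def hom_def by auto
  have kf: "k (f Z) = Z" "f (k Z) = Z" if "Z \<in> carrier ?G" for Z
    using that f'(2) bij_betw_inv_into_left bij_betw_inv_into_right bij_betwE unfolding k_def by fastforce+
  \<comment> \<open>The retraction in front makes the transported map a homomorphism on the whole
    big group, as \<open>aut_pair\<close> requires.\<close>
  define tr where "tr m g = elt E (m (wcl E (retr ?U g)))" for m :: "'a word set \<Rightarrow> 'a word set" and g
  have tr: "wcl E (tr m g) = m (wcl E g)" "tr m g \<in> gp ?U" if m: "m \<in> hom ?G ?G" and g: "g \<in> gp ?U" for m g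
  proof -
    have "m (wcl E g) \<in> carrier ?G"
      using m g unfolding hom_def s by blast
    then obtain h where "m (wcl E g) = wcl E h" "h \<in> gp ?U"
      unfolding s by blast
    then show "wcl E (tr m g) = m (wcl E g)" "tr m g \<in> gp ?U"
      using g by (simp_all add: tr_def retr_gp)
  qed
  have ghom: "ghom (tr m)" if m: "m \<in> hom ?G ?G" for m
    unfolding ghom_def
  proof (intro allI)
    fix x y
    let ?x = "retr ?U x" and ?y = "retr ?U y"
    have U: "?x \<in> gp ?U" "?y \<in> gp ?U"
      by (simp_all add: retr_in_gp)
    have e: "tr m z = tr m (retr ?U z)" for z
      unfolding tr_def by (simp add: retr_gp retr_in_gp)
    have "wcl E (tr m (?x + ?y)) = m (wcl E (?x + ?y))"
      by (rule tr(1)[OF m gp_add[OF U]])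
    also have "\<dots> = m (wcl E ?x \<otimes>\<^bsub>?G\<^esub> wcl E ?y)"
      by (simp only: s(2)[OF U])
    also have "\<dots> = m (wcl E ?x) \<otimes>\<^bsub>?G\<^esub> m (wcl E ?y)"
      using m U unfolding hom_def s(1) by blast
    also have "\<dots> = wcl E (tr m ?x) \<otimes>\<^bsub>?G\<^esub> wcl E (tr m ?y)"
      by (simp only: tr(1)[OF m U(1)] tr(1)[OF m U(2)])
    also have "\<dots> = wcl E (tr m ?x + tr m ?y)"
      by (rule s(2)[OF tr(2)[OF m U(1)] tr(2)[OF m U(2)]])
    finally have "wcl E (tr m (?x + ?y)) = wcl E (tr m ?x + tr m ?y)" .
    then have "tr m (?x + ?y) = tr m ?x + tr m ?y"
      using wcl_inject tr(2)[OF m] U gp_add by metis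
    then show "tr m (x + y) = tr m x + tr m y"
      using e[of x] e[of y] e[of "x + y"] by (simp add: ghom_add[OF ghom_retr])
  qed
  have inv: "tr m (tr n g) = g"
    if "m \<in> hom ?G ?G" "n \<in> hom ?G ?G" "\<And>Z. Z \<in> carrier ?G \<Longrightarrow> m (n Z) = Z" "g \<in> gp ?U" for m n g
  proof -
    have "wcl E (tr m (tr n g)) = m (n (wcl E g))"
      using tr[OF that(1) tr(2)[OF that(2,4)]] tr(1)[OF that(2,4)] by simp
    also have "\<dots> = wcl E g"
      using that(3,4) unfolding s by blast
    finally show ?thesis
      using wcl_inject tr(2) that by metis
  qed
  have "aut_pair ?U (tr f) (tr k)"
    unfolding aut_pair_def using ghom tr(2) f'(1) k(1) inv kf by blast
  moreover have "f = onc V E E (tr f)"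
    using onc_eqI[OF E f'(3)] tr(1)[OF f'(1)] by metis
  ultimately show ?thesis
    unfolding aut_def by blast
qed

lemma onc_compose:
  assumes E: "sgraph V E" and f: "aut (verts V E) f" "aut (verts V E) f'"
  shows "onc V E E f \<otimes>\<^bsub>AutoGroup (RAAG V E)\<^esub> onc V E E f' = onc V E E (\<lambda>g. f (f' g))"
proof -
  have B: "onc V E E f \<in> Bij (carrier (RAAG V E))" "onc V E E f' \<in> Bij (carrier (RAAG V E))"
    using onc_auto[OF E] f by (auto simp: auto_def)
  then have "onc V E E f \<otimes>\<^bsub>AutoGroup (RAAG V E)\<^esub> onc V E E f' =
      compose (carrier (RAAG V E)) (onc V E E f) (onc V E E f')"
    by (simp add: AutoGroup_def BijGroup_def)
  also have "\<dots> = onc V E E (\<lambda>g. f (f' g))"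
  proof (rule onc_eqI[OF E])
    show "compose (carrier (RAAG V E)) (onc V E E f) (onc V E E f') \<in> extensional (carrier (RAAG V E))"
      by simp
    fix g
    assume g: "g \<in> gp (verts V E)"
    then show "compose (carrier (RAAG V E)) (onc V E E f) (onc V E E f') (wcl E g) = wcl E (f (f' g))"
      using aut_gp[OF f(2)] carrier_RAAG[OF E] by (simp add: compose_eq onc_wcl[OF E])
  qed
  finally show ?thesis .
qed

lemma onc_id:
  assumes E: "sgraph V E" and f: "\<And>g. g \<in> gp (verts V E) \<Longrightarrow> f g = g"
  shows "onc V E E f = \<one>\<^bsub>AutoGroup (RAAG V E)\<^esub>"
proof -
  have "\<one>\<^bsub>AutoGroup (RAAG V E)\<^esub> = (\<lambda>x \<in> carrier (RAAG V E). x)"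
    by (simp add: AutoGroup_def BijGroup_def)
  moreover have "\<dots> = onc V E E f"
    using f carrier_RAAG[OF E] by (intro onc_eqI[OF E]) auto
  ultimately show ?thesis
    by simp
qed

lemma carrier_AutoGroup: "carrier (AutoGroup G) = auto G"
  by (simp add: AutoGroup_def)

section \<open>Graphs, coverings and elementary automorphisms inside the big graph\<close>

lemma adj_Vertex_obtain:
  assumes "sgraph V E" "adj (Vertex u E) y"
  obtains w where "y = Vertex w E" "E u w" "u \<in> V" "w \<in> V"
proof -
  have e: "edges y = E" "E u (point y)"
    using assms(2) by (auto simp: adj_vertex_def)
  then have "y = Vertex (point y) E"
    by (metis vertex.collapse)
  then show ?thesis
    using that e(2) assms(1) by (auto simp: sgraph_def)
qed

lemma closed_verts:
  assumes "sgraph V E"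
  shows "closed (verts V E)"
  unfolding closed_def
proof (intro ballI allI impI)
  fix x y
  assume xy: "x \<in> verts V E" "adj x y"
  then obtain v where "x = Vertex v E"
    by (auto simp: verts_def)
  then have "adj (Vertex v E) y"
    using xy(2) by simp
  then show "y \<in> verts V E"
    by (rule adj_Vertex_obtain[OF assms]) simp
qed

lemma nb_Vertex:
  assumes "sgraph V E" "u \<in> V"
  shows "nb (Vertex u E) = (\<lambda>w. Vertex w E) ` lk V E u"
proof
  show "nb (Vertex u E) \<subseteq> (\<lambda>w. Vertex w E) ` lk V E u"
    by (auto simp: lk_def elim!: adj_Vertex_obtain[OF assms(1)])
  show "(\<lambda>w. Vertex w E) ` lk V E u \<subseteq> nb (Vertex u E)"
    using adj_Vertex[OF assms(1)] by (auto simp: lk_def)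
qed

lemma star_Vertex:
  assumes "sgraph V E" "u \<in> V"
  shows "star (Vertex u E) = (\<lambda>w. Vertex w E) ` st V E u"
  unfolding star_def st_def nb_Vertex[OF assms] by simp

lemma le_Vertex:
  assumes "sgraph V E" "u \<in> V" "w \<in> V"
  shows "le (Vertex u E) (Vertex w E) \<longleftrightarrow> lk V E u \<subseteq> st V E w"
  unfolding le_def nb_Vertex[OF assms(1,2)] star_Vertex[OF assms(1,3)]
  by (subst inj_image_subset_iff) (auto intro: injI)

lemma cover_vertices:
  assumes L: "sgraph VL EL" and G: "sgraph VG EG" and reg: "regular_covering VL EL VG EG \<phi>"
    and iso: "no_isolated VG EG"
  shows "cover (verts VL EL) (verts VG EG) (\<lambda>x. Vertex (\<phi> (point x)) EG)"
proof
  let ?\<phi> = "\<lambda>x. Vertex (\<phi> (point x)) EG"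
  have cov: "\<phi> ` VL = VG" "\<And>u w. EL u w \<Longrightarrow> EG (\<phi> u) (\<phi> w)"
    "\<And>u. u \<in> VL \<Longrightarrow> bij_betw \<phi> (lk VL EL u) (lk VG EG (\<phi> u))"
    using reg unfolding regular_covering_def covering_map_def by auto
  show "finite (verts VL EL)" "finite (verts VG EG)"
    using L G by (auto simp: verts_def sgraph_def)
  show "closed (verts VL EL)" "closed (verts VG EG)"
    using closed_verts L G by blast+
  show "?\<phi> ` verts VL EL = verts VG EG"
    unfolding verts_def cov(1)[symmetric] by (auto simp: image_image)
  fix u
  assume u: "u \<in> verts VL EL"
  then obtain u' where u': "u = Vertex u' EL" "u' \<in> VL"
    by (auto simp: verts_def)
  then have "\<phi> u' \<in> VG"
    using cov(1) by blast
  show "adj (?\<phi> u) (?\<phi> w)" if "adj u w" for w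
    using that cov(2) adj_Vertex[OF G] unfolding u'(1) by (auto elim!: adj_Vertex_obtain[OF L])
  show "bij_betw ?\<phi> (nb u) (nb (?\<phi> u))"
  proof -
    have 1: "bij_betw (\<lambda>w. Vertex w EG) (lk VG EG (\<phi> u')) (nb (?\<phi> u))"
      unfolding u'(1) vertex.sel nb_Vertex[OF G \<open>\<phi> u' \<in> VG\<close>] by (auto simp: bij_betw_def inj_on_def)
    have "bij_betw point (nb u) (lk VL EL u')"
      unfolding u'(1) nb_Vertex[OF L u'(2)] by (auto simp: bij_betw_def inj_on_def image_image)
    then have "bij_betw ((\<lambda>w. Vertex w EG) \<circ> (\<phi> \<circ> point)) (nb u) (nb (?\<phi> u))"
      by (rule bij_betw_trans[OF bij_betw_trans[OF _ cov(3)[OF u'(2)]] 1])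
    then show ?thesis
      by (simp add: comp_def)
  qed
  show "\<exists>\<mu>. bij_betw \<mu> (verts VL EL) (verts VL EL) \<and>
      (\<forall>a \<in> verts VL EL. \<forall>b \<in> verts VL EL. adj a b \<longleftrightarrow> adj (\<mu> a) (\<mu> b)) \<and>
      (\<forall>a \<in> verts VL EL. ?\<phi> (\<mu> a) = ?\<phi> a) \<and> \<mu> u = w"
    if w: "w \<in> verts VL EL" "?\<phi> u = ?\<phi> w" for w
  proof -
    obtain w' where w': "w = Vertex w' EL" "w' \<in> VL"
      using w(1) by (auto simp: verts_def)
    then have "\<phi> u' = \<phi> w'"
      using w(2) u'(1) by simp
    then obtain \<mu> where \<mu>: "\<mu> \<in> Deck VL EL \<phi>" "\<mu> u' = w'"
      using reg u'(2) w'(2) unfolding regular_covering_def by blast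
    then have aut: "bij_betw \<mu> VL VL" "\<And>a b. a \<in> VL \<Longrightarrow> b \<in> VL \<Longrightarrow> EL a b \<longleftrightarrow> EL (\<mu> a) (\<mu> b)"
      "\<And>a. a \<in> VL \<Longrightarrow> \<phi> (\<mu> a) = \<phi> a"
      unfolding Deck_def graph_aut_def by auto
    let ?\<mu> = "\<lambda>x. Vertex (\<mu> (point x)) EL"
    have 1: "bij_betw (\<lambda>w. Vertex w EL) VL (verts VL EL)"
      by (auto simp: bij_betw_def inj_on_def verts_def)
    have "bij_betw point (verts VL EL) VL"
      by (auto simp: bij_betw_def inj_on_def verts_def image_image)
    then have "bij_betw ((\<lambda>w. Vertex w EL) \<circ> (\<mu> \<circ> point)) (verts VL EL) (verts VL EL)"
      by (rule bij_betw_trans[OF bij_betw_trans[OF _ aut(1)] 1])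
    then have "bij_betw ?\<mu> (verts VL EL) (verts VL EL)"
      by (simp add: comp_def)
    then show ?thesis
      using aut(2,3) \<mu>(2) adj_Vertex[OF L] u' w' by (intro exI[of _ ?\<mu>]) (auto simp: verts_def)
  qed
next
  fix v
  assume "v \<in> verts VG EG"
  then obtain v' w where "v = Vertex v' EG" "EG v' w"
    using iso by (auto simp: verts_def no_isolated_def)
  then have "Vertex w EG \<in> nb v"
    using adj_Vertex[OF G] by simp
  then show "nb v \<noteq> {}"
    by blast
qed

lemma compat_transvection:
  assumes "closed V" "le b a"
  shows "compatV V (\<lambda>v. if v = b then gen b + gen a else gen v)"
proof -
  have 1: "cm (gen b + gen a) (gen w)" if "adj b w" for w
  proof (rule cm_add_left)
    show "cm (gen b) (gen w)"
      using that by (intro cm_lett) simp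
    have "w \<in> star a"
      using that assms(2) unfolding le_def by auto
    then show "cm (gen a) (gen w)"
      by (intro cm_gen_lett) (auto simp: in_star adj_commute)
  qed
  have 2: "cm (gen x) (gen y)" if "adj x y" for x y :: 'a
    using that by (intro cm_lett) simp
  show ?thesis
    unfolding compatV_def
  proof (intro conjI ballI impI)
    fix x y :: 'a
    assume xy: "adj x y"
    then show "cm (if x = b then gen b + gen a else gen x) (if y = b then gen b + gen a else gen y)"
      using 1[of y] cm_sym[OF 1[of x]] 2[OF xy] adj_sym[OF xy] by auto
  qed (rule assms(1))
qed

lemma compat_partial_conj:
  assumes "closed V" "C \<subseteq> V - star v" and C: "\<And>x y. x \<in> C \<Longrightarrow> adj x y \<Longrightarrow> y \<notin> star v \<Longrightarrow> y \<in> C"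
  shows "compatV V (\<lambda>w. if w \<in> C then gen v + gen w - gen v else gen w)"
proof -
  have 1: "cm (gen v + gen x - gen v) (gen y)" if "x \<in> C" "y \<notin> C" "adj x y" for x y
  proof -
    have "y \<in> star v"
      using C that by blast
    then have "cm (gen v) (gen y)"
      by (intro cm_gen_lett) (auto simp: in_star adj_commute)
    moreover have "cm (gen x) (gen y)"
      using that(3) by (intro cm_lett) simp
    ultimately show ?thesis
      unfolding diff_conv_add_uminus by (intro cm_add_left) simp_all
  qed
  have 2: "cm (gen x) (gen y)" if "adj x y" for x y :: 'a
    using that by (intro cm_lett) simp
  show ?thesis
    unfolding compatV_def
  proof (intro conjI ballI impI)
    fix x y :: 'a
    assume xy: "adj x y"
    show "cm (if x \<in> C then gen v + gen x - gen v else gen x) (if y \<in> C then gen v + gen y - gen v else gen y)"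
      using 1[of x y] 1[of y x] 2[of x y] xy adj_sym[OF xy] by (auto simp: cm_conj intro: cm_sym)
  qed (rule assms(1))
qed

context
  fixes VL :: "'a set" and EL :: "'a \<Rightarrow> 'a \<Rightarrow> bool"
    and VG :: "'b set" and EG :: "'b \<Rightarrow> 'b \<Rightarrow> bool"
    and \<phi> :: "'a \<Rightarrow> 'b"
  assumes L: "sgraph VL EL" and G: "sgraph VG EG"
    and reg: "regular_covering VL EL VG EG \<phi>" and iso: "no_isolated VG EG"
begin

interpretation cover "verts VL EL" "verts VG EG" "\<lambda>x. Vertex (\<phi> (point x)) EG"
  by (rule cover_vertices[OF L G reg iso])

lemma induced_hom_onc: "induced_hom VL EL EG \<phi> = onc VL EL EG \<Phi>"
  unfolding induced_hom_def by (rule raag_ext_eq[OF L G ghom_\<Phi>]) (simp add: emb_def)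

lemma onc_liftable:
  assumes "laut f F"
  shows "liftable VL EL VG EG \<phi> (onc VG EG EG f)"
proof -
  have f: "aut (verts VG EG) f" "aut (verts VL EL) F" "\<And>g. g \<in> gp (verts VL EL) \<Longrightarrow> f (\<Phi> g) = \<Phi> (F g)"
    using assms unfolding laut_def by auto
  have "onc VG EG EG f (induced_hom VL EL EG \<phi> Z) = induced_hom VL EL EG \<phi> (onc VL EL EL F Z)"
    if Z: "Z \<in> carrier (RAAG VL EL)" for Z
  proof -
    obtain g where g: "Z = wcl EL g" "g \<in> gp (verts VL EL)"
      using Z carrier_RAAG[OF L] by blast
    have "\<Phi> g \<in> gp (verts VG EG)"
      using \<Phi>_gp[OF g(2)] image by simp
    then show ?thesis
      using f(3)[OF g(2)] aut_gp[OF f(2) g(2)] g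
      by (simp add: induced_hom_onc onc_wcl[OF L] onc_wcl[OF G])
  qed
  then show ?thesis
    unfolding liftable_def using onc_auto[OF G f(1)] onc_auto[OF L f(2)] by blast
qed

lemma liftable_onc:
  assumes "liftable VL EL VG EG \<phi> f"
  shows "\<exists>g F. laut g F \<and> f = onc VG EG EG g"
proof -
  obtain F where f: "f \<in> auto (RAAG VG EG)" and F: "F \<in> auto (RAAG VL EL)"
    and c: "\<And>x. x \<in> carrier (RAAG VL EL) \<Longrightarrow> f (induced_hom VL EL EG \<phi> x) = induced_hom VL EL EG \<phi> (F x)"
    using assms unfolding liftable_def by blast
  obtain f' where f': "aut (verts VG EG) f'" "f = onc VG EG EG f'"
    using auto_onc[OF G f] by blast
  obtain F' where F': "aut (verts VL EL) F'" "F = onc VL EL EL F'"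
    using auto_onc[OF L F] by blast
  have "f' (\<Phi> g) = \<Phi> (F' g)" if g: "g \<in> gp (verts VL EL)" for g
  proof -
    have \<Phi>: "\<Phi> h \<in> gp (verts VG EG)" if "h \<in> gp (verts VL EL)" for h
      using \<Phi>_gp[OF that] image by simp
    note F'g = aut_gp[OF F'(1) g]
    have "wcl EL g \<in> carrier (RAAG VL EL)"
      using g carrier_RAAG[OF L] by blast
    then have "wcl EG (f' (\<Phi> g)) = wcl EG (\<Phi> (F' g))"
      using c[of "wcl EL g"] g F'g \<Phi>[OF g]
      by (simp add: f'(2) F'(2) induced_hom_onc onc_wcl[OF L] onc_wcl[OF G])
    then show ?thesis
      using wcl_inject[OF aut_gp[OF f'(1) \<Phi>[OF g]] \<Phi>[OF F'g]] by simp
  qed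
  then show ?thesis
    using f' F'(1) unfolding laut_def by blast
qed

lemma elem_onc:
  assumes "elem e"
  shows "onc VG EG EG e \<in> graph_symmetries VG EG \<union> inversions VG EG \<union> transvections VG EG \<union> partial_conjugations VG EG"
  using assms
proof cases
  case (symmetry \<sigma>)
  define \<sigma>' where "\<sigma>' v = point (\<sigma> (Vertex v EG))" for v
  have \<sigma>: "\<sigma> (Vertex v EG) = Vertex (\<sigma>' v) EG \<and> \<sigma>' v \<in> VG" if "v \<in> VG" for v
  proof -
    have "\<sigma> (Vertex v EG) \<in> verts VG EG"
      using symmetry(2) that by (simp add: bij_betwE)
    then show ?thesis
      by (auto simp: \<sigma>'_def verts_def)
  qed
  have adj: "EG u w \<longleftrightarrow> EG (\<sigma>' u) (\<sigma>' w)" if "u \<in> VG" "w \<in> VG" for u w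
    using symmetry(3) \<sigma>[OF that(1)] \<sigma>[OF that(2)] that adj_Vertex[OF G] by (metis Vertex_in_verts)
  have "bij_betw \<sigma>' VG VG"
  proof -
    have 1: "bij_betw (\<lambda>v. Vertex v EG) VG (verts VG EG)"
      by (auto simp: bij_betw_def inj_on_def verts_def)
    have 2: "bij_betw point (verts VG EG) VG"
      by (auto simp: bij_betw_def inj_on_def verts_def image_image)
    have "bij_betw (point \<circ> (\<sigma> \<circ> (\<lambda>v. Vertex v EG))) VG VG"
      by (rule bij_betw_trans[OF bij_betw_trans[OF 1 symmetry(2)] 2])
    then show ?thesis
      by (simp add: comp_def \<sigma>'_def[abs_def])
  qed
  then have aut: "graph_aut VG EG \<sigma>'"
    using adj by (simp add: graph_aut_def)
  have compat: "compatV (verts VG EG) (\<lambda>v. gen (\<sigma> v))"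
    unfolding compatV_def using closedG symmetry(3) by (auto intro!: cm_lett)
  have "raag_ext VG EG EG (\<lambda>v. [(\<sigma>' v, True)]) = onc VG EG EG e"
  proof (rule raag_ext_eq[OF G G])
    show "ghom e"
      unfolding symmetry(1) by (rule ghom_extV[OF compat])
    show "e (gen (Vertex v EG)) = ev EG [(\<sigma>' v, True)]" if "v \<in> VG" for v
      unfolding symmetry(1) using that \<sigma> by (simp add: extV_gen[OF compat] emb_def)
  qed
  moreover have "raag_ext VG EG EG (\<lambda>v. [(\<sigma>' v, True)]) \<in> graph_symmetries VG EG"
    unfolding graph_symmetries_def using aut by (intro CollectI exI[of _ \<sigma>'] conjI refl)
  ultimately show ?thesis
    by simp
next
  case (inversion T)
  let ?T = "{v \<in> VG. Vertex v EG \<in> T}"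
  have compat: "compatV (verts VG EG) (\<lambda>v. lett (v, v \<notin> T))"
    unfolding compatV_def using closedG by (auto intro!: cm_lett)
  have "raag_ext VG EG EG (\<lambda>v. [(v, v \<notin> ?T)]) = onc VG EG EG e"
  proof (rule raag_ext_eq[OF G G])
    show "ghom e"
      unfolding inversion(1) by (rule ghom_extV[OF compat])
    show "e (gen (Vertex v EG)) = ev EG [(v, v \<notin> ?T)]" if "v \<in> VG" for v
      unfolding inversion(1) using that by (simp add: extV_gen[OF compat] emb_def)
  qed
  moreover have "raag_ext VG EG EG (\<lambda>v. [(v, v \<notin> ?T)]) \<in> inversions VG EG"
    unfolding inversions_def by (intro CollectI exI[of _ ?T] conjI refl) blast
  ultimately show ?thesis
    by simp
next
  case (transvection a b)
  obtain a' b' where ab: "a = Vertex a' EG" "b = Vertex b' EG" "a' \<in> VG" "b' \<in> VG"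
    using transvection(2,3) by (auto simp: verts_def)
  have le: "b' \<noteq> a'" "lk VG EG b' \<subseteq> st VG EG a'"
    using transvection(4,5) le_Vertex[OF G] ab by auto
  have compat: "compatV (verts VG EG) (\<lambda>v. if v = b then gen b + gen a else gen v)"
    using compat_transvection[OF closedG transvection(5)] .
  have "raag_ext VG EG EG (\<lambda>v. if v = b' then [(b', True), (a', True)] else [(v, True)]) = onc VG EG EG e"
  proof (rule raag_ext_eq[OF G G])
    show "ghom e"
      unfolding transvection(1) by (rule ghom_extV[OF compat])
    show "e (gen (Vertex v EG)) = ev EG (if v = b' then [(b', True), (a', True)] else [(v, True)])" if "v \<in> VG" for v
    proof -
      have "e (gen (Vertex v EG)) = (if Vertex v EG = b then gen b + gen a else gen (Vertex v EG))"
        unfolding transvection(1) by (rule extV_gen[OF compat]) (simp add: that)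
      then show ?thesis
        by (simp add: emb_def ab)
    qed
  qed
  moreover have "raag_ext VG EG EG (\<lambda>v. if v = b' then [(b', True), (a', True)] else [(v, True)]) \<in> transvections VG EG"
    unfolding transvections_def using ab(3,4) le by (intro CollectI exI[of _ a'] exI[of _ b'] conjI refl)
  ultimately show ?thesis
    by simp
next
  case (partial_conj v C)
  obtain v' where v: "v = Vertex v' EG" "v' \<in> VG"
    using partial_conj(2) by (auto simp: verts_def)
  let ?C = "{w \<in> VG. Vertex w EG \<in> C}"
  have C: "w \<in> VG - st VG EG v'" if "w \<in> ?C" for w
    using that partial_conj(3) star_Vertex[OF G v(2)] v(1) by auto
  have "y \<in> ?C" if x: "x \<in> ?C" and xy: "(x, y) \<in> reach_in (VG - st VG EG v') EG" for x y
    using xy unfolding reach_in_def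
  proof (induction rule: rtrancl_induct)
    case (step y z)
    have z: "z \<in> VG" "z \<notin> st VG EG v'" "EG y z" "y \<in> VG"
      using step(2) by auto
    then have "Vertex z EG \<notin> star v" "adj (Vertex y EG) (Vertex z EG)"
      using star_Vertex[OF G v(2)] v(1) adj_Vertex[OF G] by auto
    then show ?case
      using partial_conj(4)[of "Vertex y EG" "Vertex z EG"] step.IH z(1) by simp
  qed (rule x)
  then have comp: "union_of_components (VG - st VG EG v') EG ?C"
    using C unfolding union_of_components_def by blast
  have compat: "compatV (verts VG EG) (\<lambda>w. if w \<in> C then gen v + gen w - gen v else gen w)"
    using compat_partial_conj[OF closedG partial_conj(3,4)] .
  have "raag_ext VG EG EG (\<lambda>w. if w \<in> ?C then [(v', True), (w, True), (v', False)] else [(w, True)]) = onc VG EG EG e"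
  proof (rule raag_ext_eq[OF G G])
    show "ghom e"
      unfolding partial_conj(1) by (rule ghom_extV[OF compat])
    show "e (gen (Vertex w EG)) = ev EG (if w \<in> ?C then [(v', True), (w, True), (v', False)] else [(w, True)])"
      if "w \<in> VG" for w
    proof -
      have "e (gen (Vertex w EG)) =
          (if Vertex w EG \<in> C then gen v + gen (Vertex w EG) - gen v else gen (Vertex w EG))"
        unfolding partial_conj(1) by (rule extV_gen[OF compat]) (simp add: that)
      then show ?thesis
        using that by (simp add: emb_def v add.assoc diff_conv_add_uminus del: add_uminus_conv_diff)
    qed
  qed
  moreover have "raag_ext VG EG EG (\<lambda>w. if w \<in> ?C then [(v', True), (w, True), (v', False)] else [(w, True)])
      \<in> partial_conjugations VG EG"
    unfolding partial_conjugations_def using v(2) comp by (intro CollectI exI[of _ v'] exI[of _ ?C] conjI refl)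
  ultimately show ?thesis
    by simp
qed

abbreviation (input) "liftable_elementary \<equiv>
  {f \<in> graph_symmetries VG EG. liftable VL EL VG EG \<phi> f} \<union> inversions VG EG
  \<union> {f \<in> transvections VG EG. liftable VL EL VG EG \<phi> f}
  \<union> {f \<in> partial_conjugations VG EG. liftable VL EL VG EG \<phi> f}"

text \<open>Each step of \<open>GEN\<close> composes with a liftable elementary automorphism, which
  is undone by multiplying with its inverse in the generated subgroup.\<close>

lemma GEN_onc:
  assumes "GEN f" "aut (verts VG EG) f"
  shows "onc VG EG EG f \<in> generate (AutoGroup (RAAG VG EG)) liftable_elementary"
  using assms
proof (induction rule: GEN.induct)
  case (GEN_id f)
  have "f g = g" if "g \<in> gp (verts VG EG)" for g
    using ghom_eq_on_gp[OF GEN_id(1) ghom_id] GEN_id(2) that by blast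
  then have "onc VG EG EG f = \<one>\<^bsub>AutoGroup (RAAG VG EG)\<^esub>"
    by (rule onc_id[OF G])
  then show ?case
    by (simp only: generate.one)
next
  case (GEN_step f e E)
  let ?A = "AutoGroup (RAAG VG EG)"
  interpret A: group ?A
    using group.AutoGroup[OF group_RAAG[OF G]] .
  have e: "aut (verts VG EG) e"
    using GEN_step(4) unfolding laut_def by blast
  have ec: "onc VG EG EG e \<in> carrier ?A" "onc VG EG EG f \<in> carrier ?A"
    using onc_auto[OF G] e GEN_step.prems by (simp_all add: carrier_AutoGroup)
  have "onc VG EG EG e \<in> liftable_elementary"
    using elem_onc[OF GEN_step(3)] onc_liftable[OF GEN_step(4)] by blast
  then have 1: "inv\<^bsub>?A\<^esub> onc VG EG EG e \<in> generate ?A liftable_elementary"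
    by (rule generate.inv)
  have 2: "onc VG EG EG f \<otimes>\<^bsub>?A\<^esub> onc VG EG EG e \<in> generate ?A liftable_elementary"
    using GEN_step.IH aut_comp[OF GEN_step.prems e] onc_compose[OF G GEN_step.prems e] by simp
  have 3: "onc VG EG EG f = onc VG EG EG f \<otimes>\<^bsub>?A\<^esub> onc VG EG EG e \<otimes>\<^bsub>?A\<^esub> inv\<^bsub>?A\<^esub> onc VG EG EG e"
    using ec by (simp add: A.m_assoc)
  show ?case
    by (subst 3) (rule generate.eng[OF 2 1])
qed

lemma inversions_liftable: "inversions VG EG \<subseteq> LAut VL EL VG EG \<phi>"
proof
  fix f
  assume "f \<in> inversions VG EG"
  then obtain T where T: "f = raag_ext VG EG EG (\<lambda>v. [(v, v \<notin> T)])" "T \<subseteq> VG"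
    unfolding inversions_def by blast
  have "verts T EG \<subseteq> verts VG EG"
    using T(2) by (auto simp: verts_def)
  then obtain e E where e: "mv e E" "\<And>v. v \<in> verts VG EG \<Longrightarrow> e (gen v) = lett (v, v \<notin> verts T EG)"
    using mv_inversion by meson
  have "f = onc VG EG EG e"
    unfolding T(1)
  proof (rule raag_ext_eq[OF G G])
    show "ghom e"
      using laut_ghom mv_laut[OF e(1)] by blast
    show "e (gen (Vertex v EG)) = ev EG [(v, v \<notin> T)]" if "v \<in> VG" for v
      using e(2)[of "Vertex v EG"] that by (simp add: emb_def)
  qed
  then show "f \<in> LAut VL EL VG EG \<phi>"
    using onc_liftable[OF mv_laut[OF e(1)]] by (simp add: LAut_def)
qed

lemma subgroup_LAut: "subgroup (LAut VL EL VG EG \<phi>) (AutoGroup (RAAG VG EG))"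
proof -
  let ?A = "AutoGroup (RAAG VG EG)"
  interpret A: group ?A
    using group.AutoGroup[OF group_RAAG[OF G]] .
  have iff: "f \<in> LAut VL EL VG EG \<phi> \<longleftrightarrow> (\<exists>g F. laut g F \<and> f = onc VG EG EG g)" for f
    unfolding LAut_def using liftable_onc onc_liftable by auto
  have aut: "aut (verts VG EG) g" if "laut g F" for g F
    using that unfolding laut_def by blast
  show ?thesis
  proof (rule A.subgroupI)
    show "LAut VL EL VG EG \<phi> \<subseteq> carrier ?A"
      unfolding carrier_AutoGroup LAut_def liftable_def by blast
    have "onc VG EG EG (\<lambda>g. g) \<in> LAut VL EL VG EG \<phi>"
      using onc_liftable[OF mv_laut[OF mv_id]] by (simp add: LAut_def)
    then show "LAut VL EL VG EG \<phi> \<noteq> {}"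
      by blast
  next
    fix f
    assume "f \<in> LAut VL EL VG EG \<phi>"
    then obtain g F where g: "laut g F" "f = onc VG EG EG g"
      using iff by blast
    obtain h where h: "aut_pair (verts VG EG) g h"
      using aut[OF g(1)] by (auto simp: aut_def)
    obtain H where H: "aut_pair (verts VL EL) F H"
      using g(1) unfolding laut_def aut_def by blast
    have h': "aut (verts VG EG) h" "aut (verts VL EL) H"
      using aut_pair_sym h H unfolding aut_def by blast+
    have "h (\<Phi> k) = \<Phi> (H k)" if k: "k \<in> gp (verts VL EL)" for k
    proof -
      have Hk: "H k \<in> gp (verts VL EL)"
        using aut_pairD(4)[OF H k] .
      have "g (\<Phi> (H k)) = \<Phi> k"
        using g(1) Hk aut_pairD(6)[OF H k] unfolding laut_def by simp
      moreover have "\<Phi> (H k) \<in> gp (verts VG EG)"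
        using \<Phi>_gp[OF Hk] image by simp
      ultimately show ?thesis
        using aut_pairD(5)[OF h] by metis
    qed
    then have "laut h H"
      using h' unfolding laut_def by blast
    moreover have "inv\<^bsub>?A\<^esub> f = onc VG EG EG h"
    proof (rule A.inv_equality)
      show "onc VG EG EG h \<otimes>\<^bsub>?A\<^esub> f = \<one>\<^bsub>?A\<^esub>"
        unfolding g(2) onc_compose[OF G h'(1) aut[OF g(1)]] using aut_pairD(5)[OF h] by (intro onc_id[OF G])
      show "f \<in> carrier ?A" "onc VG EG EG h \<in> carrier ?A"
        using onc_auto[OF G] aut[OF g(1)] h'(1) g(2) by (simp_all add: carrier_AutoGroup)
    qed
    ultimately show "inv\<^bsub>?A\<^esub> f \<in> LAut VL EL VG EG \<phi>"
      using onc_liftable by (simp add: LAut_def)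
  next
    fix f f'
    assume "f \<in> LAut VL EL VG EG \<phi>" "f' \<in> LAut VL EL VG EG \<phi>"
    then obtain g F g' F' where g: "laut g F" "f = onc VG EG EG g" "laut g' F'" "f' = onc VG EG EG g'"
      using iff by blast
    have "f \<otimes>\<^bsub>?A\<^esub> f' = onc VG EG EG (\<lambda>x. g (g' x))"
      unfolding g(2,4) by (rule onc_compose[OF G aut[OF g(1)] aut[OF g(3)]])
    then show "f \<otimes>\<^bsub>?A\<^esub> f' \<in> LAut VL EL VG EG \<phi>"
      using onc_liftable[OF laut_comp[OF g(1,3)]] by (simp add: LAut_def)
  qed
qed

lemma LAut_generated: "LAut VL EL VG EG \<phi> = generate (AutoGroup (RAAG VG EG)) liftable_elementary"
proof
  interpret A: group "AutoGroup (RAAG VG EG)"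
    using group.AutoGroup[OF group_RAAG[OF G]] .
  show "LAut VL EL VG EG \<phi> \<subseteq> generate (AutoGroup (RAAG VG EG)) liftable_elementary"
  proof
    fix f
    assume "f \<in> LAut VL EL VG EG \<phi>"
    then obtain g F where g: "laut g F" "f = onc VG EG EG g"
      using liftable_onc unfolding LAut_def by blast
    then show "f \<in> generate (AutoGroup (RAAG VG EG)) liftable_elementary"
      using GEN_onc[OF laut_GEN[OF g(1)]] unfolding laut_def by blast
  qed
  have "liftable_elementary \<subseteq> LAut VL EL VG EG \<phi>"
    using inversions_liftable by (auto simp: LAut_def)
  then show "generate (AutoGroup (RAAG VG EG)) liftable_elementary \<subseteq> LAut VL EL VG EG \<phi>"
    using A.generate_subgroup_incl subgroup_LAut by blast
qed

end

theorem theorem6p2: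
  fixes VL :: "'a set" and EL :: "'a \<Rightarrow> 'a \<Rightarrow> bool"
    and VG :: "'b set" and EG :: "'b \<Rightarrow> 'b \<Rightarrow> bool"
    and \<phi> :: "'a \<Rightarrow> 'b"
  assumes "sgraph VL EL" and "sgraph VG EG"
    and "regular_covering VL EL VG EG \<phi>"
    and "no_isolated VG EG"
  shows "LAut VL EL VG EG \<phi> =
    generate (AutoGroup (RAAG VG EG))
      ({f \<in> graph_symmetries VG EG. liftable VL EL VG EG \<phi> f}
       \<union> inversions VG EG
       \<union> {f \<in> transvections VG EG. liftable VL EL VG EG \<phi> f}
       \<union> {f \<in> partial_conjugations VG EG. liftable VL EL VG EG \<phi> f})"
  using assms by (rule LAut_generated)

end
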